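(* Let $\omega\subset\mathbb{T}$ be a nonempty open set and let $a$ be a smooth, nonnegative function on $\mathbb{T}$ with $a(x)>0$ on $\omega$. Consider the system $$u_t-u_{xxt}+u_x+uu_x-(a(x)u_x)_x=0,\quad x\in\mathbb{T},\ t\ge 0,\qquad u(x,0)=u_0(x),\quad x\in\mathbb{T}. \qquad (\ast)$$ (i) Let $s\ge 0$ be given. For any $u_0\in H^s(\mathbb{T})$, there exist $T>0$ and a unique solution $u$ of $(\ast)$ in $C([0,T],H^s(\mathbb{T}))$. Moreover, the correspondence $u_0\in H^s(\mathbb{T})\mapsto u\in C([0,T],H^s(\mathbb{T}))$ is Lipschitz continuous. (ii) If $s=1$, one can pick any $T>0$, and $\|u(t)-[u_0]\|_{H^1(\mathbb{T})}$ is nonincreasing in $t$, where $[u_0]=(2\pi)^{-1}\int_{\mathbb{T}}u_0(x)\,dx$. (iii) (For $s=1$.) If the modified UCP Conjecture (stated in the context) is valid, then $u(t)\to[u_0]$ weakly in $H^1(\mathbb{T})$, hence strongly in $H^s(\mathbb{T})$ for $s<1$, as $t\to\infty$.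
   Context: $\mathbb{T}=\mathbb{R}/(2\pi\mathbb{Z})$; functions are real-valued. The norm of $H^s(\mathbb{T})$ is $\|\sum_{n\in\mathbb{Z}}c_ne^{inx}\|_s^2=\sum_{n\in\mathbb{Z}}|c_n|^2(1+|n|^2)^s$. The operator $(1-\partial_x^2)^{-1}$ is the Fourier multiplier $(1+n^2)^{-1}$ on $\mathbb{T}$. A solution of $(\ast)$ is understood in the integral sense $$u(t)=u_0-\int_0^t(1-\partial_x^2)^{-1}\Big[-(a(x)u_x)_x+\Big(u+\frac{u^2}{2}\Big)_x\Big](\tau)\,d\tau,$$ and the solution of the undamped BBM equation in the same sense with $a=0$. Modified UCP Conjecture (Unique Continuation Property; open, used only as a hypothesis in (iii)), obtained from the UCP conjecture for BBM by replacing the condition $v=0$ on the band by $v=C$: there exists some number $\delta>0$ such that for any $v_0\in H^1(\mathbb{T})$ with $\|v_0\|_{H^1(\mathbb{T})}<\delta$, if the solution $v=v(x,t)$ of $v_t-v_{xxt}+v_x+vv_x=0$ ($x\in\mathbb{T}$), $v(x,0)=v_0(x)$, satisfies $v(x,t)=C$ for all $(x,t)\in\omega'\times(0,T)$ for some constant $C\in\mathbb{R}$, some nonempty open set $\omega'\subset\mathbb{T}$ and some time $T>0$, then $v_0=C$ (and hence $v\equiv C$). *)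

theory Defs
  imports "HOL-Analysis.Analysis"
begin

text \<open>Functions on the torus are \<open>2\<pi>\<close>-periodic functions on the real line, and subsets of the torus
  are \<open>2\<pi>\<close>-periodic sets of reals. Elements of Sobolev spaces are represented by Borel functions;
  two representatives are identified when they agree almost everywhere.\<close>

definition periodic_2pi :: "(real \<Rightarrow> 'a) \<Rightarrow> bool" where
  "periodic_2pi f \<longleftrightarrow> (\<forall>x. f (x + 2 * pi) = f x)"

definition torus_open :: "real set \<Rightarrow> bool" where
  "torus_open S \<longleftrightarrow> open S \<and> periodic_2pi (\<lambda>x. x \<in> S)"

definition torus_smooth :: "(real \<Rightarrow> real) \<Rightarrow> bool" where
  "torus_smooth f \<longleftrightarrow> periodic_2pi f \<and> (\<forall>k. (deriv ^^ k) f differentiable_on UNIV)"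

definition torus_mean :: "(real \<Rightarrow> real) \<Rightarrow> real" where
  "torus_mean f = (1 / (2 * pi)) * (LINT x:{0..2*pi}|lborel. f x)"

text \<open>Distributions on the torus are functionals on smooth periodic complex-valued test functions.\<close>

type_synonym distr = "(real \<Rightarrow> complex) \<Rightarrow> complex"

definition regular_distr :: "(real \<Rightarrow> real) \<Rightarrow> distr" where
  "regular_distr f \<phi> = (LINT x:{0..2*pi}|lborel. f x *\<^sub>R \<phi> x)"

definition distr_deriv :: "distr \<Rightarrow> distr" where
  "distr_deriv \<Lambda> \<phi> = - \<Lambda> (\<lambda>x. vector_derivative \<phi> (at x))"

definition distr_mult :: "(real \<Rightarrow> real) \<Rightarrow> distr \<Rightarrow> distr" where
  "distr_mult a \<Lambda> \<phi> = \<Lambda> (\<lambda>x. a x *\<^sub>R \<phi> x)"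

definition distr_coeff :: "distr \<Rightarrow> int \<Rightarrow> complex" where
  "distr_coeff \<Lambda> n = \<Lambda> (\<lambda>x. cis (- (of_int n * x))) / (2 * of_real pi)"

definition fourier_coeff :: "(real \<Rightarrow> real) \<Rightarrow> int \<Rightarrow> complex" where
  "fourier_coeff f = distr_coeff (regular_distr f)"

text \<open>The space \<open>H\<^sup>s\<close> for \<open>s \<ge> 0\<close>; only then is every element a square-integrable function.
  The norm is meaningful only where the series converges (\<open>infsum\<close> is \<open>0\<close> otherwise); for \<open>s \<le> 0\<close>
  it converges for every square-integrable function.\<close>

definition sobolev_term :: "real \<Rightarrow> (real \<Rightarrow> real) \<Rightarrow> int \<Rightarrow> real" where
  "sobolev_term s f n = (cmod (fourier_coeff f n))\<^sup>2 * (1 + (of_int n)\<^sup>2) powr s"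

definition sobolev :: "real \<Rightarrow> (real \<Rightarrow> real) set" where
  "sobolev s = {f. periodic_2pi f \<and> f \<in> borel_measurable borel \<and>
     set_integrable lborel {0..2*pi} (\<lambda>x. (f x)\<^sup>2) \<and> sobolev_term s f summable_on UNIV}"

definition sobolev_norm :: "real \<Rightarrow> (real \<Rightarrow> real) \<Rightarrow> real" where
  "sobolev_norm s f = sqrt (\<Sum>\<^sub>\<infinity>n. sobolev_term s f n)"

definition sobolev_continuous_on :: "real \<Rightarrow> real set \<Rightarrow> (real \<Rightarrow> real \<Rightarrow> real) \<Rightarrow> bool" where
  "sobolev_continuous_on s J u \<longleftrightarrow> (\<forall>t\<in>J. u t \<in> sobolev s) \<and>
     (\<forall>t\<in>J. ((\<lambda>\<tau>. sobolev_norm s (\<lambda>x. u \<tau> x - u t x)) \<longlongrightarrow> 0) (at t within J))"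

text \<open>The integral over \<open>{0..t}\<close> of an \<open>H\<^sup>s\<close>-valued function: the definition
  is that of \<open>has_integral\<close> with the norm of \<open>H\<^sup>s\<close>, which is not available as a type for the parameter \<open>s\<close>.\<close>

definition sobolev_has_integral ::
    "real \<Rightarrow> (real \<Rightarrow> real \<Rightarrow> real) \<Rightarrow> (real \<Rightarrow> real) \<Rightarrow> real \<Rightarrow> bool" where
  "sobolev_has_integral s g h t \<longleftrightarrow>
     (\<forall>\<tau>\<in>{0..t}. g \<tau> \<in> sobolev s) \<and> h \<in> sobolev s \<and>
     (\<forall>e>0. \<exists>\<gamma>. gauge \<gamma> \<and>
        (\<forall>\<D>. \<D> tagged_division_of {0..t} \<and> \<gamma> fine \<D> \<longrightarrow>
           sobolev_norm s (\<lambda>x. (\<Sum>(\<tau>, K)\<in>\<D>. measure lborel K * g \<tau> x) - h x) < e))"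

text \<open>\<open>f\<close> is the image of \<open>\<Lambda>\<close> under \<open>(1 - \<partial>\<^sub>x\<^sup>2)\<^sup>-\<^sup>1\<close>.\<close>

definition inv_helmholtz :: "distr \<Rightarrow> (real \<Rightarrow> real) \<Rightarrow> bool" where
  "inv_helmholtz \<Lambda> f \<longleftrightarrow>
     (\<forall>n. fourier_coeff f n = distr_coeff \<Lambda> n / of_real (1 + (of_int n)\<^sup>2))"

text \<open>The distribution \<open>- (a u\<^sub>x)\<^sub>x + (u + u\<^sup>2/2)\<^sub>x\<close>.\<close>

definition bbm_flux :: "(real \<Rightarrow> real) \<Rightarrow> (real \<Rightarrow> real) \<Rightarrow> distr" where
  "bbm_flux a u \<phi> = - distr_deriv (distr_mult a (distr_deriv (regular_distr u))) \<phi>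
     + distr_deriv (regular_distr (\<lambda>x. u x + (u x)\<^sup>2 / 2)) \<phi>"

text \<open>Solutions in \<open>C(J, H\<^sup>s)\<close>, for an interval \<open>J\<close> of times starting at \<open>0\<close>, of the integral form
  \<open>u(t) = u\<^sub>0 - \<integral>\<^sub>0\<^sup>t g(\<tau>) d\<tau>\<close>. The undamped BBM equation is the case \<open>a = 0\<close>.\<close>

definition bbm_solution ::
    "(real \<Rightarrow> real) \<Rightarrow> real \<Rightarrow> real set \<Rightarrow> (real \<Rightarrow> real) \<Rightarrow> (real \<Rightarrow> real \<Rightarrow> real) \<Rightarrow> bool" where
  "bbm_solution a s J u0 u \<longleftrightarrow> u0 \<in> sobolev s \<and> sobolev_continuous_on s J u \<and>
     (\<exists>g. (\<forall>\<tau>\<in>J. g \<tau> \<in> sobolev s \<and> inv_helmholtz (bbm_flux a (u \<tau>)) (g \<tau>)) \<and>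
          (\<forall>t\<in>J. sobolev_has_integral s g (\<lambda>x. u0 x - u t x) t))"

text \<open>Unique solvability in \<open>C([0,T], H\<^sup>s)\<close> for all initial data in the ball of radius \<open>R\<close> of \<open>H\<^sup>s\<close>,
  with a solution map that is Lipschitz on this ball.\<close>

definition bbm_well_posed :: "(real \<Rightarrow> real) \<Rightarrow> real \<Rightarrow> real \<Rightarrow> real \<Rightarrow> bool" where
  "bbm_well_posed a s R T \<longleftrightarrow>
     (\<forall>u0\<in>sobolev s. sobolev_norm s u0 \<le> R \<longrightarrow>
        (\<exists>u. bbm_solution a s {0..T} u0 u \<and>
           (\<forall>v. bbm_solution a s {0..T} u0 v \<longrightarrow>
              (\<forall>t\<in>{0..T}. AE x in lborel. v t x = u t x)))) \<and>
     (\<exists>L. \<forall>u0\<in>sobolev s. \<forall>v0\<in>sobolev s. \<forall>u v.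
        sobolev_norm s u0 \<le> R \<longrightarrow> sobolev_norm s v0 \<le> R \<longrightarrow>
        bbm_solution a s {0..T} u0 u \<longrightarrow> bbm_solution a s {0..T} v0 v \<longrightarrow>
        (\<forall>t\<in>{0..T}. sobolev_norm s (\<lambda>x. u t x - v t x)
            \<le> L * sobolev_norm s (\<lambda>x. u0 x - v0 x)))"

text \<open>Boundedness of the functional makes it well defined on almost-everywhere classes.\<close>

definition sobolev_dual :: "real \<Rightarrow> ((real \<Rightarrow> real) \<Rightarrow> real) set" where
  "sobolev_dual s = {\<psi>.
     (\<forall>f\<in>sobolev s. \<forall>g\<in>sobolev s. \<psi> (\<lambda>x. f x + g x) = \<psi> f + \<psi> g) \<and>
     (\<forall>c. \<forall>f\<in>sobolev s. \<psi> (\<lambda>x. c * f x) = c * \<psi> f) \<and>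
     (\<exists>K. \<forall>f\<in>sobolev s. \<bar>\<psi> f\<bar> \<le> K * sobolev_norm s f)}"

definition sobolev_weak_limit ::
    "real \<Rightarrow> (real \<Rightarrow> real \<Rightarrow> real) \<Rightarrow> (real \<Rightarrow> real) \<Rightarrow> real filter \<Rightarrow> bool" where
  "sobolev_weak_limit s u f F \<longleftrightarrow> (\<forall>\<psi>\<in>sobolev_dual s. ((\<lambda>t. \<psi> (u t)) \<longlongrightarrow> \<psi> f) F)"

definition modified_UCP :: bool where
  "modified_UCP \<longleftrightarrow> (\<exists>\<delta>>0. \<forall>v0\<in>sobolev 1. sobolev_norm 1 v0 < \<delta> \<longrightarrow>
     (\<forall>v. bbm_solution (\<lambda>_. 0) 1 {0..} v0 v \<longrightarrow>
        (\<forall>C \<omega>' T. torus_open \<omega>' \<and> \<omega>' \<noteq> {} \<and> T > 0 \<and>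
            (\<forall>t\<in>{0<..<T}. AE x in lborel. x \<in> \<omega>' \<longrightarrow> v t x = C) \<longrightarrow>
          (AE x in lborel. v0 x = C))))"

end

theory Submission
  imports Defs "HOL-Complex_Analysis.Great_Picard"
begin

text \<open>In Fourier coordinates \<open>X n = (1 + n\<^sup>2)\<^bsup>s/2\<^esup> u\<^sub>n\<close> the space \<open>H\<^sup>s\<close> becomes the closed subspace of
those square-summable sequences that satisfy \<open>X (-n) = cnj (X n)\<close>, and the system becomes
\<open>X' = - rhs a s X\<close>. The operator \<open>(1 - \<partial>\<^sub>x\<^sup>2)\<^sup>-\<^sup>1\<close> absorbs the two derivatives of the damping term, and for
\<open>s \<ge> 0\<close> the product \<open>u\<^sup>2\<close> has Fourier coefficients of size \<open>O((1 + n\<^sup>2)\<^bsup>-s/2\<^esup>)\<close>, which the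
square-summable multiplier \<open>i n / (1 + n\<^sup>2)\<close> brings back to \<open>H\<^sup>s\<close>. So \<open>rhs\<close> is a continuous linear map
plus a continuous quadratic one, hence locally Lipschitz, and the Banach fixed point theorem gives local
well-posedness with a Lipschitz solution map (\<open>rhs_lipschitz\<close>, \<open>local_existence\<close>,
\<open>bbm_locally_well_posed\<close>).

For \<open>s = 1\<close> the inner product of \<open>X\<close> with \<open>rhs a 1 X\<close> is \<open>\<integral> a u\<^sub>x\<^sup>2\<close>, because \<open>\<integral> u u\<^sub>x = \<integral> u\<^sup>2 u\<^sub>x = 0\<close>, and
the mean of \<open>u\<close> is conserved. This makes the distance to every constant nonincreasing and excludes
blow-up (\<open>energy_identity\<close>, \<open>bbm_globally_well_posed\<close>, \<open>bbm_energy_antimono\<close>).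

For the asymptotics, take times \<open>\<tau>\<^sub>j \<rightarrow> \<infinity>\<close>. The translates \<open>X (\<tau>\<^sub>j + t)\<close> are bounded and equi-Lipschitz in
\<open>t\<close>, so along a subsequence they converge coordinatewise to some \<open>Z t\<close>, for all real \<open>t\<close>. As the nonlinearity
is weakly continuous on \<open>H\<^sup>1\<close>, \<open>Z\<close> solves the same equation, and as the total dissipation is finite, \<open>Z\<close>
is not damped at all: its spatial derivative vanishes where \<open>a > 0\<close> (\<open>Damp_Z\<close>, \<open>constant_on_band\<close>). It
remains to see that a bounded solution of the undamped equation which lives for all times, past and future,
and is constant in space on a band is constant (\<open>band_solution_constant\<close>).

Write \<open>w = 1 + u\<close>, \<open>\<Phi> = (1 - \<partial>\<^sub>x\<^sup>2)\<^sup>-\<^sup>1 (w\<^sup>2/2)\<close> and \<open>P = \<Phi>\<^sub>x\<close>, so that \<open>w\<^sub>t = - P\<close> and \<open>P\<^sub>x = \<Phi> - w\<^sup>2/2\<close>.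
On the band, \<open>w\<close> is a constant \<open>c\<close>, \<open>P = 0\<close> and \<open>F = \<Phi> - c\<^sup>2/2 = 0\<close>. On the rest of the circle the equation is
read with \<open>x\<close> in the role of time. From \<open>F\<^sub>x = P\<close> and \<open>P\<^sub>x = F - (w\<^sup>2 - c\<^sup>2)/2\<close> follows the conservation law
\<open>(F\<^sup>2 - P\<^sup>2)\<^sub>x = (w\<^sup>2 - c\<^sup>2) P = (c\<^sup>2 w - w\<^sup>3/3)\<^sub>t\<close>, so the integral over \<open>-T \<le> t \<le> T\<close> of \<open>F\<^sup>2 - P\<^sup>2\<close> is bounded
independently of \<open>T\<close>. Gronwall's inequality in \<open>x\<close> then bounds \<open>\<integral> P\<^sup>2 dt\<close>, so \<open>P\<close> is small at suitable
times \<open>t \<rightarrow> \<infinity>\<close> and \<open>t \<rightarrow> -\<infinity>\<close>. By compactness \<open>w\<close> converges along these times to a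
continuous function whose square is \<open>c\<^sup>2\<close>, that is, to \<open>c\<close>. Consequently the conserved quantity \<open>\<integral> (w - c) dx\<close>
is zero, and \<open>L = \<integral> (x - p) (w - c) dx\<close>, whose derivative is \<open>1/2 \<integral> (w - c)\<^sup>2 dx \<ge> 0\<close>, tends to zero at both ends
of time. So \<open>L\<close> vanishes identically and \<open>w = c\<close> everywhere.

Every weak limit being constant in space, with the conserved mean, all Fourier coefficients of
\<open>u t\<close> converge to those of the mean. Boundedness in \<open>H\<^sup>1\<close> turns this into weak convergence, and the compactness
of the embedding of \<open>H\<^sup>1\<close> into \<open>H\<^sup>s\<close> for \<open>s < 1\<close> into strong convergence.\<close>

section \<open>The Hilbert space of square-summable sequences\<close>

lemma summable_square_add:
  fixes x y :: "int \<Rightarrow> complex"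
  assumes "(\<lambda>n. (cmod (x n))\<^sup>2) summable_on UNIV" "(\<lambda>n. (cmod (y n))\<^sup>2) summable_on UNIV"
  shows "(\<lambda>n. (cmod (x n + y n))\<^sup>2) summable_on UNIV"
proof (rule summable_on_comparison_test)
  show "(\<lambda>n. 2 * (cmod (x n))\<^sup>2 + 2 * (cmod (y n))\<^sup>2) summable_on UNIV"
    by (intro summable_on_add summable_on_cmult_right assms)
  show "(cmod (x n + y n))\<^sup>2 \<le> 2 * (cmod (x n))\<^sup>2 + 2 * (cmod (y n))\<^sup>2" for n
  proof -
    have "(cmod (x n + y n))\<^sup>2 \<le> (cmod (x n) + cmod (y n))\<^sup>2"
      by (simp add: norm_triangle_ineq power_mono)
    also have "\<dots> \<le> 2 * (cmod (x n))\<^sup>2 + 2 * (cmod (y n))\<^sup>2"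
      using zero_le_power2[of "cmod (x n) - cmod (y n)"] by (simp add: power2_eq_square algebra_simps)
    finally show ?thesis .
  qed
qed auto

lemma summable_mult_of_square:
  fixes f g :: "'i \<Rightarrow> real"
  assumes "(\<lambda>n. (f n)\<^sup>2) summable_on A" "(\<lambda>n. (g n)\<^sup>2) summable_on A"
    "\<And>n. n \<in> A \<Longrightarrow> norm (h n :: 'b::banach) \<le> \<bar>f n\<bar> * \<bar>g n\<bar>"
  shows "(\<lambda>n. norm (h n)) summable_on A"
proof (rule summable_on_comparison_test)
  show "(\<lambda>n. ((f n)\<^sup>2 + (g n)\<^sup>2) / 2) summable_on A"
    using summable_on_cmult_right[OF summable_on_add[OF assms(1,2)], of "1/2"] by (simp add: field_simps)
  show "norm (h n) \<le> ((f n)\<^sup>2 + (g n)\<^sup>2) / 2" if "n \<in> A" for n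
    using assms(3)[OF that] zero_le_power2[of "\<bar>f n\<bar> - \<bar>g n\<bar>"]
    by (simp add: power2_eq_square algebra_simps)
qed auto

text \<open>The coordinates of \<open>f\<close> in \<open>H\<^sup>s\<close> will be its Fourier coefficients times \<open>(1 + n\<^sup>2)\<^bsup>s/2\<^esup>\<close>. The weight is kept out of
the type, so that a single Banach space serves for all real \<open>s\<close>.\<close>

typedef ell2 = "{x :: int \<Rightarrow> complex. (\<lambda>n. (cmod (x n))\<^sup>2) summable_on UNIV}"
  morphisms coord Abs_ell2
  by (rule exI[of _ "\<lambda>_. 0"]) auto

setup_lifting type_definition_ell2

lemma coord_Abs_ell2:
  "(\<lambda>n. (cmod (x n))\<^sup>2) summable_on UNIV \<Longrightarrow> coord (Abs_ell2 x) = x"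
  by (simp add: Abs_ell2_inverse)

lemma ell2_eqI: "(\<And>n. coord x n = coord y n) \<Longrightarrow> x = y"
  by (meson coord_inject ext)

lemma summable_coord: "(\<lambda>n. (cmod (coord x n))\<^sup>2) summable_on UNIV"
  using coord by blast

instantiation ell2 :: ab_group_add
begin
lift_definition zero_ell2 :: ell2 is "\<lambda>_. 0" by simp
lift_definition plus_ell2 :: "ell2 \<Rightarrow> ell2 \<Rightarrow> ell2" is "\<lambda>x y n. x n + y n"
  by (rule summable_square_add)
lift_definition uminus_ell2 :: "ell2 \<Rightarrow> ell2" is "\<lambda>x n. - x n" by simp
lift_definition minus_ell2 :: "ell2 \<Rightarrow> ell2 \<Rightarrow> ell2" is "\<lambda>x y n. x n - y n"
  using summable_square_add[where y = "\<lambda>n. - _ n"] by fastforce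
instance by standard (transfer; auto)+
end

lemma summable_inner_coord: "(\<lambda>n. coord x n \<bullet> coord y n) summable_on UNIV"
proof -
  have "(\<lambda>n. norm (coord x n \<bullet> coord y n)) summable_on UNIV"
    by (rule summable_mult_of_square[OF summable_coord[of x] summable_coord[of y]])
       (simp add: Cauchy_Schwarz_ineq2)
  thus ?thesis by (rule abs_summable_summable)
qed

instantiation ell2 :: real_inner
begin
lift_definition scaleR_ell2 :: "real \<Rightarrow> ell2 \<Rightarrow> ell2" is "\<lambda>r x n. r *\<^sub>R x n"
  using summable_on_cmult_right by (fastforce simp: power_mult_distrib)
definition inner_ell2 :: "ell2 \<Rightarrow> ell2 \<Rightarrow> real" where
  "inner_ell2 x y = (\<Sum>\<^sub>\<infinity>n. coord x n \<bullet> coord y n)"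
definition norm_ell2 :: "ell2 \<Rightarrow> real" where "norm_ell2 x = sqrt (x \<bullet> x)"
definition sgn_ell2 :: "ell2 \<Rightarrow> ell2" where "sgn_ell2 x = inverse (norm x) *\<^sub>R x"
definition dist_ell2 :: "ell2 \<Rightarrow> ell2 \<Rightarrow> real" where "dist_ell2 x y = norm (x - y)"
definition uniformity_ell2 :: "(ell2 \<times> ell2) filter" where
  "uniformity_ell2 = (INF e\<in>{0 <..}. principal {(x, y). dist x y < e})"
definition open_ell2 :: "ell2 set \<Rightarrow> bool" where
  "open_ell2 U \<longleftrightarrow> (\<forall>x\<in>U. eventually (\<lambda>(x', y). x' = x \<longrightarrow> y \<in> U) uniformity)"
instance
proof
  fix x y z :: ell2 and r s :: real
  show "r *\<^sub>R (x + y) = r *\<^sub>R x + r *\<^sub>R y" "(r + s) *\<^sub>R x = r *\<^sub>R x + s *\<^sub>R x"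
    "r *\<^sub>R s *\<^sub>R x = (r * s) *\<^sub>R x" "1 *\<^sub>R x = x"
    by (transfer; simp add: algebra_simps)+
  show "dist x y = norm (x - y)" by (fact dist_ell2_def)
  show "sgn x = inverse (norm x) *\<^sub>R x" by (fact sgn_ell2_def)
  show "uniformity = (INF e\<in>{0 <..}. principal {(x, y). dist (x::ell2) y < e})"
    by (fact uniformity_ell2_def)
  show "open U \<longleftrightarrow> (\<forall>x\<in>U. eventually (\<lambda>(x', y). x' = x \<longrightarrow> y \<in> U) uniformity)" for U :: "ell2 set"
    by (fact open_ell2_def)
  show "norm x = sqrt (x \<bullet> x)" by (fact norm_ell2_def)
  show "x \<bullet> y = y \<bullet> x" by (simp add: inner_ell2_def inner_commute)
  show "(x + y) \<bullet> z = x \<bullet> z + y \<bullet> z"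
    by (simp add: inner_ell2_def plus_ell2.rep_eq inner_add_left infsum_add summable_inner_coord)
  show "(r *\<^sub>R x) \<bullet> y = r * (x \<bullet> y)"
    by (simp add: inner_ell2_def scaleR_ell2.rep_eq inner_scaleR_left infsum_cmult_right'
        summable_inner_coord del: inner_complex_def)
  show "0 \<le> x \<bullet> x" unfolding inner_ell2_def by (intro infsum_nonneg) auto
  show "(x \<bullet> x = 0) = (x = 0)"
  proof
    assume "x \<bullet> x = 0"
    hence "coord x n \<bullet> coord x n = 0" for n
      using nonneg_infsum_le_0D[of "\<lambda>n. coord x n \<bullet> coord x n" UNIV n] summable_inner_coord[of x x]
      unfolding inner_ell2_def by auto
    thus "x = 0" by (intro ell2_eqI) (simp add: zero_ell2.rep_eq)
  next
    assume "x = 0" thus "x \<bullet> x = 0" by (simp add: inner_ell2_def zero_ell2.rep_eq)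
  qed
qed
end

lemmas coord_simps [simp] =
  zero_ell2.rep_eq plus_ell2.rep_eq minus_ell2.rep_eq uminus_ell2.rep_eq scaleR_ell2.rep_eq

lemma norm_ell2_square: "(norm x)\<^sup>2 = (\<Sum>\<^sub>\<infinity>n. (cmod (coord x n))\<^sup>2)"
  by (simp add: power2_norm_eq_inner inner_ell2_def)

lemma norm_ell2_eq: "norm x = sqrt (\<Sum>\<^sub>\<infinity>n. (cmod (coord x n))\<^sup>2)"
  by (metis norm_ell2_square norm_ge_zero real_sqrt_unique)

lemma sum_coord_le_norm: "finite A \<Longrightarrow> (\<Sum>n\<in>A. (cmod (coord x n))\<^sup>2) \<le> (norm x)\<^sup>2"
  unfolding norm_ell2_square by (rule finite_sum_le_infsum[OF summable_coord]) auto

lemma coord_le_norm: "cmod (coord x n) \<le> norm x"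
  using sum_coord_le_norm[of "{n}" x] by (simp add: power2_le_iff_abs_le)

lemma bounded_linear_coord: "bounded_linear (\<lambda>x. coord x n)"
  by (rule bounded_linear_intro[where K = 1]) (auto simp: coord_le_norm)

lemma norm_ell2_le:
  assumes "\<And>A. finite A \<Longrightarrow> (\<Sum>n\<in>A. (cmod (coord x n))\<^sup>2) \<le> B\<^sup>2" "0 \<le> B"
  shows "norm x \<le> B"
proof -
  have "(norm x)\<^sup>2 \<le> B\<^sup>2"
    unfolding norm_ell2_square by (rule infsum_le_finite_sums[OF summable_coord]) (use assms in auto)
  thus ?thesis using assms(2) by (simp add: power2_le_iff_abs_le)
qed

text \<open>The bound on finitely many squares passes to the limit. So a bounded family that converges in every
coordinate has its limit in the space, within the same bound.\<close>

lemma ell2_weak_limit: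
  assumes "\<And>n. ((\<lambda>j. coord (X j) n) \<longlongrightarrow> x n) F" "F \<noteq> bot" "\<forall>\<^sub>F j in F. norm (X j) \<le> B"
  shows "(\<lambda>n. (cmod (x n))\<^sup>2) summable_on UNIV" "norm (Abs_ell2 x) \<le> B" "coord (Abs_ell2 x) = x"
proof -
  have B: "0 \<le> B"
    using eventually_happens'[OF assms(2,3)] norm_ge_zero order_trans by blast
  have le: "(\<Sum>n\<in>A. (cmod (x n))\<^sup>2) \<le> B\<^sup>2" if "finite A" for A
  proof (rule tendsto_upperbound)
    show "((\<lambda>j. \<Sum>n\<in>A. (cmod (coord (X j) n))\<^sup>2) \<longlongrightarrow> (\<Sum>n\<in>A. (cmod (x n))\<^sup>2)) F"
      by (intro tendsto_intros assms)
    show "\<forall>\<^sub>F j in F. (\<Sum>n\<in>A. (cmod (coord (X j) n))\<^sup>2) \<le> B\<^sup>2"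
      using assms(3)
    proof eventually_elim
      case (elim j)
      have "(\<Sum>n\<in>A. (cmod (coord (X j) n))\<^sup>2) \<le> (norm (X j))\<^sup>2" by (rule sum_coord_le_norm[OF that])
      also have "\<dots> \<le> B\<^sup>2" using elim by (intro power_mono) auto
      finally show ?case .
    qed
  qed fact
  show s: "(\<lambda>n. (cmod (x n))\<^sup>2) summable_on UNIV"
    by (rule nonneg_bdd_above_summable_on) (auto intro!: bdd_aboveI2[where M = "B\<^sup>2"] le)
  show c: "coord (Abs_ell2 x) = x" by (rule coord_Abs_ell2[OF s])
  show "norm (Abs_ell2 x) \<le> B" by (rule norm_ell2_le) (auto simp: c le B)
qed

instance ell2 :: banach
proof
  fix X :: "nat \<Rightarrow> ell2" assume X: "Cauchy X"
  have "Cauchy (\<lambda>j. coord (X j) n)" for n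
    by (rule bounded_linear.Cauchy[OF bounded_linear_coord X])
  hence "\<exists>l. (\<lambda>j. coord (X j) n) \<longlonglongrightarrow> l" for n
    using Cauchy_convergent_iff convergent_def by blast
  then obtain x where x: "\<And>n. (\<lambda>j. coord (X j) n) \<longlonglongrightarrow> x n" by metis
  obtain B where B: "\<And>j. norm (X j) \<le> B"
    using Cauchy_Bseq[OF X] by (auto simp: Bseq_def)
  have cx: "coord (Abs_ell2 x) = x"
    by (rule ell2_weak_limit(3)[OF x, where B = B]) (auto simp: B)
  have "X \<longlonglongrightarrow> Abs_ell2 x"
  proof (rule LIMSEQ_I)
    fix r :: real assume r: "0 < r"
    then obtain N where N: "\<And>m n. m \<ge> N \<Longrightarrow> n \<ge> N \<Longrightarrow> norm (X m - X n) < r/2"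
      using X by (metis CauchyD half_gt_zero)
    have "norm (X m - Abs_ell2 x) < r" if "m \<ge> N" for m
    proof -
      have "norm (Abs_ell2 (\<lambda>n. coord (X m) n - x n)) \<le> r/2"
      proof (rule ell2_weak_limit(2)[where X = "\<lambda>j. X m - X j"])
        show "((\<lambda>j. coord (X m - X j) n) \<longlongrightarrow> coord (X m) n - x n) sequentially" for n
          by (auto intro!: tendsto_intros x)
        show "\<forall>\<^sub>F j in sequentially. norm (X m - X j) \<le> r / 2"
          using N that by (auto simp: eventually_sequentially intro!: exI[of _ N] less_imp_le)
      qed auto
      moreover have "Abs_ell2 (\<lambda>n. coord (X m) n - x n) = X m - Abs_ell2 x"
        by (subst coord_inverse[of "X m - Abs_ell2 x", symmetric]) (simp add: cx)
      ultimately show ?thesis using r by simp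
    qed
    thus "\<exists>N. \<forall>m\<ge>N. norm (X m - Abs_ell2 x) < r" by blast
  qed
  thus "convergent X" by (auto simp: convergent_def)
qed

text \<open>For bounded families, convergence of the coordinates is weak convergence: \<open>y\<close> is approximated by a finitely
supported \<open>z\<close>, and \<open>z \<bullet> X j\<close> involves only finitely many coordinates.\<close>

lemma ell2_weak_inner:
  assumes x: "\<And>n. ((\<lambda>j. coord (X j) n) \<longlongrightarrow> coord x n) F" and F: "F \<noteq> bot"
    and B: "\<forall>\<^sub>F j in F. norm (X j) \<le> B"
  shows "((\<lambda>j. y \<bullet> X j) \<longlongrightarrow> y \<bullet> x) F"
proof (rule tendstoI)
  fix e :: real assume e: "0 < e"
  have B0: "0 \<le> B"
    using eventually_happens'[OF F B] norm_ge_zero order_trans by blast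
  have Bx: "norm x \<le> B"
    using ell2_weak_limit(2)[OF x F B] by (simp add: coord_inverse)
  define d where "d = e / (4 * (B + 1))"
  have d: "0 < d" using e B0 by (simp add: d_def)
  obtain A where A: "finite A" "dist (\<Sum>n\<in>A. (cmod (coord y n))\<^sup>2) ((norm y)\<^sup>2) \<le> d\<^sup>2"
    using has_sum_finite_approximation[OF has_sum_infsum[OF summable_coord[of y]], of "d\<^sup>2"] d
    by (auto simp: norm_ell2_square)
  define z where "z = Abs_ell2 (\<lambda>n. if n \<in> A then coord y n else 0)"
  have s: "(\<lambda>n. (cmod (if n \<in> A then coord y n else 0))\<^sup>2) summable_on UNIV"
    by (rule summable_on_comparison_test[OF summable_coord[of y]]) auto
  have z: "coord z n = (if n \<in> A then coord y n else 0)" for n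
    unfolding z_def by (subst coord_Abs_ell2[OF s]) simp
  have zi: "z \<bullet> w = (\<Sum>n\<in>A. coord y n \<bullet> coord w n)" for w
  proof -
    have "z \<bullet> w = infsum (\<lambda>n. coord z n \<bullet> coord w n) A"
      unfolding inner_ell2_def by (rule infsum_cong_neutral) (auto simp: z)
    also have "\<dots> = (\<Sum>n\<in>A. coord y n \<bullet> coord w n)" using A by (simp add: z)
    finally show ?thesis .
  qed
  have "(norm (y - z))\<^sup>2 = (norm y)\<^sup>2 - (\<Sum>n\<in>A. (cmod (coord y n))\<^sup>2)"
  proof -
    have "y \<bullet> z = (\<Sum>n\<in>A. (cmod (coord y n))\<^sup>2)" "z \<bullet> z = (\<Sum>n\<in>A. (cmod (coord y n))\<^sup>2)"
      using zi[of y] zi[of z] by (auto simp: inner_commute power2_norm_eq_inner z)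
    thus ?thesis by (simp add: power2_norm_eq_inner inner_diff_left inner_diff_right inner_commute)
  qed
  also have "\<dots> \<le> d\<^sup>2" using A(2) by (simp add: dist_real_def)
  finally have yz: "norm (y - z) \<le> d" using d by (simp add: power2_le_iff_abs_le)
  have "((\<lambda>j. z \<bullet> X j) \<longlongrightarrow> z \<bullet> x) F"
    unfolding zi by (intro tendsto_intros x)
  hence "\<forall>\<^sub>F j in F. dist (z \<bullet> X j) (z \<bullet> x) < e/2"
    by (rule tendstoD) (use e in simp)
  with B show "\<forall>\<^sub>F j in F. dist (y \<bullet> X j) (y \<bullet> x) < e"
  proof eventually_elim
    case (elim j)
    have *: "\<bar>(y - z) \<bullet> w\<bar> \<le> e/4" if "norm w \<le> B" for w
    proof -
      have "\<bar>(y - z) \<bullet> w\<bar> \<le> norm (y - z) * norm w" by (rule Cauchy_Schwarz_ineq2)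
      also have "\<dots> \<le> d * (B + 1)" using yz that B0 d by (intro mult_mono) auto
      also have "\<dots> = e/4" using B0 by (simp add: d_def field_simps)
      finally show ?thesis .
    qed
    have "y \<bullet> X j - y \<bullet> x = (y - z) \<bullet> X j - (y - z) \<bullet> x + (z \<bullet> X j - z \<bullet> x)"
      by (simp add: inner_diff_left)
    moreover have "\<bar>z \<bullet> X j - z \<bullet> x\<bar> < e/2" using elim(2) by (simp add: dist_real_def)
    ultimately have "\<bar>y \<bullet> X j - y \<bullet> x\<bar> < e/4 + e/4 + e/2"
      using *[OF elim(1)] *[OF Bx] by (smt (verit))
    thus ?case by (simp add: dist_real_def)
  qed
qed

definition single :: "int \<Rightarrow> complex \<Rightarrow> ell2" where
  "single n z = Abs_ell2 (\<lambda>m. if m = n then z else 0)"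

lemma coord_single [simp]: "coord (single n z) m = (if m = n then z else 0)"
proof -
  have "(\<lambda>m. (cmod (if m = n then z else 0))\<^sup>2) summable_on UNIV"
    by (rule finite_nonzero_values_imp_summable_on) (auto intro: finite_subset[of _ "{n}"])
  thus ?thesis by (simp add: single_def coord_Abs_ell2)
qed

lemma inner_single: "single n z \<bullet> x = z \<bullet> coord x n"
proof -
  have "single n z \<bullet> x = infsum (\<lambda>m. coord (single n z) m \<bullet> coord x m) {n}"
    unfolding inner_ell2_def by (rule infsum_cong_neutral) auto
  thus ?thesis by simp
qed

section \<open>Fourier coefficients and square-integrable functions\<close>

text \<open>Normalised to a probability measure, so that Fourier coefficients are integrals against characters without
a prefactor, and \<open>L\<^sup>1\<close> norms are bounded by \<open>L\<^sup>2\<close> norms.\<close>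

definition tor :: "real measure" where
  "tor = density lborel (\<lambda>x. ennreal (indicator {0..2*pi} x / (2*pi)))"

lemma sets_tor [measurable_cong, simp]: "sets tor = sets borel"
  by (simp add: tor_def)

lemma space_tor [simp]: "space tor = UNIV"
  by (simp add: tor_def)

lemma integral_tor:
  fixes f :: "real \<Rightarrow> 'b::{banach, second_countable_topology}"
  assumes "f \<in> borel_measurable borel"
  shows "integral\<^sup>L tor f = (1 / (2*pi)) *\<^sub>R (LINT x:{0..2*pi}|lborel. f x)"
proof -
  have "integral\<^sup>L tor f = (\<integral>x. (indicator {0..2*pi} x / (2*pi)) *\<^sub>R f x \<partial>lborel)"
    unfolding tor_def by (rule integral_density) (use assms in auto)
  also have "\<dots> = (\<integral>x. (1 / (2*pi)) *\<^sub>R (indicator {0..2*pi} x *\<^sub>R f x) \<partial>lborel)"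
    by simp
  finally show ?thesis by (simp only: integral_scaleR_right set_lebesgue_integral_def)
qed

lemma integrable_tor_iff:
  fixes f :: "real \<Rightarrow> 'b::{banach, second_countable_topology}"
  assumes "f \<in> borel_measurable borel"
  shows "integrable tor f \<longleftrightarrow> set_integrable lborel {0..2*pi} f"
proof -
  have "integrable tor f \<longleftrightarrow> integrable lborel (\<lambda>x. (indicator {0..2*pi} x / (2*pi)) *\<^sub>R f x)"
    unfolding tor_def by (rule integrable_density) (use assms in auto)
  also have "\<dots> \<longleftrightarrow> integrable lborel (\<lambda>x. (1 / (2*pi)) *\<^sub>R (indicator {0..2*pi} x *\<^sub>R f x))"
    by simp
  also have "\<dots> \<longleftrightarrow> set_integrable lborel {0..2*pi} f"
    unfolding set_integrable_def
  proof
    assume "integrable lborel (\<lambda>x. (1 / (2*pi)) *\<^sub>R (indicator {0..2*pi} x *\<^sub>R f x))"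
    hence "integrable lborel (\<lambda>x. (2*pi) *\<^sub>R (1 / (2*pi)) *\<^sub>R (indicator {0..2*pi} x *\<^sub>R f x))"
      by (rule integrable_scaleR_right)
    thus "integrable lborel (\<lambda>x. indicator {0..2*pi} x *\<^sub>R f x)" by simp
  qed (rule integrable_scaleR_right)
  finally show ?thesis .
qed

lemma AE_tor: "(AE x in tor. P x) \<longleftrightarrow> (AE x in lborel. x \<in> {0..2*pi} \<longrightarrow> P x)"
  unfolding tor_def by (subst AE_density) (auto simp: indicator_def intro!: AE_cong)

interpretation tor: finite_measure tor
  rewrites "space tor = UNIV"
proof -
  have "emeasure tor (space tor) = (\<integral>\<^sup>+x. ennreal (1/(2*pi)) * indicator {0..2*pi} x \<partial>lborel)"
    unfolding tor_def by (subst emeasure_density) (auto intro!: nn_integral_cong simp: indicator_def)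
  also have "\<dots> = ennreal (1/(2*pi)) * emeasure lborel {0..2*pi}"
    by (rule nn_integral_cmult_indicator) auto
  also have "\<dots> < \<infinity>" by (simp add: ennreal_mult_less_top)
  finally show "finite_measure tor" by (auto intro: finite_measureI)
qed auto

lemma measure_tor_UNIV [simp]: "measure tor UNIV = 1"
proof -
  have "measure tor UNIV = (\<integral>x. (1::real) \<partial>tor)" by simp
  also have "\<dots> = 1" by (subst integral_tor) (auto simp: set_lebesgue_integral_def)
  finally show ?thesis .
qed

lemma integrable_tor_bounded:
  fixes f :: "real \<Rightarrow> 'b::{banach, second_countable_topology}"
  assumes "f \<in> borel_measurable borel" "\<And>x. norm (f x) \<le> B"
  shows "integrable tor f"
  by (rule tor.integrable_const_bound[of _ B]) (use assms in auto)

lemma cis_measurable [measurable]: "cis \<in> borel_measurable borel"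
  by (intro borel_measurable_continuous_onI continuous_intros)

definition char :: "int \<Rightarrow> real \<Rightarrow> complex" where "char n x = cis (of_int n * x)"

lemma char_measurable [measurable]: "char n \<in> borel_measurable borel"
  unfolding char_def by measurable

lemma norm_char [simp]: "cmod (char n x) = 1" by (simp add: char_def)

lemma char_0 [simp]: "char 0 x = 1" by (simp add: char_def)

lemma char_mult: "char n x * char m x = char (n + m) x"
  by (simp add: char_def cis_mult algebra_simps)

lemma cnj_char [simp]: "cnj (char n x) = char (- n) x"
  by (simp add: char_def cis_cnj)

lemma char_periodic: "char n (x + 2 * pi) = char n x"
proof -
  have "char n (x + 2 * pi) = cis (of_int n * x) * cis (2 * pi * of_int n)"
    by (simp add: char_def cis_mult algebra_simps)
  thus ?thesis by (simp add: char_def)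
qed

lemma char_has_vector_derivative:
  "(char n has_vector_derivative (\<i> * of_int n * char n x)) (at x within S)"
proof -
  have "((\<lambda>z. exp (\<i> * of_int n * z)) has_field_derivative (\<i> * of_int n * exp (\<i> * of_int n * of_real x)))
      (at (of_real x))"
    by (auto intro!: derivative_eq_intros)
  from has_vector_derivative_real_field[OF this, of S] show ?thesis
    by (simp add: char_def[abs_def] cis_conv_exp mult.assoc)
qed

lemma continuous_on_char [continuous_intros]: "continuous_on S (char n)"
  unfolding char_def by (intro continuous_intros)

lemma fourier_coeff_tor:
  assumes [measurable]: "f \<in> borel_measurable borel"
  shows "fourier_coeff f n = (\<integral>x. f x *\<^sub>R char (- n) x \<partial>tor)"
proof -
  have "(\<integral>x. f x *\<^sub>R char (- n) x \<partial>tor) = (1 / (2*pi)) *\<^sub>R (LINT x:{0..2*pi}|lborel. f x *\<^sub>R char (- n) x)"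
    by (rule integral_tor) simp
  thus ?thesis
    by (simp add: fourier_coeff_def distr_coeff_def regular_distr_def char_def scaleR_conv_of_real)
qed

lemma integral_char: "(\<integral>x. char n x \<partial>tor) = (if n = 0 then 1 else 0)"
proof (cases "n = 0")
  case False
  have "(LINT x:{0..2*pi}|lborel. char n x) = char n (2*pi) / (\<i> * of_int n) - char n 0 / (\<i> * of_int n)"
    unfolding set_lebesgue_integral_def
  proof (rule integral_FTC_atLeastAtMost)
    show "((\<lambda>x. char n x / (\<i> * of_int n)) has_vector_derivative char n x) (at x within {0..2*pi})" for x
      using has_vector_derivative_divide[OF char_has_vector_derivative[of n x "{0..2*pi}"], of "\<i> * of_int n"] False
      by simp
  qed (auto intro!: continuous_intros)
  also have "\<dots> = 0" using char_periodic[of n 0] by simp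
  finally show ?thesis using False by (subst integral_tor) auto
qed simp

text \<open>Only the values on one period enter; this admits indicators of intervals.\<close>

definition torus_L2 :: "(real \<Rightarrow> real) set" where
  "torus_L2 = {f. f \<in> borel_measurable borel \<and> integrable tor (\<lambda>x. (f x)\<^sup>2)}"

lemma torus_L2_measurable [measurable_dest]: "f \<in> torus_L2 \<Longrightarrow> f \<in> borel_measurable borel"
  by (simp add: torus_L2_def)

lemma torus_L2_square: "f \<in> torus_L2 \<Longrightarrow> integrable tor (\<lambda>x. (f x)\<^sup>2)"
  by (simp add: torus_L2_def)

lemma integrable_L2_mult:
  assumes f: "f \<in> torus_L2" and g: "g \<in> torus_L2"
  shows "integrable tor (\<lambda>x. f x * g x)"
proof (rule Bochner_Integration.integrable_bound)
  show "integrable tor (\<lambda>x. (f x)\<^sup>2 + (g x)\<^sup>2)"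
    by (intro Bochner_Integration.integrable_add torus_L2_square assms)
  show "(\<lambda>x. f x * g x) \<in> borel_measurable tor" using assms by measurable
  have "\<bar>a * b\<bar> \<le> a\<^sup>2 + b\<^sup>2" for a b :: real
  proof -
    have "2 * \<bar>a * b\<bar> \<le> a\<^sup>2 + b\<^sup>2"
      using zero_le_power2[of "\<bar>a\<bar> - \<bar>b\<bar>"] by (simp add: power2_eq_square algebra_simps abs_mult)
    thus ?thesis using abs_ge_zero[of "a * b"] by linarith
  qed
  thus "AE x in tor. norm (f x * g x) \<le> norm ((f x)\<^sup>2 + (g x)\<^sup>2)" by simp
qed

lemma torus_L2_bounded:
  assumes "f \<in> borel_measurable borel" "\<And>x. \<bar>f x\<bar> \<le> B"
  shows "f \<in> torus_L2"
proof -
  have "(f x)\<^sup>2 \<le> B\<^sup>2" for x using assms(2)[of x] abs_ge_zero[of "f x"] by (simp add: abs_le_square_iff[symmetric])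
  thus ?thesis unfolding torus_L2_def
    using assms(1) by (auto intro!: integrable_tor_bounded[of _ "B\<^sup>2"])
qed

lemma torus_L2_const: "(\<lambda>_. c) \<in> torus_L2"
  by (rule torus_L2_bounded[of _ "\<bar>c\<bar>"]) auto

lemma torus_L2_integrable: "f \<in> torus_L2 \<Longrightarrow> integrable tor f"
  using integrable_L2_mult[OF _ torus_L2_const[of 1]] by simp

lemma torus_L2_add:
  assumes "f \<in> torus_L2" "g \<in> torus_L2"
  shows "(\<lambda>x. f x + g x) \<in> torus_L2"
proof -
  have "integrable tor (\<lambda>x. (f x)\<^sup>2 + (g x)\<^sup>2 + 2 * (f x * g x))"
    by (intro Bochner_Integration.integrable_add torus_L2_square integrable_mult_right integrable_L2_mult assms)
  moreover have "(\<lambda>x. (f x)\<^sup>2 + (g x)\<^sup>2 + 2 * (f x * g x)) = (\<lambda>x. (f x + g x)\<^sup>2)"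
    by (simp add: fun_eq_iff power2_eq_square algebra_simps)
  ultimately show ?thesis using assms unfolding torus_L2_def by auto
qed

lemma torus_L2_cmult: "f \<in> torus_L2 \<Longrightarrow> (\<lambda>x. c * f x) \<in> torus_L2"
  unfolding torus_L2_def by (auto simp: power_mult_distrib)

lemma torus_L2_diff:
  "f \<in> torus_L2 \<Longrightarrow> g \<in> torus_L2 \<Longrightarrow> (\<lambda>x. f x - g x) \<in> torus_L2"
  using torus_L2_add[OF _ torus_L2_cmult[of g "-1"]] by simp

lemma torus_L2_mult_bounded:
  assumes "f \<in> torus_L2" "h \<in> borel_measurable borel" "\<And>x. \<bar>h x\<bar> \<le> B"
  shows "(\<lambda>x. h x * f x) \<in> torus_L2"
proof -
  have "integrable tor (\<lambda>x. (h x * f x)\<^sup>2)"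
  proof (rule Bochner_Integration.integrable_bound)
    show "integrable tor (\<lambda>x. B\<^sup>2 * (f x)\<^sup>2)" using torus_L2_square[OF assms(1)] by simp
    have "(h x)\<^sup>2 \<le> B\<^sup>2" for x using assms(3)[of x] abs_ge_zero[of "h x"] by (simp add: abs_le_square_iff[symmetric])
    thus "AE x in tor. norm ((h x * f x)\<^sup>2) \<le> norm (B\<^sup>2 * (f x)\<^sup>2)"
      by (auto simp: power_mult_distrib intro!: mult_right_mono)
  qed (use assms in measurable)
  thus ?thesis using assms unfolding torus_L2_def by auto
qed

lemma L2_cauchy_schwarz:
  assumes f: "f \<in> torus_L2" and g: "g \<in> torus_L2"
  shows "(\<integral>x. \<bar>f x * g x\<bar> \<partial>tor)\<^sup>2 \<le> (\<integral>x. (f x)\<^sup>2 \<partial>tor) * (\<integral>x. (g x)\<^sup>2 \<partial>tor)"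
proof -
  let ?A = "\<integral>x. (f x)\<^sup>2 \<partial>tor" and ?B = "\<integral>x. (g x)\<^sup>2 \<partial>tor" and ?C = "\<integral>x. \<bar>f x * g x\<bar> \<partial>tor"
  have q: "0 \<le> ?A - 2 * l * ?C + l\<^sup>2 * ?B" for l
  proof -
    have "0 \<le> (\<integral>x. (\<bar>f x\<bar> - l * \<bar>g x\<bar>)\<^sup>2 \<partial>tor)" by simp
    also have "(\<lambda>x. (\<bar>f x\<bar> - l * \<bar>g x\<bar>)\<^sup>2) = (\<lambda>x. (f x)\<^sup>2 - (2 * l) * \<bar>f x * g x\<bar> + l\<^sup>2 * (g x)\<^sup>2)"
      by (simp add: fun_eq_iff power2_eq_square algebra_simps abs_mult)
    also have "(\<integral>x. (f x)\<^sup>2 - (2 * l) * \<bar>f x * g x\<bar> + l\<^sup>2 * (g x)\<^sup>2 \<partial>tor) = ?A - 2 * l * ?C + l\<^sup>2 * ?B"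
      using torus_L2_square[OF f] torus_L2_square[OF g] integrable_L2_mult[OF f g]
      by (subst Bochner_Integration.integral_add Bochner_Integration.integral_diff; simp)+
    finally show ?thesis .
  qed
  have B0: "0 \<le> ?B" and C0: "0 \<le> ?C" and A0: "0 \<le> ?A" by simp_all
  show ?thesis
  proof (cases "?B = 0")
    case True
    \<comment> \<open>The quadratic \<open>q\<close> degenerates to a line, which is nonnegative only if its slope vanishes.\<close>
    have "?C = 0"
    proof (rule ccontr)
      assume "?C \<noteq> 0"
      with C0 have C: "?C > 0" by linarith
      have "0 \<le> ?A - 2 * ((?A + 1) / ?C) * ?C" using q[of "(?A + 1) / ?C"] True by simp
      also have "\<dots> = - ?A - 2" using C by (simp add: field_simps)
      finally show False using A0 by simp
    qed
    thus ?thesis by (simp add: True)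
  next
    case False
    with B0 have B: "?B > 0" by linarith
    \<comment> \<open>The quadratic \<open>q\<close> at its minimiser.\<close>
    have "0 \<le> (?A - 2 * (?C / ?B) * ?C + (?C / ?B)\<^sup>2 * ?B) * ?B"
      by (rule mult_nonneg_nonneg[OF q B0])
    also have "\<dots> = ?A * ?B - ?C\<^sup>2"
      using B by (simp add: field_simps power2_eq_square)
    finally show ?thesis by simp
  qed
qed

lemma L1_le_L2:
  assumes "f \<in> torus_L2"
  shows "(\<integral>x. \<bar>f x\<bar> \<partial>tor) \<le> sqrt (\<integral>x. (f x)\<^sup>2 \<partial>tor)"
  using L2_cauchy_schwarz[OF assms torus_L2_const[of 1]] by (simp add: real_le_rsqrt)

lemma integrable_scaleR_char:
  assumes "integrable tor f"
  shows "integrable tor (\<lambda>x. f x *\<^sub>R char n x)"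
proof (rule Bochner_Integration.integrable_bound[OF assms])
  have [measurable]: "f \<in> borel_measurable tor" using assms by auto
  show "(\<lambda>x. f x *\<^sub>R char n x) \<in> borel_measurable tor" by measurable
qed auto

lemma cmod_fourier_coeff_le:
  assumes "f \<in> borel_measurable borel"
  shows "cmod (fourier_coeff f n) \<le> (\<integral>x. \<bar>f x\<bar> \<partial>tor)"
proof -
  have "cmod (fourier_coeff f n) \<le> (\<integral>x. norm (f x *\<^sub>R char (-n) x) \<partial>tor)"
    unfolding fourier_coeff_tor[OF assms] by (rule integral_norm_bound)
  thus ?thesis by simp
qed

lemma fourier_coeff_add:
  assumes "f \<in> torus_L2" "g \<in> torus_L2"
  shows "fourier_coeff (\<lambda>x. f x + g x) n = fourier_coeff f n + fourier_coeff g n"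
  using assms by (simp add: fourier_coeff_tor torus_L2_measurable scaleR_left_distrib
      integrable_scaleR_char torus_L2_integrable)

lemma fourier_coeff_diff:
  assumes "f \<in> torus_L2" "g \<in> torus_L2"
  shows "fourier_coeff (\<lambda>x. f x - g x) n = fourier_coeff f n - fourier_coeff g n"
  using assms by (simp add: fourier_coeff_tor torus_L2_measurable scaleR_left_diff_distrib
      integrable_scaleR_char torus_L2_integrable)

lemma fourier_coeff_cmult:
  assumes "f \<in> torus_L2"
  shows "fourier_coeff (\<lambda>x. c * f x) n = of_real c * fourier_coeff f n"
proof -
  have "fourier_coeff (\<lambda>x. c * f x) n = (\<integral>x. of_real c * (f x *\<^sub>R char (-n) x) \<partial>tor)"
    using assms by (subst fourier_coeff_tor)
      (auto simp: torus_L2_measurable scaleR_conv_of_real mult.assoc)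
  also have "\<dots> = of_real c * (\<integral>x. f x *\<^sub>R char (-n) x \<partial>tor)"
    by (rule Bochner_Integration.integral_mult_right_zero)
  finally show ?thesis using assms by (simp add: fourier_coeff_tor torus_L2_measurable)
qed

lemma fourier_coeff_cnj:
  assumes "f \<in> torus_L2"
  shows "fourier_coeff f (- n) = cnj (fourier_coeff f n)"
proof -
  have "cnj (\<integral>x. f x *\<^sub>R char (- n) x \<partial>tor) = (\<integral>x. cnj (f x *\<^sub>R char (- n) x) \<partial>tor)"
    by (rule Bochner_Integration.integral_cnj[symmetric])
  thus ?thesis using assms by (simp add: fourier_coeff_tor torus_L2_measurable)
qed

section \<open>Uniqueness of Fourier coefficients\<close>

text \<open>Multiplication by \<open>cos\<close> or \<open>sin\<close> shifts frequencies by one, so it preserves the property of having only zero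
Fourier coefficients. The induction over the polynomial therefore has to be about all complex \<open>g\<close> with this
property, not about \<open>f\<close>.\<close>

lemma integral_real_polynomial_circle:
  assumes f: "integrable tor f" "\<And>n. (\<integral>x. f x *\<^sub>R char n x \<partial>tor) = 0"
    and p: "real_polynomial_function p"
  shows "(\<integral>x. f x *\<^sub>R char n x * of_real (p (cis x)) \<partial>tor) = 0"
proof -
  have cont: "continuous_on UNIV (\<lambda>x. p (cis x))" if "real_polynomial_function p" for p :: "complex \<Rightarrow> real"
    by (rule continuous_on_compose2[of UNIV p UNIV cis])
       (use continuous_real_polymonial_function[OF that] in \<open>auto intro!: continuous_on_cis continuous_on_id continuous_at_imp_continuous_on[of UNIV p]\<close>)
  have bdd: "\<exists>B. \<forall>x. \<bar>p (cis x)\<bar> \<le> B" if "real_polynomial_function p" for p :: "complex \<Rightarrow> real"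
  proof -
    have "compact (p ` sphere 0 1)"
      by (intro compact_continuous_image continuous_at_imp_continuous_on ballI
          continuous_real_polymonial_function[OF that]) auto
    then obtain B where "\<forall>y\<in>p ` sphere 0 1. \<bar>y\<bar> \<le> B"
      by (metis compact_imp_bounded bounded_iff real_norm_def)
    thus ?thesis by (intro exI[of _ B]) auto
  qed
  let ?good = "\<lambda>g::real\<Rightarrow>complex. integrable tor g \<and> (\<forall>n. (\<integral>x. g x * char n x \<partial>tor) = 0)"
  have ch: "integrable tor (\<lambda>x. g x * char n x)" if "integrable tor g" for g n
  proof (rule Bochner_Integration.integrable_bound[OF that])
    have [measurable]: "g \<in> borel_measurable tor" using that by auto
    show "(\<lambda>x. g x * char n x) \<in> borel_measurable tor" by measurable
  qed (auto simp: norm_mult)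
  have "?good (\<lambda>x. g x * of_real (p (cis x)))" if "?good g" for g
    using p that
  proof (induction arbitrary: g)
    case (linear l)
    have l: "complex_of_real (l (cis x)) = of_real (l 1) * ((char 1 x + char (-1) x) / 2)
        + of_real (l \<i>) * ((char 1 x - char (-1) x) / (2 * \<i>))" for x
    proof -
      interpret l: bounded_linear l by fact
      have "cis x = cos x *\<^sub>R 1 + sin x *\<^sub>R \<i>" by (simp add: complex_eq_iff)
      hence "l (cis x) = cos x * l 1 + sin x * l \<i>" by (simp add: l.add l.scaleR)
      hence e: "complex_of_real (l (cis x)) = of_real (l 1) * of_real (cos x) + of_real (l \<i>) * of_real (sin x)"
        by simp
      have c: "complex_of_real (cos x) = (char 1 x + char (-1) x) / 2"
        and s: "complex_of_real (sin x) = (char 1 x - char (-1) x) / (2 * \<i>)"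
        by (auto simp: char_def complex_eq_iff)
      show ?thesis unfolding e c s ..
    qed
    have e: "g x * of_real (l (cis x)) * char n x
        = ((of_real (l 1) - \<i> * of_real (l \<i>)) / 2) * (g x * char (n+1) x)
        + ((of_real (l 1) + \<i> * of_real (l \<i>)) / 2) * (g x * char (n-1) x)" for x n
    proof -
      have "char (n+1) x = char 1 x * char n x" "char (n-1) x = char (-1) x * char n x"
        by (simp_all add: char_mult algebra_simps)
      thus ?thesis unfolding l by (simp add: field_simps)
    qed
    have "integrable tor (\<lambda>x. g x * of_real (l (cis x)) * char n x)" for n
      unfolding e using linear by (intro Bochner_Integration.integrable_add integrable_mult_right ch) auto
    from this[of 0] have "integrable tor (\<lambda>x. g x * of_real (l (cis x)))" by simp
    moreover have "(\<integral>x. g x * of_real (l (cis x)) * char n x \<partial>tor) = 0" for n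
      unfolding e using linear by (subst Bochner_Integration.integral_add) (auto intro!: integrable_mult_right ch)
    ultimately show ?case by blast
  next
    case (const c)
    have "(\<integral>x. g x * of_real c * char n x \<partial>tor) = (\<integral>x. of_real c * (g x * char n x) \<partial>tor)" for n
      by (simp add: mult_ac)
    thus ?case using const by auto
  next
    case (add p q)
    have p: "?good (\<lambda>x. g x * of_real (p (cis x)))" and q: "?good (\<lambda>x. g x * of_real (q (cis x)))"
      using add by blast+
    have "g x * of_real (p (cis x) + q (cis x)) = g x * of_real (p (cis x)) + g x * of_real (q (cis x))" for x
      by (simp add: algebra_simps)
    moreover have "?good (\<lambda>x. g x * of_real (p (cis x)) + g x * of_real (q (cis x)))"
      using p q by (auto simp: distrib_right ch)
    ultimately show ?case by (simp only: simp_thms refl)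
  next
    case (mult p q)
    have "?good (\<lambda>x. g x * of_real (p (cis x)) * of_real (q (cis x)))"
      by (intro mult.IH mult.prems)
    thus ?case by (simp add: mult.assoc)
  qed
  moreover have "?good (\<lambda>x. complex_of_real (f x))"
    using f by (simp add: scaleR_conv_of_real)
  ultimately have "?good (\<lambda>x. complex_of_real (f x) * of_real (p (cis x)))" by blast
  hence "(\<integral>x. complex_of_real (f x) * of_real (p (cis x)) * char n x \<partial>tor) = 0" by blast
  thus ?thesis by (simp add: scaleR_conv_of_real mult_ac)
qed

lemma cis_inj_2pi:
  assumes "cis x = cis y" "\<bar>x - y\<bar> < 2 * pi"
  shows "x = y"
proof -
  have "sin x = sin y" "cos x = cos y" using assms(1) by (auto simp: complex_eq_iff)
  then obtain n :: int where n: "x = y + 2 * pi * n" using sin_cos_eq_iff[of x y] by auto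
  hence "2 * pi * \<bar>real_of_int n\<bar> < 2 * pi * 1" using assms(2) by (simp add: abs_mult)
  hence "\<bar>real_of_int n\<bar> < 1" by (subst (asm) mult_less_cancel_left_pos) auto
  hence "n = 0" by linarith
  thus ?thesis using n by simp
qed

text \<open>By the Stone--Weierstrass theorem \<open>f\<close> is orthogonal to all continuous functions on the circle, by
dominated convergence to indicators of compact sets, and by a monotone class argument to indicators of Borel sets.\<close>

lemma fourier_unique_zero:
  assumes f: "integrable tor f" "\<And>n. (\<integral>x. f x *\<^sub>R char n x \<partial>tor) = 0"
  shows "AE x in tor. f x = 0"
proof -
  have [measurable]: "f \<in> borel_measurable borel" using f(1) borel_measurable_integrable by force
  let ?I = "\<integral>x. \<bar>f x\<bar> \<partial>tor"
  have cont: "(\<integral>x. f x * h (cis x) \<partial>tor) = 0" if h: "continuous_on (sphere 0 1) h" for h :: "complex \<Rightarrow> real"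
  proof -
    have hm: "continuous_on UNIV (\<lambda>x. h (cis x))"
      by (rule continuous_on_compose2[OF h]) (auto intro!: continuous_intros)
    hence [measurable]: "(\<lambda>x. h (cis x)) \<in> borel_measurable borel" by (rule borel_measurable_continuous_onI)
    have eps: "\<bar>\<integral>x. f x * h (cis x) \<partial>tor\<bar> \<le> e * ?I" if e: "e > 0" for e
    proof -
      obtain p where p: "real_polynomial_function p" "\<And>x. x \<in> sphere 0 1 \<Longrightarrow> \<bar>h x - p x\<bar> < e"
        using Stone_Weierstrass_real_polynomial_function[OF _ h e] by auto
      have pc: "continuous_on UNIV (\<lambda>x. p (cis x))"
        by (rule continuous_on_compose2[of UNIV p UNIV cis])
           (use continuous_real_polymonial_function[OF p(1)] in \<open>auto intro!: continuous_on_cis continuous_on_id continuous_at_imp_continuous_on[of UNIV p]\<close>)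
      hence [measurable]: "(\<lambda>x. p (cis x)) \<in> borel_measurable borel" by (rule borel_measurable_continuous_onI)
      have "complex_of_real (\<integral>x. f x * p (cis x) \<partial>tor) = (\<integral>x. f x *\<^sub>R char 0 x * of_real (p (cis x)) \<partial>tor)"
        by (simp add: scaleR_conv_of_real flip: of_real_mult integral_complex_of_real)
      hence p0: "(\<integral>x. f x * p (cis x) \<partial>tor) = 0"
        using integral_real_polynomial_circle[OF f p(1), of 0] by simp
      have bd: "\<bar>f x * (h (cis x) - p (cis x))\<bar> \<le> e * \<bar>f x\<bar>" for x
        using p(2)[of "cis x"] by (auto simp: abs_mult mult.commute[of e] intro!: mult_left_mono)
      have i1: "integrable tor (\<lambda>x. f x * (h (cis x) - p (cis x)))"
        by (rule Bochner_Integration.integrable_bound[of _ "\<lambda>x. e * \<bar>f x\<bar>"]) (use f bd e in auto)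
      have i2: "integrable tor (\<lambda>x. f x * p (cis x))"
      proof -
        have "compact (p ` sphere 0 1)"
          by (intro compact_continuous_image continuous_at_imp_continuous_on ballI
              continuous_real_polymonial_function[OF p(1)]) auto
        then obtain B where "\<forall>y\<in>p ` sphere 0 1. \<bar>y\<bar> \<le> B"
          by (metis compact_imp_bounded bounded_iff real_norm_def)
        hence "\<bar>p (cis x)\<bar> \<le> B" for x by simp
        hence "\<bar>p (cis x)\<bar> \<le> \<bar>B\<bar>" for x using abs_ge_self[of B] order_trans by blast
        hence *: "norm (f x * p (cis x)) \<le> norm (B * f x)" for x
          by (auto simp: abs_mult mult.commute[of "\<bar>B\<bar>"] intro!: mult_left_mono)
        show ?thesis
        proof (rule Bochner_Integration.integrable_bound)
          show "integrable tor (\<lambda>x. B * f x)" using f by simp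
          show "AE x in tor. norm (f x * p (cis x)) \<le> norm (B * f x)" by (rule AE_I2) (rule *)
        qed measurable
      qed
      have "(\<integral>x. f x * h (cis x) \<partial>tor) = (\<integral>x. f x * (h (cis x) - p (cis x)) + f x * p (cis x) \<partial>tor)"
        by (simp add: algebra_simps)
      also have "\<dots> = (\<integral>x. f x * (h (cis x) - p (cis x)) \<partial>tor)"
        using i1 i2 p0 by simp
      also have "\<bar>\<dots>\<bar> \<le> (\<integral>x. e * \<bar>f x\<bar> \<partial>tor)"
        unfolding real_norm_def[symmetric]
        by (rule order_trans[OF integral_norm_bound integral_mono]) (use i1 f bd in auto)
      finally show ?thesis by simp
    qed
    have I: "0 < ?I + 1" by (rule add_nonneg_pos) simp_all
    have "\<bar>\<integral>x. f x * h (cis x) \<partial>tor\<bar> \<le> 0"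
    proof (rule field_le_epsilon)
      fix e :: real assume e: "e > 0"
      have "\<bar>\<integral>x. f x * h (cis x) \<partial>tor\<bar> \<le> e / (?I + 1) * ?I"
        by (rule eps) (use e I in simp)
      also have "\<dots> \<le> e"
        using e I by (simp add: field_simps)
      finally show "\<bar>\<integral>x. f x * h (cis x) \<partial>tor\<bar> \<le> 0 + e" by simp
    qed
    thus ?thesis by simp
  qed
  have closed: "(\<integral>x. f x * indicator K (cis x) \<partial>tor) = 0" if K: "compact K" "K \<noteq> {}" for K :: "complex set"
  proof -
    have [measurable]: "K \<in> sets borel" using K by (simp add: borel_compact)
    \<comment> \<open>Continuous functions on the circle that decrease to the indicator of \<open>K\<close>.\<close>
    let ?h = "\<lambda>k z. max 0 (1 - real k * infdist z K)"
    have hm [measurable]: "(\<lambda>x. ?h k (cis x)) \<in> borel_measurable borel" for k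
      by (intro borel_measurable_continuous_onI continuous_intros)
    have "(\<lambda>k. \<integral>x. f x * ?h k (cis x) \<partial>tor) \<longlonglongrightarrow> (\<integral>x. f x * indicator K (cis x) \<partial>tor)"
    proof (rule integral_dominated_convergence[where w = "\<lambda>x. \<bar>f x\<bar>"])
      show "AE x in tor. (\<lambda>k. f x * ?h k (cis x)) \<longlonglongrightarrow> f x * indicator K (cis x)"
      proof (intro AE_I2 tendsto_mult tendsto_const)
        fix x
        show "(\<lambda>k. ?h k (cis x)) \<longlonglongrightarrow> indicator K (cis x)"
        proof (cases "cis x \<in> K")
          case True thus ?thesis by simp
        next
          case False
          hence d: "infdist (cis x) K > 0"
            using K in_closed_iff_infdist_zero[of K "cis x"] infdist_nonneg[of "cis x" K]
            by (auto simp: compact_imp_closed less_le)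
          obtain N :: nat where N: "1 / infdist (cis x) K < real N" using reals_Archimedean2 by blast
          have "?h k (cis x) = 0" if "k \<ge> N" for k
          proof -
            have "1 / infdist (cis x) K \<le> real k" using N that by linarith
            thus ?thesis using d by (simp add: field_simps)
          qed
          hence "eventually (\<lambda>k. ?h k (cis x) = 0) sequentially" by (auto simp: eventually_sequentially)
          thus ?thesis using False by (simp add: tendsto_eventually)
        qed
      qed
      have "\<bar>?h k z\<bar> \<le> 1" for k z using infdist_nonneg[of z K] by auto
      thus "AE x in tor. norm (f x * ?h k (cis x)) \<le> \<bar>f x\<bar>" for k
        by (auto simp: abs_mult intro!: mult_left_le)
      show "(\<lambda>x. f x * indicator K (cis x)) \<in> borel_measurable tor" by measurable
      show "(\<lambda>x. f x * ?h k (cis x)) \<in> borel_measurable tor" for k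
        using borel_measurable_times[OF \<open>f \<in> borel_measurable borel\<close> hm[of k]]
        by (simp cong: measurable_cong_sets)
      show "integrable tor (\<lambda>x. \<bar>f x\<bar>)" using f(1) by (rule integrable_abs)
    qed
    moreover have "(\<integral>x. f x * ?h k (cis x) \<partial>tor) = 0" for k
      by (intro cont continuous_intros)
    ultimately show ?thesis by (simp add: LIMSEQ_const_iff)
  qed
  have atMost: "(\<integral>x. f x * indicator {..a} x \<partial>tor) = 0" for a
  proof (cases "0 \<le> a \<and> a < 2*pi")
    case True
    let ?K = "cis ` {0..a}"
    have K: "compact ?K" by (intro compact_continuous_image continuous_intros) auto
    have [measurable]: "?K \<in> sets borel" using K by (simp add: borel_compact)
    have "(\<integral>x. f x * indicator {..a} x \<partial>tor) = (\<integral>x. f x * indicator ?K (cis x) \<partial>tor)"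
    proof (rule integral_cong_AE)
      \<comment> \<open>The map \<open>cis\<close> is injective on the period except that it identifies its end points.\<close>
      have "AE x in lborel. x \<noteq> 2*pi" by (rule AE_lborel_singleton)
      hence "AE x in lborel. x \<in> {0..2*pi} \<longrightarrow> f x * indicator {..a} x = f x * indicator ?K (cis x)"
      proof eventually_elim
        case (elim x)
        show ?case
        proof
          assume x: "x \<in> {0..2*pi}"
          have "x \<in> {..a}" if "cis x \<in> ?K"
          proof -
            from that obtain y where y: "cis x = cis y" "y \<in> {0..a}" by (rule imageE)
            have "0 \<le> y" "y \<le> a" "0 \<le> x" "x \<le> 2*pi" using y(2) x by simp_all
            hence "\<bar>x - y\<bar> < 2 * pi" using elim True by linarith
            hence "x = y" by (rule cis_inj_2pi[OF y(1)])
            thus ?thesis using \<open>y \<le> a\<close> by simp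
          qed
          moreover have "cis x \<in> ?K" if "x \<in> {..a}" using that x by auto
          ultimately have "x \<in> {..a} \<longleftrightarrow> cis x \<in> ?K" by blast
          thus "f x * indicator {..a} x = f x * indicator ?K (cis x)" by (auto simp: indicator_def)
        qed
      qed
      thus "AE x in tor. f x * indicator {..a} x = f x * indicator ?K (cis x)" by (simp add: AE_tor)
    qed measurable
    thus ?thesis using closed[OF K] True by auto
  next
    case False
    show ?thesis
    proof (cases "a < 0")
      case True
      hence "(\<integral>x. f x * indicator {..a} x \<partial>tor) = (\<integral>x. 0 \<partial>tor)"
        by (intro integral_cong_AE) (auto simp: AE_tor)
      thus ?thesis by simp
    next
      case F: False
      hence "(\<integral>x. f x * indicator {..a} x \<partial>tor) = (\<integral>x. f x \<partial>tor)"
        using False by (intro integral_cong_AE) (auto simp: AE_tor)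
      also have "complex_of_real \<dots> = 0" using f(2)[of 0]
        by (simp add: scaleR_conv_of_real)
      finally show ?thesis by simp
    qed
  qed
  have ind: "integrable tor (\<lambda>x. f x * indicator A x)" if "A \<in> sets borel" for A
    by (rule Bochner_Integration.integrable_bound[OF f(1)]) (use that in \<open>auto simp: indicator_def\<close>)
  have all: "(\<integral>x. f x * indicator A x \<partial>tor) = 0" if "A \<in> sets borel" for A
  proof -
    have A: "A \<in> sigma_sets UNIV (range (\<lambda>a. {..a::real}))"
      using that unfolding borel_eq_atMost by (simp add: sets_measure_of)
    have st: "Int_stable (range (\<lambda>a. {..a::real}))" by (auto simp: Int_stable_def)
    have b: "sigma_sets UNIV (range (\<lambda>a. {..a::real})) = sets borel"
      unfolding borel_eq_atMost by (simp add: sets_measure_of)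
    have sub: "range (\<lambda>a. {..a::real}) \<subseteq> Pow UNIV" by simp
    show ?thesis
      using st sub A
    proof (induction A rule: sigma_sets_induct_disjoint)
      case (basic A) thus ?case using atMost by auto
    next
      case empty thus ?case by simp
    next
      case (compl A)
      have "(\<integral>x. f x * indicator (UNIV - A) x \<partial>tor) = (\<integral>x. f x - f x * indicator A x \<partial>tor)"
        by (rule Bochner_Integration.integral_cong) (auto simp: indicator_def)
      also have "\<dots> = (\<integral>x. f x \<partial>tor)"
        using f ind[of A] compl b by simp
      also have "complex_of_real \<dots> = 0" using f(2)[of 0] by (simp add: scaleR_conv_of_real)
      finally show ?case by simp
    next
      case (union A)
      have [measurable]: "A i \<in> sets borel" for i using union b by auto
      have "(\<lambda>N. \<integral>x. f x * indicator (\<Union>i<N. A i) x \<partial>tor) \<longlonglongrightarrow> (\<integral>x. f x * indicator (\<Union>i. A i) x \<partial>tor)"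
      proof (rule integral_dominated_convergence[where w = "\<lambda>x. \<bar>f x\<bar>"])
        show "AE x in tor. (\<lambda>N. f x * indicator (\<Union>i<N. A i) x) \<longlonglongrightarrow> f x * indicator (\<Union>i. A i) x"
          by (intro AE_I2 tendsto_mult tendsto_const LIMSEQ_indicator_UN)
      qed (use f in \<open>auto simp: indicator_def\<close>)
      moreover have "(\<integral>x. f x * indicator (\<Union>i<N. A i) x \<partial>tor) = 0" for N
      proof -
        have "indicator (\<Union>i<N. A i) x = (\<Sum>i<N. indicator (A i) x :: real)" for x
          using union(1) by (intro indicator_UN_disjoint) (auto simp: disjoint_family_on_def)
        hence "(\<integral>x. f x * indicator (\<Union>i<N. A i) x \<partial>tor) = (\<integral>x. (\<Sum>i<N. f x * indicator (A i) x) \<partial>tor)"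
          by (simp add: sum_distrib_left)
        also have "\<dots> = 0" using union(3) ind by (subst Bochner_Integration.integral_sum) auto
        finally show ?thesis .
      qed
      ultimately show ?case by (simp add: LIMSEQ_const_iff)
    qed
  qed
  show ?thesis
  proof (rule density_unique_real[of tor f "\<lambda>_. 0"])
    show "(LINT x:A|tor. f x) = (LINT x:A|tor. 0)" if "A \<in> sets tor" for A
      using all[of A] that by (simp add: set_lebesgue_integral_def mult.commute)
  qed (use f in auto)
qed

lemma fourier_coeff_AE_unique:
  assumes "f \<in> torus_L2" "g \<in> torus_L2" "\<And>n. fourier_coeff f n = fourier_coeff g n"
  shows "AE x in tor. f x = g x"
proof -
  have d: "(\<lambda>x. f x - g x) \<in> torus_L2" by (intro torus_L2_diff assms)
  have "AE x in tor. f x - g x = 0"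
  proof (rule fourier_unique_zero)
    show "integrable tor (\<lambda>x. f x - g x)" by (rule torus_L2_integrable[OF d])
    show "(\<integral>x. (f x - g x) *\<^sub>R char n x \<partial>tor) = 0" for n
      using fourier_coeff_tor[OF torus_L2_measurable[OF d], of "-n"]
      by (simp add: fourier_coeff_diff assms)
  qed
  thus ?thesis by simp
qed

section \<open>The Riesz--Fischer theorem and products\<close>

definition tpoly :: "(int \<Rightarrow> complex) \<Rightarrow> int set \<Rightarrow> real \<Rightarrow> complex" where
  "tpoly c A x = (\<Sum>n\<in>A. c n * char n x)"

lemma tpoly_measurable [measurable]: "tpoly c A \<in> borel_measurable borel"
  unfolding tpoly_def[abs_def] by measurable

lemma norm_tpoly_le: "cmod (tpoly c A x) \<le> (\<Sum>n\<in>A. cmod (c n))"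
  unfolding tpoly_def by (rule order_trans[OF norm_sum]) (simp add: norm_mult)

lemma integrable_char_const: "integrable tor (\<lambda>x. c * char n x)"
  by (rule integrable_tor_bounded[of _ "cmod c"]) (auto simp: norm_mult)

lemma integral_tpoly_char:
  assumes "finite A"
  shows "(\<integral>x. tpoly c A x * char (- n) x \<partial>tor) = (if n \<in> A then c n else 0)"
proof -
  have "(\<integral>x. tpoly c A x * char (- n) x \<partial>tor) = (\<integral>x. (\<Sum>m\<in>A. c m * char (m - n) x) \<partial>tor)"
    by (simp add: tpoly_def sum_distrib_right mult.assoc char_mult)
  also have "\<dots> = (\<Sum>m\<in>A. c m * (if m = n then 1 else 0))"
    by (subst Bochner_Integration.integral_sum) (auto simp: integrable_char_const integral_char)
  also have "\<dots> = (if n \<in> A then c n else 0)" using assms by (simp add: if_distrib sum.delta' cong: if_cong)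
  finally show ?thesis .
qed

lemma integral_tpoly_square:
  assumes "finite A"
  shows "(\<integral>x. (cmod (tpoly c A x))\<^sup>2 \<partial>tor) = (\<Sum>n\<in>A. (cmod (c n))\<^sup>2)"
proof -
  have "complex_of_real (\<integral>x. (cmod (tpoly c A x))\<^sup>2 \<partial>tor) = (\<integral>x. tpoly c A x * cnj (tpoly c A x) \<partial>tor)"
    by (simp only: complex_norm_square[symmetric] integral_complex_of_real[symmetric])
  also have "\<dots> = (\<integral>x. (\<Sum>m\<in>A. cnj (c m) * (tpoly c A x * char (- m) x)) \<partial>tor)"
    by (intro Bochner_Integration.integral_cong refl)
       (simp add: tpoly_def[of c A] cnj_sum sum_distrib_left mult_ac del: sum_distrib_right)
  also have "\<dots> = (\<Sum>m\<in>A. cnj (c m) * (\<integral>x. tpoly c A x * char (- m) x \<partial>tor))"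
  proof (subst Bochner_Integration.integral_sum)
    fix m
    show "integrable tor (\<lambda>x. cnj (c m) * (tpoly c A x * char (- m) x))"
      by (intro integrable_mult_right integrable_tor_bounded[of _ "\<Sum>n\<in>A. cmod (c n)"])
         (auto simp: norm_mult norm_tpoly_le)
  qed simp
  also have "\<dots> = (\<Sum>m\<in>A. complex_of_real ((cmod (c m))\<^sup>2))"
    by (simp add: integral_tpoly_char assms mult.commute[of "cnj _"] flip: complex_norm_square)
  finally have "complex_of_real (\<integral>x. (cmod (tpoly c A x))\<^sup>2 \<partial>tor) = of_real (\<Sum>n\<in>A. (cmod (c n))\<^sup>2)"
    by simp
  thus ?thesis by (simp only: of_real_eq_iff)
qed

text \<open>For conjugate-symmetric \<open>c\<close> the symmetric partial sums are real; the real part only adapts the type.\<close>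

definition psum :: "(int \<Rightarrow> complex) \<Rightarrow> nat \<Rightarrow> real \<Rightarrow> real" where
  "psum c N x = Re (tpoly c {- int N..int N} x)"

lemma psum_measurable [measurable]: "psum c N \<in> borel_measurable borel"
  unfolding psum_def[abs_def] by measurable

lemma psum_L2: "psum c N \<in> torus_L2"
  by (rule torus_L2_bounded[OF psum_measurable, of _ _ "\<Sum>n\<in>{- int N..int N}. cmod (c n)"])
     (auto simp: psum_def intro: order_trans[OF abs_Re_le_cmod norm_tpoly_le])

lemma psum_eq_tpoly:
  assumes "\<And>n. c (- n) = cnj (c n)"
  shows "complex_of_real (psum c N x) = tpoly c {- int N..int N} x"
proof -
  have "cnj (tpoly c {- int N..int N} x) = (\<Sum>n\<in>{- int N..int N}. c (- n) * char (- n) x)"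
    by (simp add: tpoly_def assms)
  also have "\<dots> = tpoly c {- int N..int N} x"
    unfolding tpoly_def by (rule sum.reindex_bij_witness[of _ uminus uminus]) auto
  finally show ?thesis unfolding psum_def
    by (metis complex_cnj_cnj complex_is_Real_iff Reals_cnj_iff of_real_Re)
qed

lemma psum_diff_square:
  assumes c: "\<And>n. c (- n) = cnj (c n)" and "M \<le> N"
  shows "(\<integral>x. (psum c N x - psum c M x)\<^sup>2 \<partial>tor)
      = (\<Sum>n\<in>{- int N..int N}. (cmod (c n))\<^sup>2) - (\<Sum>n\<in>{- int M..int M}. (cmod (c n))\<^sup>2)"
proof -
  have sub: "{- int M..int M} \<subseteq> {- int N..int N}" using assms(2) by auto
  have "complex_of_real (psum c N x - psum c M x) = tpoly c ({- int N..int N} - {- int M..int M}) x" for x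
    using sub by (simp add: psum_eq_tpoly[where c = c, OF c] tpoly_def sum_diff)
  hence "(psum c N x - psum c M x)\<^sup>2 = (cmod (tpoly c ({- int N..int N} - {- int M..int M}) x))\<^sup>2" for x
    by (metis norm_of_real power2_abs)
  thus ?thesis using sub by (simp add: integral_tpoly_square sum_diff)
qed

lemma psum_periodic: "psum c N (x + 2 * pi) = psum c N x"
  by (simp add: psum_def tpoly_def char_periodic)

lemma fourier_coeff_psum:
  assumes c: "\<And>n. c (- n) = cnj (c n)" and "\<bar>n\<bar> \<le> int N"
  shows "fourier_coeff (psum c N) n = c n"
proof -
  have "fourier_coeff (psum c N) n = (\<integral>x. tpoly c {- int N..int N} x * char (- n) x \<partial>tor)"
    by (simp add: fourier_coeff_tor scaleR_conv_of_real psum_eq_tpoly[where c = c, OF c])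
  also have "\<dots> = c n" using assms(2) by (subst integral_tpoly_char) auto
  finally show ?thesis .
qed

lemma symmetric_sums_tendsto:
  fixes f :: "int \<Rightarrow> 'a::real_normed_vector"
  assumes "(f has_sum s) UNIV"
  shows "(\<lambda>N. \<Sum>n\<in>{- int N..int N}. f n) \<longlonglongrightarrow> s"
proof -
  have "filterlim (\<lambda>N. {- int N..int N}) (finite_subsets_at_top UNIV) sequentially"
    unfolding filterlim_finite_subsets_at_top
  proof (intro allI impI)
    fix X :: "int set" assume "finite X \<and> X \<subseteq> UNIV"
    then obtain K where K: "\<And>x. x \<in> X \<Longrightarrow> \<bar>x\<bar> \<le> K"
      by (metis finite_set_of_finite_funs Max_ge finite_imageI imageI)
    show "\<forall>\<^sub>F N in sequentially. finite {- int N..int N} \<and> X \<subseteq> {- int N..int N} \<and> {- int N..int N} \<subseteq> UNIV"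
      unfolding eventually_sequentially
    proof (intro exI[of _ "nat K"] allI impI)
      fix N assume "nat K \<le> N"
      thus "finite {- int N..int N} \<and> X \<subseteq> {- int N..int N} \<and> {- int N..int N} \<subseteq> UNIV"
        using K by (auto simp: abs_le_iff) (smt (verit) K abs_le_iff nat_le_iff)+
    qed
  qed
  thus ?thesis using assms unfolding has_sum_def by (rule filterlim_compose[rotated])
qed

text \<open>A subsequence \<open>r\<close> of the partial sums is chosen so sparse that its increments are summable in \<open>L\<^sup>1\<close>, hence
absolutely summable almost everywhere. Fatou's lemma then bounds the distance in \<open>L\<^sup>2\<close> of the pointwise limit from
each partial sum by the tail of the series.\<close>

lemma riesz_fischer:
  assumes s: "(\<lambda>n. (cmod (c n))\<^sup>2) summable_on UNIV" and c: "\<And>n. c (- n) = cnj (c n)"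
  obtains g where "periodic_2pi g" "g \<in> torus_L2" "(\<lambda>N. \<integral>x. (g x - psum c N x)\<^sup>2 \<partial>tor) \<longlonglongrightarrow> 0"
proof -
  define P where "P N = (\<Sum>n\<in>{- int N..int N}. (cmod (c n))\<^sup>2)" for N
  define S where "S = (\<Sum>\<^sub>\<infinity>n. (cmod (c n))\<^sup>2)"
  have PS: "P \<longlonglongrightarrow> S"
    unfolding P_def[abs_def] S_def by (rule symmetric_sums_tendsto) (use s in simp)
  have PleS: "P N \<le> S" for N
    unfolding P_def S_def by (rule finite_sum_le_infsum[OF s]) auto
  have D: "(\<integral>x. (psum c N x - psum c M x)\<^sup>2 \<partial>tor) \<le> S - P M" if "M \<le> N" for M N
    using psum_diff_square[of c, OF c that] PleS[of N] by (simp add: P_def)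
  have "\<exists>N\<ge>k. S - P N \<le> (1/4)^k" for k
  proof -
    have "\<forall>\<^sub>F N in sequentially. dist (P N) S < (1/4)^k" by (rule tendstoD[OF PS]) simp
    then obtain N0 where "\<And>N. N \<ge> N0 \<Longrightarrow> dist (P N) S < (1/4)^k" by (auto simp: eventually_sequentially)
    hence "dist (P (max k N0)) S < (1/4)^k" by simp
    hence "S - P (max k N0) \<le> (1/4)^k" unfolding dist_real_def by linarith
    thus ?thesis by (intro exI[of _ "max k N0"]) simp
  qed
  then obtain r0 where r0: "\<And>k. r0 k \<ge> k" "\<And>k. S - P (r0 k) \<le> (1/4)^k" by metis
  \<comment> \<open>Partial sums of \<open>r0\<close>, to make the indices nondecreasing without losing either bound.\<close>
  define r where "r k = (\<Sum>i\<le>k. r0 i)" for k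
  have r_mono: "r k \<le> r (Suc k)" for k by (simp add: r_def)
  have r_ge: "r0 k \<le> r k" for k unfolding r_def by (rule member_le_sum) auto
  have P_mono: "P M \<le> P N" if "M \<le> N" for M N
    unfolding P_def by (rule sum_mono2) (use that in auto)
  have r_tail: "S - P (r k) \<le> (1/4)^k" for k
    using P_mono[OF r_ge[of k]] r0(2)[of k] by linarith
  have r_k: "k \<le> r k" for k using r0(1)[of k] r_ge[of k] by linarith
  define d where "d k x = psum c (r (Suc k)) x - psum c (r k) x" for k x
  have dL2: "d k \<in> torus_L2" for k unfolding d_def[abs_def] by (intro torus_L2_diff psum_L2)
  have [measurable]: "d k \<in> borel_measurable borel" for k using dL2 by (rule torus_L2_measurable)
  have d1: "(\<integral>x. \<bar>d k x\<bar> \<partial>tor) \<le> (1/2)^k" for k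
  proof -
    have "(\<integral>x. \<bar>d k x\<bar> \<partial>tor) \<le> sqrt (\<integral>x. (d k x)\<^sup>2 \<partial>tor)" by (rule L1_le_L2[OF dL2])
    also have "\<dots> \<le> sqrt ((1/4)^k)"
      using D[OF r_mono[of k]] r_tail[of k] by (intro real_sqrt_le_mono) (simp add: d_def)
    also have "(1/4::real)^k = ((1/2)^k)\<^sup>2" by (simp add: power2_eq_square flip: power_mult_distrib)
    finally show ?thesis by simp
  qed
  have "(\<integral>\<^sup>+x. (\<Sum>k. ennreal \<bar>d k x\<bar>) \<partial>tor) = (\<Sum>k. \<integral>\<^sup>+x. ennreal \<bar>d k x\<bar> \<partial>tor)"
    by (rule nn_integral_suminf) measurable
  also have "\<dots> \<le> (\<Sum>k. ennreal ((1/2)^k))"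
  proof (rule suminf_le)
    fix k
    have "(\<integral>\<^sup>+x. ennreal \<bar>d k x\<bar> \<partial>tor) = ennreal (\<integral>x. \<bar>d k x\<bar> \<partial>tor)"
      by (rule nn_integral_eq_integral) (use torus_L2_integrable[OF dL2] in auto)
    also have "\<dots> \<le> ennreal ((1/2)^k)" by (rule ennreal_leI[OF d1])
    finally show "(\<integral>\<^sup>+x. ennreal \<bar>d k x\<bar> \<partial>tor) \<le> ennreal ((1/2)^k)" .
  qed auto
  also have "\<dots> = ennreal (\<Sum>k. (1/2)^k)" by (rule suminf_ennreal2) (auto simp: summable_geometric)
  also have "\<dots> < \<infinity>" by simp
  finally have "AE x in tor. (\<Sum>k. ennreal \<bar>d k x\<bar>) \<noteq> \<infinity>"
    by (intro nn_integral_PInf_AE) auto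
  hence AE: "AE x in tor. convergent (\<lambda>k. psum c (r k) x)"
  proof eventually_elim
    case (elim x)
    have "summable (\<lambda>k. \<bar>d k x\<bar>)" using elim by (intro summable_suminf_not_top) (auto simp: top_ennreal_def)
    hence "summable (\<lambda>k. d k x)" by (rule summable_rabs_cancel)
    hence "convergent (\<lambda>N. \<Sum>k<N. d k x)" by (simp add: summable_iff_convergent)
    moreover have "(\<Sum>k<N. d k x) = psum c (r N) x - psum c (r 0) x" for N
      unfolding d_def by (rule sum_lessThan_telescope)
    ultimately show ?case by (simp add: convergent_diff_const_right_iff)
  qed
  \<comment> \<open>At a point of divergence the value of \<open>lim\<close> still depends only on the sequence, so \<open>g\<close> is
    periodic everywhere and not only almost everywhere.\<close>
  define g where "g x = lim (\<lambda>k. psum c (r k) x)" for x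
  have [measurable]: "g \<in> borel_measurable borel" unfolding g_def[abs_def] by measurable
  have per: "periodic_2pi g" by (simp add: periodic_2pi_def g_def psum_periodic)
  have lim: "AE x in tor. (\<lambda>k. psum c (r k) x) \<longlonglongrightarrow> g x"
    using AE by eventually_elim (simp add: g_def convergent_LIMSEQ_iff)
  have F: "(\<integral>\<^sup>+x. ennreal ((g x - psum c N x)\<^sup>2) \<partial>tor) \<le> ennreal (S - P N)" for N
  proof -
    have "(\<integral>\<^sup>+x. ennreal ((g x - psum c N x)\<^sup>2) \<partial>tor)
        = (\<integral>\<^sup>+x. liminf (\<lambda>k. ennreal ((psum c (r k) x - psum c N x)\<^sup>2)) \<partial>tor)"
    proof (rule nn_integral_cong_AE)
      show "AE x in tor. ennreal ((g x - psum c N x)\<^sup>2) = liminf (\<lambda>k. ennreal ((psum c (r k) x - psum c N x)\<^sup>2))"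
        using lim
      proof eventually_elim
        case (elim x)
        have "(\<lambda>k. ennreal ((psum c (r k) x - psum c N x)\<^sup>2)) \<longlonglongrightarrow> ennreal ((g x - psum c N x)\<^sup>2)"
          by (intro tendsto_intros elim)
        thus ?case by (rule lim_imp_Liminf[symmetric, rotated]) simp
      qed
    qed
    also have "\<dots> \<le> liminf (\<lambda>k. \<integral>\<^sup>+x. ennreal ((psum c (r k) x - psum c N x)\<^sup>2) \<partial>tor)"
      by (rule nn_integral_liminf) measurable
    also have "\<dots> \<le> ennreal (S - P N)"
    proof (rule Liminf_le)
      show "\<forall>\<^sub>F k in sequentially. (\<integral>\<^sup>+x. ennreal ((psum c (r k) x - psum c N x)\<^sup>2) \<partial>tor) \<le> ennreal (S - P N)"
        unfolding eventually_sequentially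
      proof (intro exI[of _ N] allI impI)
        fix k assume "N \<le> k"
        hence "N \<le> r k" using r_k[of k] by linarith
        have "(\<integral>\<^sup>+x. ennreal ((psum c (r k) x - psum c N x)\<^sup>2) \<partial>tor) = ennreal (\<integral>x. (psum c (r k) x - psum c N x)\<^sup>2 \<partial>tor)"
          by (rule nn_integral_eq_integral)
             (auto intro!: torus_L2_square torus_L2_diff psum_L2)
        also have "\<dots> \<le> ennreal (S - P N)" by (rule ennreal_leI[OF D[OF \<open>N \<le> r k\<close>]])
        finally show "(\<integral>\<^sup>+x. ennreal ((psum c (r k) x - psum c N x)\<^sup>2) \<partial>tor) \<le> ennreal (S - P N)" .
      qed
    qed simp
    finally show ?thesis .
  qed
  have gN: "(\<lambda>x. g x - psum c N x) \<in> torus_L2" for N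
  proof -
    have "integrable tor (\<lambda>x. (g x - psum c N x)\<^sup>2)"
      using F[of N] by (intro integrableI_nonneg) (auto intro: le_less_trans)
    thus ?thesis unfolding torus_L2_def by auto
  qed
  have "g \<in> torus_L2" using torus_L2_add[OF gN[of 0] psum_L2[of c 0]] by simp
  moreover have "(\<lambda>N. \<integral>x. (g x - psum c N x)\<^sup>2 \<partial>tor) \<longlonglongrightarrow> 0"
  proof (rule tendsto_sandwich[of "\<lambda>_. 0" _ _ "\<lambda>N. S - P N"])
    show "\<forall>\<^sub>F N in sequentially. (\<integral>x. (g x - psum c N x)\<^sup>2 \<partial>tor) \<le> S - P N"
    proof (rule always_eventually, rule allI)
      fix N
      have "ennreal (\<integral>x. (g x - psum c N x)\<^sup>2 \<partial>tor) = (\<integral>\<^sup>+x. ennreal ((g x - psum c N x)\<^sup>2) \<partial>tor)"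
        by (rule nn_integral_eq_integral[symmetric]) (use torus_L2_square[OF gN] in auto)
      also have "\<dots> \<le> ennreal (S - P N)" by (rule F)
      finally show "(\<integral>x. (g x - psum c N x)\<^sup>2 \<partial>tor) \<le> S - P N"
        using PleS[of N] by (subst (asm) ennreal_le_iff) auto
    qed
    show "(\<lambda>N. S - P N) \<longlonglongrightarrow> 0" using tendsto_diff[OF tendsto_const[of S] PS] by simp
  qed auto
  ultimately show thesis using that per by blast
qed

lemma fourier_coeff_of_L2_limit:
  assumes g: "g \<in> torus_L2" and lim: "(\<lambda>N. \<integral>x. (g x - psum c N x)\<^sup>2 \<partial>tor) \<longlonglongrightarrow> 0"
    and c: "\<And>n. c (- n) = cnj (c n)"
  shows "fourier_coeff g n = c n"
proof -
  have "(\<lambda>N. fourier_coeff g n - fourier_coeff (psum c N) n) \<longlonglongrightarrow> 0"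
  proof (rule Lim_null_comparison)
    show "\<forall>\<^sub>F N in sequentially. norm (fourier_coeff g n - fourier_coeff (psum c N) n)
        \<le> sqrt (\<integral>x. (g x - psum c N x)\<^sup>2 \<partial>tor)"
    proof (rule always_eventually, rule allI)
      fix N
      have d: "(\<lambda>x. g x - psum c N x) \<in> torus_L2" by (intro torus_L2_diff g psum_L2)
      have "norm (fourier_coeff g n - fourier_coeff (psum c N) n) = norm (fourier_coeff (\<lambda>x. g x - psum c N x) n)"
        by (simp add: fourier_coeff_diff g psum_L2)
      also have "\<dots> \<le> (\<integral>x. \<bar>g x - psum c N x\<bar> \<partial>tor)"
        by (rule cmod_fourier_coeff_le[OF torus_L2_measurable[OF d]])
      also have "\<dots> \<le> sqrt (\<integral>x. (g x - psum c N x)\<^sup>2 \<partial>tor)" by (rule L1_le_L2[OF d])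
      finally show "norm (fourier_coeff g n - fourier_coeff (psum c N) n) \<le> sqrt (\<integral>x. (g x - psum c N x)\<^sup>2 \<partial>tor)" .
    qed
    show "(\<lambda>N. sqrt (\<integral>x. (g x - psum c N x)\<^sup>2 \<partial>tor)) \<longlonglongrightarrow> 0"
      using tendsto_real_sqrt[OF lim] by simp
  qed
  moreover have "\<forall>\<^sub>F N in sequentially. fourier_coeff g n - fourier_coeff (psum c N) n = fourier_coeff g n - c n"
    unfolding eventually_sequentially
    by (intro exI[of _ "nat \<bar>n\<bar>"]) (auto simp: fourier_coeff_psum c)
  ultimately have "(\<lambda>N::nat. fourier_coeff g n - c n) \<longlonglongrightarrow> 0"
    by (rule Lim_transform_eventually)
  thus ?thesis by (simp add: LIMSEQ_const_iff)
qed

lemma bessel: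
  assumes f: "f \<in> torus_L2"
  shows "(\<lambda>n. (cmod (fourier_coeff f n))\<^sup>2) summable_on UNIV"
proof (rule nonneg_bdd_above_summable_on)
  show "bdd_above (sum (\<lambda>n. (cmod (fourier_coeff f n))\<^sup>2) ` {F. F \<subseteq> UNIV \<and> finite F})"
  proof (rule bdd_aboveI2)
    fix A :: "int set" assume A: "A \<in> {F. F \<subseteq> UNIV \<and> finite F}"
    hence fin: "finite A" by simp
    let ?c = "fourier_coeff f" and ?p = "tpoly (fourier_coeff f) A"
    have [measurable]: "f \<in> borel_measurable borel" by (rule torus_L2_measurable[OF f])
    have fi: "integrable tor (\<lambda>x. f x *\<^sub>R char n x)" for n
      by (rule integrable_scaleR_char[OF torus_L2_integrable[OF f]])
    have fp: "f x * Re (?p x) = Re (\<Sum>n\<in>A. ?c n * (f x *\<^sub>R char n x))" for x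
    proof -
      have "f x * Re (?p x) = Re (of_real (f x) * ?p x)" by simp
      also have "of_real (f x) * ?p x = (\<Sum>n\<in>A. ?c n * (f x *\<^sub>R char n x))"
        by (simp add: tpoly_def sum_distrib_left scaleR_conv_of_real mult_ac)
      finally show ?thesis .
    qed
    have i: "integrable tor (\<lambda>x. \<Sum>n\<in>A. ?c n * (f x *\<^sub>R char n x))"
      by (intro Bochner_Integration.integrable_sum integrable_mult_right fi)
    have fpi: "integrable tor (\<lambda>x. f x * Re (?p x))"
      unfolding fp by (rule integrable_Re[OF i])
    have "(\<integral>x. (\<Sum>n\<in>A. ?c n * (f x *\<^sub>R char n x)) \<partial>tor) = (\<Sum>n\<in>A. ?c n * (\<integral>x. f x *\<^sub>R char n x \<partial>tor))"
      by (subst Bochner_Integration.integral_sum) (auto intro!: integrable_mult_right fi simp del: mult_scaleR_right)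
    also have "\<dots> = (\<Sum>n\<in>A. ?c n * ?c (- n))" by (simp add: fourier_coeff_tor)
    also have "\<dots> = (\<Sum>n\<in>A. of_real ((cmod (?c n))\<^sup>2))"
      by (simp only: fourier_coeff_cnj[OF f] complex_norm_square)
    finally have "(\<integral>x. f x * Re (?p x) \<partial>tor) = (\<Sum>n\<in>A. (cmod (?c n))\<^sup>2)"
      unfolding fp using integral_Re[OF i] by simp
    moreover have "0 \<le> (\<integral>x. (f x)\<^sup>2 - 2 * (f x * Re (?p x)) + (cmod (?p x))\<^sup>2 \<partial>tor)"
    proof (rule integral_nonneg_AE, rule AE_I2)
      fix x
      have "(Re (?p x))\<^sup>2 \<le> (cmod (?p x))\<^sup>2" by (simp add: cmod_power2)
      moreover have "0 \<le> (f x - Re (?p x))\<^sup>2" by simp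
      ultimately show "0 \<le> (f x)\<^sup>2 - 2 * (f x * Re (?p x)) + (cmod (?p x))\<^sup>2"
        by (simp add: power2_diff)
    qed
    moreover have pi: "integrable tor (\<lambda>x. (cmod (?p x))\<^sup>2)"
      by (rule integrable_tor_bounded[of _ "(\<Sum>n\<in>A. cmod (?c n))\<^sup>2"]) (auto intro!: power_mono norm_tpoly_le)
    ultimately have "0 \<le> (\<integral>x. (f x)\<^sup>2 \<partial>tor) - 2 * (\<Sum>n\<in>A. (cmod (?c n))\<^sup>2) + (\<Sum>n\<in>A. (cmod (?c n))\<^sup>2)"
      using torus_L2_square[OF f] fpi integral_tpoly_square[OF fin, of ?c] by simp
    thus "(\<Sum>n\<in>A. (cmod (?c n))\<^sup>2) \<le> (\<integral>x. (f x)\<^sup>2 \<partial>tor)" by simp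
  qed
qed auto

text \<open>The limit of the partial sums that \<open>riesz_fischer\<close> provides has the same Fourier coefficients as \<open>f\<close>,
so it is \<open>f\<close>.\<close>

lemma psum_L2_tendsto:
  assumes f: "f \<in> torus_L2"
  shows "(\<lambda>N. \<integral>x. (f x - psum (fourier_coeff f) N x)\<^sup>2 \<partial>tor) \<longlonglongrightarrow> 0"
proof -
  obtain g where g: "g \<in> torus_L2" "(\<lambda>N. \<integral>x. (g x - psum (fourier_coeff f) N x)\<^sup>2 \<partial>tor) \<longlonglongrightarrow> 0"
    using riesz_fischer[OF bessel[OF f] fourier_coeff_cnj[OF f]] by metis
  have "AE x in tor. f x = g x"
    using fourier_coeff_of_L2_limit[OF g fourier_coeff_cnj[OF f]]
    by (intro fourier_coeff_AE_unique f g) simp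
  hence "(\<integral>x. (f x - psum (fourier_coeff f) N x)\<^sup>2 \<partial>tor) = (\<integral>x. (g x - psum (fourier_coeff f) N x)\<^sup>2 \<partial>tor)" for N
    by (intro integral_cong_AE) (use f g in \<open>auto dest!: torus_L2_measurable\<close>)
  thus ?thesis using g(2) by simp
qed

text \<open>Replacing \<open>f\<close> by its partial sum turns the product into a finite combination of shifted coefficients of \<open>g\<close>, with
an error that the Cauchy--Schwarz inequality bounds by the \<open>L\<^sup>2\<close> distance of \<open>f\<close> from the partial sum.\<close>

lemma fourier_coeff_mult:
  assumes f: "f \<in> torus_L2" and g: "g \<in> torus_L2"
  shows "((\<lambda>k. fourier_coeff f k * fourier_coeff g (n - k)) has_sum fourier_coeff (\<lambda>x. f x * g x) n) UNIV"
proof -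
  let ?c = "fourier_coeff f"
  have [measurable]: "f \<in> borel_measurable borel" "g \<in> borel_measurable borel"
    using f g by (auto intro: torus_L2_measurable)
  have "(\<lambda>k. (cmod (fourier_coeff g (n - k)))\<^sup>2) summable_on UNIV"
    using bessel[OF g] summable_on_reindex_bij_betw[of "\<lambda>k. n - k" UNIV UNIV "\<lambda>k. (cmod (fourier_coeff g k))\<^sup>2"]
    by (auto simp: bij_betw_def inj_on_def surj_def intro: exI[of _ "n - _"])
  hence "(\<lambda>k. cmod (?c k * fourier_coeff g (n - k))) summable_on UNIV"
    using bessel[OF f] by (intro summable_mult_of_square[of "\<lambda>k. cmod (?c k)" UNIV "\<lambda>k. cmod (fourier_coeff g (n - k))"])
      (auto simp: norm_mult)
  hence sm: "(\<lambda>k. ?c k * fourier_coeff g (n - k)) summable_on UNIV" by (rule abs_summable_summable)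
  have "(\<lambda>N. \<Sum>k\<in>{- int N..int N}. ?c k * fourier_coeff g (n - k)) \<longlonglongrightarrow> fourier_coeff (\<lambda>x. f x * g x) n"
  proof -
    have fg: "integrable tor (\<lambda>x. f x * g x)" by (rule integrable_L2_mult[OF f g])
    have pg: "integrable tor (\<lambda>x. psum ?c N x * g x)" for N by (rule integrable_L2_mult[OF psum_L2 g])
    have eq: "(\<Sum>k\<in>{- int N..int N}. ?c k * fourier_coeff g (n - k)) = (\<integral>x. (psum ?c N x * g x) *\<^sub>R char (- n) x \<partial>tor)" for N
    proof -
      have "(\<integral>x. (psum ?c N x * g x) *\<^sub>R char (- n) x \<partial>tor)
          = (\<integral>x. (\<Sum>k\<in>{- int N..int N}. ?c k * (g x *\<^sub>R char (- (n - k)) x)) \<partial>tor)"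
      proof (intro Bochner_Integration.integral_cong refl)
        fix x
        have "(psum ?c N x * g x) *\<^sub>R char (- n) x = tpoly ?c {- int N..int N} x * (of_real (g x) * char (- n) x)"
          by (simp add: scaleR_conv_of_real psum_eq_tpoly[where c = "fourier_coeff f", OF fourier_coeff_cnj[OF f]] mult_ac)
        also have "\<dots> = (\<Sum>k\<in>{- int N..int N}. ?c k * (of_real (g x) * (char k x * char (- n) x)))"
          by (simp only: tpoly_def sum_distrib_right) (simp only: mult_ac)
        finally show "(psum ?c N x * g x) *\<^sub>R char (- n) x
            = (\<Sum>k\<in>{- int N..int N}. ?c k * (g x *\<^sub>R char (- (n - k)) x))"
          by (simp add: char_mult scaleR_conv_of_real)
      qed
      also have "\<dots> = (\<Sum>k\<in>{- int N..int N}. ?c k * (\<integral>x. g x *\<^sub>R char (- (n - k)) x \<partial>tor))"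
        by (subst Bochner_Integration.integral_sum)
           (auto intro!: integrable_mult_right integrable_scaleR_char torus_L2_integrable g simp del: mult_scaleR_right)
      finally show ?thesis by (simp add: fourier_coeff_tor)
    qed
    have "(\<lambda>N. fourier_coeff (\<lambda>x. f x * g x) n - (\<Sum>k\<in>{- int N..int N}. ?c k * fourier_coeff g (n - k))) \<longlonglongrightarrow> 0"
    proof (rule Lim_null_comparison)
      let ?B = "\<lambda>N. sqrt ((\<integral>x. (f x - psum ?c N x)\<^sup>2 \<partial>tor) * (\<integral>x. (g x)\<^sup>2 \<partial>tor))"
      show "\<forall>\<^sub>F N in sequentially. norm (fourier_coeff (\<lambda>x. f x * g x) n
          - (\<Sum>k\<in>{- int N..int N}. ?c k * fourier_coeff g (n - k))) \<le> ?B N"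
      proof (rule always_eventually, rule allI)
        fix N
        have d: "(\<lambda>x. f x - psum ?c N x) \<in> torus_L2" by (intro torus_L2_diff f psum_L2)
        have "fourier_coeff (\<lambda>x. f x * g x) n - (\<Sum>k\<in>{- int N..int N}. ?c k * fourier_coeff g (n - k))
            = (\<integral>x. (f x * g x) *\<^sub>R char (- n) x \<partial>tor) - (\<integral>x. (psum ?c N x * g x) *\<^sub>R char (- n) x \<partial>tor)"
          unfolding eq by (simp add: fourier_coeff_tor)
        also have "\<dots> = (\<integral>x. (f x * g x) *\<^sub>R char (- n) x - (psum ?c N x * g x) *\<^sub>R char (- n) x \<partial>tor)"
          by (rule Bochner_Integration.integral_diff[symmetric]) (intro integrable_scaleR_char fg pg)+
        also have "\<dots> = (\<integral>x. ((f x - psum ?c N x) * g x) *\<^sub>R char (- n) x \<partial>tor)"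
          by (simp add: left_diff_distrib scaleR_left_diff_distrib)
        also have "norm \<dots> \<le> (\<integral>x. \<bar>(f x - psum ?c N x) * g x\<bar> \<partial>tor)"
          by (rule order_trans[OF integral_norm_bound]) simp
        also have "\<dots> \<le> ?B N"
          by (rule real_le_rsqrt[OF L2_cauchy_schwarz[OF d g]])
        finally show "norm (fourier_coeff (\<lambda>x. f x * g x) n
          - (\<Sum>k\<in>{- int N..int N}. ?c k * fourier_coeff g (n - k))) \<le> ?B N" .
      qed
      show "?B \<longlonglongrightarrow> 0"
        using tendsto_real_sqrt[OF tendsto_mult_left_zero[OF psum_L2_tendsto[OF f], of "\<integral>x. (g x)\<^sup>2 \<partial>tor"]]
        by simp
    qed
    from tendsto_diff[OF tendsto_const[of "fourier_coeff (\<lambda>x. f x * g x) n"] this] show ?thesis by simp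
  qed
  moreover have "(\<lambda>N. \<Sum>k\<in>{- int N..int N}. ?c k * fourier_coeff g (n - k)) \<longlonglongrightarrow> (\<Sum>\<^sub>\<infinity>k. ?c k * fourier_coeff g (n - k))"
    by (rule symmetric_sums_tendsto) (use sm in simp)
  ultimately have "fourier_coeff (\<lambda>x. f x * g x) n = (\<Sum>\<^sub>\<infinity>k. ?c k * fourier_coeff g (n - k))"
    by (rule LIMSEQ_unique)
  thus ?thesis using sm by simp
qed

section \<open>Sobolev spaces as weighted sequence spaces\<close>

definition wt :: "real \<Rightarrow> int \<Rightarrow> real" where
  "wt s n = (1 + (of_int n)\<^sup>2) powr (s/2)"

lemma one_plus_sq_pos: "(0::real) < 1 + (of_int n)\<^sup>2"
  by (simp add: add_pos_nonneg)

lemma wt_pos [simp]: "0 < wt s n" and wt_nz [simp]: "wt s n \<noteq> 0" and wt_nonneg [simp]: "0 \<le> wt s n"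
  using one_plus_sq_pos[of n] by (auto simp: wt_def)

lemma wt_0 [simp]: "wt 0 n = 1" and wt_zero [simp]: "wt s 0 = 1"
  using one_plus_sq_pos[of n] by (auto simp: wt_def)

lemma wt_add: "wt (s + t) n = wt s n * wt t n"
  by (simp add: wt_def powr_add add_divide_distrib)

lemma wt_minus: "wt (- s) n = inverse (wt s n)"
  by (simp add: wt_def powr_minus)

lemma wt_2: "wt 2 n = 1 + (of_int n)\<^sup>2"
  using one_plus_sq_pos[of n] by (simp add: wt_def)

lemma wt_1_square: "(wt 1 n)\<^sup>2 = 1 + (of_int n)\<^sup>2"
  using wt_add[of 1 1 n] by (simp add: wt_2 power2_eq_square)

lemma wt_square: "(wt s n)\<^sup>2 = (1 + (of_int n)\<^sup>2) powr s"
  by (simp add: wt_def power2_eq_square flip: powr_add)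

lemma wt_uminus [simp]: "wt s (- n) = wt s n" by (simp add: wt_def)

lemma wt_ge_1: "0 \<le> s \<Longrightarrow> 1 \<le> wt s n"
  by (simp add: wt_def ge_one_powr_ge_zero)

lemma abs_le_wt_1: "\<bar>of_int n\<bar> \<le> wt 1 n"
proof -
  have "\<bar>of_int n\<bar>\<^sup>2 \<le> (wt 1 n)\<^sup>2" unfolding wt_1_square by simp
  thus ?thesis by (rule power2_le_imp_le) simp
qed

lemma powr_mult3: "0 \<le> A \<Longrightarrow> 0 \<le> B \<Longrightarrow> (2 * A * B) powr p = 2 powr p * A powr p * B powr (p::real)"
  by (simp add: powr_mult)

text \<open>Peetre's inequality: transferring a weight from \<open>k\<close> to \<open>n\<close> costs a weight in \<open>n - k\<close> only. For negative \<open>s\<close> it is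
the inequality for \<open>- s\<close> with \<open>n\<close> and \<open>k\<close> exchanged.\<close>

lemma peetre: "wt s n \<le> 2 powr (\<bar>s\<bar>/2) * wt s k * wt \<bar>s\<bar> (n - k)"
proof -
  have base: "1 + (of_int n)\<^sup>2 \<le> 2 * (1 + (of_int k)\<^sup>2) * (1 + (of_int (n - k))\<^sup>2 :: real)" for n k
  proof -
    \<comment> \<open>The difference of the two sides, written as a sum of squares and a constant.\<close>
    have "0 \<le> (of_int n - 2 * of_int k :: real)\<^sup>2 + 2 * (of_int k * (of_int n - of_int k))\<^sup>2" by simp
    thus ?thesis by (simp add: power2_eq_square algebra_simps)
  qed
  show ?thesis
  proof (cases "0 \<le> s")
    case True
    have "wt s n \<le> (2 * (1 + (of_int k)\<^sup>2) * (1 + (of_int (n - k))\<^sup>2)) powr (s/2)"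
      unfolding wt_def using base[of n k] True one_plus_sq_pos[of n] by (intro powr_mono2) auto
    also have "\<dots> = 2 powr (s/2) * wt s k * wt s (n - k)"
      unfolding wt_def by (rule powr_mult3) auto
    finally show ?thesis using True by simp
  next
    case False
    define r where "r = - s"
    have r: "0 \<le> r" "s = - r" using False by (auto simp: r_def)
    have "wt r k \<le> (2 * (1 + (of_int n)\<^sup>2) * (1 + (of_int (k - n))\<^sup>2)) powr (r/2)"
      unfolding wt_def using base[of k n] r one_plus_sq_pos[of k] by (intro powr_mono2) auto
    also have "\<dots> = 2 powr (r/2) * wt r n * wt r (k - n)"
      unfolding wt_def by (rule powr_mult3) auto
    also have "wt r (k - n) = wt r (n - k)" using wt_uminus[of r "n - k"] by simp
    finally have "wt r k \<le> 2 powr (r/2) * wt r n * wt r (n - k)" .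
    thus ?thesis using r by (simp add: wt_minus field_simps)
  qed
qed

lemma summable_inverse_square: "(\<lambda>n::int. 1 / (1 + (of_int n)\<^sup>2 :: real)) summable_on UNIV"
proof -
  let ?f = "\<lambda>n::int. 1 / (1 + (of_int n)\<^sup>2 :: real)"
  have "(\<lambda>n::nat. ?f (int n)) summable_on UNIV"
  proof (rule summable_on_comparison_test)
    have "summable (\<lambda>n. 2 * inverse ((real (Suc n))\<^sup>2))"
      using inverse_power_summable[of 2, where ?'a = real] summable_Suc_iff[of "\<lambda>n. inverse ((real n)\<^sup>2)"]
      by (intro summable_mult) (simp del: of_nat_Suc)
    hence "summable (\<lambda>n. norm (2 * inverse ((real (Suc n))\<^sup>2)))" by simp
    thus "(\<lambda>n. 2 * inverse ((real (Suc n))\<^sup>2)) summable_on UNIV" by (rule norm_summable_imp_summable_on)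
    fix n :: nat
    have "(real (Suc n))\<^sup>2 \<le> 2 * (1 + (real n)\<^sup>2)"
      using zero_le_power2[of "real n - 1"] by (simp add: power2_eq_square algebra_simps)
    thus "?f (int n) \<le> 2 * inverse ((real (Suc n))\<^sup>2)"
      by (simp add: field_simps add_pos_nonneg)
  qed simp
  hence n: "?f summable_on range int"
    by (subst summable_on_reindex) (auto simp: o_def)
  hence "(\<lambda>n. ?f (- n)) summable_on range int" by simp
  hence m: "?f summable_on uminus ` range int"
    by (subst summable_on_reindex) (auto simp: o_def)
  have "?f summable_on (range int \<union> uminus ` range int)" by (rule summable_on_union[OF n m])
  moreover have "range int \<union> uminus ` range int = UNIV"
    by (auto simp: image_image) (metis int_cases2 rangeI)
  ultimately show ?thesis by simp
qed

lemma sobolev_term_wt: "sobolev_term s f n = (cmod (wt s n * fourier_coeff f n))\<^sup>2"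
  by (simp add: sobolev_term_def norm_mult power_mult_distrib wt_square)

lemma sobolev_iff:
  "f \<in> sobolev s \<longleftrightarrow> periodic_2pi f \<and> f \<in> torus_L2 \<and>
     (\<lambda>n. (cmod (wt s n * fourier_coeff f n))\<^sup>2) summable_on UNIV"
proof (cases "f \<in> borel_measurable borel")
  case True
  show ?thesis
    unfolding sobolev_def torus_L2_def using True
    by (simp add: sobolev_term_wt[abs_def] integrable_tor_iff)
qed (auto simp: sobolev_def torus_L2_def)

lemma sobolev_L2: "f \<in> sobolev s \<Longrightarrow> f \<in> torus_L2"
  by (auto simp: sobolev_iff)

definition emb :: "real \<Rightarrow> (real \<Rightarrow> real) \<Rightarrow> ell2" where
  "emb s f = Abs_ell2 (\<lambda>n. wt s n * fourier_coeff f n)"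

lemma coord_emb: "f \<in> sobolev s \<Longrightarrow> coord (emb s f) n = wt s n * fourier_coeff f n"
  unfolding emb_def by (subst coord_Abs_ell2) (auto simp: sobolev_iff)

lemma norm_emb: "f \<in> sobolev s \<Longrightarrow> norm (emb s f) = sobolev_norm s f"
  by (simp add: norm_ell2_eq coord_emb sobolev_norm_def sobolev_term_wt)

lemma sobolev_add:
  assumes "f \<in> sobolev s" "g \<in> sobolev s"
  shows "(\<lambda>x. f x + g x) \<in> sobolev s" "emb s (\<lambda>x. f x + g x) = emb s f + emb s g"
proof -
  have L: "f \<in> torus_L2" "g \<in> torus_L2" using assms by (auto simp: sobolev_iff)
  show 1: "(\<lambda>x. f x + g x) \<in> sobolev s"
    unfolding sobolev_iff
    using summable_square_add[of "\<lambda>n. wt s n * fourier_coeff f n" "\<lambda>n. wt s n * fourier_coeff g n"] assms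
    by (auto simp: sobolev_iff torus_L2_add fourier_coeff_add[OF L] distrib_left periodic_2pi_def)
  show "emb s (\<lambda>x. f x + g x) = emb s f + emb s g"
    by (rule ell2_eqI) (simp add: coord_emb 1 assms fourier_coeff_add[OF L] distrib_left)
qed

lemma sobolev_cmult:
  assumes "f \<in> sobolev s"
  shows "(\<lambda>x. c * f x) \<in> sobolev s" "emb s (\<lambda>x. c * f x) = c *\<^sub>R emb s f"
proof -
  have L: "f \<in> torus_L2" using assms by (auto simp: sobolev_iff)
  have "(cmod (wt s n * fourier_coeff (\<lambda>x. c * f x) n))\<^sup>2 = c\<^sup>2 * (cmod (wt s n * fourier_coeff f n))\<^sup>2" for n
    by (simp add: fourier_coeff_cmult[OF L] norm_mult power_mult_distrib)
  thus 1: "(\<lambda>x. c * f x) \<in> sobolev s"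
    unfolding sobolev_iff using assms
    by (auto simp: sobolev_iff torus_L2_cmult periodic_2pi_def intro!: summable_on_cmult_right)
  show "emb s (\<lambda>x. c * f x) = c *\<^sub>R emb s f"
    by (rule ell2_eqI) (simp add: coord_emb 1 assms fourier_coeff_cmult[OF L] scaleR_conv_of_real)
qed

lemma sobolev_diff:
  assumes "f \<in> sobolev s" "g \<in> sobolev s"
  shows "(\<lambda>x. f x - g x) \<in> sobolev s" "emb s (\<lambda>x. f x - g x) = emb s f - emb s g"
  using sobolev_add[OF assms(1) sobolev_cmult(1)[OF assms(2), of "-1"]] sobolev_cmult(2)[OF assms(2), of "-1"]
  by simp_all

lemma fourier_coeff_const: "fourier_coeff (\<lambda>_. c) n = (if n = 0 then of_real c else 0)"
proof -
  have "fourier_coeff (\<lambda>_. c) n = c *\<^sub>R (\<integral>x. char (- n) x \<partial>tor)"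
    by (simp add: fourier_coeff_tor)
  thus ?thesis by (simp add: integral_char scaleR_conv_of_real)
qed

lemma sobolev_const: "(\<lambda>_. c) \<in> sobolev s" "emb s (\<lambda>_. c) = single 0 (of_real c)"
proof -
  show 1: "(\<lambda>_. c) \<in> sobolev s"
    unfolding sobolev_iff fourier_coeff_const
    by (auto simp: periodic_2pi_def torus_L2_const
        intro!: finite_nonzero_values_imp_summable_on intro: finite_subset[of _ "{0}"])
  show "emb s (\<lambda>_. c) = single 0 (of_real c)"
    by (rule ell2_eqI) (simp add: coord_emb 1 fourier_coeff_const)
qed

lemma sobolev_sum:
  assumes "finite I" "\<And>i. i \<in> I \<Longrightarrow> f i \<in> sobolev s"
  shows "(\<lambda>x. \<Sum>i\<in>I. c i * f i x) \<in> sobolev s \<and> emb s (\<lambda>x. \<Sum>i\<in>I. c i * f i x) = (\<Sum>i\<in>I. c i *\<^sub>R emb s (f i))"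
  using assms
proof (induction I rule: finite_induct)
  case empty
  have "single 0 0 = 0" by (rule ell2_eqI) simp
  thus ?case using sobolev_const[where c = 0 and s = s] by simp
next
  case (insert j I)
  have f: "f j \<in> sobolev s" using insert by simp
  have IH: "(\<lambda>x. \<Sum>i\<in>I. c i * f i x) \<in> sobolev s" "emb s (\<lambda>x. \<Sum>i\<in>I. c i * f i x) = (\<Sum>i\<in>I. c i *\<^sub>R emb s (f i))"
    using insert by auto
  show ?case using insert(1,2) sobolev_add[OF sobolev_cmult(1)[OF f] IH(1)] IH(2) sobolev_cmult(2)[OF f]
    by simp
qed

lemma periodic_2pi_shift:
  assumes "periodic_2pi P"
  shows "P (x + 2 * pi * of_int k) = P x"
proof -
  have nat: "P (x + 2 * pi * real n) = P x" for x n
  proof (induction n)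
    case (Suc n)
    have "P (x + 2 * pi * real (Suc n)) = P ((x + 2 * pi * real n) + 2 * pi)" by (simp add: algebra_simps)
    also have "\<dots> = P x" using assms Suc by (simp add: periodic_2pi_def)
    finally show ?case .
  qed simp
  show ?thesis
  proof (cases "0 \<le> k")
    case True thus ?thesis using nat[of x "nat k"] by simp
  next
    case False
    have "P x = P ((x + 2 * pi * of_int k) + 2 * pi * real (nat (- k)))" using False by (simp add: algebra_simps)
    thus ?thesis using nat by metis
  qed
qed

text \<open>The line is a countable union of translates of the period.\<close>

lemma AE_tor_periodic:
  assumes "periodic_2pi P" "AE x in tor. P x"
  shows "AE x in lborel. P x"
proof -
  have k: "AE x in lborel. x + 2 * pi * of_int k \<in> {0..2*pi} \<longrightarrow> P (x + 2 * pi * of_int k)" for k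
  proof -
    have "AE x in lborel. x \<in> {0..2*pi} \<longrightarrow> P x" using assms(2) by (simp add: AE_tor)
    hence "AE x in distr lborel borel (\<lambda>x. 2 * pi * of_int k + x). x \<in> {0..2*pi} \<longrightarrow> P x"
      by (simp only: lborel_distr_plus)
    from AE_distrD[OF _ this] show ?thesis by (simp add: add.commute)
  qed
  have "AE x in lborel. \<forall>k::int. x + 2 * pi * of_int k \<in> {0..2*pi} \<longrightarrow> P (x + 2 * pi * of_int k)"
    using k by (simp add: AE_all_countable)
  thus ?thesis
  proof eventually_elim
    case (elim x)
    define k where "k = \<lfloor>x / (2*pi)\<rfloor>"
    have "real_of_int k \<le> x / (2*pi)" "x / (2*pi) \<le> real_of_int k + 1" unfolding k_def by linarith+
    hence "x + 2 * pi * of_int (- k) \<in> {0..2*pi}" by (simp add: field_simps)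
    thus ?case using elim periodic_2pi_shift[OF assms(1), of x "- k"] by blast
  qed
qed

lemma emb_eq_AE:
  assumes "f \<in> sobolev s" "g \<in> sobolev s" "emb s f = emb s g"
  shows "AE x in lborel. f x = g x"
proof (rule AE_tor_periodic)
  show "periodic_2pi (\<lambda>x. f x = g x)" using assms by (auto simp: sobolev_iff periodic_2pi_def)
  show "AE x in tor. f x = g x"
  proof (rule fourier_coeff_AE_unique)
    fix n
    have "wt s n * fourier_coeff f n = wt s n * fourier_coeff g n" using assms by (metis coord_emb)
    thus "fourier_coeff f n = fourier_coeff g n" by simp
  qed (use assms in \<open>auto intro: sobolev_L2\<close>)
qed

text \<open>Complex conjugation of functions, in coordinates; its fixed points are the sequences of real functions.\<close>

definition flip :: "ell2 \<Rightarrow> ell2" where "flip X = Abs_ell2 (\<lambda>n. cnj (coord X (- n)))"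

lemma coord_flip [simp]: "coord (flip X) n = cnj (coord X (- n))"
proof -
  have "(\<lambda>n. (cmod (cnj (coord X (- n))))\<^sup>2) summable_on UNIV"
    using summable_coord[of X] summable_on_reindex_bij_betw[of uminus UNIV UNIV "\<lambda>n. (cmod (coord X n))\<^sup>2"]
    by (simp add: bij_uminus)
  thus ?thesis by (simp add: flip_def coord_Abs_ell2)
qed

lemma norm_flip [simp]: "norm (flip X) = norm X"
  unfolding norm_ell2_eq
  using infsum_reindex_bij_betw[of uminus UNIV UNIV "\<lambda>n. (cmod (coord X n))\<^sup>2"] by (simp add: bij_uminus)

lemma bounded_linear_flip: "bounded_linear flip"
  by (rule bounded_linear_intro[where K = 1]) (auto intro!: ell2_eqI)

definition hermitian :: "ell2 \<Rightarrow> bool" where "hermitian X \<longleftrightarrow> flip X = X"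

lemma hermitianD: "hermitian X \<Longrightarrow> coord X (- n) = cnj (coord X n)"
  by (metis coord_flip complex_cnj_cnj hermitian_def)

lemma hermitianI: "(\<And>n. coord X (- n) = cnj (coord X n)) \<Longrightarrow> hermitian X"
  unfolding hermitian_def by (rule ell2_eqI) simp

lemma hermitian_emb: "f \<in> sobolev s \<Longrightarrow> hermitian (emb s f)"
  by (rule hermitianI) (simp add: coord_emb fourier_coeff_cnj[OF sobolev_L2])

lemma emb_surj:
  assumes s: "0 \<le> s" and X: "hermitian X"
  shows "\<exists>f\<in>sobolev s. emb s f = X"
proof -
  define c where "c n = coord X n / wt s n" for n
  have c: "c (- n) = cnj (c n)" for n using hermitianD[OF X, of n] by (simp add: c_def)
  have sm: "(\<lambda>n. (cmod (c n))\<^sup>2) summable_on UNIV"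
  proof (rule summable_on_comparison_test[OF summable_coord[of X]])
    fix n
    have "cmod (c n) \<le> cmod (coord X n)"
      using wt_ge_1[OF s, of n] by (simp add: c_def norm_divide divide_le_eq mult_le_cancel_left1)
    thus "(cmod (c n))\<^sup>2 \<le> (cmod (coord X n))\<^sup>2" by (intro power_mono) auto
  qed auto
  obtain g where g: "periodic_2pi g" "g \<in> torus_L2" "(\<lambda>N. \<integral>x. (g x - psum c N x)\<^sup>2 \<partial>tor) \<longlonglongrightarrow> 0"
    using riesz_fischer[of c, OF sm c] by blast
  have fc: "fourier_coeff g n = c n" for n by (rule fourier_coeff_of_L2_limit[OF g(2,3) c])
  hence wc: "wt s n * fourier_coeff g n = coord X n" for n by (simp add: c_def)
  have "g \<in> sobolev s" unfolding sobolev_iff using g summable_coord[of X] by (simp add: wc)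
  moreover from this have "emb s g = X" by (intro ell2_eqI) (simp add: coord_emb wc)
  ultimately show ?thesis by blast
qed

section \<open>Fourier coefficients of smooth functions\<close>

lemma periodic_deriv:
  assumes "periodic_2pi f"
  shows "periodic_2pi (deriv f)"
proof -
  have "f \<circ> (\<lambda>x. x + 2 * pi) = f" using assms by (auto simp: periodic_2pi_def)
  hence "(f has_field_derivative D) (at (x + 2 * pi)) \<longleftrightarrow> (f has_field_derivative D) (at x)" for x D :: real
    using DERIV_shift[of f D x "2 * pi"] by (simp add: o_def)
  thus ?thesis by (simp add: periodic_2pi_def deriv_def)
qed

lemma torus_smooth_deriv: "torus_smooth a \<Longrightarrow> torus_smooth (deriv a)"
  unfolding torus_smooth_def using periodic_deriv
  by (auto simp flip: funpow_Suc_right simp: funpow_swap1 elim!: allE[of _ "Suc _"])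

lemma torus_smooth_has_deriv:
  assumes "torus_smooth a" shows "(a has_real_derivative deriv a x) (at x)"
proof -
  have "(deriv ^^ 0) a differentiable_on UNIV" using assms unfolding torus_smooth_def by blast
  thus ?thesis by (simp add: differentiable_on_def DERIV_deriv_iff_real_differentiable)
qed

lemma torus_smooth_continuous: "torus_smooth a \<Longrightarrow> continuous_on S a"
  by (meson torus_smooth_has_deriv DERIV_isCont continuous_at_imp_continuous_on)

lemma periodic_continuous_bounded:
  fixes f :: "real \<Rightarrow> real"
  assumes "periodic_2pi f" "continuous_on UNIV f"
  obtains B where "\<And>x. \<bar>f x\<bar> \<le> B"
proof -
  have "compact (f ` {0..2*pi})" using assms(2) by (intro compact_continuous_image) (auto intro: continuous_on_subset)
  then obtain B where B: "\<And>y. y \<in> f ` {0..2*pi} \<Longrightarrow> \<bar>y\<bar> \<le> B"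
    by (metis compact_imp_bounded bounded_iff real_norm_def)
  have "\<bar>f x\<bar> \<le> B" for x
  proof -
    have nat: "f (x + 2 * pi * real n) = f x" for x n
    proof (induction n)
      case (Suc n)
      have "f (x + 2 * pi * real (Suc n)) = f ((x + 2 * pi * real n) + 2 * pi)" by (simp add: algebra_simps)
      also have "\<dots> = f x" using assms(1) Suc by (simp add: periodic_2pi_def)
      finally show ?case .
    qed simp
    define k where "k = \<lfloor>x / (2*pi)\<rfloor>"
    have "real_of_int k \<le> x / (2*pi)" "x / (2*pi) \<le> real_of_int k + 1" unfolding k_def by linarith+
    hence m: "x - 2 * pi * real_of_int k \<in> {0..2*pi}" by (simp add: field_simps)
    have "f x = f (x - 2 * pi * real_of_int k)"
    proof (cases "0 \<le> k")
      case True thus ?thesis using nat[of "x - 2 * pi * real_of_int k" "nat k"] by simp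
    next
      case False thus ?thesis using nat[of x "nat (- k)"] by simp
    qed
    thus ?thesis using B m by auto
  qed
  thus thesis using that by blast
qed

lemma torus_smooth_bounded:
  assumes "torus_smooth a" obtains B where "\<And>x. \<bar>a x\<bar> \<le> B"
  using periodic_continuous_bounded[OF _ torus_smooth_continuous[OF assms]] assms
  unfolding torus_smooth_def by metis

lemma torus_smooth_measurable: "torus_smooth a \<Longrightarrow> a \<in> borel_measurable borel"
  by (intro borel_measurable_continuous_onI torus_smooth_continuous)

lemma torus_smooth_L2: "torus_smooth a \<Longrightarrow> a \<in> torus_L2"
  by (metis torus_L2_bounded torus_smooth_bounded torus_smooth_measurable)

lemma fourier_coeff_deriv:
  assumes a: "torus_smooth a"
  shows "fourier_coeff (deriv a) n = \<i> * of_int n * fourier_coeff a n"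
proof -
  note [measurable] = torus_smooth_measurable[OF a] torus_smooth_measurable[OF torus_smooth_deriv[OF a]]
  let ?F = "\<lambda>x. a x *\<^sub>R char (- n) x"
  let ?F' = "\<lambda>x. deriv a x *\<^sub>R char (- n) x - (\<i> * of_int n) * (a x *\<^sub>R char (- n) x)"
  have "(LINT x:{0..2*pi}|lborel. ?F' x) = ?F (2*pi) - ?F 0"
    unfolding set_lebesgue_integral_def
  proof (rule integral_FTC_atLeastAtMost)
    show "(?F has_vector_derivative ?F' x) (at x within {0..2*pi})" for x
      using has_vector_derivative_scaleR[OF has_field_derivative_at_within[OF torus_smooth_has_deriv[OF a, of x]]
          char_has_vector_derivative[of "-n" x "{0..2*pi}"]]
      by (simp add: scaleR_conv_of_real algebra_simps)
    show "continuous_on {0..2*pi} ?F'"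
      by (intro continuous_intros torus_smooth_continuous a torus_smooth_deriv)
  qed simp
  also have "\<dots> = 0" using a char_periodic[of "-n" 0]
    unfolding torus_smooth_def periodic_2pi_def by (metis add_0 diff_self)
  finally have "(\<integral>x. ?F' x \<partial>tor) = 0" by (subst integral_tor) auto
  moreover have "(\<integral>x. ?F' x \<partial>tor) = (\<integral>x. deriv a x *\<^sub>R char (- n) x \<partial>tor) - (\<integral>x. (\<i> * of_int n) * (a x *\<^sub>R char (- n) x) \<partial>tor)"
    by (intro Bochner_Integration.integral_diff integrable_mult_right integrable_scaleR_char
        torus_L2_integrable torus_smooth_L2 a torus_smooth_deriv)
  moreover have "(\<integral>x. (\<i> * of_int n) * (a x *\<^sub>R char (- n) x) \<partial>tor) = (\<i> * of_int n) * (\<integral>x. a x *\<^sub>R char (- n) x \<partial>tor)"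
    by (rule Bochner_Integration.integral_mult_right_zero)
  ultimately show ?thesis by (simp add: fourier_coeff_tor)
qed

lemma fourier_coeff_decay:
  assumes a: "torus_smooth a"
  shows "\<exists>C. \<forall>n. cmod (fourier_coeff a n) * \<bar>of_int n\<bar> ^ k \<le> C"
  using a
proof (induction k arbitrary: a)
  case 0
  show ?case
    by (intro exI[of _ "\<integral>x. \<bar>a x\<bar> \<partial>tor"]) (simp add: cmod_fourier_coeff_le torus_smooth_measurable 0)
next
  case (Suc k)
  obtain C where "\<And>n. cmod (fourier_coeff (deriv a) n) * \<bar>of_int n\<bar> ^ k \<le> C"
    using Suc.IH[OF torus_smooth_deriv[OF Suc.prems]] by blast
  thus ?case by (intro exI[of _ C]) (simp add: fourier_coeff_deriv[OF Suc.prems] norm_mult mult_ac)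
qed

text \<open>Smooth functions have rapidly decreasing coefficients. This is what makes the damping coefficient \<open>a\<close> a
multiplier on every \<open>H\<^sup>s\<close>.\<close>

lemma fourier_coeff_summable_weighted:
  assumes a: "torus_smooth a"
  shows "(\<lambda>n. cmod (fourier_coeff a n) * wt m n) summable_on UNIV"
proof -
  \<comment> \<open>One more power of \<open>1 + n\<^sup>2\<close> than the weight has, to leave the summable factor \<open>1 / (1 + n\<^sup>2)\<close>.\<close>
  define p :: nat where "p = nat \<lceil>\<bar>m\<bar> / 2\<rceil> + 1"
  have p0: "p \<noteq> 0" by (simp add: p_def)
  have p: "m / 2 + 1 \<le> real p" unfolding p_def by linarith
  obtain C0 where C0: "\<And>n. cmod (fourier_coeff a n) \<le> C0" using fourier_coeff_decay[OF a, of 0] by auto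
  obtain C1 where C1: "\<And>n. cmod (fourier_coeff a n) * \<bar>of_int n\<bar> ^ (2 * p) \<le> C1"
    using fourier_coeff_decay[OF a, of "2 * p"] by auto
  show ?thesis
  proof (rule summable_on_comparison_test)
    show "(\<lambda>n::int. (2^p * (C0 + C1)) * (1 / (1 + (of_int n)\<^sup>2))) summable_on UNIV"
      by (intro summable_on_cmult_right summable_inverse_square)
    fix n :: int
    let ?q = "1 + (of_int n)\<^sup>2 :: real"
    have q: "1 \<le> ?q" by simp
    have "wt m n * ?q = ?q powr (m/2 + 1)" using q by (simp add: wt_def powr_add)
    also have "\<dots> \<le> ?q powr (real p)" using q p by (intro powr_mono) auto
    also have "\<dots> = ?q ^ p" by (rule powr_realpow[OF one_plus_sq_pos])
    also have "\<dots> \<le> 2^p * (1 + \<bar>of_int n\<bar> ^ (2*p))"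
    proof (cases "n = 0")
      case False
      hence "1 \<le> (of_int n :: real)\<^sup>2" using int_one_le_iff_zero_less[of "n^2"] by (simp flip: of_int_power of_int_le_iff)
      hence "?q ^ p \<le> (2 * (of_int n)\<^sup>2) ^ p" by (intro power_mono) auto
      also have "\<dots> = 2^p * \<bar>of_int n\<bar> ^ (2*p)" by (simp add: power_mult_distrib power_mult)
      finally show ?thesis by (simp add: distrib_left add_increasing)
    qed (use p0 in \<open>simp add: one_le_power power_0_left\<close>)
    finally have "wt m n * ?q \<le> 2^p * (1 + \<bar>of_int n\<bar> ^ (2*p))" .
    hence "cmod (fourier_coeff a n) * (wt m n * ?q) \<le> cmod (fourier_coeff a n) * (2^p * (1 + \<bar>of_int n\<bar> ^ (2*p)))"
      by (rule mult_left_mono) simp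
    also have "\<dots> = 2^p * (cmod (fourier_coeff a n) + cmod (fourier_coeff a n) * \<bar>of_int n\<bar> ^ (2*p))"
      by (simp add: algebra_simps)
    also have "\<dots> \<le> 2^p * (C0 + C1)" by (intro mult_left_mono add_mono C0 C1) simp
    finally show "cmod (fourier_coeff a n) * wt m n \<le> (2^p * (C0 + C1)) * (1 / ?q)"
      unfolding times_divide_eq_right mult_1_right
      by (subst pos_le_divide_eq[OF one_plus_sq_pos]) (simp only: mult.assoc)
  qed simp
qed

section \<open>The vector field in Fourier coordinates\<close>

definition conv :: "(int \<Rightarrow> complex) \<Rightarrow> (int \<Rightarrow> complex) \<Rightarrow> int \<Rightarrow> complex" where
  "conv u v n = (\<Sum>\<^sub>\<infinity>k. u k * v (n - k))"

text \<open>The coefficients of \<open>- (a u\<^sub>x)\<^sub>x\<close>, when \<open>u\<close> has the coefficients \<open>u n\<close>.\<close>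

definition damp_coeff :: "(real \<Rightarrow> real) \<Rightarrow> (int \<Rightarrow> complex) \<Rightarrow> int \<Rightarrow> complex" where
  "damp_coeff a u n = (\<Sum>\<^sub>\<infinity>k. of_int n * of_int k * fourier_coeff a (n - k) * u k)"

text \<open>The coefficients of \<open>- (a u\<^sub>x)\<^sub>x + (u + u\<^sup>2/2)\<^sub>x\<close>.\<close>

definition flux_coeff :: "(real \<Rightarrow> real) \<Rightarrow> (int \<Rightarrow> complex) \<Rightarrow> int \<Rightarrow> complex" where
  "flux_coeff a u n = damp_coeff a u n + \<i> * of_int n * (u n + conv u u n / 2)"

lemma vector_derivative_char: "vector_derivative (char n) (at x) = \<i> * of_int n * char n x"
  by (rule vector_derivative_at) (rule char_has_vector_derivative)

lemma regular_distr_tor: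
  assumes [measurable]: "f \<in> borel_measurable borel" "\<phi> \<in> borel_measurable borel"
  shows "regular_distr f \<phi> = (2 * pi) *\<^sub>R (\<integral>x. f x *\<^sub>R \<phi> x \<partial>tor)"
  by (subst integral_tor) (auto simp: regular_distr_def)

lemma torus_L2_square_coeff:
  assumes u: "u \<in> torus_L2"
  shows "integrable tor (\<lambda>x. u x + (u x)\<^sup>2 / 2)"
    "fourier_coeff (\<lambda>x. u x + (u x)\<^sup>2 / 2) n = fourier_coeff u n + conv (fourier_coeff u) (fourier_coeff u) n / 2"
proof -
  note [measurable] = torus_L2_measurable[OF u]
  have i: "integrable tor u" "integrable tor (\<lambda>x. (u x)\<^sup>2)"
    by (rule torus_L2_integrable[OF u]) (rule torus_L2_square[OF u])
  thus "integrable tor (\<lambda>x. u x + (u x)\<^sup>2 / 2)" by simp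
  have c: "fourier_coeff (\<lambda>x. (u x)\<^sup>2) n = conv (fourier_coeff u) (fourier_coeff u) n"
    using fourier_coeff_mult[OF u u, of n] by (simp add: conv_def has_sum_iff power2_eq_square)
  have "fourier_coeff (\<lambda>x. u x + (u x)\<^sup>2 / 2) n
      = (\<integral>x. u x *\<^sub>R char (- n) x + (1/2) *\<^sub>R ((u x)\<^sup>2 *\<^sub>R char (- n) x) \<partial>tor)"
    by (simp add: fourier_coeff_tor scaleR_left_distrib)
  also have "\<dots> = (\<integral>x. u x *\<^sub>R char (- n) x \<partial>tor) + (\<integral>x. (1/2) *\<^sub>R ((u x)\<^sup>2 *\<^sub>R char (- n) x) \<partial>tor)"
    by (intro Bochner_Integration.integral_add integrable_scaleR_right integrable_scaleR_char i)
  also have "(\<integral>x. (1/2) *\<^sub>R ((u x)\<^sup>2 *\<^sub>R char (- n) x) \<partial>tor) = (1/2) *\<^sub>R (\<integral>x. (u x)\<^sup>2 *\<^sub>R char (- n) x \<partial>tor)"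
    by (rule Bochner_Integration.integral_scaleR_right)
  also have "(\<integral>x. u x *\<^sub>R char (- n) x \<partial>tor) + (1/2) *\<^sub>R (\<integral>x. (u x)\<^sup>2 *\<^sub>R char (- n) x \<partial>tor)
      = fourier_coeff u n + (1/2) *\<^sub>R fourier_coeff (\<lambda>x. (u x)\<^sup>2) n"
    by (simp add: fourier_coeff_tor)
  finally show "fourier_coeff (\<lambda>x. u x + (u x)\<^sup>2 / 2) n
      = fourier_coeff u n + conv (fourier_coeff u) (fourier_coeff u) n / 2"
    by (simp add: c scaleR_conv_of_real)
qed

text \<open>Both derivatives act on the test function, which produces a term with \<open>deriv a\<close> and one with \<open>a\<close>. With
\<open>e = - i n\<close> their kernels add up to \<open>- e i (n - k) - e\<^sup>2 = n k\<close> times the coefficient of \<open>a\<close> at \<open>n - k\<close>.\<close>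

lemma distr_coeff_bbm_flux:
  assumes a: "torus_smooth a" and u: "u \<in> torus_L2"
  shows "distr_coeff (bbm_flux a u) n = flux_coeff a (fourier_coeff u) n"
proof -
  note m [measurable] = torus_smooth_measurable[OF a] torus_smooth_measurable[OF torus_smooth_deriv[OF a]] torus_L2_measurable[OF u]
  define e where "e = - (\<i> * of_int n)"
  have ch: "(\<lambda>x. cis (- (of_int n * x))) = char (- n)" by (simp add: char_def fun_eq_iff)
  have vd: "(\<lambda>x. vector_derivative (char (- n)) (at x)) = (\<lambda>x. e * char (- n) x)"
    by (simp add: vector_derivative_char e_def fun_eq_iff)
  have vd2: "vector_derivative (\<lambda>x. a x *\<^sub>R (e * char (- n) x)) (at x)
      = e * (deriv a x *\<^sub>R char (- n) x) + e\<^sup>2 * (a x *\<^sub>R char (- n) x)" for x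
  proof (rule vector_derivative_at)
    have "((\<lambda>x. e * char (- n) x) has_vector_derivative e * (e * char (- n) x)) (at x)"
      using has_vector_derivative_mult_right[OF char_has_vector_derivative[of "-n" x UNIV], of e]
      by (simp add: e_def)
    from has_vector_derivative_scaleR[OF torus_smooth_has_deriv[OF a, of x] this]
    show "((\<lambda>x. a x *\<^sub>R (e * char (- n) x)) has_vector_derivative
        e * (deriv a x *\<^sub>R char (- n) x) + e\<^sup>2 * (a x *\<^sub>R char (- n) x)) (at x)"
      by (simp add: algebra_simps power2_eq_square scaleR_conv_of_real)
  qed
  have aL: "(\<lambda>x. u x * a x) \<in> torus_L2" "(\<lambda>x. u x * deriv a x) \<in> torus_L2"
    using torus_smooth_bounded[OF a] torus_smooth_bounded[OF torus_smooth_deriv[OF a]]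
    by (metis (no_types, lifting) ext m mult.commute torus_L2_mult_bounded u)+
  have "regular_distr u (\<lambda>x. e * (deriv a x *\<^sub>R char (- n) x) + e\<^sup>2 * (a x *\<^sub>R char (- n) x))
     = (2 * pi) *\<^sub>R (\<integral>x. u x *\<^sub>R (e * (deriv a x *\<^sub>R char (- n) x) + e\<^sup>2 * (a x *\<^sub>R char (- n) x)) \<partial>tor)"
    by (rule regular_distr_tor) measurable
  also have "(\<lambda>x. u x *\<^sub>R (e * (deriv a x *\<^sub>R char (- n) x) + e\<^sup>2 * (a x *\<^sub>R char (- n) x)))
     = (\<lambda>x. e * ((u x * deriv a x) *\<^sub>R char (- n) x) + e\<^sup>2 * ((u x * a x) *\<^sub>R char (- n) x))"
    by (simp add: fun_eq_iff scaleR_conv_of_real algebra_simps)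
  also have "(\<integral>x. e * ((u x * deriv a x) *\<^sub>R char (- n) x) + e\<^sup>2 * ((u x * a x) *\<^sub>R char (- n) x) \<partial>tor)
     = (\<integral>x. e * ((u x * deriv a x) *\<^sub>R char (- n) x) \<partial>tor) + (\<integral>x. e\<^sup>2 * ((u x * a x) *\<^sub>R char (- n) x) \<partial>tor)"
    by (intro Bochner_Integration.integral_add integrable_mult_right integrable_scaleR_char torus_L2_integrable aL)
  also have "\<dots> = e * fourier_coeff (\<lambda>x. u x * deriv a x) n + e\<^sup>2 * fourier_coeff (\<lambda>x. u x * a x) n"
    by (simp only: Bochner_Integration.integral_mult_right_zero) (simp add: fourier_coeff_tor)
  finally have R1: "regular_distr u (\<lambda>x. e * (deriv a x *\<^sub>R char (- n) x) + e\<^sup>2 * (a x *\<^sub>R char (- n) x))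
     = (2 * pi) *\<^sub>R (e * fourier_coeff (\<lambda>x. u x * deriv a x) n + e\<^sup>2 * fourier_coeff (\<lambda>x. u x * a x) n)" .
  have "regular_distr (\<lambda>x. u x + (u x)\<^sup>2 / 2) (\<lambda>x. e * char (- n) x)
     = (2 * pi) *\<^sub>R (\<integral>x. e * ((u x + (u x)\<^sup>2 / 2) *\<^sub>R char (- n) x) \<partial>tor)"
    by (subst regular_distr_tor) auto
  also have "\<dots> = (2 * pi) *\<^sub>R (e * fourier_coeff (\<lambda>x. u x + (u x)\<^sup>2 / 2) n)"
    by (simp only: Bochner_Integration.integral_mult_right_zero) (simp add: fourier_coeff_tor)
  finally have R2: "regular_distr (\<lambda>x. u x + (u x)\<^sup>2 / 2) (\<lambda>x. e * char (- n) x)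
     = (2 * pi) *\<^sub>R (e * fourier_coeff (\<lambda>x. u x + (u x)\<^sup>2 / 2) n)" .
  have "bbm_flux a u (char (- n)) = - regular_distr u (\<lambda>x. e * (deriv a x *\<^sub>R char (- n) x) + e\<^sup>2 * (a x *\<^sub>R char (- n) x))
      - regular_distr (\<lambda>x. u x + (u x)\<^sup>2 / 2) (\<lambda>x. e * char (- n) x)"
    unfolding bbm_flux_def distr_deriv_def distr_mult_def vd by (simp add: vd2)
  hence "distr_coeff (bbm_flux a u) n = - (e * fourier_coeff (\<lambda>x. u x * deriv a x) n + e\<^sup>2 * fourier_coeff (\<lambda>x. u x * a x) n)
      - e * fourier_coeff (\<lambda>x. u x + (u x)\<^sup>2 / 2) n"
    unfolding distr_coeff_def ch R1 R2 by (simp add: scaleR_conv_of_real field_simps)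
  moreover have "- (e * fourier_coeff (\<lambda>x. u x * deriv a x) n + e\<^sup>2 * fourier_coeff (\<lambda>x. u x * a x) n)
      = damp_coeff a (fourier_coeff u) n"
  proof -
    have "((\<lambda>k. (- e) * (fourier_coeff u k * fourier_coeff (deriv a) (n - k)) + (- (e\<^sup>2)) * (fourier_coeff u k * fourier_coeff a (n - k)))
       has_sum ((- e) * fourier_coeff (\<lambda>x. u x * deriv a x) n + (- (e\<^sup>2)) * fourier_coeff (\<lambda>x. u x * a x) n)) UNIV"
      by (intro has_sum_add has_sum_cmult_right fourier_coeff_mult u torus_smooth_L2 a torus_smooth_deriv)
    moreover have "(- e) * (fourier_coeff u k * fourier_coeff (deriv a) (n - k)) + (- (e\<^sup>2)) * (fourier_coeff u k * fourier_coeff a (n - k))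
       = of_int n * of_int k * fourier_coeff a (n - k) * fourier_coeff u k" for k
      by (simp add: fourier_coeff_deriv[OF a] e_def power2_eq_square algebra_simps)
    ultimately show ?thesis by (simp add: damp_coeff_def has_sum_iff)
  qed
  ultimately show ?thesis
    by (simp add: flux_coeff_def torus_L2_square_coeff[OF u] e_def)
qed

text \<open>\<open>T\<close> is a sum of weighted shifts, the one by \<open>m\<close> having norm at most \<open>A m\<close>, so it converges absolutely in
operator norm.\<close>

lemma shift_sum_operator:
  fixes \<kappa> :: "int \<Rightarrow> int \<Rightarrow> complex" and A :: "int \<Rightarrow> real"
  assumes A: "A summable_on UNIV" and \<kappa>: "\<And>m n. cmod (\<kappa> m n) \<le> A m"
  obtains T where "bounded_linear T" "\<And>X n. ((\<lambda>m. \<kappa> m n * coord X (n - m)) has_sum coord (T X) n) UNIV"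
proof -
  have A0: "0 \<le> A m" for m using \<kappa>[of m 0] norm_ge_zero order_trans by blast
  define S where "S m X = Abs_ell2 (\<lambda>n. \<kappa> m n * coord X (n - m))" for m X
  have bij: "bij_betw (\<lambda>n. n - m) UNIV UNIV" for m :: int
    by (rule bij_betw_byWitness[where f' = "\<lambda>n. n + m"]) auto
  have shift: "(\<lambda>n. (cmod (coord X (n - m)))\<^sup>2) summable_on UNIV" "(\<Sum>\<^sub>\<infinity>n. (cmod (coord X (n - m)))\<^sup>2) = (norm X)\<^sup>2" for X m
    using summable_on_reindex_bij_betw[OF bij[of m], of "\<lambda>n. (cmod (coord X n))\<^sup>2"]
      infsum_reindex_bij_betw[OF bij[of m], of "\<lambda>n. (cmod (coord X n))\<^sup>2"] summable_coord[of X]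
    by (simp_all add: norm_ell2_square)
  have le: "(cmod (\<kappa> m n * coord X (n - m)))\<^sup>2 \<le> (A m)\<^sup>2 * (cmod (coord X (n - m)))\<^sup>2" for m n X
    by (simp add: norm_mult power_mult_distrib mult_right_mono power_mono[OF \<kappa>])
  have sm: "(\<lambda>n. (cmod (\<kappa> m n * coord X (n - m)))\<^sup>2) summable_on UNIV" for m X
    by (rule summable_on_comparison_test[OF summable_on_cmult_right[OF shift(1)[of X m], of "(A m)\<^sup>2"] le]) auto
  have cS: "coord (S m X) n = \<kappa> m n * coord X (n - m)" for m X n
    unfolding S_def by (subst coord_Abs_ell2[OF sm]) simp
  have nS: "norm (S m X) \<le> A m * norm X" for m X
  proof -
    have "(norm (S m X))\<^sup>2 \<le> (\<Sum>\<^sub>\<infinity>n. (A m)\<^sup>2 * (cmod (coord X (n - m)))\<^sup>2)"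
      unfolding norm_ell2_square cS by (rule infsum_mono[OF sm _ le]) (intro summable_on_cmult_right shift)
    also have "\<dots> = (A m * norm X)\<^sup>2"
      by (simp add: infsum_cmult_right' shift power_mult_distrib)
    finally show ?thesis by (rule power2_le_imp_le) (simp add: A0)
  qed
  have abs: "(\<lambda>m. norm (S m X)) summable_on UNIV" for X
    by (rule summable_on_comparison_test[OF summable_on_cmult_left[OF A, of "norm X"] nS]) simp
  have sS: "(\<lambda>m. S m X) summable_on UNIV" for X
    by (rule abs_summable_summable[OF abs])
  define T where "T X = (\<Sum>\<^sub>\<infinity>m. S m X)" for X
  have T: "((\<lambda>m. S m X) has_sum T X) UNIV" for X
    unfolding T_def using sS by simp
  have "bounded_linear T"
  proof (rule bounded_linear_intro)
    fix X Y :: ell2 and r :: real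
    have "S m (X + Y) = S m X + S m Y" "S m (r *\<^sub>R X) = r *\<^sub>R S m X" for m
      by (rule ell2_eqI; simp add: cS distrib_left scaleR_conv_of_real mult_ac)+
    thus "T (X + Y) = T X + T Y" "T (r *\<^sub>R X) = r *\<^sub>R T X"
      by (simp_all add: T_def infsum_add sS infsum_scaleR_right)
    have "norm (T X) \<le> (\<Sum>\<^sub>\<infinity>m. norm (S m X))"
      unfolding T_def by (rule norm_infsum_bound[OF abs])
    also have "\<dots> \<le> (\<Sum>\<^sub>\<infinity>m. A m * norm X)"
      by (rule infsum_mono[OF abs summable_on_cmult_left[OF A] nS])
    also have "\<dots> = norm X * (\<Sum>\<^sub>\<infinity>m. A m)" by (simp add: infsum_cmult_left' mult.commute)
    finally show "norm (T X) \<le> norm X * (\<Sum>\<^sub>\<infinity>m. A m)" .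
  qed
  moreover have "((\<lambda>m. \<kappa> m n * coord X (n - m)) has_sum coord (T X) n) UNIV" for X n
    using has_sum_bounded_linear[OF bounded_linear_coord[where n = n] T[of X]] by (simp add: cS)
  ultimately show thesis by (rule that)
qed

text \<open>The symbol of \<open>\<partial>\<^sub>x (1 - \<partial>\<^sub>x\<^sup>2)\<^sup>-\<^sup>1\<close>.\<close>

definition beta :: "int \<Rightarrow> complex" where "beta n = \<i> * of_int n / (1 + (of_int n)\<^sup>2)"

lemma norm_beta_square_le: "(cmod (beta n))\<^sup>2 \<le> 1 / (1 + (of_int n)\<^sup>2)"
proof -
  have "cmod (1 + (of_int n)\<^sup>2 :: complex) = 1 + (of_int n)\<^sup>2"
    using norm_of_real[of "1 + (of_int n)\<^sup>2", where 'a = complex] by simp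
  hence "(cmod (beta n))\<^sup>2 = (of_int n)\<^sup>2 / (1 + (of_int n)\<^sup>2)\<^sup>2"
    by (simp add: beta_def norm_divide norm_mult power_divide)
  also have "\<dots> \<le> (1 + (of_int n)\<^sup>2) / (1 + (of_int n)\<^sup>2)\<^sup>2" by (intro divide_right_mono) auto
  also have "\<dots> = 1 / (1 + (of_int n)\<^sup>2)"
    using one_plus_sq_pos[of n] by (simp add: power2_eq_square)
  finally show ?thesis .
qed

lemma norm_beta_le_1: "cmod (beta n) \<le> 1"
proof -
  have "(cmod (beta n))\<^sup>2 \<le> 1\<^sup>2"
    using norm_beta_square_le[of n] by (rule order_trans) (simp add: divide_le_eq add_pos_nonneg)
  thus ?thesis by (rule power2_le_imp_le) simp
qed

lemma summable_beta: "(\<lambda>n. (cmod (beta n))\<^sup>2) summable_on UNIV"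
  by (rule summable_on_comparison_test[OF summable_inverse_square norm_beta_square_le]) auto

text \<open>For \<open>s \<ge> 0\<close> the weighted coefficients of a product are bounded but need not be square-summable;
such a multiplier makes them so.\<close>

definition square_summable_multiplier :: "(int \<Rightarrow> complex) \<Rightarrow> bool" where
  "square_summable_multiplier b \<longleftrightarrow> (\<forall>n. cmod (b n) \<le> 1) \<and> (\<lambda>n. (cmod (b n))\<^sup>2) summable_on UNIV"

lemma beta_multiplier: "square_summable_multiplier beta"
  by (simp add: square_summable_multiplier_def norm_beta_le_1 summable_beta)

definition Disp :: "(int \<Rightarrow> complex) \<Rightarrow> ell2 \<Rightarrow> ell2" where "Disp b X = Abs_ell2 (\<lambda>n. b n * coord X n)"

lemma norm_multiplier_le: "square_summable_multiplier b \<Longrightarrow> cmod (b n * z) \<le> cmod z"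
  using mult_right_mono[of "cmod (b n)" 1 "cmod z"] by (simp add: norm_mult square_summable_multiplier_def)

lemma coord_Disp:
  assumes b: "square_summable_multiplier b" shows "coord (Disp b X) n = b n * coord X n"
proof -
  have "(\<lambda>n. (cmod (b n * coord X n))\<^sup>2) summable_on UNIV"
    by (rule summable_on_comparison_test[OF summable_coord[of X]]) (auto intro!: power_mono norm_multiplier_le b)
  thus ?thesis by (simp add: Disp_def coord_Abs_ell2)
qed

lemma bounded_linear_Disp:
  assumes b: "square_summable_multiplier b" shows "bounded_linear (Disp b)"
proof (rule bounded_linear_intro[where K = 1])
  fix X Y :: ell2 and r :: real
  show "Disp b (X + Y) = Disp b X + Disp b Y" "Disp b (r *\<^sub>R X) = r *\<^sub>R Disp b X"
    by (rule ell2_eqI; simp add: coord_Disp[OF b] distrib_left scaleR_conv_of_real mult_ac)+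
  show "norm (Disp b X) \<le> norm X * 1"
  proof (rule norm_ell2_le)
    fix A :: "int set" assume "finite A"
    have "(\<Sum>n\<in>A. (cmod (coord (Disp b X) n))\<^sup>2) \<le> (\<Sum>n\<in>A. (cmod (coord X n))\<^sup>2)"
      by (intro sum_mono power_mono) (auto simp: coord_Disp[OF b] norm_multiplier_le[OF b])
    also have "\<dots> \<le> (norm X * 1)\<^sup>2" using sum_coord_le_norm[OF \<open>finite A\<close>] by simp
    finally show "(\<Sum>n\<in>A. (cmod (coord (Disp b X) n))\<^sup>2) \<le> (norm X * 1)\<^sup>2" .
  qed simp
qed

definition unwt :: "real \<Rightarrow> ell2 \<Rightarrow> int \<Rightarrow> complex" where "unwt s X n = coord X n / wt s n"

lemma unwt_emb: "f \<in> sobolev s \<Longrightarrow> unwt s (emb s f) = fourier_coeff f"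
  by (simp add: fun_eq_iff unwt_def coord_emb)

lemma conv_summable:
  fixes u v :: "int \<Rightarrow> complex"
  assumes "(\<lambda>n. (cmod (u n))\<^sup>2) summable_on UNIV" "(\<lambda>n. (cmod (v n))\<^sup>2) summable_on UNIV"
  shows "(\<lambda>k. cmod (u k * v (n - k))) summable_on UNIV"
    "(\<Sum>\<^sub>\<infinity>k. cmod (u k * v (n - k))) \<le> sqrt (\<Sum>\<^sub>\<infinity>n. (cmod (u n))\<^sup>2) * sqrt (\<Sum>\<^sub>\<infinity>n. (cmod (v n))\<^sup>2)"
proof -
  have bij: "bij_betw (\<lambda>k. n - k) UNIV UNIV" for n :: int
    by (rule bij_betw_byWitness[where f' = "\<lambda>k. n - k"]) auto
  have v: "(\<lambda>k. (cmod (v (n - k)))\<^sup>2) summable_on UNIV" "(\<Sum>\<^sub>\<infinity>k. (cmod (v (n - k)))\<^sup>2) = (\<Sum>\<^sub>\<infinity>n. (cmod (v n))\<^sup>2)"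
    using summable_on_reindex_bij_betw[OF bij[of n], of "\<lambda>k. (cmod (v k))\<^sup>2"]
      infsum_reindex_bij_betw[OF bij[of n], of "\<lambda>k. (cmod (v k))\<^sup>2"] assms(2) by simp_all
  show s: "(\<lambda>k. cmod (u k * v (n - k))) summable_on UNIV"
    by (rule summable_mult_of_square[OF assms(1) v(1)]) (simp add: norm_mult)
  show "(\<Sum>\<^sub>\<infinity>k. cmod (u k * v (n - k))) \<le> sqrt (\<Sum>\<^sub>\<infinity>n. (cmod (u n))\<^sup>2) * sqrt (\<Sum>\<^sub>\<infinity>n. (cmod (v n))\<^sup>2)"
  proof (rule infsum_le_finite_sums[OF s])
    fix F :: "int set" assume F: "finite F"
    have "(\<Sum>k\<in>F. cmod (u k * v (n - k))) = (\<Sum>k\<in>F. \<bar>cmod (u k)\<bar> * \<bar>cmod (v (n - k))\<bar>)" by (simp add: norm_mult)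
    also have "\<dots> \<le> L2_set (\<lambda>k. cmod (u k)) F * L2_set (\<lambda>k. cmod (v (n - k))) F"
      by (rule L2_set_mult_ineq)
    also have "\<dots> \<le> sqrt (\<Sum>\<^sub>\<infinity>n. (cmod (u n))\<^sup>2) * sqrt (\<Sum>\<^sub>\<infinity>n. (cmod (v n))\<^sup>2)"
      unfolding L2_set_def
      using finite_sum_le_infsum[OF assms(1) F] finite_sum_le_infsum[OF v(1) F] v(2)
      by (intro mult_mono real_sqrt_le_mono) (auto intro!: sum_nonneg infsum_nonneg)
    finally show "(\<Sum>k\<in>F. cmod (u k * v (n - k))) \<le> sqrt (\<Sum>\<^sub>\<infinity>n. (cmod (u n))\<^sup>2) * sqrt (\<Sum>\<^sub>\<infinity>n. (cmod (v n))\<^sup>2)" .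
  qed
qed

lemma unwt_summable: "0 \<le> s \<Longrightarrow> (\<lambda>n. (cmod (unwt s X n))\<^sup>2) summable_on UNIV"
proof (rule summable_on_comparison_test[OF summable_coord[of X]])
  fix n assume "0 \<le> s"
  hence "cmod (unwt s X n) \<le> cmod (coord X n)"
    using wt_ge_1[of s n] by (simp add: unwt_def norm_divide divide_le_eq mult_le_cancel_left1)
  thus "(cmod (unwt s X n))\<^sup>2 \<le> (cmod (coord X n))\<^sup>2" by (intro power_mono) auto
qed auto

text \<open>Peetre's inequality distributes the weight over both factors; the Cauchy--Schwarz inequality does the rest.\<close>

lemma conv_unwt_bound:
  assumes s: "0 \<le> s"
  shows "wt s n * cmod (conv (unwt s X) (unwt s Y) n) \<le> 2 powr (s/2) * norm X * norm Y"
proof -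
  have "cmod (conv (unwt s X) (unwt s Y) n) \<le> (\<Sum>\<^sub>\<infinity>k. cmod (unwt s X k * unwt s Y (n - k)))"
    unfolding conv_def by (rule norm_infsum_bound[OF conv_summable(1)[OF unwt_summable unwt_summable]]) (use s in auto)
  hence "wt s n * cmod (conv (unwt s X) (unwt s Y) n) \<le> wt s n * (\<Sum>\<^sub>\<infinity>k. cmod (unwt s X k * unwt s Y (n - k)))"
    by (intro mult_left_mono) auto
  also have "\<dots> = (\<Sum>\<^sub>\<infinity>k. wt s n * cmod (unwt s X k * unwt s Y (n - k)))"
    by (simp add: infsum_cmult_right')
  also have "\<dots> \<le> (\<Sum>\<^sub>\<infinity>k. 2 powr (s/2) * cmod (coord X k * coord Y (n - k)))"
  proof (rule infsum_mono)
    show "(\<lambda>k. wt s n * cmod (unwt s X k * unwt s Y (n - k))) summable_on UNIV"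
      by (intro summable_on_cmult_right conv_summable unwt_summable s)
    show "(\<lambda>k. 2 powr (s/2) * cmod (coord X k * coord Y (n - k))) summable_on UNIV"
      by (intro summable_on_cmult_right conv_summable summable_coord)
    fix k
    have "wt s n * cmod (unwt s X k * unwt s Y (n - k))
        = (wt s n / (wt s k * wt s (n - k))) * cmod (coord X k * coord Y (n - k))"
      by (simp add: unwt_def norm_mult norm_divide)
    also have "\<dots> \<le> 2 powr (s/2) * cmod (coord X k * coord Y (n - k))"
      using peetre[of s n k] s by (intro mult_right_mono) (auto simp: divide_le_eq mult.assoc)
    finally show "wt s n * cmod (unwt s X k * unwt s Y (n - k)) \<le> 2 powr (s/2) * cmod (coord X k * coord Y (n - k))" .
  qed
  also have "\<dots> = 2 powr (s/2) * (\<Sum>\<^sub>\<infinity>k. cmod (coord X k * coord Y (n - k)))"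
    by (simp add: infsum_cmult_right')
  also have "\<dots> \<le> 2 powr (s/2) * (norm X * norm Y)"
    unfolding norm_ell2_eq by (intro mult_left_mono conv_summable summable_coord) auto
  finally show ?thesis by (simp add: mult.assoc)
qed

text \<open>The multiplier \<open>b\<close> applied to half the product of the functions with coordinates \<open>X\<close> and \<open>Y\<close>.\<close>

definition Nonlin :: "(int \<Rightarrow> complex) \<Rightarrow> real \<Rightarrow> ell2 \<Rightarrow> ell2 \<Rightarrow> ell2" where
  "Nonlin b s X Y = Abs_ell2 (\<lambda>n. b n * (wt s n * conv (unwt s X) (unwt s Y) n / 2))"

lemma Nonlin_bound:
  assumes "0 \<le> s"
  shows "(cmod (b n * (wt s n * conv (unwt s X) (unwt s Y) n / 2)))\<^sup>2
    \<le> (cmod (b n))\<^sup>2 * (2 powr (s/2) * norm X * norm Y)\<^sup>2"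
proof -
  have "cmod (b n * (wt s n * conv (unwt s X) (unwt s Y) n / 2))
      = cmod (b n) * (wt s n * cmod (conv (unwt s X) (unwt s Y) n) / 2)"
    by (simp add: norm_mult norm_divide)
  also have "\<dots> \<le> cmod (b n) * (2 powr (s/2) * norm X * norm Y)"
  proof (rule mult_left_mono)
    have "0 \<le> wt s n * cmod (conv (unwt s X) (unwt s Y) n)" by simp
    thus "wt s n * cmod (conv (unwt s X) (unwt s Y) n) / 2 \<le> 2 powr (s/2) * norm X * norm Y"
      using conv_unwt_bound[OF assms, of n X Y] by linarith
  qed simp
  finally show ?thesis by (subst power_mult_distrib[symmetric]) (rule power_mono, auto)
qed

lemma coord_Nonlin:
  assumes b: "square_summable_multiplier b" and s: "0 \<le> s"
  shows "coord (Nonlin b s X Y) n = b n * (wt s n * conv (unwt s X) (unwt s Y) n / 2)"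
proof -
  have sb: "(\<lambda>n. (cmod (b n))\<^sup>2) summable_on UNIV" using b by (simp add: square_summable_multiplier_def)
  have "(\<lambda>n. (cmod (b n * (wt s n * conv (unwt s X) (unwt s Y) n / 2)))\<^sup>2) summable_on UNIV"
    by (rule summable_on_comparison_test[OF summable_on_cmult_left[OF sb] Nonlin_bound[OF s, where b = b]]) auto
  thus ?thesis by (simp add: Nonlin_def coord_Abs_ell2)
qed

lemma conv_unwt_add:
  assumes s: "0 \<le> s"
  shows "conv (unwt s (X + X')) (unwt s Y) n = conv (unwt s X) (unwt s Y) n + conv (unwt s X') (unwt s Y) n"
    "conv (unwt s X) (unwt s (Y + Y')) n = conv (unwt s X) (unwt s Y) n + conv (unwt s X) (unwt s Y') n"
    "conv (unwt s (r *\<^sub>R X)) (unwt s Y) n = of_real r * conv (unwt s X) (unwt s Y) n"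
    "conv (unwt s X) (unwt s (r *\<^sub>R Y)) n = of_real r * conv (unwt s X) (unwt s Y) n"
proof -
  have sm: "(\<lambda>k. unwt s X k * unwt s Y (n - k)) summable_on UNIV" for X Y
    by (rule abs_summable_summable, rule conv_summable(1)) (rule unwt_summable, rule s)+
  have l: "unwt s (X + Y) k = unwt s X k + unwt s Y k" "unwt s (r *\<^sub>R X) k = of_real r * unwt s X k" for X Y k r
    by (simp_all add: unwt_def add_divide_distrib scaleR_conv_of_real)
  show "conv (unwt s (X + X')) (unwt s Y) n = conv (unwt s X) (unwt s Y) n + conv (unwt s X') (unwt s Y) n"
    "conv (unwt s X) (unwt s (Y + Y')) n = conv (unwt s X) (unwt s Y) n + conv (unwt s X) (unwt s Y') n"
    by (simp_all add: conv_def l distrib_left distrib_right infsum_add sm)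
  show "conv (unwt s (r *\<^sub>R X)) (unwt s Y) n = of_real r * conv (unwt s X) (unwt s Y) n"
    "conv (unwt s X) (unwt s (r *\<^sub>R Y)) n = of_real r * conv (unwt s X) (unwt s Y) n"
    by (simp_all add: conv_def l mult.assoc mult.left_commute[of _ "of_real r"] infsum_cmult_right')
qed

lemma bounded_bilinear_Nonlin:
  assumes b: "square_summable_multiplier b" and s: "0 \<le> s"
  shows "bounded_bilinear (Nonlin b s)"
proof
  have sb: "(\<lambda>n. (cmod (b n))\<^sup>2) summable_on UNIV" using b by (simp add: square_summable_multiplier_def)
  note c = coord_Nonlin[OF b s] conv_unwt_add[OF s]
  fix X X' Y Y' :: ell2 and r :: real
  show "Nonlin b s (X + X') Y = Nonlin b s X Y + Nonlin b s X' Y"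
    "Nonlin b s X (Y + Y') = Nonlin b s X Y + Nonlin b s X Y'"
    "Nonlin b s (r *\<^sub>R X) Y = r *\<^sub>R Nonlin b s X Y" "Nonlin b s X (r *\<^sub>R Y) = r *\<^sub>R Nonlin b s X Y"
    by (rule ell2_eqI; simp add: c distrib_left add_divide_distrib scaleR_conv_of_real)+
  define B where "B = (\<Sum>\<^sub>\<infinity>n. (cmod (b n))\<^sup>2)"
  have B: "0 \<le> B" unfolding B_def by (rule infsum_nonneg) simp
  have "norm (Nonlin b s X Y) \<le> norm X * norm Y * (sqrt B * 2 powr (s/2))" for X Y
  proof (rule norm_ell2_le)
    fix A :: "int set" assume A: "finite A"
    have "(\<Sum>n\<in>A. (cmod (coord (Nonlin b s X Y) n))\<^sup>2) \<le> (\<Sum>n\<in>A. (cmod (b n))\<^sup>2 * (2 powr (s/2) * norm X * norm Y)\<^sup>2)"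
      unfolding coord_Nonlin[OF b s] by (rule sum_mono) (rule Nonlin_bound[OF s])
    also have "\<dots> \<le> B * (2 powr (s/2) * norm X * norm Y)\<^sup>2"
      unfolding sum_distrib_right[symmetric] B_def
      by (intro mult_right_mono finite_sum_le_infsum[OF sb A]) auto
    also have "\<dots> = (norm X * norm Y * (sqrt B * 2 powr (s/2)))\<^sup>2"
      using B by (simp add: power_mult_distrib mult_ac)
    finally show "(\<Sum>n\<in>A. (cmod (coord (Nonlin b s X Y) n))\<^sup>2) \<le> (norm X * norm Y * (sqrt B * 2 powr (s/2)))\<^sup>2" .
  qed (use B in simp)
  thus "\<exists>K. \<forall>X Y. norm (Nonlin b s X Y) \<le> norm X * norm Y * K" by blast
qed

text \<open>The kernel of the operator is the coefficient of \<open>a\<close> at \<open>n - k\<close>, times \<open>n k / (1 + n\<^sup>2)\<close> and \<open>wt s n / wt s k\<close>. The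
last two factors are together at most \<open>wt (s - 1) n / wt (s - 1) k\<close>, which Peetre's inequality charges to the
rapidly decreasing coefficients of \<open>a\<close>.\<close>

lemma damping_operator:
  assumes a: "torus_smooth a"
  shows "\<exists>T. bounded_linear T \<and> (\<forall>X n. coord (T X) n = wt s n / (1 + (of_int n)\<^sup>2) * damp_coeff a (unwt s X) n)"
proof -
  let ?C = "2 powr (\<bar>s - 1\<bar>/2)"
  define \<kappa> where "\<kappa> m n = of_real (wt s n / (1 + (of_int n)\<^sup>2)) * (of_int n * of_int (n - m) * fourier_coeff a m) / of_real (wt s (n - m))" for m n :: int
  define A where "A m = ?C * (cmod (fourier_coeff a m) * wt \<bar>s - 1\<bar> m)" for m
  have A: "A summable_on UNIV"
    unfolding A_def by (intro summable_on_cmult_right fourier_coeff_summable_weighted a)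
  have w1: "wt s n / (1 + (of_int n)\<^sup>2) * \<bar>of_int n\<bar> \<le> wt (s - 1) n" for n
  proof -
    have "wt s n * \<bar>of_int n\<bar> \<le> wt s n * wt 1 n" by (intro mult_left_mono abs_le_wt_1) simp
    also have "\<dots> = wt ((s - 1) + 2) n" by (simp add: add.commute flip: wt_add)
    also have "\<dots> = wt (s - 1) n * (1 + (of_int n)\<^sup>2)" unfolding wt_add[of "s - 1" 2 n] by (simp add: wt_2)
    finally show ?thesis using one_plus_sq_pos[of n] by (simp add: divide_le_eq)
  qed
  have w2: "\<bar>of_int k\<bar> / wt s k \<le> 1 / wt (s - 1) k" for k
  proof -
    have "\<bar>of_int k\<bar> * wt (s - 1) k \<le> wt 1 k * wt (s - 1) k" by (intro mult_right_mono abs_le_wt_1) simp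
    also have "\<dots> = wt s k" by (simp flip: wt_add)
    finally show ?thesis by (simp add: field_simps)
  qed
  have \<kappa>: "cmod (\<kappa> m n) \<le> A m" for m n
  proof -
    have "cmod (\<kappa> m n) = (wt s n / (1 + (of_int n)\<^sup>2) * \<bar>of_int n\<bar>) * (\<bar>of_int (n - m)\<bar> / wt s (n - m)) * cmod (fourier_coeff a m)"
      unfolding \<kappa>_def norm_divide norm_mult norm_of_real norm_of_int by simp
    also have "\<dots> \<le> wt (s - 1) n * (1 / wt (s - 1) (n - m)) * cmod (fourier_coeff a m)"
      by (intro mult_right_mono mult_mono w1 w2) auto
    also have "\<dots> \<le> (?C * wt \<bar>s - 1\<bar> m) * cmod (fourier_coeff a m)"
      using peetre[of "s - 1" n "n - m"] by (intro mult_right_mono) (auto simp: field_simps)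
    finally show ?thesis by (simp add: A_def mult_ac)
  qed
  obtain T where T: "bounded_linear T" "\<And>X n. ((\<lambda>m. \<kappa> m n * coord X (n - m)) has_sum coord (T X) n) UNIV"
    using shift_sum_operator[of A \<kappa>, OF A \<kappa>] by metis
  have "coord (T X) n = wt s n / (1 + (of_int n)\<^sup>2) * damp_coeff a (unwt s X) n" for X n
  proof -
    let ?r = "of_real (wt s n / (1 + (of_int n)\<^sup>2)) :: complex"
    have bij: "bij_betw (\<lambda>k. n - k) UNIV UNIV"
      by (rule bij_betw_byWitness[where f' = "\<lambda>k. n - k"]) auto
    have "((\<lambda>k. \<kappa> (n - k) n * coord X (n - (n - k))) has_sum coord (T X) n) UNIV"
      using has_sum_reindex_bij_betw[OF bij, of "\<lambda>m. \<kappa> m n * coord X (n - m)" "coord (T X) n"] T(2) by simp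
    moreover have "\<kappa> (n - k) n * coord X (n - (n - k)) = ?r * (of_int n * of_int k * fourier_coeff a (n - k) * unwt s X k)" for k
      by (simp add: \<kappa>_def unwt_def)
    ultimately have h: "((\<lambda>k. ?r * (of_int n * of_int k * fourier_coeff a (n - k) * unwt s X k)) has_sum coord (T X) n) UNIV" by simp
    have r: "?r \<noteq> 0" using one_plus_sq_pos[of n] by (simp only: of_real_eq_0_iff) simp
    have "((\<lambda>k. inverse ?r * (?r * (of_int n * of_int k * fourier_coeff a (n - k) * unwt s X k))) has_sum inverse ?r * coord (T X) n) UNIV"
      by (rule has_sum_cmult_right[OF h])
    hence h': "((\<lambda>k. of_int n * of_int k * fourier_coeff a (n - k) * unwt s X k) has_sum inverse ?r * coord (T X) n) UNIV"
      unfolding mult.assoc[symmetric] left_inverse[OF r] by (simp add: mult.assoc)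
    hence "damp_coeff a (unwt s X) n = inverse ?r * coord (T X) n" by (simp add: damp_coeff_def has_sum_iff)
    hence "?r * damp_coeff a (unwt s X) n = coord (T X) n" using r by (simp only: mult.assoc[symmetric] right_inverse) simp
    thus ?thesis by simp
  qed
  thus ?thesis using T(1) by blast
qed

definition Damp :: "(real \<Rightarrow> real) \<Rightarrow> real \<Rightarrow> ell2 \<Rightarrow> ell2" where
  "Damp a s X = Abs_ell2 (\<lambda>n. wt s n / (1 + (of_int n)\<^sup>2) * damp_coeff a (unwt s X) n)"

lemma Damp:
  assumes a: "torus_smooth a"
  shows coord_Damp: "coord (Damp a s X) n = wt s n / (1 + (of_int n)\<^sup>2) * damp_coeff a (unwt s X) n"
    and bounded_linear_Damp: "bounded_linear (Damp a s)"
proof -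
  obtain T where T: "bounded_linear T" "\<And>X n. coord (T X) n = wt s n / (1 + (of_int n)\<^sup>2) * damp_coeff a (unwt s X) n"
    using damping_operator[OF a, of s] by blast
  have "Damp a s X = T X" for X
    unfolding Damp_def T(2)[symmetric] by (rule coord_inverse)
  hence "Damp a s = T" by blast
  thus "coord (Damp a s X) n = wt s n / (1 + (of_int n)\<^sup>2) * damp_coeff a (unwt s X) n"
    "bounded_linear (Damp a s)"
    using T by auto
qed

definition rhs :: "(real \<Rightarrow> real) \<Rightarrow> real \<Rightarrow> ell2 \<Rightarrow> ell2" where
  "rhs a s X = Damp a s X + Disp beta X + Nonlin beta s X X"

lemma coord_rhs:
  assumes "torus_smooth a" "0 \<le> s"
  shows "coord (rhs a s X) n = wt s n * flux_coeff a (unwt s X) n / (1 + (of_int n)\<^sup>2)"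
proof -
  have "coord X n = wt s n * unwt s X n" by (simp add: unwt_def)
  hence "coord (rhs a s X) n = wt s n / (1 + (of_int n)\<^sup>2) * damp_coeff a (unwt s X) n
     + beta n * (wt s n * unwt s X n) + beta n * (wt s n * conv (unwt s X) (unwt s X) n / 2)"
    by (simp add: rhs_def coord_Damp assms coord_Disp[OF beta_multiplier] coord_Nonlin[OF beta_multiplier])
  also have "\<dots> = wt s n * flux_coeff a (unwt s X) n / (1 + (of_int n)\<^sup>2)"
    by (simp add: flux_coeff_def beta_def add_divide_distrib distrib_left mult_ac)
  finally show ?thesis .
qed

lemma rhs_lipschitz:
  assumes a: "torus_smooth a" and s: "0 \<le> s"
  shows "\<exists>K\<ge>0. \<forall>X Y. norm X \<le> r \<longrightarrow> norm Y \<le> r \<longrightarrow> norm (rhs a s X - rhs a s Y) \<le> K * norm (X - Y)"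
proof -
  interpret D: bounded_linear "Damp a s" by (rule bounded_linear_Damp[OF a])
  interpret L: bounded_linear "Disp beta" by (rule bounded_linear_Disp[OF beta_multiplier])
  interpret N: bounded_bilinear "Nonlin beta s" by (rule bounded_bilinear_Nonlin[OF beta_multiplier s])
  obtain KD where KD: "KD \<ge> 0" "\<And>X. norm (Damp a s X) \<le> norm X * KD" using D.nonneg_bounded by blast
  obtain KL where KL: "KL \<ge> 0" "\<And>X. norm (Disp beta X) \<le> norm X * KL" using L.nonneg_bounded by blast
  obtain KN where KN: "KN \<ge> 0" "\<And>X Y. norm (Nonlin beta s X Y) \<le> norm X * norm Y * KN" using N.nonneg_bounded by blast
  show ?thesis
  proof (intro exI[of _ "KD + KL + 2 * \<bar>r\<bar> * KN"] conjI allI impI)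
    show "0 \<le> KD + KL + 2 * \<bar>r\<bar> * KN" using KD KL KN by simp
    fix X Y :: ell2 assume r: "norm X \<le> r" "norm Y \<le> r"
    have "rhs a s X - rhs a s Y = Damp a s (X - Y) + Disp beta (X - Y) + (Nonlin beta s (X - Y) X + Nonlin beta s Y (X - Y))"
      by (simp add: rhs_def D.diff L.diff N.diff_left N.diff_right)
    also have "norm \<dots> \<le> norm (Damp a s (X - Y)) + norm (Disp beta (X - Y)) + (norm (Nonlin beta s (X - Y) X) + norm (Nonlin beta s Y (X - Y)))"
      by (intro norm_triangle_le add_mono order_refl norm_triangle_ineq)
    also have "\<dots> \<le> norm (X - Y) * KD + norm (X - Y) * KL + (norm (X - Y) * norm X * KN + norm Y * norm (X - Y) * KN)"
      by (intro add_mono KD KL KN)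
    also have "\<dots> \<le> norm (X - Y) * KD + norm (X - Y) * KL + (norm (X - Y) * \<bar>r\<bar> * KN + \<bar>r\<bar> * norm (X - Y) * KN)"
      using r KN by (intro add_mono mult_right_mono mult_left_mono) auto
    also have "\<dots> = (KD + KL + 2 * \<bar>r\<bar> * KN) * norm (X - Y)" by (simp add: algebra_simps)
    finally show "norm (rhs a s X - rhs a s Y) \<le> (KD + KL + 2 * \<bar>r\<bar> * KN) * norm (X - Y)" .
  qed
qed

text \<open>The equation preserves real functions, as \<open>a\<close> is real-valued.\<close>

lemma hermitian_rhs:
  assumes a: "torus_smooth a" and s: "0 \<le> s" and X: "hermitian X"
  shows "hermitian (rhs a s X)"
proof (rule hermitianI)
  fix n
  have u: "unwt s X (- k) = cnj (unwt s X k)" for k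
    using hermitianD[OF X, of k] by (simp add: unwt_def)
  have c: "conv (unwt s X) (unwt s X) (- n) = cnj (conv (unwt s X) (unwt s X) n)"
  proof -
    have "conv (unwt s X) (unwt s X) (- n) = (\<Sum>\<^sub>\<infinity>k. unwt s X (- k) * unwt s X (- n - (- k)))"
      unfolding conv_def using infsum_reindex_bij_betw[OF bij_uminus, of "\<lambda>k. unwt s X k * unwt s X (- n - k)"] by simp
    also have "\<dots> = (\<Sum>\<^sub>\<infinity>k. cnj (unwt s X k * unwt s X (n - k)))"
      using u[of "n - _"] by (simp add: u)
    finally show ?thesis by (simp only: infsum_cnj conv_def)
  qed
  have d: "damp_coeff a (unwt s X) (- n) = cnj (damp_coeff a (unwt s X) n)"
  proof -
    have "damp_coeff a (unwt s X) (- n) = (\<Sum>\<^sub>\<infinity>k. of_int (- n) * of_int (- k) * fourier_coeff a (- n - (- k)) * unwt s X (- k))"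
      unfolding damp_coeff_def
      using infsum_reindex_bij_betw[OF bij_uminus, of "\<lambda>k. of_int (- n) * of_int k * fourier_coeff a (- n - k) * unwt s X k"] by simp
    also have "\<dots> = (\<Sum>\<^sub>\<infinity>k. cnj (of_int n * of_int k * fourier_coeff a (n - k) * unwt s X k))"
      using fourier_coeff_cnj[OF torus_smooth_L2[OF a], of "n - _"] by (simp add: u)
    finally show ?thesis by (simp only: infsum_cnj damp_coeff_def)
  qed
  show "coord (rhs a s X) (- n) = cnj (coord (rhs a s X) n)"
    by (simp add: coord_rhs[OF a s] flux_coeff_def c d u)
qed

section \<open>Differential equations with locally Lipschitz right-hand side\<close>

text \<open>The sign is that of \<open>bbm_solution\<close>: the equation is \<open>X' = - G X\<close>.\<close>

definition ode_sol :: "('a::real_normed_vector \<Rightarrow> 'a) \<Rightarrow> real set \<Rightarrow> 'a \<Rightarrow> (real \<Rightarrow> 'a) \<Rightarrow> bool" where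
  "ode_sol G J x0 X \<longleftrightarrow> continuous_on J X \<and> (\<forall>t\<in>J. ((\<lambda>\<tau>. G (X \<tau>)) has_integral (x0 - X t)) {0..t})"

lemma has_integral_point: "(f has_integral 0) {a..a::real}"
  by (rule has_integral_null_real) simp

lemma ode_sol_subset: "ode_sol G J x0 X \<Longrightarrow> J' \<subseteq> J \<Longrightarrow> ode_sol G J' x0 X"
  unfolding ode_sol_def by (auto intro: continuous_on_subset)

lemma ode_sol_initial:
  assumes "ode_sol G J x0 X" "0 \<in> J" shows "X 0 = x0"
proof -
  have "((\<lambda>\<tau>. G (X \<tau>)) has_integral (x0 - X 0)) {0..0}" using assms unfolding ode_sol_def by blast
  from has_integral_unique[OF this has_integral_point] show ?thesis by simp
qed

text \<open>The bounded operator \<open>\<sigma>\<close> is a symmetry whose fixed space the field preserves. It is carried along because the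
solutions have to stay in the subspace of sequences that come from real functions.\<close>

locale lipschitz_field =
  fixes G :: "'a::{real_inner, banach} \<Rightarrow> 'a" and \<sigma> :: "'a \<Rightarrow> 'a"
  assumes lip: "\<And>r. \<exists>K\<ge>0. \<forall>x y. norm x \<le> r \<longrightarrow> norm y \<le> r \<longrightarrow> norm (G x - G y) \<le> K * norm (x - y)"
    and \<sigma>: "bounded_linear \<sigma>" and G_\<sigma>: "\<And>x. \<sigma> x = x \<Longrightarrow> \<sigma> (G x) = G x"
begin

lemma continuous_G: "continuous_on S G"
proof (rule continuous_at_imp_continuous_on, rule ballI)
  fix x assume "x \<in> S"
  obtain K where K: "K \<ge> 0" "\<And>y z. norm y \<le> norm x + 1 \<Longrightarrow> norm z \<le> norm x + 1 \<Longrightarrow> norm (G y - G z) \<le> K * norm (y - z)"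
    using lip[of "norm x + 1"] by blast
  have "(\<lambda>y. G y - G x) \<midarrow>x\<rightarrow> 0"
  proof (rule Lim_null_comparison)
    have "\<forall>\<^sub>F y in at x. norm (y - x) < 1"
      using eventually_at_ball[of 1 x UNIV] by (auto simp: dist_norm norm_minus_commute elim: eventually_mono)
    thus "\<forall>\<^sub>F y in at x. norm (G y - G x) \<le> K * norm (y - x)"
    proof eventually_elim
      case (elim y)
      have "norm y \<le> norm x + 1" using norm_triangle_ineq2[of y x] elim by linarith
      thus ?case by (intro K) auto
    qed
    have "((\<lambda>y. K * norm (y - x)) \<longlongrightarrow> K * norm (x - x)) (at x)" by (intro tendsto_intros)
    thus "((\<lambda>y. K * norm (y - x)) \<longlongrightarrow> 0) (at x)" by simp
  qed
  thus "isCont G x" unfolding isCont_def by (simp add: LIM_zero_cancel)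
qed

lemma continuous_G_comp: "continuous_on S X \<Longrightarrow> continuous_on S (\<lambda>t. G (X t))"
  by (rule continuous_on_compose2[OF continuous_G[of UNIV]]) auto

lemma sol_derivative:
  assumes X: "ode_sol G {0..T} x0 X" and t: "t \<in> {0..T}"
  shows "(X has_vector_derivative - G (X t)) (at t within {0..T})"
proof -
  have c: "continuous_on {0..T} (\<lambda>t. G (X t))" using X by (intro continuous_G_comp) (simp add: ode_sol_def)
  have "((\<lambda>t. x0 - integral {0..t} (\<lambda>\<tau>. G (X \<tau>))) has_vector_derivative 0 - G (X t)) (at t within {0..T})"
    by (intro has_vector_derivative_diff has_vector_derivative_const integral_has_vector_derivative c t)
  moreover have "x0 - integral {0..s} (\<lambda>\<tau>. G (X \<tau>)) = X s" if "s \<in> {0..T}" for s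
  proof -
    have "integral {0..s} (\<lambda>\<tau>. G (X \<tau>)) = x0 - X s"
      by (rule integral_unique) (use X that in \<open>auto simp: ode_sol_def\<close>)
    thus ?thesis by simp
  qed
  ultimately show ?thesis
    using has_vector_derivative_transform[OF t, of X "\<lambda>t. x0 - integral {0..t} (\<lambda>\<tau>. G (X \<tau>))"] by simp
qed

text \<open>Gronwall's inequality for the squared distance of two solutions.\<close>

lemma sol_stability:
  assumes X: "ode_sol G {0..T} x0 X" and Y: "ode_sol G {0..T} y0 Y"
    and K: "K \<ge> 0" "\<And>x y. norm x \<le> r \<Longrightarrow> norm y \<le> r \<Longrightarrow> norm (G x - G y) \<le> K * norm (x - y)"
    and r: "\<And>t. t \<in> {0..T} \<Longrightarrow> norm (X t) \<le> r" "\<And>t. t \<in> {0..T} \<Longrightarrow> norm (Y t) \<le> r"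
    and t: "t \<in> {0..T}"
  shows "norm (X t - Y t) \<le> exp (K * t) * norm (x0 - y0)"
proof -
  have 0: "0 \<in> {0..T}" using t by auto
  define f where "f s = (X s - Y s) \<bullet> (X s - Y s)" for s
  have d: "(f has_real_derivative 2 * ((X s - Y s) \<bullet> (- G (X s) + G (Y s)))) (at s within {0..T})" if s: "s \<in> {0..T}" for s
  proof -
    have "((\<lambda>s. X s - Y s) has_vector_derivative (- G (X s) - - G (Y s))) (at s within {0..T})"
      by (intro has_vector_derivative_diff sol_derivative[OF X] sol_derivative[OF Y] s)
    from bounded_bilinear.has_vector_derivative[OF bounded_bilinear_inner this this]
    show ?thesis unfolding f_def has_real_derivative_iff_has_vector_derivative
      by (simp add: inner_commute)
  qed
  define g where "g s = exp (- 2 * K * s) * f s" for s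
  have "g t \<le> g 0"
  proof (rule DERIV_nonpos_imp_decreasing_open[of 0 t g])
    show "0 \<le> t" using t by simp
    have "(g has_real_derivative exp (- 2 * K * s) * (2 * ((X s - Y s) \<bullet> (- G (X s) + G (Y s))) - 2 * K * f s)) (at s within {0..T})"
      if "s \<in> {0..T}" for s
      unfolding g_def[abs_def] by (rule derivative_eq_intros d that refl | simp add: algebra_simps)+
    note dg = this
    show "continuous_on {0..t} g"
    proof (rule continuous_on_subset)
      show "continuous_on {0..T} g" by (rule DERIV_continuous_on) (rule dg)
      show "{0..t} \<subseteq> {0..T}" using t by auto
    qed
    fix s assume s: "0 < s" "s < t"
    hence sT: "s \<in> {0..T}" "s \<in> interior {0..T}" using t by auto
    have "(X s - Y s) \<bullet> (- G (X s) + G (Y s)) \<le> norm (X s - Y s) * norm (- G (X s) + G (Y s))"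
      by (rule norm_cauchy_schwarz)
    also have "norm (- G (X s) + G (Y s)) = norm (G (X s) - G (Y s))" by (metis norm_minus_commute uminus_add_conv_diff)
    also have "norm (X s - Y s) * norm (G (X s) - G (Y s)) \<le> norm (X s - Y s) * (K * norm (X s - Y s))"
      by (intro mult_left_mono K r sT) auto
    also have "\<dots> = K * f s" by (simp add: f_def power2_norm_eq_inner[symmetric] power2_eq_square)
    finally have "2 * ((X s - Y s) \<bullet> (- G (X s) + G (Y s))) - 2 * K * f s \<le> 0" by simp
    hence "exp (- 2 * K * s) * (2 * ((X s - Y s) \<bullet> (- G (X s) + G (Y s))) - 2 * K * f s) \<le> 0"
      by (simp add: mult_nonneg_nonpos)
    moreover have "(g has_real_derivative exp (- 2 * K * s) * (2 * ((X s - Y s) \<bullet> (- G (X s) + G (Y s))) - 2 * K * f s)) (at s)"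
      using dg[OF sT(1)] by (simp only: at_within_interior[OF sT(2)])
    ultimately show "\<exists>y. DERIV g s :> y \<and> y \<le> 0" by blast
  qed
  hence "exp (- 2 * K * t) * (norm (X t - Y t))\<^sup>2 \<le> (norm (x0 - y0))\<^sup>2"
    by (simp add: g_def f_def ode_sol_initial[OF X 0] ode_sol_initial[OF Y 0] power2_norm_eq_inner)
  hence "exp (2 * K * t) * (exp (- 2 * K * t) * (norm (X t - Y t))\<^sup>2) \<le> exp (2 * K * t) * (norm (x0 - y0))\<^sup>2"
    by (rule mult_left_mono) simp
  also have "exp (2 * K * t) * (exp (- 2 * K * t) * (norm (X t - Y t))\<^sup>2) = (norm (X t - Y t))\<^sup>2"
    by (simp add: mult.assoc[symmetric] exp_add[symmetric])
  also have "exp (2 * K * t) * (norm (x0 - y0))\<^sup>2 = (exp (K * t) * norm (x0 - y0))\<^sup>2"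
    by (simp add: power_mult_distrib power2_eq_square exp_add[symmetric])
  finally show ?thesis by (rule power2_le_imp_le) simp
qed

lemma sol_unique:
  assumes X: "ode_sol G {0..T} x0 X" and Y: "ode_sol G {0..T} x0 Y" and t: "t \<in> {0..T}"
  shows "X t = Y t"
proof -
  have "compact (X ` {0..T})" "compact (Y ` {0..T})"
    using X Y by (auto simp: ode_sol_def intro!: compact_continuous_image)
  then obtain b c where b: "\<And>t. t \<in> {0..T} \<Longrightarrow> norm (X t) \<le> b" and c: "\<And>t. t \<in> {0..T} \<Longrightarrow> norm (Y t) \<le> c"
    by (metis compact_imp_bounded bounded_iff imageI)
  obtain K where K: "K \<ge> 0" "\<And>x y. norm x \<le> max b c \<Longrightarrow> norm y \<le> max b c \<Longrightarrow> norm (G x - G y) \<le> K * norm (x - y)"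
    using lip[of "max b c"] by blast
  have "norm (X t - Y t) \<le> exp (K * t) * norm (x0 - x0)"
    by (rule sol_stability[OF X Y K _ _ t]) (auto intro: order_trans[OF b] order_trans[OF c])
  thus ?thesis by simp
qed

text \<open>Picard iteration on functions with values in the ball of radius \<open>R + 1\<close> and in the fixed space of \<open>\<sigma>\<close>. The time
of existence depends only on \<open>R\<close>.\<close>

lemma local_existence:
  assumes R: "0 \<le> R"
  obtains T where "T > 0" "\<And>x0. norm x0 \<le> R \<Longrightarrow> \<sigma> x0 = x0 \<Longrightarrow>
    \<exists>X. ode_sol G {0..T} x0 X \<and> (\<forall>t\<in>{0..T}. norm (X t) \<le> R + 1 \<and> \<sigma> (X t) = X t)"
proof -
  define r where "r = R + 1"
  obtain K where K: "K \<ge> 0" "\<And>x y. norm x \<le> r \<Longrightarrow> norm y \<le> r \<Longrightarrow> norm (G x - G y) \<le> K * norm (x - y)"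
    using lip[of r] by blast
  define M where "M = norm (G 0) + K * r"
  have M: "norm (G x) \<le> M" if "norm x \<le> r" for x
  proof -
    have "norm (G x - G 0) \<le> K * norm (x - 0)" using that R by (intro K) (auto simp: r_def)
    also have "\<dots> \<le> K * r" using that K by (intro mult_left_mono) auto
    finally show ?thesis unfolding M_def using norm_triangle_ineq2[of "G x" "G 0"] by linarith
  qed
  have M0: "0 \<le> M" using K R by (simp add: M_def r_def)
  define T where "T = min (1 / (M + 1)) (1 / (2 * (K + 1)))"
  have T: "0 < T" "T * M \<le> 1" "T * K \<le> 1/2"
  proof -
    show "0 < T" using M0 K by (simp add: T_def)
    have "T * M \<le> (1 / (M + 1)) * (M + 1)" using M0 by (intro mult_mono) (auto simp: T_def)
    thus "T * M \<le> 1" using M0 by simp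
    have "T * K \<le> (1 / (2 * (K + 1))) * (K + 1)" using K by (intro mult_mono) (auto simp: T_def)
    also have "\<dots> = 1/2" using K by (simp add: field_simps)
    finally show "T * K \<le> 1/2" .
  qed
  have "\<exists>X. ode_sol G {0..T} x0 X \<and> (\<forall>t\<in>{0..T}. norm (X t) \<le> R + 1 \<and> \<sigma> (X t) = X t)"
    if x0: "norm x0 \<le> R" "\<sigma> x0 = x0" for x0
  proof -
    interpret \<sigma>: bounded_linear \<sigma> by (rule \<sigma>)
    \<comment> \<open>Clamping time to \<open>[0, T]\<close> lets the iteration act on bounded continuous functions
      on the whole line, which form a Banach space.\<close>
    define c where "c t = max 0 (min T t)" for t
    have c: "c t \<in> {0..T}" for t using T by (auto simp: c_def)
    define S where "S = {u :: real \<Rightarrow>\<^sub>C 'a. \<forall>t. norm (u t) \<le> r \<and> \<sigma> (u t) = u t}"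
    define P where "P u t = x0 - integral {0..c t} (\<lambda>\<tau>. G (apply_bcontfun u \<tau>))" for u t
    have Gc: "continuous_on A (\<lambda>\<tau>. G (apply_bcontfun u \<tau>))" for u A
      by (intro continuous_G_comp) auto
    have int: "(\<lambda>\<tau>. G (apply_bcontfun u \<tau>)) integrable_on {0..c t}" for u t
      by (intro integrable_continuous_real Gc)
    have Pn: "norm (P u t) \<le> r" if "u \<in> S" for u t
    proof -
      have "norm (integral {0..c t} (\<lambda>\<tau>. G (apply_bcontfun u \<tau>))) \<le> M * (c t - 0)"
        using c[of t] that by (intro integral_bound Gc M) (auto simp: S_def)
      also have "\<dots> \<le> M * T" using c[of t] M0 by (intro mult_left_mono) auto
      also have "\<dots> \<le> 1" using T by (simp add: mult.commute)
      finally show ?thesis unfolding P_def r_def using norm_triangle_ineq4[of x0] x0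
        by (meson add_mono order_trans)
    qed
    have Pc: "continuous_on UNIV (P u)" for u
    proof -
      have "continuous_on {0..T} (\<lambda>s. integral {0..s} (\<lambda>\<tau>. G (apply_bcontfun u \<tau>)))"
        by (intro indefinite_integral_continuous_1 integrable_continuous_real Gc)
      hence "continuous_on UNIV (\<lambda>t. integral {0..c t} (\<lambda>\<tau>. G (apply_bcontfun u \<tau>)))"
        by (rule continuous_on_compose2) (use c in \<open>auto simp: c_def intro!: continuous_intros\<close>)
      thus ?thesis unfolding P_def[abs_def] by (intro continuous_intros)
    qed
    have PS: "\<sigma> (P u t) = P u t" if "u \<in> S" for u t
    proof -
      have "((\<lambda>\<tau>. G (apply_bcontfun u \<tau>)) has_integral integral {0..c t} (\<lambda>\<tau>. G (apply_bcontfun u \<tau>))) {0..c t}"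
        using int by (rule integrable_integral)
      note I = this
      have "\<sigma> (G (apply_bcontfun u \<tau>)) = G (apply_bcontfun u \<tau>)" for \<tau>
        using that by (intro G_\<sigma>) (simp add: S_def)
      hence "\<sigma> \<circ> (\<lambda>\<tau>. G (apply_bcontfun u \<tau>)) = (\<lambda>\<tau>. G (apply_bcontfun u \<tau>))" by (simp add: fun_eq_iff)
      with has_integral_linear[OF I \<sigma>]
      have "((\<lambda>\<tau>. G (apply_bcontfun u \<tau>)) has_integral \<sigma> (integral {0..c t} (\<lambda>\<tau>. G (apply_bcontfun u \<tau>)))) {0..c t}"
        by (simp only:)
      from has_integral_unique[OF this I]
      have "\<sigma> (integral {0..c t} (\<lambda>\<tau>. G (apply_bcontfun u \<tau>))) = integral {0..c t} (\<lambda>\<tau>. G (apply_bcontfun u \<tau>))" .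
      thus ?thesis by (simp add: P_def \<sigma>.diff x0)
    qed
    define Q where "Q u = Bcontfun (P u)" for u
    have Q: "apply_bcontfun (Q u) = P u" if "u \<in> S" for u
      unfolding Q_def by (rule Bcontfun_inverse, rule bcontfun_normI[OF Pc Pn[OF that]])
    have "\<exists>!u\<in>S. Q u = u"
    proof (rule Banach_fix)
      show "complete S"
      proof -
        have "S = PiC UNIV (\<lambda>_. {x. norm x \<le> r} \<inter> {x. \<sigma> x = x})"
          by (simp add: S_def mem_PiC_iff Pi_iff set_eq_iff)
        moreover have "closed ({x. norm x \<le> r} \<inter> {x. \<sigma> x = x})"
          by (intro closed_Int closed_Collect_le closed_Collect_eq continuous_intros \<sigma>.continuous_on)
        ultimately have "closed S" by (auto intro!: closed_PiC)
        thus ?thesis by (simp add: complete_eq_closed)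
      qed
      show "S \<noteq> {}"
      proof -
        have "const_bcontfun x0 \<in> S" using x0 by (simp add: S_def r_def)
        thus ?thesis by blast
      qed
      show "0 \<le> (1/2::real)" "(1/2::real) < 1" by auto
      show "Q ` S \<subseteq> S"
      proof
        fix v assume "v \<in> Q ` S"
        then obtain u where u: "u \<in> S" "v = Q u" by blast
        show "v \<in> S" unfolding S_def mem_Collect_eq u(2) Q[OF u(1)] using Pn[OF u(1)] PS[OF u(1)] by blast
      qed
      show "dist (Q u) (Q v) \<le> 1/2 * dist u v" if u: "u \<in> S" and v: "v \<in> S" for u v
      proof (rule dist_bound)
        fix t
        have "dist (apply_bcontfun (Q u) t) (apply_bcontfun (Q v) t)
            = norm (integral {0..c t} (\<lambda>\<tau>. G (apply_bcontfun u \<tau>) - G (apply_bcontfun v \<tau>)))"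
          unfolding Q[OF u] Q[OF v] P_def by (simp add: dist_norm integral_diff[OF int int] norm_minus_commute)
        also have "\<dots> \<le> (K * dist u v) * (c t - 0)"
        proof (rule integral_bound)
          fix \<tau>
          have "norm (G (apply_bcontfun u \<tau>) - G (apply_bcontfun v \<tau>)) \<le> K * norm (apply_bcontfun u \<tau> - apply_bcontfun v \<tau>)"
            using u v by (intro K) (auto simp: S_def)
          also have "\<dots> \<le> K * dist u v"
            using dist_bounded[of u \<tau> v] K by (intro mult_left_mono) (auto simp: dist_norm)
          finally show "norm (G (apply_bcontfun u \<tau>) - G (apply_bcontfun v \<tau>)) \<le> K * dist u v" .
        qed (use c[of t] in \<open>auto intro!: continuous_intros Gc\<close>)
        also have "\<dots> \<le> (K * dist u v) * T" using c[of t] K by (intro mult_left_mono) auto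
        also have "\<dots> = (T * K) * dist u v" by (simp add: mult_ac)
        also have "\<dots> \<le> 1/2 * dist u v" using T by (intro mult_right_mono) auto
        finally show "dist (apply_bcontfun (Q u) t) (apply_bcontfun (Q v) t) \<le> 1/2 * dist u v" .
      qed
    qed
    then obtain u where u: "u \<in> S" "Q u = u" by blast
    have uP: "apply_bcontfun u t = P u t" for t using Q[OF u(1)] u(2) by simp
    have "ode_sol G {0..T} x0 (apply_bcontfun u)"
      unfolding ode_sol_def
    proof (intro conjI ballI)
      fix t assume t: "t \<in> {0..T}"
      hence ct: "c t = t" by (auto simp: c_def)
      have "x0 - apply_bcontfun u t = integral {0..t} (\<lambda>\<tau>. G (apply_bcontfun u \<tau>))"
        unfolding uP[of t] P_def ct by simp
      thus "((\<lambda>\<tau>. G (apply_bcontfun u \<tau>)) has_integral x0 - apply_bcontfun u t) {0..t}"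
        using integrable_integral[OF int[of u t]] unfolding ct by simp
    qed simp
    moreover have "\<forall>t\<in>{0..T}. norm (apply_bcontfun u t) \<le> R + 1 \<and> \<sigma> (apply_bcontfun u t) = apply_bcontfun u t"
      using u(1) by (simp add: S_def r_def)
    ultimately show ?thesis by blast
  qed
  thus thesis using that T(1) by blast
qed

lemma sol_append:
  assumes X: "ode_sol G {0..S} x0 X" and Y: "ode_sol G {0..T} (X S) Y" and S: "0 \<le> S" "0 \<le> T"
  shows "ode_sol G {0..S + T} x0 (\<lambda>t. if t \<le> S then X t else Y (t - S))"
  unfolding ode_sol_def
proof (intro conjI ballI)
  let ?Z = "\<lambda>t. if t \<le> S then X t else Y (t - S)"
  have YX: "Y 0 = X S" using ode_sol_initial[OF Y] S by auto
  have Xc: "continuous_on {0..S} X" and Yc: "continuous_on {0..T} Y" using X Y by (auto simp: ode_sol_def)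
  have "continuous_on ({0..S} \<union> {S..S+T}) ?Z"
  proof (rule continuous_on_If)
    show "continuous_on {S..S+T} (\<lambda>t. Y (t - S))"
      by (rule continuous_on_compose2[OF Yc]) (auto intro!: continuous_intros)
  qed (use Xc YX in \<open>auto\<close>)
  moreover have "{0..S} \<union> {S..S+T} = {0..S+T}" using S by auto
  ultimately show "continuous_on {0..S+T} ?Z" by simp
  fix t assume t: "t \<in> {0..S+T}"
  have i1: "((\<lambda>\<tau>. G (?Z \<tau>)) has_integral (x0 - X t)) {0..t}" if "t \<in> {0..S}" for t
  proof -
    have "((\<lambda>\<tau>. G (X \<tau>)) has_integral (x0 - X t)) {0..t}" using X that by (auto simp: ode_sol_def)
    thus ?thesis by (rule has_integral_eq[rotated]) (use that in auto)
  qed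
  show "((\<lambda>\<tau>. G (?Z \<tau>)) has_integral (x0 - ?Z t)) {0..t}"
  proof (cases "t \<le> S")
    case True thus ?thesis using i1[of t] t by simp
  next
    case False
    have "((\<lambda>\<tau>. G (Y \<tau>)) has_integral (X S - Y (t - S))) {0..t - S}"
      using Y t False by (auto simp: ode_sol_def)
    from has_integral_shift_real_ivl[OF this, of "- S"]
    have "((\<lambda>\<tau>. G (Y (\<tau> - S))) has_integral (X S - Y (t - S))) {S..t}" by simp
    hence "((\<lambda>\<tau>. G (?Z \<tau>)) has_integral (X S - Y (t - S))) {S..t}"
      by (rule has_integral_eq[rotated]) (use YX in \<open>auto\<close>)
    from has_integral_combine[OF _ _ i1[of S] this] show ?thesis using False S by simp
  qed
qed

text \<open>An a priori bound keeps the length of the local steps fixed, so finitely many of them reach any time.\<close>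

lemma global_existence:
  assumes x0: "\<sigma> x0 = x0"
    and bound: "\<And>T X t. ode_sol G {0..T} x0 X \<Longrightarrow> (\<forall>t\<in>{0..T}. \<sigma> (X t) = X t) \<Longrightarrow> t \<in> {0..T} \<Longrightarrow> norm (X t) \<le> M"
  shows "\<exists>X. ode_sol G {0..T} x0 X \<and> (\<forall>t\<in>{0..T}. \<sigma> (X t) = X t)"
proof -
  have M0: "0 \<le> \<bar>M\<bar>" by simp
  obtain d where d: "d > 0" "\<And>y. norm y \<le> \<bar>M\<bar> \<Longrightarrow> \<sigma> y = y \<Longrightarrow>
      \<exists>X. ode_sol G {0..d} y X \<and> (\<forall>t\<in>{0..d}. norm (X t) \<le> \<bar>M\<bar> + 1 \<and> \<sigma> (X t) = X t)"
    using local_existence[OF M0] by blast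
  have steps: "\<exists>X. ode_sol G {0..real k * d} x0 X \<and> (\<forall>t\<in>{0..real k * d}. \<sigma> (X t) = X t)" for k
  proof (induction k)
    case 0
    have "ode_sol G {0..0} x0 (\<lambda>_. x0)" unfolding ode_sol_def
      using has_integral_point by auto
    thus ?case using x0 by auto
  next
    case (Suc k)
    then obtain X where X: "ode_sol G {0..real k * d} x0 X" "\<forall>t\<in>{0..real k * d}. \<sigma> (X t) = X t" by blast
    have kd: "real k * d \<in> {0..real k * d}" using d by simp
    have "norm (X (real k * d)) \<le> M" by (rule bound[OF X kd])
    hence "norm (X (real k * d)) \<le> \<bar>M\<bar>" by linarith
    then obtain Y where Y: "ode_sol G {0..d} (X (real k * d)) Y" "\<forall>t\<in>{0..d}. \<sigma> (Y t) = Y t"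
      using d(2)[of "X (real k * d)"] X(2) kd by blast
    have "ode_sol G {0..real k * d + d} x0 (\<lambda>t. if t \<le> real k * d then X t else Y (t - real k * d))"
      by (rule sol_append[OF X(1) Y(1)]) (use d in auto)
    moreover have "real (Suc k) * d = real k * d + d" by (simp add: algebra_simps)
    ultimately show ?case using X(2) Y(2)
      by (intro exI[of _ "\<lambda>t. if t \<le> real k * d then X t else Y (t - real k * d)"]) auto
  qed
  obtain k :: nat where "T / d < real k" using reals_Archimedean2 by blast
  hence "T \<le> real k * d" using d by (simp add: field_simps)
  hence sub: "{0..T} \<subseteq> {0..real k * d}" by auto
  obtain X where "ode_sol G {0..real k * d} x0 X" "\<forall>t\<in>{0..real k * d}. \<sigma> (X t) = X t" using steps[of k] by blast
  thus ?thesis using ode_sol_subset[OF _ sub] sub by blast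
qed

end

section \<open>Well-posedness\<close>

lemma lipschitz_field_rhs:
  "torus_smooth a \<Longrightarrow> 0 \<le> s \<Longrightarrow> lipschitz_field (rhs a s) flip"
  by (rule lipschitz_field.intro)
    (rule rhs_lipschitz bounded_linear_flip hermitian_rhs[unfolded hermitian_def] | assumption)+

text \<open>\<open>emb s\<close> is linear and isometric, so it maps Riemann sums to Riemann sums.\<close>

lemma sobolev_has_integral_iff:
  assumes g: "\<And>\<tau>. \<tau> \<in> {0..t} \<Longrightarrow> g \<tau> \<in> sobolev s" and h: "h \<in> sobolev s"
    and G: "\<And>\<tau>. \<tau> \<in> {0..t} \<Longrightarrow> G \<tau> = emb s (g \<tau>)"
  shows "sobolev_has_integral s g h t \<longleftrightarrow> (G has_integral emb s h) {0..t}"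
proof -
  have "sobolev_norm s (\<lambda>x. (\<Sum>(\<tau>, K)\<in>\<D>. measure lborel K * g \<tau> x) - h x)
      = norm ((\<Sum>(\<tau>, K)\<in>\<D>. measure lborel K *\<^sub>R G \<tau>) - emb s h)"
    if D: "\<D> tagged_division_of {0..t}" for \<D>
  proof -
    have m: "fst p \<in> {0..t}" if "p \<in> \<D>" for p
      using D that tagged_division_ofD(2,3)[OF D, of "fst p" "snd p"] by auto
    have *: "(\<lambda>x. \<Sum>p\<in>\<D>. measure lborel (snd p) * g (fst p) x) \<in> sobolev s \<and>
        emb s (\<lambda>x. \<Sum>p\<in>\<D>. measure lborel (snd p) * g (fst p) x) = (\<Sum>p\<in>\<D>. measure lborel (snd p) *\<^sub>R emb s (g (fst p)))"
      by (rule sobolev_sum) (use D m g in \<open>auto simp: tagged_division_of_finite\<close>)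
    have "sobolev_norm s (\<lambda>x. (\<Sum>p\<in>\<D>. measure lborel (snd p) * g (fst p) x) - h x)
      = norm (emb s (\<lambda>x. (\<Sum>p\<in>\<D>. measure lborel (snd p) * g (fst p) x) - h x))"
      by (rule norm_emb[symmetric], rule sobolev_diff(1)) (use * h in auto)
    also have "\<dots> = norm ((\<Sum>p\<in>\<D>. measure lborel (snd p) *\<^sub>R emb s (g (fst p))) - emb s h)"
      using * h by (simp add: sobolev_diff)
    also have "(\<Sum>p\<in>\<D>. measure lborel (snd p) *\<^sub>R emb s (g (fst p))) = (\<Sum>p\<in>\<D>. measure lborel (snd p) *\<^sub>R G (fst p))"
      by (rule sum.cong) (use m G in auto)
    finally show ?thesis by (simp add: case_prod_beta')
  qed
  thus ?thesis using g h unfolding sobolev_has_integral_def has_integral_real by (auto cong: conj_cong imp_cong)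
qed

lemma inv_helmholtz_iff:
  assumes a: "torus_smooth a" and s: "0 \<le> s" and u: "u \<in> sobolev s" and g: "g \<in> sobolev s"
  shows "inv_helmholtz (bbm_flux a u) g \<longleftrightarrow> emb s g = rhs a s (emb s u)"
proof -
  have "coord (emb s g) n = coord (rhs a s (emb s u)) n \<longleftrightarrow>
      fourier_coeff g n = distr_coeff (bbm_flux a u) n / of_real (1 + (of_int n)\<^sup>2)" for n
    by (simp add: coord_emb[OF g] coord_rhs[OF a s] unwt_emb[OF u] distr_coeff_bbm_flux[OF a sobolev_L2[OF u]]
        flip: times_divide_eq_right)
  thus ?thesis unfolding inv_helmholtz_def by (metis ell2_eqI)
qed

lemma bbm_solution_ode:
  assumes a: "torus_smooth a" and s: "0 \<le> s" and u: "bbm_solution a s J u0 u"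
    and J: "\<And>t. t \<in> J \<Longrightarrow> {0..t} \<subseteq> J"
  shows "ode_sol (rhs a s) J (emb s u0) (\<lambda>t. emb s (u t))" "u0 \<in> sobolev s" "\<And>t. t \<in> J \<Longrightarrow> u t \<in> sobolev s"
proof -
  show u0: "u0 \<in> sobolev s" using u by (simp add: bbm_solution_def)
  show ut: "u t \<in> sobolev s" if "t \<in> J" for t
    using u that by (auto simp: bbm_solution_def sobolev_continuous_on_def)
  obtain g where g: "\<And>\<tau>. \<tau> \<in> J \<Longrightarrow> g \<tau> \<in> sobolev s" "\<And>\<tau>. \<tau> \<in> J \<Longrightarrow> inv_helmholtz (bbm_flux a (u \<tau>)) (g \<tau>)"
    "\<And>t. t \<in> J \<Longrightarrow> sobolev_has_integral s g (\<lambda>x. u0 x - u t x) t"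
    using u by (auto simp: bbm_solution_def)
  show "ode_sol (rhs a s) J (emb s u0) (\<lambda>t. emb s (u t))"
    unfolding ode_sol_def
  proof (intro conjI ballI)
    show "continuous_on J (\<lambda>t. emb s (u t))"
      unfolding continuous_on_def
    proof
      fix t assume t: "t \<in> J"
      have "((\<lambda>\<tau>. sobolev_norm s (\<lambda>x. u \<tau> x - u t x)) \<longlongrightarrow> 0) (at t within J)"
        using u t by (auto simp: bbm_solution_def sobolev_continuous_on_def)
      moreover have "\<forall>\<^sub>F \<tau> in at t within J. sobolev_norm s (\<lambda>x. u \<tau> x - u t x) = norm (emb s (u \<tau>) - emb s (u t))"
        unfolding eventually_at_filter
      proof (rule always_eventually, intro allI impI)
        fix \<tau> assume "\<tau> \<in> J"
        note d = sobolev_diff[OF ut[OF this] ut[OF t]]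
        show "sobolev_norm s (\<lambda>x. u \<tau> x - u t x) = norm (emb s (u \<tau>) - emb s (u t))"
          by (simp only: norm_emb[OF d(1), symmetric] d(2))
      qed
      ultimately have "((\<lambda>\<tau>. norm (emb s (u \<tau>) - emb s (u t))) \<longlongrightarrow> 0) (at t within J)"
        by (rule Lim_transform_eventually)
      thus "((\<lambda>t. emb s (u t)) \<longlongrightarrow> emb s (u t)) (at t within J)"
        by (simp add: tendsto_norm_zero_iff LIM_zero_iff)
    qed
    fix t assume t: "t \<in> J"
    have m: "\<tau> \<in> J" if "\<tau> \<in> {0..t}" for \<tau> using J[OF t] that by blast
    have e: "rhs a s (emb s (u \<tau>)) = emb s (g \<tau>)" if "\<tau> \<in> {0..t}" for \<tau>
      using inv_helmholtz_iff[OF a s ut[OF m[OF that]] g(1)[OF m[OF that]]] g(2)[OF m[OF that]] by simp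
    have h: "(\<lambda>x. u0 x - u t x) \<in> sobolev s" by (rule sobolev_diff(1)[OF u0 ut[OF t]])
    show "((\<lambda>\<tau>. rhs a s (emb s (u \<tau>))) has_integral emb s u0 - emb s (u t)) {0..t}"
      using sobolev_has_integral_iff[of t g s, OF g(1)[OF m] h e] g(3)[OF t] sobolev_diff(2)[OF u0 ut[OF t]] by simp
  qed
qed

text \<open>Some representative of the class of functions with coordinates \<open>X\<close>.\<close>

definition realize :: "real \<Rightarrow> ell2 \<Rightarrow> real \<Rightarrow> real" where
  "realize s X = (SOME f. f \<in> sobolev s \<and> emb s f = X)"

lemma realize:
  assumes "0 \<le> s" "hermitian X"
  shows "realize s X \<in> sobolev s" "emb s (realize s X) = X"
  using someI_ex[of "\<lambda>f. f \<in> sobolev s \<and> emb s f = X"] emb_surj[OF assms]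
  by (auto simp: realize_def Bex_def)

lemma ode_bbm_solution:
  assumes a: "torus_smooth a" and s: "0 \<le> s" and u0: "u0 \<in> sobolev s"
    and X: "ode_sol (rhs a s) J (emb s u0) X" and H: "\<And>t. t \<in> J \<Longrightarrow> hermitian (X t)"
    and J: "\<And>t. t \<in> J \<Longrightarrow> {0..t} \<subseteq> J"
  shows "bbm_solution a s J u0 (\<lambda>t. realize s (X t))"
proof -
  let ?u = "\<lambda>t. realize s (X t)" and ?g = "\<lambda>\<tau>. realize s (rhs a s (X \<tau>))"
  have u: "?u t \<in> sobolev s" "emb s (?u t) = X t" if "t \<in> J" for t
    using realize[OF s H[OF that]] by auto
  have g: "?g t \<in> sobolev s" "emb s (?g t) = rhs a s (X t)" if "t \<in> J" for t
    using realize[OF s hermitian_rhs[OF a s H[OF that]]] by auto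
  have "sobolev_continuous_on s J ?u"
    unfolding sobolev_continuous_on_def
  proof (intro conjI ballI)
    fix t assume t: "t \<in> J"
    have "((\<lambda>\<tau>. X \<tau>) \<longlongrightarrow> X t) (at t within J)"
      using X t by (auto simp: ode_sol_def continuous_on_def)
    hence "((\<lambda>\<tau>. norm (X \<tau> - X t)) \<longlongrightarrow> 0) (at t within J)"
      by (simp add: tendsto_norm_zero_iff LIM_zero_iff)
    moreover have "\<forall>\<^sub>F \<tau> in at t within J. norm (X \<tau> - X t) = sobolev_norm s (\<lambda>x. ?u \<tau> x - ?u t x)"
      unfolding eventually_at_filter
    proof (rule always_eventually, intro allI impI)
      fix \<tau> assume \<tau>: "\<tau> \<in> J"
      note d = sobolev_diff[OF u(1)[OF \<tau>] u(1)[OF t]]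
      show "norm (X \<tau> - X t) = sobolev_norm s (\<lambda>x. ?u \<tau> x - ?u t x)"
        by (simp only: norm_emb[OF d(1), symmetric] d(2) u(2)[OF \<tau>] u(2)[OF t])
    qed
    ultimately show "((\<lambda>\<tau>. sobolev_norm s (\<lambda>x. ?u \<tau> x - ?u t x)) \<longlongrightarrow> 0) (at t within J)"
      by (rule Lim_transform_eventually)
  qed (rule u)
  moreover have "\<exists>g. (\<forall>\<tau>\<in>J. g \<tau> \<in> sobolev s \<and> inv_helmholtz (bbm_flux a (?u \<tau>)) (g \<tau>)) \<and>
      (\<forall>t\<in>J. sobolev_has_integral s g (\<lambda>x. u0 x - ?u t x) t)"
  proof (intro exI[of _ ?g] conjI ballI)
    fix t assume t: "t \<in> J"
    show "?g t \<in> sobolev s" by (rule g(1)[OF t])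
    show "inv_helmholtz (bbm_flux a (?u t)) (?g t)"
      using inv_helmholtz_iff[OF a s u(1)[OF t] g(1)[OF t]] g(2)[OF t] u(2)[OF t] by simp
    have m: "\<tau> \<in> J" if "\<tau> \<in> {0..t}" for \<tau> using J[OF t] that by blast
    have e: "rhs a s (X \<tau>) = emb s (?g \<tau>)" if "\<tau> \<in> {0..t}" for \<tau> using g(2)[OF m[OF that]] by simp
    have h: "(\<lambda>x. u0 x - ?u t x) \<in> sobolev s" by (rule sobolev_diff(1)[OF u0 u(1)[OF t]])
    have "((\<lambda>\<tau>. rhs a s (X \<tau>)) has_integral emb s u0 - X t) {0..t}" using X t by (auto simp: ode_sol_def)
    thus "sobolev_has_integral s ?g (\<lambda>x. u0 x - ?u t x) t"
      using sobolev_has_integral_iff[of t ?g s, OF g(1)[OF m] h e] sobolev_diff(2)[OF u0 u(1)[OF t]] u(2)[OF t] by simp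
  qed
  ultimately show ?thesis using u0 by (simp add: bbm_solution_def)
qed

text \<open>Existence in coordinates, within one ball for all data of norm at most \<open>R\<close>, is enough: uniqueness in coordinates
puts all solutions in that ball, where \<open>rhs\<close> has one Lipschitz constant.\<close>

lemma bbm_well_posedI:
  assumes a: "torus_smooth a" and s: "0 \<le> s"
    and ex: "\<And>x0. norm x0 \<le> R \<Longrightarrow> hermitian x0 \<Longrightarrow>
      \<exists>X. ode_sol (rhs a s) {0..T} x0 X \<and> (\<forall>t\<in>{0..T}. norm (X t) \<le> r \<and> hermitian (X t))"
  shows "bbm_well_posed a s R T"
proof -
  interpret lipschitz_field "rhs a s" flip by (rule lipschitz_field_rhs[OF a s])
  have J: "{0..t} \<subseteq> {0..T}" if "t \<in> {0..T}" for t using that by auto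
  note ode = bbm_solution_ode[OF a s _ J]
  have exu: "\<exists>X. ode_sol (rhs a s) {0..T} (emb s u0) X \<and> (\<forall>t\<in>{0..T}. norm (X t) \<le> r \<and> hermitian (X t))"
    if "u0 \<in> sobolev s" "sobolev_norm s u0 \<le> R" for u0
    using ex[of "emb s u0"] that by (simp add: norm_emb hermitian_emb)
  have "\<exists>u. bbm_solution a s {0..T} u0 u \<and>
           (\<forall>v. bbm_solution a s {0..T} u0 v \<longrightarrow> (\<forall>t\<in>{0..T}. AE x in lborel. v t x = u t x))"
    if u0: "u0 \<in> sobolev s" "sobolev_norm s u0 \<le> R" for u0
  proof -
    obtain X where X: "ode_sol (rhs a s) {0..T} (emb s u0) X" "\<And>t. t \<in> {0..T} \<Longrightarrow> hermitian (X t)"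
      using exu[OF u0] by blast
    have sol: "bbm_solution a s {0..T} u0 (\<lambda>t. realize s (X t))"
      by (rule ode_bbm_solution[OF a s u0(1) X J])
    moreover have "AE x in lborel. v t x = realize s (X t) x" if v: "bbm_solution a s {0..T} u0 v" and t: "t \<in> {0..T}" for v t
    proof (rule emb_eq_AE)
      show "v t \<in> sobolev s" by (rule ode(3)[OF v _ t])
      show "realize s (X t) \<in> sobolev s" by (rule realize(1)[OF s X(2)[OF t]])
      have "emb s (v t) = X t" by (rule sol_unique[OF ode(1)[OF v] X(1) t])
      thus "emb s (v t) = emb s (realize s (X t))" by (simp add: realize(2)[OF s X(2)[OF t]])
    qed
    ultimately show ?thesis by blast
  qed
  moreover have "\<exists>L. \<forall>u0\<in>sobolev s. \<forall>v0\<in>sobolev s. \<forall>u v.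
        sobolev_norm s u0 \<le> R \<longrightarrow> sobolev_norm s v0 \<le> R \<longrightarrow>
        bbm_solution a s {0..T} u0 u \<longrightarrow> bbm_solution a s {0..T} v0 v \<longrightarrow>
        (\<forall>t\<in>{0..T}. sobolev_norm s (\<lambda>x. u t x - v t x) \<le> L * sobolev_norm s (\<lambda>x. u0 x - v0 x))"
  proof -
    obtain K where K: "K \<ge> 0" "\<And>x y. norm x \<le> r \<Longrightarrow> norm y \<le> r \<Longrightarrow> norm (rhs a s x - rhs a s y) \<le> K * norm (x - y)"
      using lip[of r] by blast
    show ?thesis
    proof (intro exI[of _ "exp (K * T)"] ballI allI impI)
      fix u0 v0 u v t
      assume u0: "u0 \<in> sobolev s" and v0: "v0 \<in> sobolev s" and n: "sobolev_norm s u0 \<le> R" "sobolev_norm s v0 \<le> R"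
        and u: "bbm_solution a s {0..T} u0 u" and v: "bbm_solution a s {0..T} v0 v" and t: "t \<in> {0..T}"
      have b: "norm (emb s (w \<tau>)) \<le> r" if w0: "w0 \<in> sobolev s" "sobolev_norm s w0 \<le> R"
        and w: "bbm_solution a s {0..T} w0 w" and \<tau>: "\<tau> \<in> {0..T}" for w0 w \<tau>
      proof -
        obtain X where X: "ode_sol (rhs a s) {0..T} (emb s w0) X" "\<forall>t\<in>{0..T}. norm (X t) \<le> r"
          using exu[OF w0] by blast
        have "emb s (w \<tau>) = X \<tau>" by (rule sol_unique[OF ode(1)[OF w] X(1) \<tau>])
        thus ?thesis using X(2) \<tau> by simp
      qed
      have ut: "u t \<in> sobolev s" "v t \<in> sobolev s" using ode(3)[OF u _ t] ode(3)[OF v _ t] by auto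
      have "sobolev_norm s (\<lambda>x. u t x - v t x) = norm (emb s (u t) - emb s (v t))"
        using norm_emb[OF sobolev_diff(1)[OF ut]] sobolev_diff(2)[OF ut] by simp
      also have "\<dots> \<le> exp (K * t) * norm (emb s u0 - emb s v0)"
        by (rule sol_stability[OF ode(1)[OF u] ode(1)[OF v] K _ _ t]) (use b[OF u0 n(1) u] b[OF v0 n(2) v] in auto)
      also have "\<dots> \<le> exp (K * T) * norm (emb s u0 - emb s v0)"
        using t K by (intro mult_right_mono) (auto intro: mult_left_mono)
      also have "norm (emb s u0 - emb s v0) = sobolev_norm s (\<lambda>x. u0 x - v0 x)"
        using norm_emb[OF sobolev_diff(1)[OF u0 v0]] sobolev_diff(2)[OF u0 v0] by simp
      finally show "sobolev_norm s (\<lambda>x. u t x - v t x) \<le> exp (K * T) * sobolev_norm s (\<lambda>x. u0 x - v0 x)" .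
    qed
  qed
  ultimately show ?thesis unfolding bbm_well_posed_def by blast
qed

lemma bbm_locally_well_posed:
  assumes a: "torus_smooth a" and s: "0 \<le> s" and R: "0 < R"
  shows "\<exists>T>0. bbm_well_posed a s R T"
proof -
  interpret lipschitz_field "rhs a s" flip by (rule lipschitz_field_rhs[OF a s])
  have R0: "0 \<le> R" using R by simp
  obtain T where T: "T > 0" "\<And>x0. norm x0 \<le> R \<Longrightarrow> flip x0 = x0 \<Longrightarrow>
      \<exists>X. ode_sol (rhs a s) {0..T} x0 X \<and> (\<forall>t\<in>{0..T}. norm (X t) \<le> R + 1 \<and> flip (X t) = X t)"
    using local_existence[OF R0] by blast
  have "bbm_well_posed a s R T"
    by (rule bbm_well_posedI[OF a s, where r = "R + 1"]) (use T(2) in \<open>simp add: hermitian_def\<close>)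
  thus ?thesis using T(1) by blast
qed

section \<open>The energy identity\<close>

lemma unwt_1_le: "cmod (of_int n * unwt 1 X n) \<le> cmod (coord X n)"
proof -
  have "\<bar>of_int n\<bar> * cmod (coord X n) \<le> wt 1 n * cmod (coord X n)"
    by (intro mult_right_mono abs_le_wt_1) simp
  thus ?thesis by (simp add: unwt_def norm_mult norm_divide field_simps)
qed

lemma unwt_1_l1: "(\<lambda>n. cmod (unwt 1 X n)) summable_on UNIV"
proof (rule summable_mult_of_square)
  show "(\<lambda>n. (cmod (coord X n))\<^sup>2) summable_on UNIV" by (rule summable_coord)
  show "(\<lambda>n. (1 / wt 1 n)\<^sup>2) summable_on UNIV"
    using summable_inverse_square by (simp add: power_divide wt_1_square)
  show "norm (unwt 1 X n) \<le> \<bar>cmod (coord X n)\<bar> * \<bar>1 / wt 1 n\<bar>" for n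
    by (simp add: unwt_def norm_divide)
qed

text \<open>\<open>y\<close> is the weak derivative of the function in \<open>H\<^sup>1\<close> with coordinates \<open>X\<close>.\<close>

lemma derivative_function:
  assumes "hermitian X"
  obtains y where "y \<in> sobolev 0" "\<And>n. fourier_coeff y n = \<i> * of_int n * unwt 1 X n"
proof -
  define Y where "Y = Abs_ell2 (\<lambda>n. \<i> * of_int n * unwt 1 X n)"
  have "(\<lambda>n. (cmod (\<i> * of_int n * unwt 1 X n))\<^sup>2) summable_on UNIV"
  proof (rule summable_on_comparison_test[OF summable_coord[of X]])
    show "(cmod (\<i> * of_int n * unwt 1 X n))\<^sup>2 \<le> (cmod (coord X n))\<^sup>2" for n
      using unwt_1_le[of n X] by (intro power_mono) (simp_all add: norm_mult)
  qed simp
  hence Y: "coord Y n = \<i> * of_int n * unwt 1 X n" for n by (simp add: Y_def coord_Abs_ell2)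
  have "hermitian Y"
    by (rule hermitianI) (use hermitianD[OF assms] in \<open>simp add: Y unwt_def\<close>)
  then obtain y where y: "y \<in> sobolev 0" "emb 0 y = Y" using emb_surj[of 0 Y] by auto
  have "fourier_coeff y n = \<i> * of_int n * unwt 1 X n" for n
    using coord_emb[OF y(1), of n] y(2) Y by simp
  thus thesis using that y(1) by blast
qed

lemma damp_coeff_derivative:
  assumes a: "torus_smooth a" and y: "y \<in> sobolev 0" "\<And>n. fourier_coeff y n = \<i> * of_int n * unwt 1 X n"
  shows "damp_coeff a (unwt 1 X) n = - \<i> * of_int n * fourier_coeff (\<lambda>x. y x * a x) n"
proof -
  have "((\<lambda>k. (- \<i> * of_int n) * (fourier_coeff y k * fourier_coeff a (n - k))) has_sum (- \<i> * of_int n) * fourier_coeff (\<lambda>x. y x * a x) n) UNIV"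
    by (intro has_sum_cmult_right fourier_coeff_mult torus_smooth_L2 a sobolev_L2[OF y(1)])
  moreover have "(- \<i> * of_int n) * (fourier_coeff y k * fourier_coeff a (n - k)) = of_int n * of_int k * fourier_coeff a (n - k) * unwt 1 X k" for k
    by (simp add: y(2) algebra_simps)
  ultimately show ?thesis by (simp add: damp_coeff_def has_sum_iff)
qed

lemma torus_smooth_mult_L2: "torus_smooth a \<Longrightarrow> y \<in> torus_L2 \<Longrightarrow> (\<lambda>x. y x * a x) \<in> torus_L2"
  using torus_smooth_bounded[of a] torus_L2_mult_bounded[of y a] torus_smooth_measurable[of a]
  by (metis (no_types, lifting) ext mult.commute)

text \<open>The rate of dissipation is \<open>\<integral> a u\<^sub>x\<^sup>2\<close>: the weights of \<open>H\<^sup>1\<close> cancel the symbol of \<open>(1 - \<partial>\<^sub>x\<^sup>2)\<^sup>-\<^sup>1\<close>, and the rest is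
Parseval's identity.\<close>

lemma inner_Damp:
  assumes a: "torus_smooth a" and y: "y \<in> sobolev 0" "\<And>n. fourier_coeff y n = \<i> * of_int n * unwt 1 X n"
  shows "X \<bullet> Damp a 1 X = (\<integral>x. a x * (y x)\<^sup>2 \<partial>tor)"
proof -
  have yL: "y \<in> torus_L2" by (rule sobolev_L2[OF y(1)])
  have ayL: "(\<lambda>x. y x * a x) \<in> torus_L2" by (rule torus_smooth_mult_L2[OF a yL])
  note [measurable] = torus_L2_measurable[OF yL] torus_smooth_measurable[OF a]
  have t: "coord X n \<bullet> coord (Damp a 1 X) n = Re (fourier_coeff y n * fourier_coeff (\<lambda>x. y x * a x) (0 - n))" for n
  proof -
    have X: "coord X n = of_real (wt 1 n) * unwt 1 X n" by (simp add: unwt_def)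
    have w: "wt 1 n * (wt 1 n / (1 + (of_int n)\<^sup>2)) = 1"
      using wt_1_square[of n] one_plus_sq_pos[of n] by (simp add: power2_eq_square)
    have "coord X n \<bullet> coord (Damp a 1 X) n = (wt 1 n * (wt 1 n / (1 + (of_int n)\<^sup>2))) * (unwt 1 X n \<bullet> damp_coeff a (unwt 1 X) n)"
      unfolding X coord_Damp[OF a] scaleR_conv_of_real[symmetric]
      by (simp add: inner_scaleR_left inner_scaleR_right flip: scaleR_conv_of_real)
    also have "\<dots> = unwt 1 X n \<bullet> damp_coeff a (unwt 1 X) n" unfolding w by simp
    also have "\<dots> = Re (unwt 1 X n * cnj (damp_coeff a (unwt 1 X) n))" by (simp add: inner_complex_def)
    also have "unwt 1 X n * cnj (damp_coeff a (unwt 1 X) n) = fourier_coeff y n * fourier_coeff (\<lambda>x. y x * a x) (0 - n)"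
      by (simp add: damp_coeff_derivative[OF a y] y(2) fourier_coeff_cnj[OF ayL])
    finally show ?thesis .
  qed
  have "((\<lambda>n. fourier_coeff y n * fourier_coeff (\<lambda>x. y x * a x) (0 - n)) has_sum fourier_coeff (\<lambda>x. y x * (y x * a x)) 0) UNIV"
    by (rule fourier_coeff_mult[OF yL ayL])
  hence "X \<bullet> Damp a 1 X = Re (fourier_coeff (\<lambda>x. y x * (y x * a x)) 0)"
    unfolding inner_ell2_def t by (intro infsumI has_sum_Re)
  also have "fourier_coeff (\<lambda>x. y x * (y x * a x)) 0 = of_real (\<integral>x. y x * (y x * a x) \<partial>tor)"
    by (subst fourier_coeff_tor) (auto simp: scaleR_conv_of_real simp del: of_real_mult)
  finally show ?thesis by (simp add: power2_eq_square mult_ac)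
qed

lemma inner_Damp_nonneg:
  assumes a: "torus_smooth a" "\<And>x. 0 \<le> a x" and X: "hermitian X"
  shows "0 \<le> X \<bullet> Damp a 1 X"
proof -
  obtain y where y: "y \<in> sobolev 0" "\<And>n. fourier_coeff y n = \<i> * of_int n * unwt 1 X n"
    using derivative_function[OF X] by blast
  show ?thesis unfolding inner_Damp[OF a(1) y] using a(2) by (intro integral_nonneg_AE) auto
qed

lemma inner_Disp: "X \<bullet> Disp beta X = 0"
proof -
  have "coord X n \<bullet> coord (Disp beta X) n = 0" for n
  proof -
    have b: "beta n = \<i> * of_real (of_int n / (1 + (of_int n)\<^sup>2))" by (simp add: beta_def)
    show ?thesis unfolding coord_Disp[OF beta_multiplier] b by (simp add: inner_complex_def)
  qed
  thus ?thesis by (simp add: inner_ell2_def)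
qed

text \<open>This is \<open>\<integral> u\<^sup>2 u\<^sub>x = 0\<close> in coordinates: the sum runs over frequencies \<open>p + q + r = 0\<close> with the factor \<open>p\<close>, and summing
its versions with the factors \<open>p\<close>, \<open>q\<close> and \<open>r\<close> gives zero. Absolute convergence, which permits the
rearrangement, uses that \<open>u\<^sub>x\<close> is in \<open>L\<^sup>2\<close> and that the coefficients of \<open>u\<close> are summable.\<close>

lemma cubic_sum_zero:
  fixes u :: "int \<Rightarrow> complex"
  defines "h \<equiv> (\<lambda>(q, p). of_int p * u p * u q * u (- p - q))"
  assumes l1: "(\<lambda>n. cmod (u n)) summable_on UNIV" and l2: "(\<lambda>n. (cmod (u n))\<^sup>2) summable_on UNIV"
    and h1: "(\<lambda>n. (cmod (of_int n * u n))\<^sup>2) summable_on UNIV"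
  shows "h summable_on UNIV" "infsum h UNIV = 0"
proof -
  let ?B = "sqrt (\<Sum>\<^sub>\<infinity>n. (cmod (of_int n * u n))\<^sup>2) * sqrt (\<Sum>\<^sub>\<infinity>n. (cmod (u n))\<^sup>2)"
  have l2': "(\<lambda>n. (cmod (u (- n)))\<^sup>2) summable_on UNIV" "(\<Sum>\<^sub>\<infinity>n. (cmod (u (- n)))\<^sup>2) = (\<Sum>\<^sub>\<infinity>n. (cmod (u n))\<^sup>2)"
    using l2 summable_on_reindex_bij_betw[OF bij_uminus, of "\<lambda>n. (cmod (u n))\<^sup>2"]
      infsum_reindex_bij_betw[OF bij_uminus, of "\<lambda>n. (cmod (u n))\<^sup>2"] by simp_all
  have inner: "(\<lambda>p. norm (h (q, p))) summable_on UNIV" "(\<Sum>\<^sub>\<infinity>p. norm (h (q, p))) \<le> cmod (u q) * ?B" for q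
  proof -
    have s: "(\<lambda>p. cmod ((of_int p * u p) * u (- q - p))) summable_on UNIV"
      "(\<Sum>\<^sub>\<infinity>p. cmod ((of_int p * u p) * u (- q - p))) \<le> ?B"
      using conv_summable[OF h1 l2, of "- q"] by auto
    have e: "norm (h (q, p)) = cmod (u q) * cmod ((of_int p * u p) * u (- q - p))" for p
    proof -
      have "- p - q = - q - p" by simp
      thus ?thesis unfolding h_def prod.case by (simp only: norm_mult mult_ac)
    qed
    show "(\<lambda>p. norm (h (q, p))) summable_on UNIV"
      unfolding e by (intro summable_on_cmult_right s)
    show "(\<Sum>\<^sub>\<infinity>p. norm (h (q, p))) \<le> cmod (u q) * ?B"
      unfolding e infsum_cmult_right' by (intro mult_left_mono s) simp
  qed
  have nn: "0 \<le> (\<Sum>\<^sub>\<infinity>p. norm (h (q, p)))" for q by (rule infsum_nonneg) simp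
  have "(\<lambda>q. \<Sum>\<^sub>\<infinity>p. norm (h (q, p))) summable_on UNIV"
    by (rule summable_on_comparison_test[OF summable_on_cmult_left[OF l1, of ?B] inner(2) nn])
  hence "(\<lambda>q. norm (\<Sum>\<^sub>\<infinity>p. norm (h (q, p)))) summable_on UNIV" using nn by simp
  with inner(1) have "(\<lambda>x. norm (h x)) summable_on Sigma UNIV (\<lambda>_. UNIV)"
    using Infinite_Sum.abs_summable_on_Sigma_iff[where f = h and A = UNIV and B = "\<lambda>_. UNIV"] by blast
  hence "(\<lambda>x. norm (h x)) summable_on UNIV" by simp
  thus sh: "h summable_on UNIV" by (rule abs_summable_summable)
  have b1: "bij_betw (\<lambda>(q, p). (p, q)) (UNIV :: (int \<times> int) set) UNIV"
    by (rule bij_betw_byWitness[where f' = "\<lambda>(q, p). (p, q)"]) auto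
  have b2: "bij_betw (\<lambda>(q, p). (q, - p - q)) (UNIV :: (int \<times> int) set) UNIV"
    by (rule bij_betw_byWitness[where f' = "\<lambda>(q, p). (q, - p - q)"]) auto
  have s1: "((\<lambda>x. h ((\<lambda>(q, p). (p, q)) x)) has_sum infsum h UNIV) UNIV"
    using has_sum_reindex_bij_betw[OF b1, of h "infsum h UNIV"] sh by simp
  have s2: "((\<lambda>x. h ((\<lambda>(q, p). (q, - p - q)) x)) has_sum infsum h UNIV) UNIV"
    using has_sum_reindex_bij_betw[OF b2, of h "infsum h UNIV"] sh by simp
  have s0: "(h has_sum infsum h UNIV) UNIV" using sh by simp
  have "((\<lambda>x. h x + h ((\<lambda>(q, p). (p, q)) x) + h ((\<lambda>(q, p). (q, - p - q)) x)) has_sum infsum h UNIV + infsum h UNIV + infsum h UNIV) UNIV"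
    by (intro has_sum_add s0 s1 s2)
  moreover have "h x + h ((\<lambda>(q, p). (p, q)) x) + h ((\<lambda>(q, p). (q, - p - q)) x) = 0" for x
  proof -
    obtain q p where x: "x = (q, p)" by (cases x)
    have 1: "h x = of_int p * (u p * u q * u (- p - q))" by (simp add: h_def x)
    have 2: "h ((\<lambda>(q, p). (p, q)) x) = of_int q * (u p * u q * u (- p - q))"
    proof -
      have "- q - p = - p - q" by simp
      thus ?thesis by (simp only: h_def x prod.case) (simp only: mult_ac)
    qed
    have 3: "h ((\<lambda>(q, p). (q, - p - q)) x) = of_int (- p - q) * (u p * u q * u (- p - q))"
    proof -
      have "- (- p - q) - q = p" by simp
      thus ?thesis by (simp only: h_def x prod.case) (simp only: mult_ac)
    qed
    show ?thesis unfolding 1 2 3 by (simp add: algebra_simps)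
  qed
  ultimately have "((\<lambda>x :: int \<times> int. 0) has_sum infsum h UNIV + infsum h UNIV + infsum h UNIV) UNIV"
    by (simp only:)
  from has_sum_unique[OF this has_sum_0_simp] have "infsum h UNIV + infsum h UNIV + infsum h UNIV = 0" .
  hence "3 * infsum h UNIV = 0" by simp
  thus "infsum h UNIV = 0" by simp
qed

lemma inner_Nonlin:
  assumes X: "hermitian X"
  shows "X \<bullet> Nonlin beta 1 X X = 0"
proof -
  define u where "u = unwt 1 X"
  have uc: "cnj (u n) = u (- n)" for n using hermitianD[OF X, of n] by (simp add: u_def unwt_def)
  have l2: "(\<lambda>n. (cmod (u n))\<^sup>2) summable_on UNIV" unfolding u_def by (rule unwt_summable) simp
  have h1: "(\<lambda>n. (cmod (of_int n * u n))\<^sup>2) summable_on UNIV"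
    unfolding u_def by (rule summable_on_comparison_test[OF summable_coord[of X]]) (auto intro!: power_mono unwt_1_le)
  define h where "h = (\<lambda>(q, p). of_int p * u p * u q * u (- p - q))"
  have h: "h summable_on UNIV" "infsum h UNIV = 0"
    using cubic_sum_zero[OF unwt_1_l1[of X, folded u_def] l2 h1] by (simp_all add: h_def)
  have t: "coord X n \<bullet> coord (Nonlin beta 1 X X) n = Re (- \<i> / 2 * (of_int n * u n * cnj (conv u u n)))" for n
  proof -
    have Xn: "coord X n = of_real (wt 1 n) * u n" by (simp add: unwt_def u_def)
    have w: "complex_of_real (wt 1 n) * complex_of_real (wt 1 n) = 1 + (of_int n)\<^sup>2"
      using arg_cong[OF wt_1_square[of n], of complex_of_real] by (simp add: power2_eq_square)
    have nz: "(1 + (of_int n)\<^sup>2 :: complex) \<noteq> 0"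
      using one_plus_sq_pos[of n] by (metis of_real_1 of_real_add of_real_eq_0_iff of_real_of_int_eq of_real_power less_irrefl)
    have "coord X n \<bullet> coord (Nonlin beta 1 X X) n = Re (coord X n * cnj (coord (Nonlin beta 1 X X) n))"
      by (simp add: inner_complex_def)
    also have "coord X n * cnj (coord (Nonlin beta 1 X X) n)
        = (of_real (wt 1 n) * of_real (wt 1 n)) * (cnj (beta n) * (u n * cnj (conv u u n)) / 2)"
      by (simp add: Xn coord_Nonlin[OF beta_multiplier] u_def[symmetric] mult_ac)
    also have "\<dots> = - \<i> / 2 * (of_int n * u n * cnj (conv u u n))"
    proof -
      define q :: complex where "q = 1 + (of_int n)\<^sup>2"
      have "cnj (beta n) = - \<i> * of_int n / q" by (simp add: beta_def q_def)
      thus ?thesis unfolding w using nz unfolding q_def[symmetric] by simp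
    qed
    finally show ?thesis .
  qed
  have "((\<lambda>n. of_int n * u n * cnj (conv u u n)) has_sum 0) UNIV"
  proof -
    define k where "k = (\<lambda>(n, p). of_int n * u n * u (- p) * u (p - n))"
    have b: "bij_betw (\<lambda>(n, p). (- p, n)) (UNIV :: (int \<times> int) set) UNIV"
      by (rule bij_betw_byWitness[where f' = "\<lambda>(q, p). (p, - q)"]) auto
    have "((\<lambda>x. h ((\<lambda>(n, p). (- p, n)) x)) has_sum 0) UNIV"
      using has_sum_reindex_bij_betw[OF b, of h 0] h by (metis has_sum_infsum)
    moreover have "h ((\<lambda>(n, p). (- p, n)) x) = k x" for x
    proof -
      obtain n p where x: "x = (n, p)" by (cases x)
      have "- n - - p = p - n" by simp
      thus ?thesis by (simp add: h_def k_def x)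
    qed
    ultimately have "(k has_sum 0) (Sigma UNIV (\<lambda>_. UNIV))" by simp
    moreover have "((\<lambda>p. k (n, p)) has_sum of_int n * u n * cnj (conv u u n)) UNIV" for n
    proof -
      have "((\<lambda>p. u p * u (n - p)) has_sum conv u u n) UNIV"
        unfolding conv_def by (rule has_sum_infsum, rule abs_summable_summable, rule conv_summable(1)[OF l2 l2])
      hence "((\<lambda>p. cnj (u p * u (n - p))) has_sum cnj (conv u u n)) UNIV"
        by (rule has_sum_cnj_iff[THEN iffD2])
      from has_sum_cmult_right[OF this, of "of_int n * u n"]
      have "((\<lambda>p. of_int n * u n * cnj (u p * u (n - p))) has_sum of_int n * u n * cnj (conv u u n)) UNIV" .
      moreover have "of_int n * u n * cnj (u p * u (n - p)) = k (n, p)" for p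
        by (simp add: k_def uc mult.assoc)
      ultimately show ?thesis by simp
    qed
    ultimately show ?thesis by (rule has_sum_SigmaD)
  qed
  from has_sum_Re[OF has_sum_cmult_right[OF this, of "- \<i> / 2"]]
  have "((\<lambda>n. coord X n \<bullet> coord (Nonlin beta 1 X X) n) has_sum 0) UNIV" unfolding t by simp
  thus ?thesis unfolding inner_ell2_def by (rule infsumI)
qed

text \<open>The mean is conserved.\<close>

lemma coord_rhs_zero:
  assumes "torus_smooth a" "0 \<le> s" shows "coord (rhs a s X) 0 = 0"
  by (simp add: coord_rhs[OF assms] flux_coeff_def damp_coeff_def)

text \<open>Every \<open>m\<close> is allowed because the field has no component at frequency zero.\<close>

lemma energy_identity:
  assumes a: "torus_smooth a" and X: "ode_sol (rhs a 1) {0..T} x0 X" "\<And>t. t \<in> {0..T} \<Longrightarrow> hermitian (X t)"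
    and t: "0 \<le> t1" "t1 \<le> t2" "t2 \<le> T"
  shows "((\<lambda>t. 2 * (X t \<bullet> Damp a 1 (X t))) has_integral
      ((norm (X t1 - single 0 m))\<^sup>2 - (norm (X t2 - single 0 m))\<^sup>2)) {t1..t2}"
proof -
  interpret lipschitz_field "rhs a 1" flip by (rule lipschitz_field_rhs[OF a]) simp
  let ?f = "\<lambda>t. - ((X t - single 0 m) \<bullet> (X t - single 0 m))"
  have "((\<lambda>t. 2 * (X t \<bullet> Damp a 1 (X t))) has_integral (?f t2 - ?f t1)) {t1..t2}"
  proof (rule fundamental_theorem_of_calculus)
    fix s assume s: "s \<in> {t1..t2}"
    hence sT: "s \<in> {0..T}" using t by auto
    have d: "((\<lambda>s. X s - single 0 m) has_vector_derivative - rhs a 1 (X s)) (at s within {t1..t2})"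
      using has_vector_derivative_within_subset[OF sol_derivative[OF X(1) sT], of "{t1..t2}"] t
      by (auto intro!: derivative_eq_intros)
    have e: "(X s - single 0 m) \<bullet> rhs a 1 (X s) = X s \<bullet> Damp a 1 (X s)"
      by (simp add: inner_diff_left inner_single coord_rhs_zero[OF a])
         (simp add: rhs_def inner_add_right inner_Disp inner_Nonlin[OF X(2)[OF sT]])
    from has_vector_derivative_minus[OF bounded_bilinear.has_vector_derivative[OF bounded_bilinear_inner d d]]
    show "(?f has_vector_derivative 2 * (X s \<bullet> Damp a 1 (X s))) (at s within {t1..t2})"
      using e by (simp add: inner_commute[of "rhs a 1 (X s)"])
  qed fact
  thus ?thesis by (simp add: power2_norm_eq_inner)
qed

lemma energy_decreasing:
  assumes a: "torus_smooth a" "\<And>x. 0 \<le> a x" and X: "ode_sol (rhs a 1) {0..T} x0 X" "\<And>t. t \<in> {0..T} \<Longrightarrow> hermitian (X t)"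
    and t: "0 \<le> t1" "t1 \<le> t2" "t2 \<le> T"
  shows "norm (X t2 - single 0 m) \<le> norm (X t1 - single 0 m)"
proof -
  have "0 \<le> (norm (X t1 - single 0 m))\<^sup>2 - (norm (X t2 - single 0 m))\<^sup>2"
  proof (rule has_integral_nonneg[OF energy_identity[OF a(1) X t]])
    fix s assume "s \<in> {t1..t2}"
    hence "s \<in> {0..T}" using t by auto
    from inner_Damp_nonneg[OF a X(2)[OF this]] show "0 \<le> 2 * (X s \<bullet> Damp a 1 (X s))" by simp
  qed
  hence "(norm (X t2 - single 0 m))\<^sup>2 \<le> (norm (X t1 - single 0 m))\<^sup>2" by simp
  thus ?thesis by (rule power2_le_imp_le) simp
qed

lemma bbm_globally_well_posed:
  assumes a: "torus_smooth a" "\<And>x. 0 \<le> a x"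
  shows "bbm_well_posed a 1 R T"
proof -
  interpret lipschitz_field "rhs a 1" flip by (rule lipschitz_field_rhs[OF a(1)]) simp
  have z: "single 0 0 = 0" by (rule ell2_eqI) simp
  have bound: "norm (X t) \<le> norm x0"
    if "ode_sol (rhs a 1) {0..T} x0 X" "\<forall>t\<in>{0..T}. flip (X t) = X t" "t \<in> {0..T}" for T x0 X t
  proof -
    have "norm (X t - single 0 0) \<le> norm (X 0 - single 0 0)"
      by (rule energy_decreasing[OF a that(1)]) (use that(2,3) in \<open>auto simp: hermitian_def\<close>)
    moreover have "X 0 = x0" by (rule ode_sol_initial[OF that(1)]) (use that(3) in auto)
    ultimately show ?thesis by (simp add: z)
  qed
  show ?thesis
  proof (rule bbm_well_posedI[OF a(1), where r = R])
    fix x0 assume x0: "norm x0 \<le> R" "hermitian x0"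
    have "\<exists>X. ode_sol (rhs a 1) {0..T} x0 X \<and> (\<forall>t\<in>{0..T}. flip (X t) = X t)"
      by (rule global_existence[OF x0(2)[unfolded hermitian_def]]) (rule bound)
    then obtain X where X: "ode_sol (rhs a 1) {0..T} x0 X" "\<forall>t\<in>{0..T}. flip (X t) = X t" by blast
    have "norm (X t) \<le> R" if "t \<in> {0..T}" for t
      using bound[OF X that] x0(1) by linarith
    thus "\<exists>X. ode_sol (rhs a 1) {0..T} x0 X \<and> (\<forall>t\<in>{0..T}. norm (X t) \<le> R \<and> hermitian (X t))"
      using X by (auto simp: hermitian_def)
  qed simp
qed

lemma bbm_energy_antimono:
  assumes a: "torus_smooth a" "\<And>x. 0 \<le> a x" and u: "bbm_solution a 1 {0..T} u0 u"
  shows "antimono_on {0..T} (\<lambda>t. sobolev_norm 1 (\<lambda>x. u t x - m))"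
proof (rule monotone_onI)
  fix t1 t2 assume t: "t1 \<in> {0..T}" "t2 \<in> {0..T}" "t1 \<le> t2"
  have J: "{0..t} \<subseteq> {0..T}" if "t \<in> {0..T}" for t using that by auto
  note ode = bbm_solution_ode[OF a(1) _ u J]
  have n: "sobolev_norm 1 (\<lambda>x. u t x - m) = norm (emb 1 (u t) - single 0 m)" if "t \<in> {0..T}" for t
  proof -
    have ut: "u t \<in> sobolev 1" by (rule ode(3)) (use that in auto)
    show ?thesis
      using norm_emb[OF sobolev_diff(1)[OF ut sobolev_const(1)[where c = m]]]
        sobolev_diff(2)[OF ut sobolev_const(1)[where c = m]] sobolev_const(2)[where c = m and s = 1] by simp
  qed
  have "norm (emb 1 (u t2) - single 0 m) \<le> norm (emb 1 (u t1) - single 0 m)"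
    by (rule energy_decreasing[OF a ode(1)]) (use t ode(3) in \<open>auto intro: hermitian_emb\<close>)
  thus "sobolev_norm 1 (\<lambda>x. u t2 x - m) \<le> sobolev_norm 1 (\<lambda>x. u t1 x - m)"
    using n t by simp
qed

section \<open>Unique continuation for bounded complete solutions\<close>

lemma leibniz_Icc:
  fixes f fx :: "real \<Rightarrow> real \<Rightarrow> real"
  assumes "\<And>x t. x \<in> U \<Longrightarrow> t \<in> {a..b} \<Longrightarrow> ((\<lambda>x. f x t) has_real_derivative fx x t) (at x within U)"
    and "\<And>x. x \<in> U \<Longrightarrow> continuous_on {a..b} (f x)"
    and "continuous_on (U \<times> {a..b}) (\<lambda>(x, t). fx x t)" and "x0 \<in> U" "convex U"
  shows "((\<lambda>x. integral {a..b} (f x)) has_real_derivative integral {a..b} (fx x0)) (at x0 within U)"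
  using leibniz_rule_field_derivative[of U a b f fx x0] assms by (simp add: integrable_continuous_real)

lemma swap_Icc:
  fixes f :: "real \<Rightarrow> real \<Rightarrow> real"
  assumes "continuous_on ({a..b} \<times> {c..d}) (\<lambda>(x, y). f x y)"
  shows "integral {a..b} (\<lambda>x. integral {c..d} (f x)) = integral {c..d} (\<lambda>y. integral {a..b} (\<lambda>x. f x y))"
  using integral_swap_continuous[of a c b d f] assms by (simp add: cbox_Pair_eq)

lemma nonincreasing_within:
  fixes f :: "real \<Rightarrow> real"
  assumes f: "\<And>x. x \<in> {p..q} \<Longrightarrow> (f has_real_derivative f' x) (at x within {p..q})"
    and le: "\<And>x. x \<in> {p..q} \<Longrightarrow> f' x \<le> 0" and x: "p \<le> x" "x \<le> y" "y \<le> q"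
  shows "f y \<le> f x"
proof (rule DERIV_nonpos_imp_decreasing_open[of x y f])
  have "continuous_on {p..q} f" by (rule DERIV_continuous_on) (rule f)
  thus "continuous_on {x..y} f" by (rule continuous_on_subset) (use x in auto)
  fix z assume "x < z" "z < y"
  hence z: "z \<in> {p..q}" "z \<in> interior {p..q}" using x by auto
  have "(f has_real_derivative f' z) (at z)" using f[OF z(1)] by (simp only: at_within_interior[OF z(2)])
  thus "\<exists>D. DERIV f z :> D \<and> D \<le> 0" using le[OF z(1)] by blast
next
  show "x \<le> y" by fact
qed

lemma gronwall_within:
  fixes f :: "real \<Rightarrow> real"
  assumes f: "\<And>x. x \<in> {p..q} \<Longrightarrow> (f has_real_derivative f' x) (at x within {p..q})"
    and le: "\<And>x. x \<in> {p..q} \<Longrightarrow> f' x \<le> 2 * f x + K" and K: "0 \<le> K" and p: "f p = 0" and x: "x \<in> {p..q}"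
  shows "f x \<le> K * exp (2 * (q - p))"
proof -
  define g where "g x = (f x + K / 2) * exp (- 2 * (x - p))" for x
  have "g x \<le> g p"
  proof (rule nonincreasing_within[where p = p and q = q and f = g and f' = "\<lambda>x. (f' x - 2 * (f x + K / 2)) * exp (- 2 * (x - p))"])
    show "(g has_real_derivative (f' x - 2 * (f x + K / 2)) * exp (- 2 * (x - p))) (at x within {p..q})"
      if "x \<in> {p..q}" for x
      unfolding g_def[abs_def] by (rule derivative_eq_intros f that refl | simp add: algebra_simps)+
    show "(f' x - 2 * (f x + K / 2)) * exp (- 2 * (x - p)) \<le> 0" if "x \<in> {p..q}" for x
      using le[OF that] by (intro mult_nonpos_nonneg) auto
  qed (use x in auto)
  hence "(f x + K / 2) * exp (- 2 * (x - p)) * exp (2 * (x - p)) \<le> K / 2 * exp (2 * (x - p))"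
    by (intro mult_right_mono) (auto simp: g_def p)
  hence "f x + K / 2 \<le> K / 2 * exp (2 * (x - p))" by (simp add: mult.assoc flip: exp_add)
  also have "\<dots> \<le> K * exp (2 * (q - p))" using K x by (intro mult_mono) auto
  finally show ?thesis using K by linarith
qed

lemma exists_le_average:
  fixes f :: "real \<Rightarrow> real"
  assumes "continuous_on {a..b} f" "a < b" "integral {a..b} f \<le> K"
  shows "\<exists>t\<in>{a..b}. f t \<le> K / (b - a)"
proof -
  obtain t where t: "t \<in> {a..b}" "\<And>s. s \<in> {a..b} \<Longrightarrow> f t \<le> f s"
    using continuous_attains_inf[of "{a..b}" f] assms by auto
  have "integral {a..b} (\<lambda>_. f t) \<le> integral {a..b} f"
    by (intro integral_le integrable_continuous_real assms continuous_intros t)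
  hence "f t * (b - a) \<le> K" using assms by (simp add: mult.commute)
  thus ?thesis using t assms by (auto simp: pos_le_divide_eq)
qed

text \<open>Here \<open>{p..q}\<close> is one full turn around the circle, starting and ending in the band where the solution is constant
in space; \<open>left\<close> and \<open>right\<close> are the values forced by the band. The solution satisfies
\<open>w\<^sub>t = - P\<close> with \<open>P = \<Phi>\<^sub>x\<close> and \<open>P\<^sub>x = \<Phi> - w\<^sup>2/2\<close>, and all bounds are uniform over all times.\<close>

locale stationary_band =
  fixes w \<Phi> P :: "real \<Rightarrow> real \<Rightarrow> real" and p q c M :: real
  assumes pq: "p < q"
    and w_t: "\<And>t x. x \<in> {p..q} \<Longrightarrow> ((\<lambda>t. w t x) has_real_derivative - P t x) (at t)"
    and \<Phi>_x: "\<And>t x. x \<in> {p..q} \<Longrightarrow> (\<Phi> t has_real_derivative P t x) (at x within {p..q})"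
    and P_x: "\<And>t x. x \<in> {p..q} \<Longrightarrow> (P t has_real_derivative \<Phi> t x - (w t x)\<^sup>2 / 2) (at x within {p..q})"
    and cont: "continuous_on (UNIV \<times> {p..q}) (\<lambda>z. w (fst z) (snd z))"
      "continuous_on (UNIV \<times> {p..q}) (\<lambda>z. \<Phi> (fst z) (snd z))"
      "continuous_on (UNIV \<times> {p..q}) (\<lambda>z. P (fst z) (snd z))"
    and bound: "\<And>t x. x \<in> {p..q} \<Longrightarrow> \<bar>w t x\<bar> \<le> M" "\<And>t x. x \<in> {p..q} \<Longrightarrow> \<bar>\<Phi> t x\<bar> \<le> M" "\<And>t x. x \<in> {p..q} \<Longrightarrow> \<bar>P t x\<bar> \<le> M"
    and left: "\<And>t. w t p = c" "\<And>t. \<Phi> t p = c\<^sup>2 / 2" "\<And>t. P t p = 0"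
    and right: "\<And>t. \<Phi> t q = c\<^sup>2 / 2" "\<And>t. P t q = 0"
    and equi: "\<And>e. e > 0 \<Longrightarrow> \<exists>d>0. \<forall>t. \<forall>x\<in>{p..q}. \<forall>y\<in>{p..q}. \<bar>x - y\<bar> < d \<longrightarrow> \<bar>w t x - w t y\<bar> < e"
begin

definition F where "F t x = \<Phi> t x - c\<^sup>2 / 2"

lemma F_x: "x \<in> {p..q} \<Longrightarrow> (F t has_real_derivative P t x) (at x within {p..q})"
  unfolding F_def[abs_def] using DERIV_diff[OF \<Phi>_x DERIV_const] by simp

lemma P_x': "x \<in> {p..q} \<Longrightarrow> (P t has_real_derivative F t x - ((w t x)\<^sup>2 - c\<^sup>2) / 2) (at x within {p..q})"
  using P_x[of x t] by (simp add: F_def diff_divide_distrib)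

lemma comp_cont [continuous_intros]:
  assumes "continuous_on A f" "continuous_on A g" "\<And>z. z \<in> A \<Longrightarrow> g z \<in> {p..q}"
  shows "continuous_on A (\<lambda>z. w (f z) (g z))" "continuous_on A (\<lambda>z. \<Phi> (f z) (g z))"
    "continuous_on A (\<lambda>z. P (f z) (g z))" "continuous_on A (\<lambda>z. F (f z) (g z))"
proof -
  have pr: "continuous_on A (\<lambda>z. (f z, g z))" "(\<lambda>z. (f z, g z)) ` A \<subseteq> UNIV \<times> {p..q}"
    using assms by (auto intro: continuous_on_Pair)
  show "continuous_on A (\<lambda>z. w (f z) (g z))" "continuous_on A (\<lambda>z. \<Phi> (f z) (g z))" "continuous_on A (\<lambda>z. P (f z) (g z))"
    using continuous_on_compose2[OF cont(1) pr] continuous_on_compose2[OF cont(2) pr] continuous_on_compose2[OF cont(3) pr]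
    by simp_all
  thus "continuous_on A (\<lambda>z. F (f z) (g z))" unfolding F_def by (intro continuous_intros)
qed

lemma M_nonneg: "0 \<le> M"
  using bound(1)[of p 0] pq by (smt (verit) abs_ge_zero atLeastAtMost_iff)

lemma conv_Icc: "convex {p..q}" by simp

definition K0 where "K0 = (M^3 + c\<^sup>2 * (2 * M)) * (q - p)"

lemma K0_nonneg: "0 \<le> K0"
  unfolding K0_def using M_nonneg pq by simp

text \<open>A conservation law: \<open>(F\<^sup>2 - P\<^sup>2)\<^sub>x = (w\<^sup>2 - c\<^sup>2) P = (c\<^sup>2 w - w\<^sup>3/3)\<^sub>t\<close>. So the derivative in \<open>x\<close> of the time integral is
a difference of two bounded terms, for every \<open>T\<close>.\<close>

lemma time_integral_flux:
  assumes T: "0 \<le> T" and x: "x \<in> {p..q}"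
  shows "\<bar>integral {-T..T} (\<lambda>t. (F t x)\<^sup>2 - (P t x)\<^sup>2)\<bar> \<le> K0"
proof -
  let ?f = "\<lambda>t x. (F t x)\<^sup>2 - (P t x)\<^sup>2" and ?g = "\<lambda>t y. ((w t y)\<^sup>2 - c\<^sup>2) * P t y"
  let ?B = "M^3 + c\<^sup>2 * (2 * M)"
  have d: "((\<lambda>x. integral {-T..T} (\<lambda>t. ?f t x)) has_real_derivative integral {-T..T} (\<lambda>t. ?g t y)) (at y within {p..q})"
    if y: "y \<in> {p..q}" for y
  proof (rule leibniz_Icc)
    fix x t assume x: "x \<in> {p..q}"
    show "((\<lambda>x. ?f t x) has_real_derivative ?g t x) (at x within {p..q})"
      by (rule derivative_eq_intros F_x[OF x] P_x'[OF x] refl | simp add: field_simps power2_eq_square)+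
  qed (use y in \<open>auto intro!: continuous_intros simp: split_beta\<close>)
  have b: "\<bar>integral {-T..T} (\<lambda>t. ?g t y)\<bar> \<le> ?B" if y: "y \<in> {p..q}" for y
  proof -
    let ?G = "\<lambda>t. c\<^sup>2 * w t y - (w t y)^3 / 3"
    have "((\<lambda>t. ?g t y) has_integral (?G T - ?G (-T))) {-T..T}"
    proof (rule fundamental_theorem_of_calculus)
      fix t
      have "(?G has_real_derivative ?g t y) (at t)"
        by (rule derivative_eq_intros w_t[OF y] refl | simp add: power2_eq_square algebra_simps)+
      thus "(?G has_vector_derivative ?g t y) (at t within {-T..T})"
        by (simp add: has_real_derivative_iff_has_vector_derivative has_vector_derivative_at_within)
    qed (use T in simp)
    hence int: "integral {-T..T} (\<lambda>t. ?g t y) = ?G T - ?G (-T)" by (rule integral_unique)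
    have cube: "\<bar>(w s y)^3\<bar> \<le> M^3" for s
      unfolding power_abs by (intro power_mono bound y) simp
    have "\<bar>c\<^sup>2 * w s y\<bar> \<le> c\<^sup>2 * M" for s
      unfolding abs_mult using bound(1)[OF y, of s] by (intro mult_mono) auto
    from this[of T] this[of "-T"] have "\<bar>c\<^sup>2 * w T y - c\<^sup>2 * w (-T) y\<bar> \<le> c\<^sup>2 * (2 * M)" by linarith
    moreover from cube[of T] cube[of "-T"] have "\<bar>(w (-T) y)^3 / 3 - (w T y)^3 / 3\<bar> \<le> M^3"
      using zero_le_power[OF M_nonneg, of 3] by linarith
    ultimately show ?thesis using int by linarith
  qed
  have "norm (integral {-T..T} (\<lambda>t. ?f t x) - integral {-T..T} (\<lambda>t. ?f t p)) \<le> ?B * norm (x - p)"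
    by (rule field_differentiable_bound[OF conv_Icc d]) (use b x pq in auto)
  moreover have "integral {-T..T} (\<lambda>t. ?f t p) = 0" by (simp add: F_def left)
  moreover have "?B * norm (x - p) \<le> K0" unfolding K0_def using x M_nonneg by (intro mult_left_mono) auto
  ultimately show ?thesis by simp
qed

lemma F_P_time_integrals:
  assumes T: "0 \<le> T" and x: "x \<in> {p..q}"
  shows "\<bar>integral {-T..T} (\<lambda>t. (F t x)\<^sup>2) - integral {-T..T} (\<lambda>t. (P t x)\<^sup>2)\<bar> \<le> K0"
proof -
  have i: "(\<lambda>t. (F t x)\<^sup>2) integrable_on {-T..T}" "(\<lambda>t. (P t x)\<^sup>2) integrable_on {-T..T}"
    using x by (auto intro!: integrable_continuous_real continuous_intros)
  show ?thesis using time_integral_flux[OF T x] by (simp only: Henstock_Kurzweil_Integration.integral_diff[OF i])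
qed

definition K1 where "K1 = K0 * exp (2 * (q - p)) + K0"

text \<open>\<open>\<integral> F\<^sup>2 dt\<close> and \<open>\<integral> P\<^sup>2 dt\<close> differ by at most \<open>K0\<close>, and \<open>(F\<^sup>2)\<^sub>x = 2 F P \<le> F\<^sup>2 + P\<^sup>2\<close>; Gronwall's inequality in \<open>x\<close>
bounds both, with a constant that does not depend on \<open>T\<close>.\<close>

lemma P_time_integral:
  assumes T: "0 \<le> T" and x: "x \<in> {p..q}"
  shows "integral {-T..T} (\<lambda>t. (P t x)\<^sup>2) \<le> K1"
proof -
  let ?A = "\<lambda>x. integral {-T..T} (\<lambda>t. (F t x)\<^sup>2)" and ?B = "\<lambda>x. integral {-T..T} (\<lambda>t. (P t x)\<^sup>2)"
  have "?A x \<le> K0 * exp (2 * (q - p))"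
  proof (rule gronwall_within[OF _ _ K0_nonneg _ x])
    fix y assume y: "y \<in> {p..q}"
    show "(?A has_real_derivative integral {-T..T} (\<lambda>t. 2 * F t y * P t y)) (at y within {p..q})"
    proof (rule leibniz_Icc)
      fix x t assume x: "x \<in> {p..q}"
      show "((\<lambda>x. (F t x)\<^sup>2) has_real_derivative 2 * F t x * P t x) (at x within {p..q})"
        by (rule derivative_eq_intros F_x[OF x] refl | simp)+
    qed (use y in \<open>auto intro!: continuous_intros simp: split_beta\<close>)
    have i: "(\<lambda>t. (F t y)\<^sup>2) integrable_on {-T..T}" "(\<lambda>t. (P t y)\<^sup>2) integrable_on {-T..T}"
      using y by (auto intro!: integrable_continuous_real continuous_intros)
    have "integral {-T..T} (\<lambda>t. 2 * F t y * P t y) \<le> integral {-T..T} (\<lambda>t. (F t y)\<^sup>2 + (P t y)\<^sup>2)"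
    proof (rule integral_le)
      show "(\<lambda>t. 2 * F t y * P t y) integrable_on {-T..T}"
        using y by (auto intro!: integrable_continuous_real continuous_intros)
      show "(\<lambda>t. (F t y)\<^sup>2 + (P t y)\<^sup>2) integrable_on {-T..T}" by (rule integrable_add[OF i])
      show "2 * F t y * P t y \<le> (F t y)\<^sup>2 + (P t y)\<^sup>2" for t
        using zero_le_power2[of "F t y - P t y"] by (simp add: power2_eq_square algebra_simps)
    qed
    also have "\<dots> = ?A y + ?B y" by (rule Henstock_Kurzweil_Integration.integral_add[OF i])
    also have "\<dots> \<le> 2 * ?A y + K0" using F_P_time_integrals[OF T y] by linarith
    finally show "integral {-T..T} (\<lambda>t. 2 * F t y * P t y) \<le> 2 * ?A y + K0" .
  qed (simp add: F_def left)
  thus ?thesis unfolding K1_def using F_P_time_integrals[OF T x] by linarith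
qed

definition E where "E t = integral {p..q} (\<lambda>x. (P t x)\<^sup>2)"

lemma E_continuous: "continuous_on A E"
proof -
  have "continuous_on (A \<times> cbox p q) (\<lambda>(t, x). (P t x)\<^sup>2)"
    by (auto intro!: continuous_intros simp: split_beta)
  from integral_continuous_on_param[OF this] show ?thesis by (simp add: E_def[abs_def])
qed

lemma E_nonneg: "0 \<le> E t"
  unfolding E_def by (intro integral_nonneg integrable_continuous_real) (auto intro!: continuous_intros)

lemma E_time_integral:
  assumes T: "0 \<le> T"
  shows "integral {-T..T} E \<le> K1 * (q - p)"
proof -
  have "integral {-T..T} E = integral {p..q} (\<lambda>x. integral {-T..T} (\<lambda>t. (P t x)\<^sup>2))"
    unfolding E_def[abs_def] by (rule swap_Icc) (auto intro!: continuous_intros simp: split_beta)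
  also have "\<dots> \<le> integral {p..q} (\<lambda>x. K1)"
  proof (rule integral_le)
    have "continuous_on ({p..q} \<times> cbox (-T) T) (\<lambda>(x, t). (P t x)\<^sup>2)"
      by (auto intro!: continuous_intros simp: split_beta)
    from integral_continuous_on_param[OF this]
    show "(\<lambda>x. integral {-T..T} (\<lambda>t. (P t x)\<^sup>2)) integrable_on {p..q}"
      by (intro integrable_continuous_real) simp
  qed (use P_time_integral[OF T] in auto)
  also have "\<dots> = K1 * (q - p)" using pq by simp
  finally show ?thesis .
qed

lemma E_small_somewhere:
  assumes T: "0 < T" and ab: "{a..b} \<subseteq> {-T..T}" "a < b"
  shows "\<exists>t\<in>{a..b}. E t \<le> K1 * (q - p) / (b - a)"
proof (rule exists_le_average[OF E_continuous ab(2)])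
  have "integral {a..b} E \<le> integral {-T..T} E"
    by (rule integral_subset_le[OF ab(1)]) (auto intro!: integrable_continuous_real E_continuous E_nonneg)
  also have "\<dots> \<le> K1 * (q - p)" by (rule E_time_integral) (use T in simp)
  finally show "integral {a..b} E \<le> K1 * (q - p)" .
qed

text \<open>A function that vanishes at \<open>p\<close> is controlled by the integral of \<open>2 f f'\<close>. The parameter \<open>l\<close> of Young's inequality
is left open, so that \<open>l * D\<close> and \<open>E t / l\<close> can both be made small.\<close>

lemma sup_bound_of_E:
  assumes f: "\<And>x. x \<in> {p..q} \<Longrightarrow> (f has_real_derivative f' x) (at x within {p..q})" and p: "f p = 0"
    and l: "l > 0" and le: "\<And>x. x \<in> {p..q} \<Longrightarrow> 2 * f x * f' x \<le> (P t x)\<^sup>2 / l + l * D"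
    and D: "0 \<le> D" and x: "x \<in> {p..q}"
  shows "(f x)\<^sup>2 \<le> E t / l + l * D * (q - p)"
proof -
  define N where "N x = integral {p..x} (\<lambda>y. (P t y)\<^sup>2)" for x
  have Nd: "(N has_real_derivative (P t x)\<^sup>2) (at x within {p..q})" if "x \<in> {p..q}" for x
    unfolding N_def[abs_def] by (rule integral_has_real_derivative[OF _ that]) (auto intro!: continuous_intros)
  define h where "h x = (f x)\<^sup>2 - N x / l - l * D * (x - p)" for x
  have "h x \<le> h p"
  proof (rule nonincreasing_within[where p = p and q = q and f = h and f' = "\<lambda>x. 2 * f x * f' x - (P t x)\<^sup>2 / l - l * D"])
    show "(h has_real_derivative 2 * f x * f' x - (P t x)\<^sup>2 / l - l * D) (at x within {p..q})" if "x \<in> {p..q}" for x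
      unfolding h_def[abs_def] by (rule derivative_eq_intros f Nd that refl | use l in simp)+
    show "2 * f x * f' x - (P t x)\<^sup>2 / l - l * D \<le> 0" if "x \<in> {p..q}" for x using le[OF that] by simp
  qed (use x in auto)
  hence "(f x)\<^sup>2 \<le> N x / l + l * D * (x - p)" by (simp add: h_def p N_def)
  also have "N x \<le> E t"
    unfolding N_def E_def using x
    by (intro integral_subset_le integrable_continuous_real) (auto intro!: continuous_intros)
  also have "l * D * (x - p) \<le> l * D * (q - p)" using x l D by (intro mult_left_mono) auto
  finally show ?thesis using l by (simp add: divide_right_mono)
qed

lemma uniformly_small:
  assumes \<tau>: "(\<lambda>j. E (\<tau> j)) \<longlonglongrightarrow> 0" and e: "0 < e"
  shows "\<forall>\<^sub>F j in sequentially. \<forall>x\<in>{p..q}. \<bar>F (\<tau> j) x\<bar> \<le> e \<and> \<bar>P (\<tau> j) x\<bar> \<le> e"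
proof -
  \<comment> \<open>A common bound for the squares of \<open>F\<close> and \<open>P\<^sub>x\<close>.\<close>
  define D where "D = (M + c\<^sup>2 / 2 + M\<^sup>2 / 2)\<^sup>2"
  have D0: "0 \<le> D" by (simp add: D_def)
  define l where "l = e\<^sup>2 / (2 * (D * (q - p) + 1))"
  have pos: "0 < D * (q - p) + 1" using D0 pq by (simp add: add_nonneg_pos)
  have l: "0 < l" using e pos by (simp add: l_def)
  have ll: "l * D * (q - p) \<le> e\<^sup>2 / 2"
  proof -
    have "l * D * (q - p) \<le> l * (D * (q - p) + 1)" using l by (simp add: algebra_simps)
    also have "\<dots> = e\<^sup>2 / 2"
    proof -
      have "e\<^sup>2 / (2 * Y) * Y = e\<^sup>2 / 2" if "0 < Y" for Y using that by simp
      from this[OF pos] show ?thesis by (simp only: l_def)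
    qed
    finally show ?thesis .
  qed
  have "\<forall>\<^sub>F j in sequentially. dist (E (\<tau> j)) 0 < e\<^sup>2 * l / 2"
    by (rule tendstoD[OF \<tau>]) (use e l in simp)
  thus ?thesis
  proof eventually_elim
    case (elim j)
    define t where "t = \<tau> j"
    have "E t < e\<^sup>2 * l / 2" using elim by (simp add: t_def dist_real_def)
    hence El: "E t / l \<le> e\<^sup>2 / 2" using l by (simp add: divide_le_eq)
    have young: "2 * a * b \<le> a\<^sup>2 / l + l * D" if "b\<^sup>2 \<le> D" for a b :: real
    proof -
      have "0 \<le> (a - l * b)\<^sup>2 / l" using l by simp
      also have "\<dots> = a\<^sup>2 / l - 2 * a * b + l * b\<^sup>2" using l by (simp add: power2_eq_square field_simps)
      finally have "2 * a * b \<le> a\<^sup>2 / l + l * b\<^sup>2" by simp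
      also have "l * b\<^sup>2 \<le> l * D" using that l by simp
      finally show ?thesis by simp
    qed
    have sq: "b\<^sup>2 \<le> D" if "\<bar>b\<bar> \<le> M + c\<^sup>2 / 2 + M\<^sup>2 / 2" for b
      unfolding D_def using that abs_le_square_iff[of b "M + c\<^sup>2 / 2 + M\<^sup>2 / 2"] by linarith
    have wb: "(w t x)\<^sup>2 \<le> M\<^sup>2" if "x \<in> {p..q}" for x
      using bound(1)[OF that, of t] M_nonneg by (simp add: abs_le_square_iff[symmetric])
    have Fb: "(F t x)\<^sup>2 \<le> D" if "x \<in> {p..q}" for x
    proof (rule sq)
      have "\<bar>F t x\<bar> \<le> \<bar>\<Phi> t x\<bar> + c\<^sup>2 / 2" unfolding F_def using zero_le_power2[of c] by linarith
      thus "\<bar>F t x\<bar> \<le> M + c\<^sup>2 / 2 + M\<^sup>2 / 2" using bound(2)[OF that, of t] zero_le_power2[of M] by linarith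
    qed
    have Pb: "(F t x - ((w t x)\<^sup>2 - c\<^sup>2) / 2)\<^sup>2 \<le> D" if "x \<in> {p..q}" for x
    proof (rule sq)
      have "F t x - ((w t x)\<^sup>2 - c\<^sup>2) / 2 = \<Phi> t x - (w t x)\<^sup>2 / 2" by (simp add: F_def field_simps)
      thus "\<bar>F t x - ((w t x)\<^sup>2 - c\<^sup>2) / 2\<bar> \<le> M + c\<^sup>2 / 2 + M\<^sup>2 / 2"
        using bound(2)[OF that, of t] wb[OF that] zero_le_power2[of "w t x"] zero_le_power2[of c] by linarith
    qed
    have "\<bar>F t x\<bar> \<le> e \<and> \<bar>P t x\<bar> \<le> e" if x: "x \<in> {p..q}" for x
    proof
      have "(F t x)\<^sup>2 \<le> E t / l + l * D * (q - p)"
      proof (rule sup_bound_of_E[where f = "F t" and f' = "P t" and t = t and l = l and D = D])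
        fix y assume "y \<in> {p..q}"
        show "2 * F t y * P t y \<le> (P t y)\<^sup>2 / l + l * D"
          using young[OF Fb[OF \<open>y \<in> {p..q}\<close>], of "P t y"] by (simp add: mult_ac)
      qed (use x l D0 in \<open>auto intro: F_x simp: F_def left\<close>)
      hence "(F t x)\<^sup>2 \<le> e\<^sup>2" using El ll by linarith
      thus "\<bar>F t x\<bar> \<le> e" using e by (simp add: power2_le_iff_abs_le)
      have "(P t x)\<^sup>2 \<le> E t / l + l * D * (q - p)"
      proof (rule sup_bound_of_E[where f = "P t" and f' = "\<lambda>x. F t x - ((w t x)\<^sup>2 - c\<^sup>2) / 2" and t = t and l = l and D = D])
        fix y assume "y \<in> {p..q}"
        show "2 * P t y * (F t y - ((w t y)\<^sup>2 - c\<^sup>2) / 2) \<le> (P t y)\<^sup>2 / l + l * D"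
          by (rule young[OF Pb[OF \<open>y \<in> {p..q}\<close>]])
      qed (use x l D0 in \<open>auto intro: P_x' simp: left\<close>)
      hence "(P t x)\<^sup>2 \<le> e\<^sup>2" using El ll by linarith
      thus "\<bar>P t x\<bar> \<le> e" using e by (simp add: power2_le_iff_abs_le)
    qed
    thus ?case by (simp add: t_def)
  qed
qed

text \<open>By the Arzela--Ascoli theorem there is a uniform limit \<open>g\<close>. As \<open>P\<close> and \<open>F\<close> tend to zero, integrating
\<open>P\<^sub>x = F - (w\<^sup>2 - c\<^sup>2)/2\<close> in \<open>x\<close> shows \<open>g\<^sup>2 = c\<^sup>2\<close>. By continuity \<open>g\<close> cannot change sign, and \<open>g p = c\<close>.\<close>

lemma subsequence_to_constant:
  assumes \<tau>: "(\<lambda>j. E (\<tau> j)) \<longlonglongrightarrow> 0"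
  obtains k :: "nat \<Rightarrow> nat" where "strict_mono k" "uniform_limit {p..q} (\<lambda>j. w (\<tau> (k j))) (\<lambda>_. c) sequentially"
proof -
  obtain g k where g: "continuous_on {p..q} g" and k: "strict_mono (k :: nat \<Rightarrow> nat)"
    and lim: "\<And>e. 0 < e \<Longrightarrow> \<exists>N. \<forall>n x. n \<ge> N \<and> x \<in> {p..q} \<longrightarrow> norm (w (\<tau> (k n)) x - g x) < e"
  proof (rule Arzela_Ascoli[of "{p..q}" "\<lambda>j. w (\<tau> j)" M])
    show "norm (w (\<tau> n) x) \<le> M" if "x \<in> {p..q}" for n x using bound(1)[OF that] by simp
    show "\<exists>d>0. \<forall>n y. y \<in> {p..q} \<and> norm (x - y) < d \<longrightarrow> norm (w (\<tau> n) x - w (\<tau> n) y) < e"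
      if "x \<in> {p..q}" "0 < e" for x e
      using equi[OF that(2)] that(1) by (metis real_norm_def)
  qed auto
  have ul: "uniform_limit {p..q} (\<lambda>j. w (\<tau> (k j))) g sequentially"
    unfolding uniform_limit_sequentially_iff
  proof (intro allI impI)
    fix e :: real assume "e > 0"
    from lim[OF this] show "\<exists>N. \<forall>n\<ge>N. \<forall>x\<in>{p..q}. dist (w (\<tau> (k n)) x) (g x) < e"
      unfolding dist_norm by blast
  qed
  have gM: "\<bar>g x\<bar> \<le> M" if "x \<in> {p..q}" for x
    by (rule tendsto_upperbound[OF tendsto_rabs[OF tendsto_uniform_limitI[OF ul that]]])
       (auto intro!: always_eventually bound that)
  have \<tau>k: "(\<lambda>j. E (\<tau> (k j))) \<longlonglongrightarrow> 0"
    using LIMSEQ_subseq_LIMSEQ[OF \<tau> k] by (simp add: o_def)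
  have int0: "integral {p..x} (\<lambda>y. ((g y)\<^sup>2 - c\<^sup>2) / 2) = 0" if x: "x \<in> {p..q}" for x
  proof -
    have sub: "{p..x} \<subseteq> {p..q}" using x by auto
    have "uniform_limit {p..x} (\<lambda>j y. ((w (\<tau> (k j)) y)\<^sup>2 - c\<^sup>2) / 2) (\<lambda>y. ((g y)\<^sup>2 - c\<^sup>2) / 2) sequentially"
    proof (rule uniform_limitI)
      fix e :: real assume e: "e > 0"
      have "\<forall>\<^sub>F j in sequentially. \<forall>y\<in>{p..q}. dist (w (\<tau> (k j)) y) (g y) < e / (M + 1)"
        by (rule uniform_limitD[OF ul]) (use e M_nonneg in simp)
      thus "\<forall>\<^sub>F j in sequentially. \<forall>y\<in>{p..x}. dist (((w (\<tau> (k j)) y)\<^sup>2 - c\<^sup>2) / 2) (((g y)\<^sup>2 - c\<^sup>2) / 2) < e"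
      proof eventually_elim
        case (elim j)
        show ?case
        proof
          fix y assume "y \<in> {p..x}"
          hence y: "y \<in> {p..q}" using sub by blast
          have "dist (((w (\<tau> (k j)) y)\<^sup>2 - c\<^sup>2) / 2) (((g y)\<^sup>2 - c\<^sup>2) / 2)
              = \<bar>w (\<tau> (k j)) y - g y\<bar> * (\<bar>w (\<tau> (k j)) y + g y\<bar> / 2)"
          proof -
            have "((w (\<tau> (k j)) y)\<^sup>2 - c\<^sup>2) / 2 - ((g y)\<^sup>2 - c\<^sup>2) / 2
                = (w (\<tau> (k j)) y - g y) * ((w (\<tau> (k j)) y + g y) / 2)"
              by (simp add: power2_eq_square field_simps)
            thus ?thesis unfolding dist_real_def by (simp only: abs_mult abs_divide abs_numeral)
          qed
          also have "\<dots> \<le> \<bar>w (\<tau> (k j)) y - g y\<bar> * (M + 1)"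
            using bound(1)[OF y, of "\<tau> (k j)"] gM[OF y] by (intro mult_left_mono) auto
          also have "\<dots> < e"
            using elim y M_nonneg by (simp add: dist_real_def pos_less_divide_eq)
          finally show "dist (((w (\<tau> (k j)) y)\<^sup>2 - c\<^sup>2) / 2) (((g y)\<^sup>2 - c\<^sup>2) / 2) < e" .
        qed
      qed
    qed
    moreover have cw: "continuous_on {p..x} (\<lambda>y. ((w t y)\<^sup>2 - c\<^sup>2) / 2)" for t
      using sub by (auto intro!: continuous_intros)
    ultimately obtain I J where I: "\<And>j. ((\<lambda>y. ((w (\<tau> (k j)) y)\<^sup>2 - c\<^sup>2) / 2) has_integral I j) {p..x}"
      and J: "((\<lambda>y. ((g y)\<^sup>2 - c\<^sup>2) / 2) has_integral J) {p..x}" and IJ: "(I \<longlongrightarrow> J) sequentially"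
      by (rule uniform_limit_integral) auto
    have "I \<longlonglongrightarrow> 0"
    proof (rule tendstoI)
      fix e :: real assume e: "0 < e"
      define e' where "e' = e / (2 * (q - p + 1))"
      have e': "0 < e'" using e pq by (simp add: e'_def)
      have ee: "e' * (q - p) + e' < e"
      proof -
        have "e' * (q - p) + e' = e' * (q - p + 1)" by (simp add: algebra_simps)
        also have "\<dots> = e / 2"
        proof -
          have "e / (2 * Y) * Y = e / 2" if "0 < Y" for Y using that by simp
          from this[of "q - p + 1"] show ?thesis using pq by (simp only: e'_def)
        qed
        finally show ?thesis using e by simp
      qed
      show "\<forall>\<^sub>F j in sequentially. dist (I j) 0 < e"
        using uniformly_small[OF \<tau>k e']
      proof eventually_elim
        case (elim j)
        define t where "t = \<tau> (k j)"
        have A: "((\<lambda>y. F t y - ((w t y)\<^sup>2 - c\<^sup>2) / 2) has_integral (P t x - P t p)) {p..x}"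
        proof (rule fundamental_theorem_of_calculus)
          fix y assume "y \<in> {p..x}"
          hence "y \<in> {p..q}" using sub by blast
          from DERIV_subset[OF P_x'[OF this] sub]
          show "(P t has_vector_derivative F t y - ((w t y)\<^sup>2 - c\<^sup>2) / 2) (at y within {p..x})"
            by (simp add: has_real_derivative_iff_has_vector_derivative)
        qed (use x in simp)
        have Fc: "continuous_on {p..x} (F t)" using sub by (auto intro!: continuous_intros)
        hence "(F t has_integral integral {p..x} (F t)) {p..x}"
          by (intro integrable_integral integrable_continuous_real)
        from has_integral_diff[OF this A]
        have "((\<lambda>y. F t y - (F t y - ((w t y)\<^sup>2 - c\<^sup>2) / 2)) has_integral (integral {p..x} (F t) - (P t x - P t p))) {p..x}" .
        hence "((\<lambda>y. ((w t y)\<^sup>2 - c\<^sup>2) / 2) has_integral (integral {p..x} (F t) - P t x)) {p..x}"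
          by (simp add: left)
        hence Ij: "I j = integral {p..x} (F t) - P t x"
          using has_integral_unique[OF I[of j]] by (simp add: t_def)
        have "norm (integral {p..x} (F t)) \<le> e' * (x - p)"
          by (rule integral_bound) (use x Fc elim sub in \<open>auto simp: t_def\<close>)
        also have "\<dots> \<le> e' * (q - p)" using x e' by (intro mult_left_mono) auto
        finally have "\<bar>integral {p..x} (F t)\<bar> \<le> e' * (q - p)" by simp
        moreover have "\<bar>P t x\<bar> \<le> e'" using elim x by (simp add: t_def)
        ultimately have "\<bar>I j\<bar> \<le> e' * (q - p) + e'"
          unfolding Ij by linarith
        thus ?case using ee by (simp add: dist_real_def)
      qed
    qed
    with IJ have "J = 0" by (rule LIMSEQ_unique)
    with integral_unique[OF J] show ?thesis by (simp only:)
  qed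
  have gsq: "(g x)\<^sup>2 = c\<^sup>2" if x: "x \<in> {p..q}" for x
  proof -
    have gc: "continuous_on {p..q} (\<lambda>y. ((g y)\<^sup>2 - c\<^sup>2) / 2)" by (intro continuous_intros g) auto
    have "((\<lambda>x. integral {p..x} (\<lambda>y. ((g y)\<^sup>2 - c\<^sup>2) / 2)) has_vector_derivative ((g x)\<^sup>2 - c\<^sup>2) / 2) (at x within {p..q})"
      by (rule integral_has_vector_derivative[OF gc x])
    hence d: "((\<lambda>x. 0 :: real) has_vector_derivative ((g x)\<^sup>2 - c\<^sup>2) / 2) (at x within {p..q})"
      by (rule has_vector_derivative_transform[OF x, rotated]) (simp only: int0)
    have "((g x)\<^sup>2 - c\<^sup>2) / 2 = 0"
      by (rule vector_derivative_unique_within_closed_interval[OF pq, unfolded box_real, OF x d])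
        (rule has_vector_derivative_const)
    thus ?thesis by simp
  qed
  have gp: "g p = c"
    using tendsto_unique[OF _ tendsto_uniform_limitI[OF ul, of p], of c] pq left by auto
  have gx: "g x = c" if x: "x \<in> {p..q}" for x
  proof (rule ccontr)
    assume "g x \<noteq> c"
    hence gm: "g x = - c" "c \<noteq> 0" using gsq[OF x] by (auto simp: power2_eq_iff)
    have cpx: "continuous_on {p..x} g" using g x by (auto intro: continuous_on_subset)
    have "\<exists>z. p \<le> z \<and> z \<le> x \<and> g z = 0"
    proof (cases "c > 0")
      case True thus ?thesis using IVT2'[of g x 0 p] gm gp x cpx by auto
    next
      case False thus ?thesis using IVT'[of g p 0 x] gm gp x cpx by auto
    qed
    then obtain z where z: "p \<le> z" "z \<le> x" "g z = 0" by blast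
    have "z \<in> {p..q}" using z x by simp
    thus False using gsq[of z] gm z by simp
  qed
  have "uniform_limit {p..q} (\<lambda>j. w (\<tau> (k j))) (\<lambda>_. c) sequentially"
    using ul by (rule uniform_limit_cong'[THEN iffD1, rotated -1]) (auto simp: gx)
  thus thesis using that k by blast
qed

text \<open>The integral of \<open>E\<close> over all times is finite, so on the intervals between \<open>j\<close> and \<open>2 j\<close>, and between \<open>- 2 j\<close> and
\<open>- j\<close>, \<open>E\<close> has small values.\<close>

lemma E_sequences:
  shows "\<exists>\<tau>. (\<forall>j. real j \<le> \<tau> j) \<and> (\<lambda>j. E (\<tau> j)) \<longlonglongrightarrow> 0"
    and "\<exists>\<tau>. (\<forall>j. \<tau> j \<le> - real j) \<and> (\<lambda>j. E (\<tau> j)) \<longlonglongrightarrow> 0"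
proof -
  have lim: "(\<lambda>j. K1 * (q - p) / real (Suc j)) \<longlonglongrightarrow> 0"
    using tendsto_mult_right_zero[OF lim_inverse_n'[THEN LIMSEQ_Suc], of "K1 * (q - p)"]
    by (simp add: divide_inverse)
  have z: "(\<lambda>j. E (\<tau> j)) \<longlonglongrightarrow> 0" if "\<And>j. E (\<tau> j) \<le> K1 * (q - p) / real (Suc j)" for \<tau>
    by (rule tendsto_sandwich[OF _ _ tendsto_const lim]) (rule always_eventually, rule allI, rule that E_nonneg)+
  have "\<exists>t\<in>{real (Suc j)..2 * real (Suc j)}. E t \<le> K1 * (q - p) / real (Suc j)" for j
    using E_small_somewhere[of "2 * real (Suc j)" "real (Suc j)" "2 * real (Suc j)"] by (auto simp del: of_nat_Suc)
  then obtain \<tau> where "\<And>j. \<tau> j \<in> {real (Suc j)..2 * real (Suc j)}" "\<And>j. E (\<tau> j) \<le> K1 * (q - p) / real (Suc j)" by metis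
  thus "\<exists>\<tau>. (\<forall>j. real j \<le> \<tau> j) \<and> (\<lambda>j. E (\<tau> j)) \<longlonglongrightarrow> 0"
  proof (intro exI[of _ \<tau>] conjI allI)
    fix j
    have "real (Suc j) \<le> \<tau> j" using \<open>\<And>j. \<tau> j \<in> {real (Suc j)..2 * real (Suc j)}\<close>[of j] by simp
    thus "real j \<le> \<tau> j" by simp
  qed (rule z, rule \<open>\<And>j. E (\<tau> j) \<le> K1 * (q - p) / real (Suc j)\<close>)
  have "\<exists>t\<in>{- 2 * real (Suc j)..- real (Suc j)}. E t \<le> K1 * (q - p) / real (Suc j)" for j
    using E_small_somewhere[of "2 * real (Suc j)" "- 2 * real (Suc j)" "- real (Suc j)"] by (auto simp del: of_nat_Suc)
  then obtain \<sigma> where "\<And>j. \<sigma> j \<in> {- 2 * real (Suc j)..- real (Suc j)}" "\<And>j. E (\<sigma> j) \<le> K1 * (q - p) / real (Suc j)" by metis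
  thus "\<exists>\<tau>. (\<forall>j. \<tau> j \<le> - real j) \<and> (\<lambda>j. E (\<tau> j)) \<longlonglongrightarrow> 0"
  proof (intro exI[of _ \<sigma>] conjI allI)
    fix j
    have "\<sigma> j \<le> - real (Suc j)" using \<open>\<And>j. \<sigma> j \<in> {- 2 * real (Suc j)..- real (Suc j)}\<close>[of j] by simp
    thus "\<sigma> j \<le> - real j" by simp
  qed (rule z, rule \<open>\<And>j. E (\<sigma> j) \<le> K1 * (q - p) / real (Suc j)\<close>)
qed

lemma weighted_integral_tendsto:
  assumes ul: "uniform_limit {p..q} (\<lambda>j. w (\<tau> j)) (\<lambda>_. c) sequentially" and h: "continuous_on {p..q} h"
  shows "(\<lambda>j. integral {p..q} (\<lambda>x. h x * (w (\<tau> j) x - c))) \<longlonglongrightarrow> 0"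
proof -
  have "bounded (h ` {p..q})" by (intro compact_imp_bounded compact_continuous_image h) auto
  moreover have "uniform_limit {p..q} (\<lambda>j x. w (\<tau> j) x - c) (\<lambda>x. c - c) sequentially"
    by (intro uniform_limit_intros ul)
  ultimately have "uniform_limit {p..q} (\<lambda>j x. h x * (w (\<tau> j) x - c)) (\<lambda>x. h x * (c - c)) sequentially"
    by (intro uniform_lim_mult uniform_limit_const) (auto simp: image_constant_conv)
  hence u: "uniform_limit {p..q} (\<lambda>j x. h x * (w (\<tau> j) x - c)) (\<lambda>x. 0) sequentially" by simp
  have "continuous_on {p..q} (\<lambda>x. h x * (w (\<tau> j) x - c))" for j by (auto intro!: continuous_intros h)
  then obtain I J where "\<And>j. ((\<lambda>x. h x * (w (\<tau> j) x - c)) has_integral I j) {p..q}" "((\<lambda>x. 0::real) has_integral J) {p..q}" "(I \<longlongrightarrow> J) sequentially"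
    using uniform_limit_integral[OF u] by (metis trivial_limit_sequentially)
  thus ?thesis by (metis (no_types, lifting) ext has_integral_0 has_integral_unique integral_unique)
qed

text \<open>\<open>m\<close> is conserved because \<open>F\<close> has equal values at both ends, and \<open>L\<close> is nondecreasing because its derivative is
\<open>\<integral> F dx = \<integral> (w\<^sup>2 - c\<^sup>2)/2 dx = D/2 + c m\<close> and \<open>m = 0\<close>. Both tend to zero along times going to \<open>\<infinity>\<close> and to \<open>-\<infinity>\<close>. It
is here that the solution must exist for all times in both directions.\<close>

theorem band_solution_constant:
  assumes x: "x \<in> {p..q}" shows "w t x = c"
proof -
  define m where "m t = integral {p..q} (\<lambda>x. 1 * (w t x - c))" for t
  define L where "L t = integral {p..q} (\<lambda>x. (x - p) * (w t x - c))" for t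
  define D where "D t = integral {p..q} (\<lambda>x. (w t x - c)\<^sup>2)" for t
  have PF: "((\<lambda>x. F t x - ((w t x)\<^sup>2 - c\<^sup>2) / 2) has_integral 0) {p..q}" for t
    using fundamental_theorem_of_calculus[of p q "P t" "\<lambda>x. F t x - ((w t x)\<^sup>2 - c\<^sup>2) / 2"] P_x' pq
    by (simp add: has_real_derivative_iff_has_vector_derivative left right)
  have Pint: "integral {p..q} (P t) = 0" for t
    using fundamental_theorem_of_calculus[of p q "F t" "P t"] F_x pq
    by (simp add: has_real_derivative_iff_has_vector_derivative left right F_def integral_unique)
  have Fint: "integral {p..q} (F t) = D t / 2 + c * m t" for t
  proof -
    have F: "(F t has_integral integral {p..q} (F t)) {p..q}"
      by (intro integrable_integral integrable_continuous_real) (auto intro!: continuous_intros)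
    have 1: "((\<lambda>x. (w t x - c)\<^sup>2) has_integral D t) {p..q}" "((\<lambda>x. 1 * (w t x - c)) has_integral m t) {p..q}"
      unfolding D_def m_def by (intro integrable_integral integrable_continuous_real; auto intro!: continuous_intros)+
    have "((\<lambda>x. (w t x - c)\<^sup>2 / 2 + c * (1 * (w t x - c))) has_integral (D t / 2 + c * m t)) {p..q}"
      by (intro has_integral_add has_integral_divide has_integral_mult_right 1)
    moreover have "(\<lambda>x. (w t x - c)\<^sup>2 / 2 + c * (1 * (w t x - c))) = (\<lambda>x. F t x - (F t x - ((w t x)\<^sup>2 - c\<^sup>2) / 2))"
      by (simp add: fun_eq_iff power2_eq_square field_simps)
    moreover have "((\<lambda>x. F t x - (F t x - ((w t x)\<^sup>2 - c\<^sup>2) / 2)) has_integral (integral {p..q} (F t) - 0)) {p..q}"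
      by (rule has_integral_diff[OF F PF])
    ultimately have "((\<lambda>x. (w t x - c)\<^sup>2 / 2 + c * (1 * (w t x - c))) has_integral integral {p..q} (F t)) {p..q}"
      "((\<lambda>x. (w t x - c)\<^sup>2 / 2 + c * (1 * (w t x - c))) has_integral (D t / 2 + c * m t)) {p..q}"
      by (simp_all only: diff_zero)
    thus ?thesis by (rule has_integral_unique)
  qed
  have md: "(m has_real_derivative 0) (at t)" for t
  proof -
    have "(m has_real_derivative integral {p..q} (\<lambda>x. - P t x)) (at t within UNIV)"
      unfolding m_def
    proof (rule leibniz_Icc)
      fix t x assume x: "x \<in> {p..q}"
      show "((\<lambda>t. 1 * (w t x - c)) has_real_derivative - P t x) (at t within UNIV)"
        using DERIV_diff[OF w_t[OF x] DERIV_const] by simp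
    qed (auto intro!: continuous_intros simp: split_beta)
    thus ?thesis using Pint by simp
  qed
  have Ld: "(L has_real_derivative D t / 2 + c * m t) (at t)" for t
  proof -
    have "(L has_real_derivative integral {p..q} (\<lambda>x. (x - p) * - P t x)) (at t within UNIV)"
      unfolding L_def
    proof (rule leibniz_Icc)
      fix t x assume x: "x \<in> {p..q}"
      show "((\<lambda>t. (x - p) * (w t x - c)) has_real_derivative (x - p) * - P t x) (at t within UNIV)"
        using DERIV_cmult[OF DERIV_diff[OF w_t[OF x] DERIV_const]] by simp
    qed (auto intro!: continuous_intros simp: split_beta)
    moreover have "integral {p..q} (\<lambda>x. (x - p) * - P t x) = integral {p..q} (F t)"
    proof -
      have "((\<lambda>x. F t x + (x - p) * P t x) has_integral ((q - p) * F t q - (p - p) * F t p)) {p..q}"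
      proof (rule fundamental_theorem_of_calculus)
        fix x assume x: "x \<in> {p..q}"
        have "((\<lambda>x. (x - p) * F t x) has_real_derivative F t x + (x - p) * P t x) (at x within {p..q})"
          by (rule derivative_eq_intros F_x[OF x] refl | simp)+
        thus "((\<lambda>x. (x - p) * F t x) has_vector_derivative F t x + (x - p) * P t x) (at x within {p..q})"
          by (simp add: has_real_derivative_iff_has_vector_derivative)
      qed (use pq in simp)
      hence 0: "((\<lambda>x. F t x + (x - p) * P t x) has_integral 0) {p..q}" by (simp add: F_def right)
      have F: "(F t has_integral integral {p..q} (F t)) {p..q}"
        by (intro integrable_integral integrable_continuous_real) (auto intro!: continuous_intros)
      have "((\<lambda>x. F t x - (F t x + (x - p) * P t x)) has_integral (integral {p..q} (F t) - 0)) {p..q}"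
        by (rule has_integral_diff[OF F 0])
      hence "((\<lambda>x. (x - p) * - P t x) has_integral integral {p..q} (F t)) {p..q}" by simp
      thus ?thesis by (rule integral_unique)
    qed
    ultimately show ?thesis using Fint by simp
  qed
  obtain \<tau> where \<tau>: "\<And>j. real j \<le> \<tau> j" "(\<lambda>j. E (\<tau> j)) \<longlonglongrightarrow> 0" using E_sequences(1) by blast
  obtain \<sigma> where \<sigma>: "\<And>j. \<sigma> j \<le> - real j" "(\<lambda>j. E (\<sigma> j)) \<longlonglongrightarrow> 0" using E_sequences(2) by blast
  obtain k where k: "strict_mono k" "uniform_limit {p..q} (\<lambda>j. w (\<tau> (k j))) (\<lambda>_. c) sequentially"
    using subsequence_to_constant[OF \<tau>(2)] by blast
  obtain l where l: "strict_mono l" "uniform_limit {p..q} (\<lambda>j. w (\<sigma> (l j))) (\<lambda>_. c) sequentially"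
    using subsequence_to_constant[OF \<sigma>(2)] by blast
  have kge: "real j \<le> \<tau> (k j)" for j using \<tau>(1)[of "k j"] seq_suble[OF k(1), of j] by linarith
  have lle: "\<sigma> (l j) \<le> - real j" for j using \<sigma>(1)[of "l j"] seq_suble[OF l(1), of j] by linarith
  have m0: "m t = 0" for t
  proof -
    have mt: "m s = m t" for s using DERIV_isconst_all[of m s t] md by blast
    have "(\<lambda>j. m (\<tau> (k j))) \<longlonglongrightarrow> 0"
      unfolding m_def by (rule weighted_integral_tendsto[OF k(2)]) auto
    moreover have "(\<lambda>j. m (\<tau> (k j))) = (\<lambda>j. m t)" by (rule ext) (rule mt)
    ultimately have "(\<lambda>j::nat. m t) \<longlonglongrightarrow> 0" by (simp only:)
    thus ?thesis by (simp add: LIMSEQ_const_iff)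
  qed
  have Dn: "0 \<le> D t" for t
    unfolding D_def by (intro integral_nonneg integrable_continuous_real) (auto intro!: continuous_intros)
  have Lmono: "L s \<le> L t" if "s \<le> t" for s t
    by (rule DERIV_nonneg_imp_nondecreasing[OF that]) (use Ld m0 Dn in \<open>auto intro!: exI\<close>)
  have L0: "L t = 0" for t
  proof (rule antisym)
    have "(\<lambda>j. L (\<tau> (k j))) \<longlonglongrightarrow> 0"
      unfolding L_def by (rule weighted_integral_tendsto[OF k(2)]) (auto intro!: continuous_intros)
    moreover have "\<forall>\<^sub>F j in sequentially. L t \<le> L (\<tau> (k j))"
      using eventually_ge_at_top[of "nat \<lceil>t\<rceil>"]
    proof eventually_elim
      case (elim j)
      have "t \<le> real j" using elim by linarith
      thus ?case using kge[of j] by (intro Lmono) linarith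
    qed
    ultimately show "L t \<le> 0" by (rule tendsto_lowerbound) simp
    have "(\<lambda>j. L (\<sigma> (l j))) \<longlonglongrightarrow> 0"
      unfolding L_def by (rule weighted_integral_tendsto[OF l(2)]) (auto intro!: continuous_intros)
    moreover have "\<forall>\<^sub>F j in sequentially. L (\<sigma> (l j)) \<le> L t"
      using eventually_ge_at_top[of "nat \<lceil>- t\<rceil>"]
    proof eventually_elim
      case (elim j)
      have "- t \<le> real j" using elim by linarith
      thus ?case using lle[of j] by (intro Lmono) linarith
    qed
    ultimately show "0 \<le> L t" by (rule tendsto_upperbound) simp
  qed
  have "L = (\<lambda>_. 0)" by (rule ext) (rule L0)
  hence "(L has_real_derivative 0) (at t)" by (simp only: DERIV_const)
  from DERIV_unique[OF this Ld[of t]] have "D t = 0" using m0 by simp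
  moreover have "continuous_on {p..q} (\<lambda>x. (w t x - c)\<^sup>2)" by (auto intro!: continuous_intros)
  ultimately have "\<forall>x\<in>{p..q}. (w t x - c)\<^sup>2 = 0"
    unfolding D_def using integral_eq_0_iff[of p q "\<lambda>x. (w t x - c)\<^sup>2"] pq by simp
  thus ?thesis using x by simp
qed

end

section \<open>Absolutely convergent Fourier series\<close>

text \<open>The continuous representative of a function with summable coefficients.\<close>

definition fser :: "(int \<Rightarrow> complex) \<Rightarrow> real \<Rightarrow> real" where
  "fser c x = Re (\<Sum>\<^sub>\<infinity>n. c n * char n x)"

lemma fser_summable:
  assumes "(\<lambda>n. cmod (c n)) summable_on UNIV"
  shows "(\<lambda>n. cmod (c n * char n x)) summable_on UNIV" "(\<lambda>n. c n * char n x) summable_on UNIV"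
proof -
  show 1: "(\<lambda>n. cmod (c n * char n x)) summable_on UNIV" using assms by (simp add: norm_mult)
  show "(\<lambda>n. c n * char n x) summable_on UNIV" by (rule abs_summable_summable[OF 1])
qed

lemma fser_periodic: "fser c (x + 2 * pi) = fser c x"
  by (simp add: fser_def char_periodic)

lemma psum_uniform_limit:
  assumes c: "(\<lambda>n. cmod (c n)) summable_on UNIV"
  shows "uniform_limit UNIV (psum c) (fser c) sequentially"
proof (rule uniform_limitI)
  fix e :: real assume e: "0 < e"
  have "(\<lambda>N. \<Sum>n\<in>{- int N..int N}. cmod (c n)) \<longlonglongrightarrow> (\<Sum>\<^sub>\<infinity>n. cmod (c n))"
    by (rule symmetric_sums_tendsto) (use c in simp)
  hence "\<forall>\<^sub>F N in sequentially. dist (\<Sum>n\<in>{- int N..int N}. cmod (c n)) (\<Sum>\<^sub>\<infinity>n. cmod (c n)) < e"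
    using e by (rule tendstoD)
  thus "\<forall>\<^sub>F N in sequentially. \<forall>x\<in>UNIV. dist (psum c N x) (fser c x) < e"
  proof eventually_elim
    case (elim N)
    let ?A = "{- int N..int N}"
    have split: "infsum f UNIV = sum f ?A + infsum f (- ?A)" if "f summable_on UNIV" for f :: "int \<Rightarrow> 'b::banach"
    proof -
      have "infsum f (?A \<union> - ?A) = infsum f ?A + infsum f (- ?A)"
        by (rule infsum_Un_disjoint) (auto intro: summable_on_subset_banach[OF that])
      thus ?thesis by (simp add: Compl_partition)
    qed
    show ?case
    proof
      fix x
      have tail: "(\<lambda>n. cmod (c n * char n x)) summable_on (- ?A)"
        by (rule summable_on_subset_banach[OF fser_summable(1)[OF c]]) simp
      have "dist (psum c N x) (fser c x) = \<bar>Re ((\<Sum>\<^sub>\<infinity>n. c n * char n x) - tpoly c ?A x)\<bar>"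
        by (simp add: dist_real_def psum_def fser_def abs_minus_commute)
      also have "\<dots> \<le> cmod ((\<Sum>\<^sub>\<infinity>n. c n * char n x) - tpoly c ?A x)" by (rule abs_Re_le_cmod)
      also have "(\<Sum>\<^sub>\<infinity>n. c n * char n x) - tpoly c ?A x = infsum (\<lambda>n. c n * char n x) (- ?A)"
        unfolding split[OF fser_summable(2)[OF c]] by (simp add: tpoly_def)
      also have "cmod \<dots> \<le> infsum (\<lambda>n. cmod (c n * char n x)) (- ?A)" by (rule norm_infsum_bound[OF tail])
      also have "\<dots> = infsum (\<lambda>n. cmod (c n)) (- ?A)" by (simp add: norm_mult)
      also have "\<dots> = (\<Sum>\<^sub>\<infinity>n. cmod (c n)) - (\<Sum>n\<in>?A. cmod (c n))"
        unfolding split[OF c] by simp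
      also have "\<dots> < e" using elim unfolding dist_real_def by linarith
      finally show "dist (psum c N x) (fser c x) < e" .
    qed
  qed
qed

lemma fser_continuous:
  assumes c: "(\<lambda>n. cmod (c n)) summable_on UNIV"
  shows "continuous_on A (fser c)"
proof -
  have "continuous_on UNIV (fser c)"
  proof (rule uniform_limit_theorem[OF _ psum_uniform_limit[OF c]])
    show "\<forall>\<^sub>F N in sequentially. continuous_on UNIV (psum c N)"
      unfolding psum_def[abs_def] tpoly_def by (intro always_eventually allI continuous_intros)
  qed simp
  thus ?thesis by (rule continuous_on_subset) simp
qed

lemma continuous_periodic_L2:
  assumes "continuous_on UNIV f" "periodic_2pi f" shows "f \<in> torus_L2"
  using periodic_continuous_bounded[OF assms(2,1)] torus_L2_bounded[OF borel_measurable_continuous_onI[OF assms(1)]] by metis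

lemma fser_L2: "(\<lambda>n. cmod (c n)) summable_on UNIV \<Longrightarrow> fser c \<in> torus_L2"
  by (intro continuous_periodic_L2 fser_continuous) (auto simp: periodic_2pi_def fser_periodic)

lemma fourier_coeff_fser:
  assumes c: "(\<lambda>n. cmod (c n)) summable_on UNIV" and herm: "\<And>n. c (- n) = cnj (c n)"
  shows "fourier_coeff (fser c) n = c n"
proof (rule fourier_coeff_of_L2_limit[where c = c, OF fser_L2[OF c] _ herm])
  show "(\<lambda>N. \<integral>x. (fser c x - psum c N x)\<^sup>2 \<partial>tor) \<longlonglongrightarrow> 0"
  proof (rule tendstoI)
    fix e :: real assume e: "0 < e"
    hence "0 < sqrt (e / 2)" by simp
    from uniform_limitD[OF psum_uniform_limit[OF c] this]
    show "\<forall>\<^sub>F N in sequentially. dist (\<integral>x. (fser c x - psum c N x)\<^sup>2 \<partial>tor) 0 < e"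
    proof eventually_elim
      case (elim N)
      have "(fser c x - psum c N x)\<^sup>2 \<le> e / 2" for x
      proof -
        have "dist (psum c N x) (fser c x) < sqrt (e / 2)" using elim by blast
        hence "\<bar>fser c x - psum c N x\<bar> \<le> sqrt (e / 2)" unfolding dist_real_def by linarith
        hence "\<bar>fser c x - psum c N x\<bar>\<^sup>2 \<le> (sqrt (e / 2))\<^sup>2" by (intro power_mono) auto
        thus ?thesis using e by simp
      qed
      hence "(\<integral>x. (fser c x - psum c N x)\<^sup>2 \<partial>tor) \<le> (\<integral>x. e / 2 \<partial>tor)"
        by (intro integral_mono torus_L2_square torus_L2_diff fser_L2 c psum_L2) auto
      moreover have "0 \<le> (\<integral>x. (fser c x - psum c N x)\<^sup>2 \<partial>tor)" by simp
      ultimately show ?case using e by (simp add: dist_real_def)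
    qed
  qed
qed

lemma fourier_coeff_indicator:
  assumes "0 \<le> y" "y \<le> x" "x \<le> 2 * pi"
  shows "of_int n * fourier_coeff (indicator {y..x}) (- n) = (char n x - char n y) / (2 * pi * \<i>)"
proof (cases "n = 0")
  case False
  have "fourier_coeff (indicator {y..x}) (- n) = (1 / (2*pi)) *\<^sub>R (LINT z:{0..2*pi}|lborel. indicator {y..x} z *\<^sub>R char n z)"
    by (subst fourier_coeff_tor, simp, subst integral_tor) auto
  also have "(LINT z:{0..2*pi}|lborel. indicator {y..x} z *\<^sub>R char n z) = (LINT z|lborel. indicator {y..x} z *\<^sub>R char n z)"
    unfolding set_lebesgue_integral_def
    by (rule Bochner_Integration.integral_cong) (use assms in \<open>auto simp: indicator_def\<close>)
  also have "\<dots> = char n x / (\<i> * of_int n) - char n y / (\<i> * of_int n)"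
  proof (rule integral_FTC_atLeastAtMost)
    show "((\<lambda>x. char n x / (\<i> * of_int n)) has_vector_derivative char n z) (at z within {y..x})" for z
      using has_vector_derivative_divide[OF char_has_vector_derivative[of n z "{y..x}"], of "\<i> * of_int n"] False
      by simp
  qed (use assms in \<open>auto intro!: continuous_intros\<close>)
  finally show ?thesis using False by (simp add: scaleR_conv_of_real field_simps)
qed simp

text \<open>Parseval's identity for \<open>y\<close> and the indicator of \<open>{a..b}\<close>.\<close>

lemma fser_diff_eq_integral:
  assumes c: "(\<lambda>n. cmod (c n)) summable_on UNIV"
    and y: "y \<in> torus_L2" "\<And>n. fourier_coeff y n = \<i> * of_int n * c n"
    and ab: "0 \<le> a" "a \<le> b" "b \<le> 2 * pi"
  shows "fser c b - fser c a = (LINT z:{a..b}|lborel. y z)"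
proof -
  have iL: "indicator {a..b} \<in> torus_L2"
    by (rule torus_L2_bounded[of _ 1]) (auto simp: indicator_def)
  note [measurable] = torus_L2_measurable[OF y(1)]
  have "((\<lambda>k. fourier_coeff y k * fourier_coeff (indicator {a..b}) (0 - k)) has_sum fourier_coeff (\<lambda>z. y z * indicator {a..b} z) 0) UNIV"
    by (rule fourier_coeff_mult[OF y(1) iL])
  moreover have "fourier_coeff y k * fourier_coeff (indicator {a..b}) (0 - k) = (1 / (2 * pi)) * (c k * char k b - c k * char k a)" for k
  proof -
    have "fourier_coeff y k * fourier_coeff (indicator {a..b}) (0 - k) = \<i> * c k * (of_int k * fourier_coeff (indicator {a..b}) (- k))"
      by (simp add: y(2))
    also have "\<dots> = \<i> * c k * ((char k b - char k a) / (2 * pi * \<i>))" unfolding fourier_coeff_indicator[OF ab] ..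
    also have "\<dots> = (1 / (2 * pi)) * (c k * (char k b - char k a))" by simp
    finally show ?thesis by (simp only: right_diff_distrib)
  qed
  ultimately have 1: "((\<lambda>k. (1 / (2 * pi)) * (c k * char k b - c k * char k a)) has_sum fourier_coeff (\<lambda>z. y z * indicator {a..b} z) 0) UNIV"
    by simp
  have "((\<lambda>k. c k * char k b + - (c k * char k a)) has_sum ((\<Sum>\<^sub>\<infinity>k. c k * char k b) + - (\<Sum>\<^sub>\<infinity>k. c k * char k a))) UNIV"
    by (intro has_sum_add has_sum_uminusI has_sum_infsum fser_summable(2)[OF c])
  from has_sum_cmult_right[OF this, of "complex_of_real (1 / (2 * pi))"]
  have 2: "((\<lambda>k. (1 / (2 * pi)) * (c k * char k b - c k * char k a)) has_sum (1 / (2 * pi)) * ((\<Sum>\<^sub>\<infinity>k. c k * char k b) - (\<Sum>\<^sub>\<infinity>k. c k * char k a))) UNIV"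
    by simp
  have "fourier_coeff (\<lambda>z. y z * indicator {a..b} z) 0 = complex_of_real (\<integral>z. y z * indicator {a..b} z \<partial>tor)"
    by (subst fourier_coeff_tor) (auto simp: scaleR_conv_of_real simp del: of_real_mult)
  also have "(\<integral>z. y z * indicator {a..b} z \<partial>tor) = (1 / (2*pi)) * (LINT z:{a..b}|lborel. y z)"
  proof (subst integral_tor)
    have "(LINT z:{0..2*pi}|lborel. y z * indicator {a..b} z) = (LINT z:{a..b}|lborel. y z)"
      unfolding set_lebesgue_integral_def
      by (rule Bochner_Integration.integral_cong) (use ab in \<open>auto simp: indicator_def\<close>)
    thus "(1 / (2*pi)) *\<^sub>R (LINT z:{0..2*pi}|lborel. y z * indicator {a..b} z) = (1 / (2*pi)) * (LINT z:{a..b}|lborel. y z)" by simp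
  qed simp
  finally have "complex_of_real (1 / (2*pi)) * of_real (LINT z:{a..b}|lborel. y z)
     = of_real (1 / (2 * pi)) * ((\<Sum>\<^sub>\<infinity>k. c k * char k b) - (\<Sum>\<^sub>\<infinity>k. c k * char k a))"
    using has_sum_unique[OF 1 2] by simp
  moreover have "complex_of_real (1 / (2*pi)) \<noteq> 0" by simp
  ultimately have "of_real (LINT z:{a..b}|lborel. y z) = (\<Sum>\<^sub>\<infinity>k. c k * char k b) - (\<Sum>\<^sub>\<infinity>k. c k * char k a)"
    by (metis mult_left_cancel)
  from arg_cong[OF this, of Re] show ?thesis by (simp add: fser_def)
qed

text \<open>Two periods are covered because the intervals of interest have length \<open>2 \<pi>\<close> and start anywhere in the first
period.\<close>

lemma fser_has_derivative:
  assumes c: "(\<lambda>n. cmod (c n)) summable_on UNIV"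
    and y: "continuous_on UNIV y" "periodic_2pi y" "\<And>n. fourier_coeff y n = \<i> * of_int n * c n"
    and S: "{p..q} \<subseteq> {0..4 * pi}" and x: "x \<in> {p..q}"
  shows "(fser c has_real_derivative y x) (at x within {p..q})"
proof -
  have yc: "continuous_on A y" for A using y(1) by (rule continuous_on_subset) simp
  have 1: "fser c b - fser c a = integral {a..b} y" if "0 \<le> a" "a \<le> b" "b \<le> 2 * pi" for a b
  proof -
    have "fser c b - fser c a = (LINT z:{a..b}|lborel. y z)"
      by (rule fser_diff_eq_integral[OF c continuous_periodic_L2[OF y(1,2)] y(3) that])
    also have "\<dots> = integral {a..b} y"
      by (rule set_borel_integral_eq_integral(2)) (rule borel_integrable_atLeastAtMost', rule yc)
    finally show ?thesis .
  qed
  have 2: "fser c x = fser c 0 + integral {0..x} y" if x: "x \<in> {0..4*pi}" for x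
  proof (cases "x \<le> 2 * pi")
    case True thus ?thesis using 1[of 0 x] x by simp
  next
    case False
    have "integral {0..2*pi} y + integral {2*pi..x} y = integral {0..x} y"
      by (rule Henstock_Kurzweil_Integration.integral_combine) (use False yc in \<open>auto intro!: integrable_continuous_real\<close>)
    moreover have "integral {0..2*pi} y = 0" using 1[of 0 "2*pi"] fser_periodic[of c 0] by simp
    moreover have "integral {2*pi..x} y = integral {0..x - 2*pi} y"
    proof -
      have "integral {2*pi - 2*pi..x - 2*pi} (\<lambda>z. y (z + 2*pi)) = integral {2*pi..x} y"
        by (rule integral_shift_real_ivl)
      moreover have "y (z + 2*pi) = y z" for z using y(2) by (simp add: periodic_2pi_def)
      ultimately show ?thesis by simp
    qed
    moreover have "fser c (x - 2*pi) - fser c 0 = integral {0..x - 2*pi} y"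
      using 1[of 0 "x - 2*pi"] False x by simp
    moreover have "fser c x = fser c (x - 2*pi)" using fser_periodic[of c "x - 2*pi"] by simp
    ultimately show ?thesis by simp
  qed
  have xS: "x \<in> {0..4*pi}" using x S by blast
  have "((\<lambda>x. integral {0..x} y) has_real_derivative y x) (at x within {0..4*pi})"
    by (rule integral_has_real_derivative[OF yc xS])
  from DERIV_add[OF DERIV_const[of "fser c 0"] this]
  have "((\<lambda>x. fser c 0 + integral {0..x} y) has_real_derivative y x) (at x within {0..4*pi})" by simp
  hence "(fser c has_real_derivative y x) (at x within {0..4*pi})"
    unfolding has_real_derivative_iff_has_vector_derivative
    by (rule has_vector_derivative_transform[OF xS, rotated]) (rule 2)
  thus ?thesis using S by (rule DERIV_subset)
qed

section \<open>Point evaluation\<close>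

lemma unwt_herm: "hermitian X \<Longrightarrow> unwt s X (- n) = cnj (unwt s X n)"
  using hermitianD[of X n] by (simp add: unwt_def)

text \<open>The vector of \<open>H\<^sup>1\<close> that represents evaluation at \<open>x\<close>. It reduces joint continuity in time and space, and
equicontinuity in space, to continuity of \<open>evec\<close>.\<close>

definition evec :: "real \<Rightarrow> ell2" where "evec x = Abs_ell2 (\<lambda>n. char (- n) x / wt 1 n)"

lemma coord_evec [simp]: "coord (evec x) n = char (- n) x / wt 1 n"
proof -
  have "(\<lambda>n. (cmod (char (- n) x / wt 1 n))\<^sup>2) summable_on UNIV"
    using summable_inverse_square by (simp add: norm_divide power_divide wt_1_square)
  thus ?thesis by (simp add: evec_def coord_Abs_ell2)
qed

lemma inner_evec: "evec x \<bullet> X = fser (unwt 1 X) x"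
proof -
  have "((\<lambda>n. unwt 1 X n * char n x) has_sum (\<Sum>\<^sub>\<infinity>n. unwt 1 X n * char n x)) UNIV"
    by (rule has_sum_infsum[OF fser_summable(2)[OF unwt_1_l1]])
  from has_sum_Re[OF this] have "((\<lambda>n. coord (evec x) n \<bullet> coord X n) has_sum fser (unwt 1 X) x) UNIV"
    unfolding fser_def
  proof (rule has_sum_cong[THEN iffD1, rotated])
    fix n
    have "coord X n * cnj (coord (evec x) n) = unwt 1 X n * char n x" by (simp add: unwt_def)
    moreover have "z \<bullet> w = Re (w * cnj z)" for z w :: complex by (simp add: inner_complex_def)
    ultimately show "Re (unwt 1 X n * char n x) = coord (evec x) n \<bullet> coord X n" by (simp only:)
  qed
  thus ?thesis unfolding inner_ell2_def by (rule infsumI)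
qed

lemma evec_continuous: "continuous_on A evec"
proof -
  \<comment> \<open>The reproducing kernel: \<open>evec x \<bullet> evec y\<close> depends on \<open>x - y\<close> only.\<close>
  define c :: "int \<Rightarrow> complex" where "c n = of_real (1 / (1 + (of_int n)\<^sup>2))" for n
  have c: "(\<lambda>n. cmod (c n)) summable_on UNIV"
    unfolding c_def norm_of_real using summable_inverse_square by simp
  have ip: "evec x \<bullet> evec y = fser c (x - y)" for x y
  proof -
    have "unwt 1 (evec y) n * char n x = c n * char n (x - y)" for n
    proof -
      have "wt 1 n * wt 1 n = 1 + (of_int n)\<^sup>2" using wt_1_square[of n] by (simp add: power2_eq_square)
      hence "complex_of_real (wt 1 n) * complex_of_real (wt 1 n) = of_real (1 + (of_int n)\<^sup>2)" by (metis of_real_mult)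
      hence "unwt 1 (evec y) n = c n * char (- n) y" by (simp add: unwt_def c_def)
      moreover have "char (- n) y * char n x = char n (x - y)"
        by (simp add: char_def cis_mult algebra_simps)
      ultimately show ?thesis by (simp add: mult.assoc)
    qed
    thus ?thesis unfolding inner_evec fser_def by simp
  qed
  have "isCont evec x" for x
  proof -
    have "(\<lambda>y. norm (evec y - evec x)) \<midarrow>x\<rightarrow> 0"
    proof -
      have n: "norm (evec y - evec x) = sqrt (2 * fser c 0 - 2 * fser c (x - y))" for y
      proof -
        have "(evec y - evec x) \<bullet> (evec y - evec x) = evec y \<bullet> evec y + evec x \<bullet> evec x - 2 * (evec x \<bullet> evec y)"
          by (simp add: inner_diff_left inner_diff_right inner_commute[of "evec y" "evec x"])
        thus ?thesis unfolding norm_eq_sqrt_inner ip by simp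
      qed
      have "isCont (\<lambda>y. fser c (x - y)) x"
        using continuous_on_compose2[OF fser_continuous[OF c, of UNIV], of UNIV "\<lambda>y. x - y"]
        by (simp add: continuous_on_eq_continuous_at continuous_on_diff)
      hence "(\<lambda>y. fser c (x - y)) \<midarrow>x\<rightarrow> fser c 0" by (simp add: isCont_def)
      hence "(\<lambda>y. sqrt (2 * fser c 0 - 2 * fser c (x - y))) \<midarrow>x\<rightarrow> sqrt (2 * fser c 0 - 2 * fser c 0)"
        by (intro tendsto_intros)
      thus ?thesis by (simp add: n)
    qed
    from LIM_zero_cancel[OF tendsto_norm_zero_cancel[OF this]] show ?thesis unfolding isCont_def .
  qed
  thus ?thesis by (simp add: continuous_at_imp_continuous_on)
qed

lemma evec_norm_bounded: "norm (evec x) = norm (evec 0)"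
  unfolding norm_ell2_eq by (simp add: norm_divide)

section \<open>Weak convergence\<close>

lemma ell2_decomposition: "((\<lambda>n. single n (coord X n)) has_sum X) UNIV"
  unfolding has_sum_def
proof (rule tendstoI)
  fix e :: real assume e: "0 < e"
  have "(sum (\<lambda>n. (cmod (coord X n))\<^sup>2) \<longlongrightarrow> (norm X)\<^sup>2) (finite_subsets_at_top UNIV)"
    unfolding norm_ell2_square by (rule infsum_tendsto[OF summable_coord])
  hence "\<forall>\<^sub>F A in finite_subsets_at_top UNIV. dist (\<Sum>n\<in>A. (cmod (coord X n))\<^sup>2) ((norm X)\<^sup>2) < e\<^sup>2"
    by (rule tendstoD) (use e in simp)
  thus "\<forall>\<^sub>F A in finite_subsets_at_top UNIV. dist (\<Sum>n\<in>A. single n (coord X n)) X < e"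
  proof eventually_elim
    case (elim A)
    show ?case
    proof (cases "finite A")
      case True
      let ?Y = "\<Sum>n\<in>A. single n (coord X n)"
      have XY: "?Y \<bullet> X = (\<Sum>n\<in>A. (cmod (coord X n))\<^sup>2)"
        by (simp add: inner_sum_left inner_single power2_norm_eq_inner)
      have cY: "coord ?Y n = (if n \<in> A then coord X n else 0)" for n
      proof -
        have "coord ?Y n = (\<Sum>m\<in>A. coord (single m (coord X m)) n)"
          by (rule linear_sum[of "\<lambda>X. coord X n", OF bounded_linear.linear[OF bounded_linear_coord]])
        thus ?thesis using True by (simp add: if_distrib sum.delta cong: if_cong)
      qed
      have YY: "?Y \<bullet> ?Y = (\<Sum>n\<in>A. (cmod (coord X n))\<^sup>2)"
        unfolding inner_sum_left inner_single cY by (simp add: power2_norm_eq_inner)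
      have "(dist ?Y X)\<^sup>2 = (norm X)\<^sup>2 - (\<Sum>n\<in>A. (cmod (coord X n))\<^sup>2)"
        unfolding dist_norm power2_norm_eq_inner
        using XY YY by (simp add: inner_diff_left inner_diff_right inner_commute[of X ?Y] power2_norm_eq_inner)
      also have "\<dots> < e\<^sup>2" using elim unfolding dist_real_def by linarith
      finally show ?thesis using e by (simp add: power2_less_imp_less)
    next
      case False
      hence "(norm X)\<^sup>2 < e\<^sup>2" using elim by (simp add: dist_real_def)
      thus ?thesis using False e by (simp add: dist_norm power2_less_imp_less)
    qed
  qed
qed

lemma ell2_riesz:
  fixes f :: "ell2 \<Rightarrow> real"
  assumes f: "bounded_linear f"
  obtains b where "\<And>X. f X = b \<bullet> X"
proof -
  interpret f: bounded_linear f by fact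
  obtain K where K: "K \<ge> 0" "\<And>X. norm (f X) \<le> norm X * K" using f.nonneg_bounded by blast
  define b where "b n = Complex (f (single n 1)) (f (single n \<i>))" for n
  have bn: "f (single n z) = b n \<bullet> z" for n z
  proof -
    have "single n z = Re z *\<^sub>R single n 1 + Im z *\<^sub>R single n \<i>"
      by (rule ell2_eqI) (auto simp: complex_eq_iff)
    thus ?thesis by (simp add: f.add f.scaleR b_def inner_complex_def mult.commute)
  qed
  have le: "(\<Sum>n\<in>A. (cmod (b n))\<^sup>2) \<le> K\<^sup>2" if A: "finite A" for A
  proof -
    let ?B = "\<Sum>n\<in>A. single n (b n)" and ?s = "\<Sum>n\<in>A. (cmod (b n))\<^sup>2"
    have cB: "coord ?B n = (if n \<in> A then b n else 0)" for n
    proof -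
      have "coord ?B n = (\<Sum>m\<in>A. coord (single m (b m)) n)"
        by (rule linear_sum[of "\<lambda>X. coord X n", OF bounded_linear.linear[OF bounded_linear_coord]])
      thus ?thesis using A by (simp add: if_distrib sum.delta cong: if_cong)
    qed
    have s: "f ?B = ?s" by (simp add: f.sum bn power2_norm_eq_inner)
    have "(norm ?B)\<^sup>2 = ?s"
      unfolding power2_norm_eq_inner inner_sum_left inner_single cB by (simp add: power2_norm_eq_inner)
    moreover have "?s \<le> norm ?B * K" using K(2)[of ?B] s by simp
    ultimately have nn: "(norm ?B)\<^sup>2 \<le> norm ?B * K" by simp
    have "norm ?B \<le> K"
    proof (cases "norm ?B = 0")
      case False
      hence "norm ?B > 0" by simp
      thus ?thesis using nn by (simp add: power2_eq_square)
    qed (use K in simp)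
    hence "(norm ?B)\<^sup>2 \<le> K\<^sup>2" by (intro power_mono) auto
    thus ?thesis using \<open>(norm ?B)\<^sup>2 = ?s\<close> by simp
  qed
  have "(\<lambda>n. (cmod (b n))\<^sup>2) summable_on UNIV"
    by (rule nonneg_bdd_above_summable_on) (auto intro!: bdd_aboveI2[where M = "K\<^sup>2"] le)
  hence B: "coord (Abs_ell2 b) n = b n" for n by (simp add: coord_Abs_ell2)
  have "f X = Abs_ell2 b \<bullet> X" for X
  proof -
    have "((\<lambda>n. f (single n (coord X n))) has_sum f X) UNIV"
      by (rule has_sum_bounded_linear[OF f ell2_decomposition])
    hence "((\<lambda>n. coord (Abs_ell2 b) n \<bullet> coord X n) has_sum f X) UNIV" by (simp add: bn B)
    thus ?thesis unfolding inner_ell2_def by (simp add: infsumI)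
  qed
  thus thesis by (rule that)
qed

lemma ell2_weak_functional:
  fixes f :: "ell2 \<Rightarrow> 'b::euclidean_space"
  assumes f: "bounded_linear f" and x: "\<And>n. ((\<lambda>j. coord (X j) n) \<longlongrightarrow> coord x n) F" and F: "F \<noteq> bot"
    and B: "\<forall>\<^sub>F j in F. norm (X j) \<le> B"
  shows "((\<lambda>j. f (X j)) \<longlongrightarrow> f x) F"
proof (rule tendsto_componentwise_iff[THEN iffD2], rule ballI)
  fix i :: 'b assume "i \<in> Basis"
  have "bounded_linear (\<lambda>X. f X \<bullet> i)" by (rule bounded_linear_compose[OF bounded_linear_inner_left f])
  then obtain b where "\<And>X. f X \<bullet> i = b \<bullet> X" using ell2_riesz by blast
  thus "((\<lambda>j. f (X j) \<bullet> i) \<longlongrightarrow> f x \<bullet> i) F" using ell2_weak_inner[OF x F B, of b] by simp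
qed

text \<open>Rellich's theorem: the weight makes the high frequencies uniformly small, and the finitely many low ones
converge.\<close>

lemma compact_embedding:
  assumes x: "\<And>n. ((\<lambda>j. coord (X j) n) \<longlongrightarrow> 0) F" and B: "\<forall>\<^sub>F j in F. norm (X j) \<le> B" and r: "0 < r"
  shows "((\<lambda>j. \<Sum>\<^sub>\<infinity>n. (wt (- r) n)\<^sup>2 * (cmod (coord (X j) n))\<^sup>2) \<longlongrightarrow> 0) F"
proof (rule tendstoI)
  fix e :: real assume e: "0 < e"
  define C where "C = B\<^sup>2 + 1"
  have C: "0 < C" by (simp add: C_def add_nonneg_pos)
  obtain N :: nat where N: "(2 * C / e) powr (1 / r) < real N" using reals_Archimedean2 by blast
  have w1: "(wt (- r) n)\<^sup>2 \<le> 1" for n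
  proof -
    have "wt (- r) n \<le> 1" unfolding wt_minus using wt_ge_1[of r n] r by (simp add: inverse_le_1_iff)
    thus ?thesis by (simp add: power_le_one)
  qed
  have wN: "(wt (- r) n)\<^sup>2 \<le> e / (2 * C)" if "n \<notin> {- int N..int N}" for n
  proof -
    have "real N \<le> \<bar>of_int n\<bar>" using that by auto
    also have "\<dots> \<le> 1 + (of_int n)\<^sup>2"
      using zero_le_power2[of "\<bar>of_int n\<bar> - 1 :: real"] by (simp add: power2_eq_square algebra_simps)
    finally have "(2 * C / e) powr (1 / r) \<le> 1 + (of_int n)\<^sup>2" using N by linarith
    hence "((2 * C / e) powr (1 / r)) powr r \<le> (1 + (of_int n)\<^sup>2) powr r"
      using r by (intro powr_mono2) auto
    hence "2 * C / e \<le> (wt r n)\<^sup>2" using r C e by (simp add: powr_powr wt_square)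
    moreover have "0 < 2 * C / e" using C e by simp
    ultimately have "inverse ((wt r n)\<^sup>2) \<le> inverse (2 * C / e)" by (intro le_imp_inverse_le)
    thus ?thesis by (simp add: wt_minus power_inverse)
  qed
  have "((\<lambda>j. \<Sum>n\<in>{- int N..int N}. (cmod (coord (X j) n))\<^sup>2) \<longlongrightarrow> (\<Sum>n\<in>{- int N..int N}. (cmod 0)\<^sup>2)) F"
    by (intro tendsto_intros x)
  hence "\<forall>\<^sub>F j in F. dist (\<Sum>n\<in>{- int N..int N}. (cmod (coord (X j) n))\<^sup>2) 0 < e / 2"
    using e by (intro tendstoD) auto
  with B show "\<forall>\<^sub>F j in F. dist (\<Sum>\<^sub>\<infinity>n. (wt (- r) n)\<^sup>2 * (cmod (coord (X j) n))\<^sup>2) 0 < e"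
  proof eventually_elim
    case (elim j)
    let ?f = "\<lambda>n. (wt (- r) n)\<^sup>2 * (cmod (coord (X j) n))\<^sup>2" and ?A = "{- int N..int N}"
    have s: "?f summable_on UNIV"
      by (rule summable_on_comparison_test[OF summable_coord[of "X j"]])
         (auto intro!: mult_left_le_one_le w1)
    have "infsum ?f UNIV \<le> e / 2 + (\<Sum>n\<in>?A. (cmod (coord (X j) n))\<^sup>2)"
    proof (rule infsum_le_finite_sums[OF s])
      fix G :: "int set" assume G: "finite G"
      have "sum ?f G = sum ?f (G - ?A) + sum ?f (G \<inter> ?A)"
        by (subst sum.union_disjoint[symmetric]) (use G in \<open>auto intro!: sum.cong\<close>)
      also have "sum ?f (G \<inter> ?A) \<le> (\<Sum>n\<in>G \<inter> ?A. (cmod (coord (X j) n))\<^sup>2)"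
        by (intro sum_mono mult_left_le_one_le w1) auto
      also have "\<dots> \<le> (\<Sum>n\<in>?A. (cmod (coord (X j) n))\<^sup>2)"
        by (intro sum_mono2) auto
      also have "sum ?f (G - ?A) \<le> (\<Sum>n\<in>G - ?A. e / (2 * C) * (cmod (coord (X j) n))\<^sup>2)"
        by (intro sum_mono mult_right_mono wN) auto
      also have "\<dots> \<le> e / (2 * C) * (norm (X j))\<^sup>2"
        unfolding sum_distrib_left[symmetric]
        using G e C by (intro mult_left_mono sum_coord_le_norm) auto
      also have "\<dots> \<le> e / (2 * C) * C"
      proof (intro mult_left_mono)
        have "(norm (X j))\<^sup>2 \<le> B\<^sup>2" using elim(1) by (intro power_mono) auto
        thus "(norm (X j))\<^sup>2 \<le> C" by (simp add: C_def)
      qed (use e C in simp)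
      also have "\<dots> = e / 2" using C by simp
      finally show "sum ?f G \<le> e / 2 + (\<Sum>n\<in>?A. (cmod (coord (X j) n))\<^sup>2)" by simp
    qed
    moreover have "(\<Sum>n\<in>?A. (cmod (coord (X j) n))\<^sup>2) < e / 2"
      using elim(2) by (simp add: dist_real_def abs_of_nonneg sum_nonneg)
    moreover have "0 \<le> infsum ?f UNIV" by (rule infsum_nonneg) simp
    ultimately show ?case by (simp add: dist_real_def)
  qed
qed

text \<open>Weak convergence in \<open>H\<^sup>1\<close> is norm convergence in \<open>L\<^sup>2\<close>, where the coefficients of a product are continuous.\<close>

lemma conv_weak_continuous:
  assumes x: "\<And>n. ((\<lambda>j. coord (X j) n) \<longlongrightarrow> coord x n) F" and B: "\<forall>\<^sub>F j in F. norm (X j) \<le> B"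
  shows "((\<lambda>j. conv (unwt 1 (X j)) (unwt 1 (X j)) n) \<longlongrightarrow> conv (unwt 1 x) (unwt 1 x) n) F"
proof -
  define S where "S X = Abs_ell2 (unwt 1 X)" for X
  have cS: "coord (S X) n = unwt 1 X n" for X n
    unfolding S_def by (subst coord_Abs_ell2[OF unwt_summable]) auto
  have uS: "unwt 1 X = unwt 0 (S X)" for X by (simp add: unwt_def cS fun_eq_iff)
  have Sd: "S X - S Y = S (X - Y)" for X Y
    by (rule ell2_eqI) (simp add: cS unwt_def diff_divide_distrib)
  have nS: "(norm (S X))\<^sup>2 = (\<Sum>\<^sub>\<infinity>n. (wt (- 1) n)\<^sup>2 * (cmod (coord X n))\<^sup>2)" for X
    unfolding norm_ell2_square cS
    by (simp add: unwt_def norm_divide power_divide wt_minus power_inverse field_simps)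
  have "((\<lambda>j. (norm (S (X j - x)))\<^sup>2) \<longlongrightarrow> 0) F"
    unfolding nS
  proof (rule compact_embedding)
    show "((\<lambda>j. coord (X j - x) n) \<longlongrightarrow> 0) F" for n
      using tendsto_diff[OF x[of n] tendsto_const[of "coord x n"]] by simp
    show "\<forall>\<^sub>F j in F. norm (X j - x) \<le> B + norm x"
      using B by eventually_elim (rule order_trans[OF norm_triangle_ineq4], simp)
  qed simp
  from tendsto_real_sqrt[OF this] have "((\<lambda>j. norm (S (X j - x))) \<longlongrightarrow> 0) F" by simp
  hence lim: "((\<lambda>j. S (X j)) \<longlongrightarrow> S x) F"
    unfolding Sd[symmetric] by (simp add: LIM_zero_iff tendsto_norm_zero_iff)
  define b where "b X Y = conv (unwt 0 X) (unwt 0 Y) n" for X Y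
  have bb: "bounded_bilinear b"
  proof
    note l = conv_unwt_add[of 0, simplified]
    show "b (X + X') Y = b X Y + b X' Y" "b X (Y + Y') = b X Y + b X Y'" "b (r *\<^sub>R X) Y = r *\<^sub>R b X Y" "b X (r *\<^sub>R Y) = r *\<^sub>R b X Y"
      for X X' Y Y' r by (simp_all add: b_def l scaleR_conv_of_real)
    show "\<exists>K. \<forall>X Y. norm (b X Y) \<le> norm X * norm Y * K"
      using conv_unwt_bound[of 0 n] by (intro exI[of _ 1]) (simp add: b_def)
  qed
  have "((\<lambda>j. b (S (X j)) (S (X j))) \<longlongrightarrow> b (S x) (S x)) F"
    by (rule bounded_bilinear.tendsto[OF bb lim lim])
  thus ?thesis by (simp add: b_def uS)
qed

lemma rhs_weak_continuous:
  assumes a: "torus_smooth a"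
    and x: "\<And>n. ((\<lambda>j. coord (X j) n) \<longlongrightarrow> coord x n) F" and F: "F \<noteq> bot" and B: "\<forall>\<^sub>F j in F. norm (X j) \<le> B"
  shows "((\<lambda>j. coord (rhs a 1 (X j)) n) \<longlongrightarrow> coord (rhs a 1 x) n) F"
proof -
  have D: "((\<lambda>j. coord (Damp a 1 (X j)) n) \<longlongrightarrow> coord (Damp a 1 x) n) F"
    by (rule ell2_weak_functional[OF bounded_linear_compose[OF bounded_linear_coord bounded_linear_Damp[OF a]] x F B])
  have "((\<lambda>j. coord (Damp a 1 (X j)) n + beta n * coord (X j) n + beta n * (wt 1 n * conv (unwt 1 (X j)) (unwt 1 (X j)) n / 2))
      \<longlongrightarrow> coord (Damp a 1 x) n + beta n * coord x n + beta n * (wt 1 n * conv (unwt 1 x) (unwt 1 x) n / 2)) F"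
    by (intro tendsto_intros D x conv_weak_continuous[OF x B]) auto
  thus ?thesis
    by (simp add: rhs_def coord_Disp[OF beta_multiplier] coord_Nonlin[OF beta_multiplier])
qed

section \<open>Limits of translates of a trajectory\<close>

text \<open>The Cauchy--Schwarz inequality for \<open>a u\<^sub>x = \<surd>a * (\<surd>a u\<^sub>x)\<close>. So the damping term itself, and not only the
dissipated energy, tends to zero when the dissipation does.\<close>

lemma coord_Damp_square_le:
  assumes a: "torus_smooth a" "\<And>x. 0 \<le> a x" and X: "hermitian X"
  shows "(cmod (coord (Damp a 1 X) n))\<^sup>2 \<le> (\<integral>x. a x \<partial>tor) * (X \<bullet> Damp a 1 X)"
proof -
  obtain y where y: "y \<in> sobolev 0" "\<And>n. fourier_coeff y n = \<i> * of_int n * unwt 1 X n"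
    using derivative_function[OF X] by blast
  have yL: "y \<in> torus_L2" by (rule sobolev_L2[OF y(1)])
  note [measurable] = torus_L2_measurable[OF yL] torus_smooth_measurable[OF a(1)]
  obtain B where B: "\<And>x. \<bar>a x\<bar> \<le> B" using torus_smooth_bounded[OF a(1)] by blast
  have rb: "\<bar>sqrt (a x)\<bar> \<le> sqrt B" for x using B[of x] a(2)[of x] by simp
  have rL: "(\<lambda>x. sqrt (a x)) \<in> torus_L2" by (rule torus_L2_bounded[OF _ rb]) simp
  have ryL: "(\<lambda>x. sqrt (a x) * y x) \<in> torus_L2" by (rule torus_L2_mult_bounded[OF yL _ rb]) simp
  have "cmod (fourier_coeff (\<lambda>x. y x * a x) n) \<le> (\<integral>x. \<bar>y x * a x\<bar> \<partial>tor)"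
    by (rule cmod_fourier_coeff_le) simp
  also have "(\<lambda>x. \<bar>y x * a x\<bar>) = (\<lambda>x. \<bar>sqrt (a x) * (sqrt (a x) * y x)\<bar>)"
  proof
    fix x
    have eq: "sqrt (a x) * (sqrt (a x) * y x) = a x * y x" using a(2)[of x] by (simp add: mult.assoc[symmetric])
    show "\<bar>y x * a x\<bar> = \<bar>sqrt (a x) * (sqrt (a x) * y x)\<bar>" unfolding eq by (simp only: mult.commute)
  qed
  finally have "(cmod (fourier_coeff (\<lambda>x. y x * a x) n))\<^sup>2 \<le> (\<integral>x. \<bar>sqrt (a x) * (sqrt (a x) * y x)\<bar> \<partial>tor)\<^sup>2"
    by (intro power_mono) auto
  also have "\<dots> \<le> (\<integral>x. (sqrt (a x))\<^sup>2 \<partial>tor) * (\<integral>x. (sqrt (a x) * y x)\<^sup>2 \<partial>tor)"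
    by (rule L2_cauchy_schwarz[OF rL ryL])
  also have "\<dots> = (\<integral>x. a x \<partial>tor) * (X \<bullet> Damp a 1 X)"
    unfolding inner_Damp[OF a(1) y] by (simp add: power_mult_distrib a(2))
  finally have 1: "(cmod (fourier_coeff (\<lambda>x. y x * a x) n))\<^sup>2 \<le> (\<integral>x. a x \<partial>tor) * (X \<bullet> Damp a 1 X)" .
  have "cmod (coord (Damp a 1 X) n) = wt 1 n * \<bar>of_int n\<bar> / (1 + (of_int n)\<^sup>2) * cmod (fourier_coeff (\<lambda>x. y x * a x) n)"
  proof -
    have "coord (Damp a 1 X) n = of_real (wt 1 n / (1 + (of_int n)\<^sup>2)) * (- \<i> * of_int n * fourier_coeff (\<lambda>x. y x * a x) n)"
      by (simp add: coord_Damp[OF a(1)] damp_coeff_derivative[OF a(1) y])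
    moreover have "\<bar>wt 1 n / (1 + (of_int n)\<^sup>2)\<bar> = wt 1 n / (1 + (of_int n)\<^sup>2)"
      using one_plus_sq_pos[of n] by simp
    ultimately show ?thesis by (simp only: norm_mult norm_of_real) (simp add: norm_mult)
  qed
  also have "\<dots> \<le> 1 * cmod (fourier_coeff (\<lambda>x. y x * a x) n)"
  proof (rule mult_right_mono)
    have "wt 1 n * \<bar>of_int n\<bar> \<le> wt 1 n * wt 1 n" by (intro mult_left_mono abs_le_wt_1) simp
    also have "\<dots> = 1 + (of_int n)\<^sup>2" using wt_1_square[of n] by (simp add: power2_eq_square)
    finally show "wt 1 n * \<bar>of_int n\<bar> / (1 + (of_int n)\<^sup>2) \<le> 1" using one_plus_sq_pos[of n] by simp
  qed simp
  finally have "(cmod (coord (Damp a 1 X) n))\<^sup>2 \<le> (cmod (fourier_coeff (\<lambda>x. y x * a x) n))\<^sup>2"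
    by (intro power_mono) auto
  thus ?thesis using 1 by linarith
qed

text \<open>A global solution in \<open>H\<^sup>1\<close>, in coordinates.\<close>

locale damped_trajectory =
  fixes a :: "real \<Rightarrow> real" and x0 :: ell2 and X :: "real \<Rightarrow> ell2"
  assumes a: "torus_smooth a" "\<And>x. 0 \<le> a x"
    and sol: "ode_sol (rhs a 1) {0..} x0 X"
    and herm: "\<And>t. 0 \<le> t \<Longrightarrow> hermitian (X t)"
begin

sublocale lipschitz_field "rhs a 1" flip by (rule lipschitz_field_rhs[OF a(1)]) simp

lemma solT: "ode_sol (rhs a 1) {0..T} x0 X"
  by (rule ode_sol_subset[OF sol]) auto

lemma single_0 [simp]: "single n 0 = 0" by (rule ell2_eqI) simp

lemma norm_decreasing: "0 \<le> s \<Longrightarrow> s \<le> t \<Longrightarrow> norm (X t) \<le> norm (X s)"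
  using energy_decreasing[OF a solT[of t] herm, of s t 0] by simp

lemma X0: "X 0 = x0" by (rule ode_sol_initial[OF sol]) simp

lemma norm_le: "0 \<le> t \<Longrightarrow> norm (X t) \<le> norm x0"
  using norm_decreasing[of 0 t] by (simp add: X0)

text \<open>A bound for the field on the ball in which the trajectory stays; it is a Lipschitz constant of the trajectory.\<close>

definition K where "K = (SOME K. 0 \<le> K \<and> (\<forall>Y. norm Y \<le> norm x0 \<longrightarrow> norm (rhs a 1 Y) \<le> K))"

lemma K: "0 \<le> K" "norm Y \<le> norm x0 \<Longrightarrow> norm (rhs a 1 Y) \<le> K"
proof -
  obtain L where L: "L \<ge> 0" "\<And>x y. norm x \<le> norm x0 \<Longrightarrow> norm y \<le> norm x0 \<Longrightarrow> norm (rhs a 1 x - rhs a 1 y) \<le> L * norm (x - y)"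
    using lip[of "norm x0"] by blast
  have "0 \<le> L * norm x0 + norm (rhs a 1 0) \<and> (\<forall>Y. norm Y \<le> norm x0 \<longrightarrow> norm (rhs a 1 Y) \<le> L * norm x0 + norm (rhs a 1 0))"
  proof (intro conjI allI impI)
    fix Y :: ell2 assume Y: "norm Y \<le> norm x0"
    have "norm (rhs a 1 Y) \<le> norm (rhs a 1 Y - rhs a 1 0) + norm (rhs a 1 0)" by (metis diff_add_cancel norm_triangle_ineq)
    also have "norm (rhs a 1 Y - rhs a 1 0) \<le> L * norm (Y - 0)" by (rule L(2)[OF Y]) simp
    also have "L * norm (Y - 0) \<le> L * norm x0" using Y L(1) by (intro mult_left_mono) auto
    finally show "norm (rhs a 1 Y) \<le> L * norm x0 + norm (rhs a 1 0)" by simp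
  qed (use L in simp)
  from someI[of "\<lambda>K. 0 \<le> K \<and> (\<forall>Y. norm Y \<le> norm x0 \<longrightarrow> norm (rhs a 1 Y) \<le> K)", OF this]
  show "0 \<le> K" "norm Y \<le> norm x0 \<Longrightarrow> norm (rhs a 1 Y) \<le> K" unfolding K_def[symmetric] by auto
qed

lemma increment:
  assumes "0 \<le> s" "s \<le> t"
  shows "((\<lambda>r. rhs a 1 (X r)) has_integral (X s - X t)) {s..t}"
proof -
  have "((\<lambda>r. - rhs a 1 (X r)) has_integral (X t - X s)) {s..t}"
  proof (rule fundamental_theorem_of_calculus[OF assms(2)])
    fix r assume "r \<in> {s..t}"
    hence "r \<in> {0..t}" using assms by auto
    from has_vector_derivative_within_subset[OF sol_derivative[OF solT this], of "{s..t}"]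
    show "(X has_vector_derivative - rhs a 1 (X r)) (at r within {s..t})" using assms by auto
  qed
  from has_integral_neg[OF this] show ?thesis by simp
qed

lemma lipschitz: "0 \<le> s \<Longrightarrow> 0 \<le> t \<Longrightarrow> norm (X t - X s) \<le> K * \<bar>t - s\<bar>"
proof (induction s t rule: linorder_wlog)
  case (le s t)
  have "norm (X s - X t) \<le> K * measure lborel (cbox s t)"
    by (rule has_integral_bound[OF K(1)]) (use increment[OF le(2,1)] le K(2) norm_le in auto)
  thus ?case using le by (simp add: norm_minus_commute)
next
  case (sym s t) thus ?case by (simp add: norm_minus_commute abs_minus_commute)
qed

lemma zero_mode: "0 \<le> t \<Longrightarrow> coord (X t) 0 = coord x0 0"
proof -
  assume t: "0 \<le> t"
  have "((\<lambda>r. rhs a 1 (X r)) has_integral (x0 - X t)) {0..t}" using sol t by (simp add: ode_sol_def)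
  from has_integral_linear[OF this bounded_linear_coord[where n = 0]]
  have "((\<lambda>r. 0) has_integral coord (x0 - X t) 0) {0..t}"
    by (simp add: o_def coord_rhs_zero[OF a(1)])
  moreover have "((\<lambda>r. 0 :: complex) has_integral 0) {0..t}" by simp
  ultimately show ?thesis using has_integral_unique[of "\<lambda>_. 0" "coord (x0 - X t) 0" "{0..t}" 0] by simp
qed

lemma energy_convergent: "\<exists>l. ((\<lambda>t. (norm (X t))\<^sup>2) \<longlongrightarrow> l) at_top"
proof -
  define l where "l = Inf ((\<lambda>t. (norm (X t))\<^sup>2) ` {0..})"
  have bdd: "bdd_below ((\<lambda>t. (norm (X t))\<^sup>2) ` {0..})" by (rule bdd_belowI2[of _ 0]) simp
  have "((\<lambda>t. (norm (X t))\<^sup>2) \<longlongrightarrow> l) at_top"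
  proof (rule tendstoI)
    fix e :: real assume e: "0 < e"
    have "\<exists>t\<in>{0..}. (norm (X t))\<^sup>2 < l + e"
      using cInf_less_iff[OF _ bdd, of "l + e"] e by (auto simp: l_def)
    then obtain t where t: "0 \<le> t" "(norm (X t))\<^sup>2 < l + e" by auto
    show "\<forall>\<^sub>F s in at_top. dist ((norm (X s))\<^sup>2) l < e"
      using eventually_ge_at_top[of t]
    proof eventually_elim
      case (elim s)
      have "(norm (X s))\<^sup>2 \<le> (norm (X t))\<^sup>2" by (intro power_mono norm_decreasing t elim) auto
      moreover have "l \<le> (norm (X s))\<^sup>2" unfolding l_def by (rule cInf_lower[OF _ bdd]) (use t elim in auto)
      ultimately show ?case using t(2) unfolding dist_real_def by linarith
    qed
  qed
  thus ?thesis ..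
qed

text \<open>The trajectory seen from time \<open>\<tau>\<close>. For \<open>t < - \<tau>\<close> it is frozen at its initial value; for fixed \<open>t\<close> this does not
occur once \<open>\<tau>\<close> is large.\<close>

definition Y where "Y \<tau> t = X (max 0 (\<tau> + t))"

lemma Y_norm: "norm (Y \<tau> t) \<le> norm x0" and Y_herm: "hermitian (Y \<tau> t)"
  unfolding Y_def by (auto intro: norm_le herm)

lemma Y_lipschitz: "norm (Y \<tau> t - Y \<tau> s) \<le> K * \<bar>t - s\<bar>"
proof -
  have "norm (Y \<tau> t - Y \<tau> s) \<le> K * \<bar>max 0 (\<tau> + t) - max 0 (\<tau> + s)\<bar>"
    unfolding Y_def by (rule lipschitz) auto
  also have "\<dots> \<le> K * \<bar>t - s\<bar>" using K(1) by (intro mult_left_mono) auto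
  finally show ?thesis .
qed

lemma Y_continuous: "continuous_on A (Y \<tau>)"
proof -
  have "continuous_on {0..} X" using sol by (simp add: ode_sol_def)
  thus ?thesis unfolding Y_def[abs_def]
    by (rule continuous_on_compose2) (auto intro!: continuous_intros)
qed

end

text \<open>A weak limit of translates, which is defined for all real times because \<open>\<tau>\<close> tends to infinity.\<close>

locale limit_trajectory = damped_trajectory +
  fixes \<tau> :: "nat \<Rightarrow> real" and Z :: "real \<Rightarrow> ell2"
  assumes \<tau>: "filterlim \<tau> at_top sequentially"
    and lim: "\<And>t n. (\<lambda>j. coord (Y (\<tau> j) t) n) \<longlonglongrightarrow> coord (Z t) n"
begin

lemma Y_bdd: "\<forall>\<^sub>F j in sequentially. norm (Y (\<tau> j) t) \<le> norm x0"
  by (intro always_eventually allI Y_norm)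

lemma Z_norm: "norm (Z t) \<le> norm x0"
  using ell2_weak_limit(2)[OF lim sequentially_bot Y_bdd] by (simp add: coord_inverse)

lemma Z_herm: "hermitian (Z t)"
proof (rule hermitianI)
  fix n
  have "(\<lambda>j. coord (Y (\<tau> j) t) (- n)) \<longlonglongrightarrow> cnj (coord (Z t) n)"
    unfolding hermitianD[OF Y_herm] by (intro tendsto_intros lim)
  thus "coord (Z t) (- n) = cnj (coord (Z t) n)" using lim[of t "- n"] LIMSEQ_unique by blast
qed

lemma Z_lipschitz: "norm (Z t - Z s) \<le> K * \<bar>t - s\<bar>"
proof -
  have "norm (Abs_ell2 (coord (Z t - Z s))) \<le> K * \<bar>t - s\<bar>"
  proof (rule ell2_weak_limit(2)[where X = "\<lambda>j. Y (\<tau> j) t - Y (\<tau> j) s"])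
    show "(\<lambda>j. coord (Y (\<tau> j) t - Y (\<tau> j) s) n) \<longlonglongrightarrow> coord (Z t - Z s) n" for n
      by (simp add: tendsto_diff lim)
    show "\<forall>\<^sub>F j in sequentially. norm (Y (\<tau> j) t - Y (\<tau> j) s) \<le> K * \<bar>t - s\<bar>"
      by (intro always_eventually allI Y_lipschitz)
  qed simp
  thus ?thesis by (simp only: coord_inverse)
qed

lemma Z_continuous: "continuous_on A Z"
proof -
  have "K-lipschitz_on A Z"
    by (rule lipschitz_onI) (use Z_lipschitz K(1) in \<open>auto simp: dist_norm dist_real_def\<close>)
  thus ?thesis by (rule lipschitz_on_continuous_on)
qed

lemma late: "\<forall>\<^sub>F j in sequentially. 0 \<le> \<tau> j + s"
  using filterlim_at_top[THEN iffD1, OF \<tau>, rule_format, of "- s"] by eventually_elim simp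

text \<open>The integral equation passes to the limit coordinate by coordinate, as the field is weakly continuous.\<close>

lemma Z_increment:
  assumes st: "s \<le> t"
  shows "integral {s..t} (\<lambda>r. rhs a 1 (Z r)) = Z s - Z t"
proof (rule ell2_eqI)
  fix n
  have rc: "continuous_on {s..t} (\<lambda>r. rhs a 1 (Z r))" by (rule continuous_G_comp[OF Z_continuous])
  have yc: "continuous_on {s..t} (\<lambda>r. coord (rhs a 1 (Y \<tau> r)) n)" for \<tau>
    by (rule bounded_linear.continuous_on[OF bounded_linear_coord continuous_G_comp[OF Y_continuous]])
  have "(\<lambda>j. integral {s..t} (\<lambda>r. coord (rhs a 1 (Y (\<tau> j) r)) n)) \<longlonglongrightarrow> integral {s..t} (\<lambda>r. coord (rhs a 1 (Z r)) n)"
  proof (rule dominated_convergence(2))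
    show "(\<lambda>r. coord (rhs a 1 (Y (\<tau> j) r)) n) integrable_on {s..t}" for j by (intro integrable_continuous_real yc)
    show "(\<lambda>r. K) integrable_on {s..t}" by (intro integrable_continuous_real continuous_intros)
    show "norm (coord (rhs a 1 (Y (\<tau> j) r)) n) \<le> K" for j r
      by (rule order_trans[OF coord_le_norm K(2)[OF Y_norm]])
    show "(\<lambda>j. coord (rhs a 1 (Y (\<tau> j) r)) n) \<longlonglongrightarrow> coord (rhs a 1 (Z r)) n" for r
      by (rule rhs_weak_continuous[OF a(1) lim sequentially_bot Y_bdd])
  qed
  moreover have "\<forall>\<^sub>F j in sequentially. integral {s..t} (\<lambda>r. coord (rhs a 1 (Y (\<tau> j) r)) n) = coord (Y (\<tau> j) s) n - coord (Y (\<tau> j) t) n"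
    using late[of s]
  proof eventually_elim
    case (elim j)
    have "((\<lambda>r. rhs a 1 (X r)) has_integral (X (\<tau> j + s) - X (\<tau> j + t))) {\<tau> j + s..\<tau> j + t}"
      by (rule increment) (use elim st in auto)
    from has_integral_linear[OF has_integral_shift_real_ivl[OF this, of "\<tau> j"] bounded_linear_coord[where n = n]]
    have "((\<lambda>r. coord (rhs a 1 (X (r + \<tau> j))) n) has_integral coord (X (\<tau> j + s) - X (\<tau> j + t)) n) {s..t}"
      by (simp add: o_def)
    hence "((\<lambda>r. coord (rhs a 1 (Y (\<tau> j) r)) n) has_integral coord (X (\<tau> j + s) - X (\<tau> j + t)) n) {s..t}"
      by (rule has_integral_eq[rotated]) (use elim in \<open>auto simp: Y_def max_def add.commute\<close>)
    thus ?case using elim st by (simp add: integral_unique Y_def max_def)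
  qed
  ultimately have "(\<lambda>j. coord (Y (\<tau> j) s) n - coord (Y (\<tau> j) t) n) \<longlonglongrightarrow> integral {s..t} (\<lambda>r. coord (rhs a 1 (Z r)) n)"
    by (rule Lim_transform_eventually)
  moreover have "(\<lambda>j. coord (Y (\<tau> j) s) n - coord (Y (\<tau> j) t) n) \<longlonglongrightarrow> coord (Z s) n - coord (Z t) n"
    by (intro tendsto_diff lim)
  ultimately have "integral {s..t} (\<lambda>r. coord (rhs a 1 (Z r)) n) = coord (Z s) n - coord (Z t) n"
    by (rule LIMSEQ_unique)
  moreover have "integral {s..t} ((\<lambda>Y. coord Y n) \<circ> (\<lambda>r. rhs a 1 (Z r))) = coord (integral {s..t} (\<lambda>r. rhs a 1 (Z r))) n"
    by (rule integral_linear[OF integrable_continuous_real[OF rc] bounded_linear_coord])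
  ultimately show "coord (integral {s..t} (\<lambda>r. rhs a 1 (Z r))) n = coord (Z s - Z t) n"
    by (simp add: o_def)
qed

lemma Z_derivative: "(Z has_vector_derivative - rhs a 1 (Z t)) (at t)"
proof -
  have t: "t \<in> {t - 1..t + 1}" "t \<in> interior {t - 1..t + 1}" by auto
  have "((\<lambda>s. Z (t - 1) - integral {t - 1..s} (\<lambda>r. rhs a 1 (Z r))) has_vector_derivative 0 - rhs a 1 (Z t)) (at t within {t - 1..t + 1})"
    by (intro has_vector_derivative_diff has_vector_derivative_const integral_has_vector_derivative
        continuous_G_comp[OF Z_continuous] t)
  hence "(Z has_vector_derivative 0 - rhs a 1 (Z t)) (at t within {t - 1..t + 1})"
    by (rule has_vector_derivative_transform[OF t(1), rotated]) (simp add: Z_increment)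
  thus ?thesis by (simp add: at_within_interior[OF t(2)])
qed

text \<open>The dissipation of the trajectory during a unit of time is a drop of a convergent energy, so it tends to zero along
\<open>\<tau>\<close>. By \<open>coord_Damp_square_le\<close> so do the coordinates of the damping term, which converge to those of
the damping term of \<open>Z\<close>.\<close>

lemma Damp_Z: "Damp a 1 (Z r) = 0"
proof (rule ell2_eqI)
  fix n
  define f where "f r = (cmod (coord (Damp a 1 (Z r)) n))\<^sup>2" for r
  define A where "A = (\<integral>x. a x \<partial>tor)"
  have A: "0 \<le> A" unfolding A_def using a(2) by (intro integral_nonneg_AE) auto
  interpret D: bounded_linear "Damp a 1" by (rule bounded_linear_Damp[OF a(1)])
  obtain KD where KD: "KD \<ge> 0" "\<And>X. norm (Damp a 1 X) \<le> norm X * KD" using D.nonneg_bounded by blast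
  have cc: "continuous_on S (\<lambda>r. (cmod (coord (Damp a 1 (g r)) n))\<^sup>2)" if "continuous_on S g" for g S
    by (intro continuous_intros bounded_linear.continuous_on[OF bounded_linear_coord] bounded_linear.continuous_on[OF D.bounded_linear_axioms] that)
  let ?I = "{r..r + 1}"
  have l1: "(\<lambda>j. integral ?I (\<lambda>r. (cmod (coord (Damp a 1 (Y (\<tau> j) r)) n))\<^sup>2)) \<longlonglongrightarrow> integral ?I f"
  proof (rule dominated_convergence(2))
    show "(\<lambda>r. (cmod (coord (Damp a 1 (Y (\<tau> j) r)) n))\<^sup>2) integrable_on ?I" for j
      by (intro integrable_continuous_real cc Y_continuous)
    show "(\<lambda>r. (norm x0 * KD)\<^sup>2) integrable_on ?I" by (intro integrable_continuous_real continuous_intros)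
    show "norm ((cmod (coord (Damp a 1 (Y (\<tau> j) s)) n))\<^sup>2) \<le> (norm x0 * KD)\<^sup>2" for j s
    proof -
      have "cmod (coord (Damp a 1 (Y (\<tau> j) s)) n) \<le> norm (Y (\<tau> j) s) * KD"
        by (rule order_trans[OF coord_le_norm KD(2)])
      also have "\<dots> \<le> norm x0 * KD" by (intro mult_right_mono Y_norm KD)
      finally show ?thesis by (simp add: power_mono)
    qed
    show "(\<lambda>j. (cmod (coord (Damp a 1 (Y (\<tau> j) s)) n))\<^sup>2) \<longlonglongrightarrow> f s" for s
      unfolding f_def
      by (intro tendsto_intros ell2_weak_functional[OF bounded_linear_compose[OF bounded_linear_coord bounded_linear_Damp[OF a(1)]] lim sequentially_bot Y_bdd])
  qed
  obtain l where l: "((\<lambda>t. (norm (X t))\<^sup>2) \<longlongrightarrow> l) at_top" using energy_convergent by blast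
  have sh: "filterlim (\<lambda>j. \<tau> j + s) at_top sequentially" for s
    using filterlim_tendsto_add_at_top[OF tendsto_const \<tau>, of s] by (simp add: add.commute)
  have e: "(\<lambda>j. A / 2 * ((norm (X (\<tau> j + r)))\<^sup>2 - (norm (X (\<tau> j + (r + 1))))\<^sup>2)) \<longlonglongrightarrow> A / 2 * (l - l)"
    by (intro tendsto_intros filterlim_compose[OF l sh])
  have "\<forall>\<^sub>F j in sequentially. integral ?I (\<lambda>r. (cmod (coord (Damp a 1 (Y (\<tau> j) r)) n))\<^sup>2)
      \<le> A / 2 * ((norm (X (\<tau> j + r)))\<^sup>2 - (norm (X (\<tau> j + (r + 1))))\<^sup>2)"
    using late[of r]
  proof eventually_elim
    case (elim j)
    have "((\<lambda>t. 2 * (X t \<bullet> Damp a 1 (X t))) has_integral ((norm (X (\<tau> j + r)))\<^sup>2 - (norm (X (\<tau> j + (r + 1))))\<^sup>2)) {\<tau> j + r..\<tau> j + (r + 1)}"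
      using energy_identity[OF a(1) solT[of "\<tau> j + (r + 1)"] herm, of "\<tau> j + r" "\<tau> j + (r + 1)" 0] elim by simp
    from has_integral_mult_right[OF has_integral_shift_real_ivl[OF this, of "\<tau> j"], of "A / 2"]
    have "((\<lambda>t. A / 2 * (2 * (X (t + \<tau> j) \<bullet> Damp a 1 (X (t + \<tau> j))))) has_integral A / 2 * ((norm (X (\<tau> j + r)))\<^sup>2 - (norm (X (\<tau> j + (r + 1))))\<^sup>2)) ?I"
      by simp
    hence h: "((\<lambda>t. A * (Y (\<tau> j) t \<bullet> Damp a 1 (Y (\<tau> j) t))) has_integral A / 2 * ((norm (X (\<tau> j + r)))\<^sup>2 - (norm (X (\<tau> j + (r + 1))))\<^sup>2)) ?I"
      by (rule has_integral_eq[rotated]) (use elim in \<open>auto simp: Y_def max_def add.commute\<close>)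
    show ?case
    proof (rule has_integral_le[OF integrable_integral h])
      show "(\<lambda>r. (cmod (coord (Damp a 1 (Y (\<tau> j) r)) n))\<^sup>2) integrable_on ?I"
        by (intro integrable_continuous_real cc Y_continuous)
      show "(cmod (coord (Damp a 1 (Y (\<tau> j) s)) n))\<^sup>2 \<le> A * (Y (\<tau> j) s \<bullet> Damp a 1 (Y (\<tau> j) s))" for s
        unfolding A_def by (rule coord_Damp_square_le[OF a Y_herm])
    qed
  qed
  from tendsto_le[OF _ e l1 this] have "integral ?I f \<le> 0" by simp
  moreover have "0 \<le> integral ?I f"
    unfolding f_def by (intro integral_nonneg integrable_continuous_real cc Z_continuous) simp
  ultimately have "integral ?I f = 0" by simp
  moreover have "continuous_on ?I f" unfolding f_def[abs_def] by (intro cc Z_continuous)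
  ultimately have "\<forall>x\<in>?I. f x = 0"
    using integral_eq_0_iff[of r "r + 1" f] by (simp add: f_def)
  hence "f r = 0" by simp
  thus "coord (Damp a 1 (Z r)) n = coord 0 n" by (simp add: f_def)
qed

text \<open>The symbol of \<open>(1 - \<partial>\<^sub>x\<^sup>2)\<^sup>-\<^sup>1\<close>. The coordinates of \<open>(1 - \<partial>\<^sub>x\<^sup>2)\<^sup>-\<^sup>1 (U + U\<^sup>2/2)\<close> are \<open>V\<close>, where \<open>U\<close> is the function with
coordinates \<open>Z\<close>.\<close>

definition b0 :: "int \<Rightarrow> complex" where "b0 n = of_real (1 / (1 + (of_int n)\<^sup>2))"

lemma b0: "square_summable_multiplier b0"
proof -
  have le: "cmod (b0 n) \<le> 1" and nn: "0 \<le> 1 / (1 + (of_int n)\<^sup>2 :: real)" for n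
    unfolding b0_def norm_of_real using one_plus_sq_pos[of n] by (auto simp: divide_le_eq)
  have e: "cmod (b0 n) = 1 / (1 + (of_int n)\<^sup>2)" for n
    unfolding b0_def norm_of_real using nn[of n] by simp
  have "(\<lambda>n. (cmod (b0 n))\<^sup>2) summable_on UNIV"
  proof (rule summable_on_comparison_test[OF summable_inverse_square])
    fix n
    show "(cmod (b0 n))\<^sup>2 \<le> 1 / (1 + (of_int n)\<^sup>2)"
      unfolding e[symmetric] using le[of n] by (simp add: power2_eq_square mult_left_le)
  qed simp
  thus ?thesis using le by (simp add: square_summable_multiplier_def)
qed

definition V where "V t = Disp b0 (Z t) + Nonlin b0 1 (Z t) (Z t)"

definition U where "U t = fser (unwt 1 (Z t))"

lemma U_L2: "U t \<in> torus_L2" and U_cont: "continuous_on A (U t)" and U_per: "periodic_2pi (U t)"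
  and U_coeff: "fourier_coeff (U t) n = unwt 1 (Z t) n"
  unfolding U_def by (auto intro!: fser_L2 fser_continuous unwt_1_l1 fourier_coeff_fser
      simp: periodic_2pi_def fser_periodic unwt_herm[OF Z_herm])

definition q where "q t n = fourier_coeff (\<lambda>x. U t x + (U t x)\<^sup>2 / 2) n"

lemma q_eq: "q t n = unwt 1 (Z t) n + conv (unwt 1 (Z t)) (unwt 1 (Z t)) n / 2"
proof -
  have "fourier_coeff (U t) = unwt 1 (Z t)" by (rule ext) (rule U_coeff)
  thus ?thesis unfolding q_def torus_L2_square_coeff(2)[OF U_L2] by simp
qed

lemma q_L2: "(\<lambda>x. U t x + (U t x)\<^sup>2 / 2) \<in> torus_L2"
  by (rule continuous_periodic_L2) (use U_per[of t] in \<open>auto intro!: continuous_intros U_cont simp: periodic_2pi_def\<close>)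

lemma q_herm: "q t (- n) = cnj (q t n)"
  unfolding q_def by (rule fourier_coeff_cnj[OF q_L2])

lemma unwt_V: "unwt 1 (V t) n = b0 n * q t n"
  by (simp add: V_def unwt_def coord_Disp[OF b0] coord_Nonlin[OF b0] q_eq add_divide_distrib distrib_left)

lemma unwt_rhs: "unwt 1 (rhs a 1 (Z t)) n = beta n * q t n"
  by (simp add: rhs_def Damp_Z unwt_def coord_Disp[OF beta_multiplier] coord_Nonlin[OF beta_multiplier] q_eq
      add_divide_distrib distrib_left)

lemma beta_b0: "beta n = \<i> * of_int n * b0 n"
  by (simp add: beta_def b0_def)

lemma hermitian_Z_rhs: "hermitian (rhs a 1 (Z t))"
  by (rule hermitian_rhs[OF a(1) _ Z_herm]) simp

text \<open>The functions of \<open>stationary_band\<close>. The constant \<open>1/2\<close> comes from \<open>w\<^sup>2/2 = 1/2 + U + U\<^sup>2/2\<close>.\<close>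

definition w where "w t x = 1 + evec x \<bullet> Z t"
definition \<Phi> where "\<Phi> t x = 1 / 2 + evec x \<bullet> V t"
definition P where "P t x = evec x \<bullet> rhs a 1 (Z t)"

lemma w_U: "w t x = 1 + U t x" by (simp add: w_def U_def inner_evec)
lemma P_fser: "P t = fser (unwt 1 (rhs a 1 (Z t)))" by (simp add: P_def inner_evec fun_eq_iff)
lemma \<Phi>_fser: "\<Phi> t x = 1 / 2 + fser (unwt 1 (V t)) x" by (simp add: \<Phi>_def inner_evec)

lemma w_t: "((\<lambda>t. w t x) has_real_derivative - P t x) (at t)"
proof -
  have "((\<lambda>t. evec x \<bullet> Z t) has_vector_derivative evec x \<bullet> (- rhs a 1 (Z t))) (at t)"
    by (rule bounded_linear.has_vector_derivative[OF bounded_linear_inner_right Z_derivative])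
  from DERIV_add[OF DERIV_const this[folded has_real_derivative_iff_has_vector_derivative], of 1]
  show ?thesis by (simp add: w_def P_def)
qed

lemma \<Phi>_x:
  assumes "{p'..q'} \<subseteq> {0..4 * pi}" "x \<in> {p'..q'}"
  shows "(\<Phi> t has_real_derivative P t x) (at x within {p'..q'})"
proof -
  have "(fser (unwt 1 (V t)) has_real_derivative P t x) (at x within {p'..q'})"
  proof (rule fser_has_derivative[OF unwt_1_l1 _ _ _ assms])
    show "continuous_on UNIV (P t)" unfolding P_fser by (rule fser_continuous[OF unwt_1_l1])
    show "periodic_2pi (P t)" unfolding P_fser by (simp add: periodic_2pi_def fser_periodic)
    show "fourier_coeff (P t) n = \<i> * of_int n * unwt 1 (V t) n" for n
    proof -
      have "fourier_coeff (P t) n = unwt 1 (rhs a 1 (Z t)) n"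
        unfolding P_fser by (rule fourier_coeff_fser[OF unwt_1_l1]) (rule unwt_herm[OF hermitian_Z_rhs])
      thus ?thesis by (simp add: unwt_rhs unwt_V beta_b0 mult.assoc)
    qed
  qed
  from DERIV_add[OF DERIV_const this, of "1/2"] show ?thesis unfolding \<Phi>_fser[abs_def] by simp
qed

lemma P_x:
  assumes "{p'..q'} \<subseteq> {0..4 * pi}" "x \<in> {p'..q'}"
  shows "(P t has_real_derivative \<Phi> t x - (w t x)\<^sup>2 / 2) (at x within {p'..q'})"
proof -
  let ?y = "\<lambda>x. fser (unwt 1 (V t)) x - (U t x + (U t x)\<^sup>2 / 2)"
  have y: "\<Phi> t x - (w t x)\<^sup>2 / 2 = ?y x" for x
    by (simp add: \<Phi>_fser w_U power2_eq_square field_simps)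
  show ?thesis
    unfolding P_fser y
  proof (rule fser_has_derivative[OF unwt_1_l1 _ _ _ assms])
    show "continuous_on UNIV ?y" by (intro continuous_intros fser_continuous unwt_1_l1 U_cont) auto
    show "periodic_2pi ?y" using U_per[of t] by (simp add: periodic_2pi_def fser_periodic)
    show "fourier_coeff ?y n = \<i> * of_int n * unwt 1 (rhs a 1 (Z t)) n" for n
    proof -
      have "fourier_coeff ?y n = fourier_coeff (fser (unwt 1 (V t))) n - q t n"
        unfolding q_def by (rule fourier_coeff_diff[OF fser_L2[OF unwt_1_l1] q_L2])
      also have "fourier_coeff (fser (unwt 1 (V t))) n = b0 n * q t n"
        unfolding unwt_V[symmetric]
        by (rule fourier_coeff_fser[OF unwt_1_l1]) (simp add: unwt_V q_herm b0_def)
      also have "b0 n * q t n - q t n = \<i> * of_int n * (beta n * q t n)"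
      proof -
        have nz: "(1 + (of_int n)\<^sup>2 :: complex) \<noteq> 0"
          using one_plus_sq_pos[of n] by (metis of_real_1 of_real_add of_real_eq_0_iff of_real_of_int_eq of_real_power less_irrefl)
        define z :: complex where "z = 1 + (of_int n)\<^sup>2"
        have n2: "(of_int n)\<^sup>2 = z - 1" by (simp add: z_def)
        have bz: "b0 n = 1 / z" by (simp add: b0_def z_def)
        have sq: "\<i> * N * (\<i> * N * b * Q) = - (N\<^sup>2 * b) * Q" for N b Q :: complex
          by (simp add: power2_eq_square algebra_simps)
        have "\<i> * of_int n * (beta n * q t n) = - ((of_int n)\<^sup>2 * (1 / z)) * q t n"
          unfolding beta_b0 bz by (rule sq)
        also have "\<dots> = (1 / z) * q t n - q t n"
          unfolding n2 using nz[folded z_def] by (simp add: field_simps)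
        finally show ?thesis by (simp add: bz)
      qed
      finally show ?thesis by (simp add: unwt_rhs)
    qed
  qed
qed

lemma V_continuous: "continuous_on A V"
  unfolding V_def[abs_def]
  by (intro continuous_on_add bounded_linear.continuous_on[OF bounded_linear_Disp[OF b0]]
      bounded_bilinear.continuous_on[OF bounded_bilinear_Nonlin[OF b0]] Z_continuous) simp

lemma V_bounded: "\<exists>B. \<forall>t. norm (V t) \<le> B"
proof -
  obtain K1 where K1: "K1 \<ge> 0" "\<And>X. norm (Disp b0 X) \<le> norm X * K1"
    using bounded_linear.nonneg_bounded[OF bounded_linear_Disp[OF b0]] by blast
  obtain K2 where K2: "K2 \<ge> 0" "\<And>X Y. norm (Nonlin b0 1 X Y) \<le> norm X * norm Y * K2"
    using bounded_bilinear.nonneg_bounded[OF bounded_bilinear_Nonlin[OF b0, of 1]] by auto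
  have "norm (V t) \<le> norm x0 * K1 + norm x0 * norm x0 * K2" for t
  proof -
    have "norm (V t) \<le> norm (Z t) * K1 + norm (Z t) * norm (Z t) * K2"
      unfolding V_def by (rule norm_triangle_le) (intro add_mono K1 K2)
    also have "\<dots> \<le> norm x0 * K1 + norm x0 * norm x0 * K2"
      by (intro add_mono mult_right_mono mult_mono Z_norm K1 K2) auto
    finally show ?thesis .
  qed
  thus ?thesis by blast
qed

lemma evec_inner_continuous:
  assumes "continuous_on UNIV G"
  shows "continuous_on (UNIV \<times> S) (\<lambda>z. evec (snd z) \<bullet> G (fst z))"
  by (intro continuous_on_inner continuous_on_compose2[OF evec_continuous[of UNIV]]
      continuous_on_compose2[OF assms] continuous_intros) auto

text \<open>The energy dissipated by \<open>Z\<close> is zero, so \<open>a U\<^sub>x\<^sup>2\<close> vanishes almost everywhere.\<close>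

lemma constant_on_band:
  assumes \<alpha>: "0 \<le> \<alpha>" "\<alpha> < \<beta>" "\<beta> \<le> 2 * pi" and pos: "\<And>x. x \<in> {\<alpha>..\<beta>} \<Longrightarrow> a x > 0" and x: "x \<in> {\<alpha>..\<beta>}"
  shows "w t x = w t \<alpha>"
proof -
  obtain y where y: "y \<in> sobolev 0" "\<And>n. fourier_coeff y n = \<i> * of_int n * unwt 1 (Z t) n"
    using derivative_function[OF Z_herm] by blast
  have yL: "y \<in> torus_L2" by (rule sobolev_L2[OF y(1)])
  note [measurable] = torus_L2_measurable[OF yL] torus_smooth_measurable[OF a(1)]
  obtain B where B: "\<And>x. \<bar>a x\<bar> \<le> B" using torus_smooth_bounded[OF a(1)] by blast
  have int: "integrable tor (\<lambda>x. a x * (y x)\<^sup>2)"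
  proof (rule Bochner_Integration.integrable_bound)
    show "integrable tor (\<lambda>x. B * (y x)\<^sup>2)" using torus_L2_square[OF yL] by simp
    show "AE x in tor. norm (a x * (y x)\<^sup>2) \<le> norm (B * (y x)\<^sup>2)"
      using B order_trans[OF B abs_ge_self] by (auto simp: abs_mult intro!: mult_right_mono)
  qed measurable
  have "(\<integral>x. a x * (y x)\<^sup>2 \<partial>tor) = 0"
    unfolding inner_Damp[OF a(1) y, symmetric] by (simp add: Damp_Z)
  hence "AE x in tor. a x * (y x)\<^sup>2 = 0"
    using integral_nonneg_eq_0_iff_AE[OF int] a(2) by simp
  hence "AE z in lborel. z \<in> {0..2*pi} \<longrightarrow> a z * (y z)\<^sup>2 = 0" by (simp add: AE_tor)
  hence "AE z in lborel. indicator {\<alpha>..x} z *\<^sub>R y z = 0"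
  proof eventually_elim
    case (elim z)
    show ?case
    proof (cases "z \<in> {\<alpha>..x}")
      case True
      hence "z \<in> {0..2*pi}" "z \<in> {\<alpha>..\<beta>}" using \<alpha> x by auto
      thus ?thesis using elim pos[of z] by auto
    qed simp
  qed
  hence "(LINT z:{\<alpha>..x}|lborel. y z) = 0"
    unfolding set_lebesgue_integral_def by (simp add: integral_eq_zero_AE)
  moreover have "fser (unwt 1 (Z t)) x - fser (unwt 1 (Z t)) \<alpha> = (LINT z:{\<alpha>..x}|lborel. y z)"
    by (rule fser_diff_eq_integral[OF unwt_1_l1 yL y(2)]) (use \<alpha> x in auto)
  ultimately show ?thesis by (simp add: w_U U_def)
qed

lemma derivative_of_constant:
  fixes f :: "real \<Rightarrow> real"
  assumes "p' < q'" "x \<in> {p'..q'}" "(f has_real_derivative D) (at x within {p'..q'})" "\<And>y. y \<in> {p'..q'} \<Longrightarrow> f y = c"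
  shows "D = 0"
proof -
  have "(f has_vector_derivative 0) (at x within {p'..q'})"
    by (rule has_vector_derivative_transform[OF assms(2,4) has_vector_derivative_const])
  thus ?thesis
    using vector_derivative_unique_within_closed_interval[OF assms(1), unfolded box_real, OF assms(2)]
      assms(3)[unfolded has_real_derivative_iff_has_vector_derivative] by blast
qed

text \<open>On the band, \<open>w\<^sub>x = 0\<close> gives \<open>P\<^sub>x = - w\<^sub>t\<^sub>x = 0\<close>, hence \<open>\<Phi> = w\<^sup>2/2\<close>, hence \<open>P = \<Phi>\<^sub>x = w w\<^sub>x = 0\<close>, hence \<open>w\<^sub>t = 0\<close>. So the full turn
that starts and ends in the band is an instance of \<open>stationary_band\<close>.\<close>

lemma limit_is_constant:
  assumes \<alpha>: "0 \<le> \<alpha>" "\<alpha> < \<beta>" "\<beta> \<le> 2 * pi" and pos: "\<And>x. x \<in> {\<alpha>..\<beta>} \<Longrightarrow> a x > 0" and n: "n \<noteq> 0"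
  shows "coord (Z t) n = 0"
proof -
  have sub: "{\<alpha>..\<beta>} \<subseteq> {0..4 * pi}" using \<alpha> by auto
  have \<alpha>\<beta>: "\<alpha> \<in> {\<alpha>..\<beta>}" using \<alpha> by simp
  note wc = constant_on_band[OF \<alpha> pos]
  have Pc: "P s x = P s \<alpha>" if "x \<in> {\<alpha>..\<beta>}" for s x
  proof -
    have "(\<lambda>t. w t x) = (\<lambda>t. w t \<alpha>)" using wc[OF _ that] by auto
    with w_t[of x s] have "((\<lambda>t. w t \<alpha>) has_real_derivative - P s x) (at s)" by simp
    from DERIV_unique[OF this w_t[of \<alpha> s]] show ?thesis by simp
  qed
  have \<Phi>w: "\<Phi> s x = (w s x)\<^sup>2 / 2" if "x \<in> {\<alpha>..\<beta>}" for s x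
    using derivative_of_constant[OF \<alpha>(2) that P_x[OF sub that] Pc] by simp
  have P0: "P s x = 0" if x: "x \<in> {\<alpha>..\<beta>}" for s x
  proof (rule derivative_of_constant[OF \<alpha>(2) x \<Phi>_x[OF sub x]])
    show "\<Phi> s y = (w s \<alpha>)\<^sup>2 / 2" if "y \<in> {\<alpha>..\<beta>}" for y
      using \<Phi>w[OF that] wc[OF _ that] by simp
  qed
  define c where "c = w 0 \<alpha>"
  have wa: "w s \<alpha> = c" for s
    unfolding c_def by (rule DERIV_isconst_all) (use w_t[of \<alpha>] P0[OF \<alpha>\<beta>] in auto)
  let ?q = "\<alpha> + 2 * pi"
  have S: "{\<alpha>..?q} \<subseteq> {0..4 * pi}" using \<alpha> by auto
  obtain BV where BV: "\<And>t. norm (V t) \<le> BV" using V_bounded by blast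
  \<comment> \<open>All vectors \<open>evec x\<close> have the norm \<open>E0\<close>, so \<open>M\<close> bounds \<open>w\<close>, \<open>\<Phi>\<close> and \<open>P\<close> at once.\<close>
  define E0 where "E0 = norm (evec 0)"
  define M where "M = 1 + E0 * (norm x0 + \<bar>BV\<bar> + K)"
  have E0: "0 \<le> E0" by (simp add: E0_def)
  have ev: "\<bar>evec x \<bullet> G\<bar> \<le> E0 * (norm x0 + \<bar>BV\<bar> + K)" if "norm G \<le> norm x0 + \<bar>BV\<bar> + K" for x G
  proof -
    have "\<bar>evec x \<bullet> G\<bar> \<le> norm (evec x) * norm G" by (rule Cauchy_Schwarz_ineq2)
    also have "\<dots> \<le> E0 * (norm x0 + \<bar>BV\<bar> + K)"
      unfolding E0_def evec_norm_bounded[of x] using that by (intro mult_left_mono) auto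
    finally show ?thesis .
  qed
  have bZ: "norm (Z t) \<le> norm x0 + \<bar>BV\<bar> + K" for t using Z_norm[of t] K(1) by linarith
  have bV: "norm (V t) \<le> norm x0 + \<bar>BV\<bar> + K" for t using BV[of t] K(1) norm_ge_zero[of x0] by linarith
  have bR: "norm (rhs a 1 (Z t)) \<le> norm x0 + \<bar>BV\<bar> + K" for t
    using K(2)[OF Z_norm[of t]] norm_ge_zero[of x0] by linarith
  interpret band: stationary_band w \<Phi> P \<alpha> ?q c M
  proof
    show "\<alpha> < ?q" by simp
    show "((\<lambda>t. w t x) has_real_derivative - P t x) (at t)" for t x by (rule w_t)
    show "(\<Phi> t has_real_derivative P t x) (at x within {\<alpha>..?q})" if "x \<in> {\<alpha>..?q}" for t x by (rule \<Phi>_x[OF S that])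
    show "(P t has_real_derivative \<Phi> t x - (w t x)\<^sup>2 / 2) (at x within {\<alpha>..?q})" if "x \<in> {\<alpha>..?q}" for t x by (rule P_x[OF S that])
    show "continuous_on (UNIV \<times> {\<alpha>..?q}) (\<lambda>z. w (fst z) (snd z))"
      unfolding w_def by (intro continuous_intros evec_inner_continuous Z_continuous)
    show "continuous_on (UNIV \<times> {\<alpha>..?q}) (\<lambda>z. \<Phi> (fst z) (snd z))"
      unfolding \<Phi>_def by (intro continuous_intros evec_inner_continuous V_continuous)
    show "continuous_on (UNIV \<times> {\<alpha>..?q}) (\<lambda>z. P (fst z) (snd z))"
      unfolding P_def by (intro evec_inner_continuous continuous_G_comp Z_continuous)
    show "\<bar>w t x\<bar> \<le> M" for t x using ev[OF bZ[of t], of x] unfolding w_def M_def by linarith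
    show "\<bar>\<Phi> t x\<bar> \<le> M" for t x using ev[OF bV[of t], of x] unfolding \<Phi>_def M_def by linarith
    show "\<bar>P t x\<bar> \<le> M" for t x using ev[OF bR[of t], of x] unfolding P_def M_def by linarith
    show "w t \<alpha> = c" for t by (rule wa)
    show "\<Phi> t \<alpha> = c\<^sup>2 / 2" for t using \<Phi>w[OF \<alpha>\<beta>] wa by simp
    show "P t \<alpha> = 0" for t by (rule P0[OF \<alpha>\<beta>])
    show "\<Phi> t ?q = c\<^sup>2 / 2" for t using \<Phi>w[OF \<alpha>\<beta>, of t] wa[of t] by (simp add: \<Phi>_fser fser_periodic)
    show "P t ?q = 0" for t using P0[OF \<alpha>\<beta>, of t] by (simp add: P_fser fser_periodic)
    show "\<exists>d>0. \<forall>t. \<forall>x\<in>{\<alpha>..?q}. \<forall>y\<in>{\<alpha>..?q}. \<bar>x - y\<bar> < d \<longrightarrow> \<bar>w t x - w t y\<bar> < e" if e: "e > 0" for e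
    proof -
      have "uniformly_continuous_on {\<alpha>..?q} evec"
        by (intro compact_uniformly_continuous evec_continuous) auto
      moreover have "e / (norm x0 + 1) > 0" using e by (simp add: add_nonneg_pos)
      ultimately obtain d where d: "d > 0" "\<And>x y. x \<in> {\<alpha>..?q} \<Longrightarrow> y \<in> {\<alpha>..?q} \<Longrightarrow> dist y x < d \<Longrightarrow> dist (evec y) (evec x) < e / (norm x0 + 1)"
        unfolding uniformly_continuous_on_def by blast
      have "\<bar>w t x - w t y\<bar> < e" if xy: "x \<in> {\<alpha>..?q}" "y \<in> {\<alpha>..?q}" "\<bar>x - y\<bar> < d" for t x y
      proof -
        have "\<bar>w t x - w t y\<bar> = \<bar>(evec x - evec y) \<bullet> Z t\<bar>" by (simp add: w_def inner_diff_left)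
        also have "\<dots> \<le> norm (evec x - evec y) * norm (Z t)" by (rule Cauchy_Schwarz_ineq2)
        also have "\<dots> \<le> norm (evec x - evec y) * (norm x0 + 1)"
          using Z_norm[of t] by (intro mult_left_mono) auto
        also have "\<dots> < e"
        proof -
          have "norm (evec x - evec y) < e / (norm x0 + 1)"
            using d(2)[OF xy(2,1)] xy(3) by (simp add: dist_norm)
          thus ?thesis by (simp add: pos_less_divide_eq add_nonneg_pos)
        qed
        finally show ?thesis .
      qed
      thus ?thesis using d(1) by blast
    qed
  qed
  have Uc: "U t x = c - 1" if "x \<in> {0..2*pi}" for x
  proof (cases "\<alpha> \<le> x")
    case True
    thus ?thesis using band.band_solution_constant[of x t] that \<alpha> by (simp add: w_U)
  next
    case False
    have "U t x = U t (x + 2 * pi)" using U_per[of t] by (simp add: periodic_2pi_def)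
    thus ?thesis using band.band_solution_constant[of "x + 2 * pi" t] that \<alpha> False by (simp add: w_U)
  qed
  have "unwt 1 (Z t) n = fourier_coeff (\<lambda>_. c - 1) n"
    unfolding U_coeff[symmetric] fourier_coeff_def distr_coeff_def regular_distr_def
    by (rule arg_cong[where f = "\<lambda>z. z / _"], rule set_lebesgue_integral_cong) (auto simp: Uc)
  thus ?thesis using n by (simp add: fourier_coeff_const unwt_def)
qed

end

section \<open>Convergence to the mean\<close>

context damped_trajectory
begin

text \<open>A diagonal argument gives convergence of all coordinates at all rational times, and the common Lipschitz constant
extends it to all real times.\<close>

lemma limit_trajectory_exists:
  assumes \<tau>: "filterlim \<tau> at_top sequentially"
  obtains k Z where "strict_mono (k :: nat \<Rightarrow> nat)" "limit_trajectory a x0 X (\<tau> \<circ> k) Z"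
proof -
  let ?f = "\<lambda>j (n, t). coord (Y (\<tau> j) t) n"
  have "countable (UNIV \<times> \<rat> :: (int \<times> real) set)" by (intro countable_SIGMA countable_rat) simp
  moreover have "norm (?f j p) \<le> norm x0" for j p
    by (cases p) (use order_trans[OF coord_le_norm Y_norm] in auto)
  ultimately obtain k :: "nat \<Rightarrow> nat" where k: "strict_mono k"
    and kl: "\<And>p. p \<in> UNIV \<times> \<rat> \<Longrightarrow> \<exists>l. (\<lambda>j. ?f (k j) p) \<longlonglongrightarrow> l"
    using function_convergent_subsequence[of "UNIV \<times> \<rat>" ?f "norm x0"] by blast
  let ?c = "\<lambda>t n j. coord (Y (\<tau> (k j)) t) n"
  have cv: "convergent (?c t n)" for t n
  proof -
    have "Cauchy (?c t n)"
    proof (rule metric_CauchyI)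
      fix e :: real assume e: "0 < e"
      define d where "d = e / 3 / (K + 1)"
      have d: "0 < d" using e K(1) by (simp add: d_def)
      obtain r where r: "r \<in> \<rat>" "\<bar>r - t\<bar> < d"
        using Rats_dense_in_real[of "t - d" "t + d"] d by (auto simp: abs_less_iff)
      have "K * \<bar>r - t\<bar> \<le> (K + 1) * d" using K(1) r(2) d by (intro mult_mono) auto
      also have "(K + 1) * d = e / 3" using K(1) nonzero_mult_div_cancel_left[of "K + 1" "e / 3"] unfolding d_def times_divide_eq_right by linarith
      finally have Kd: "K * \<bar>r - t\<bar> \<le> e / 3" .
      have near: "dist (?c t n j) (?c r n j) \<le> e / 3" for j
      proof -
        have "dist (?c t n j) (?c r n j) = cmod (coord (Y (\<tau> (k j)) r - Y (\<tau> (k j)) t) n)"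
          by (simp add: dist_norm norm_minus_commute)
        also have "\<dots> \<le> K * \<bar>r - t\<bar>" by (rule order_trans[OF coord_le_norm Y_lipschitz])
        finally show ?thesis using Kd by simp
      qed
      obtain l where "?c r n \<longlonglongrightarrow> l" using kl[of "(n, r)"] r(1) by auto
      hence "Cauchy (?c r n)" by (rule LIMSEQ_imp_Cauchy)
      then obtain N where N: "\<And>i j. i \<ge> N \<Longrightarrow> j \<ge> N \<Longrightarrow> dist (?c r n i) (?c r n j) < e / 3"
        using e metric_CauchyD[of "?c r n" "e / 3"] by auto
      have "dist (?c t n i) (?c t n j) < e" if "i \<ge> N" "j \<ge> N" for i j
        using near[of i] near[of j] N[OF that] dist_triangle[of "?c t n i" "?c t n j" "?c r n i"]
          dist_triangle[of "?c r n i" "?c t n j" "?c r n j"] dist_commute[of "?c t n j" "?c r n j"] by linarith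
      thus "\<exists>M. \<forall>i\<ge>M. \<forall>j\<ge>M. dist (?c t n i) (?c t n j) < e" by blast
    qed
    thus ?thesis by (rule Cauchy_convergent)
  qed
  define Z where "Z t = Abs_ell2 (\<lambda>n. lim (?c t n))" for t
  have cl: "?c t n \<longlonglongrightarrow> lim (?c t n)" for t n using cv by (simp add: convergent_LIMSEQ_iff)
  have "coord (Z t) = (\<lambda>n. lim (?c t n))" for t
    unfolding Z_def by (rule ell2_weak_limit(3)[OF cl sequentially_bot, where B = "norm x0"]) (simp add: Y_norm)
  hence "limit_trajectory a x0 X (\<tau> \<circ> k) Z"
    using cl by unfold_locales (auto intro: filterlim_compose[OF \<tau> filterlim_subseq[OF k]] simp: o_def)
  thus ?thesis using that k by blast
qed

text \<open>Otherwise some sequence of times would keep a nonconstant Fourier coefficient away from zero, and a limit of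
translates along it would not be constant.\<close>

lemma coord_tendsto:
  assumes "0 \<le> \<alpha>" "\<alpha> < \<beta>" "\<beta> \<le> 2 * pi" "\<And>x. x \<in> {\<alpha>..\<beta>} \<Longrightarrow> a x > 0"
  shows "((\<lambda>t. coord (X t) n) \<longlongrightarrow> coord (single 0 (coord x0 0)) n) at_top"
proof (cases "n = 0")
  case True
  have "\<forall>\<^sub>F t in at_top. coord (X t) n = coord (single 0 (coord x0 0)) n"
    using eventually_ge_at_top[of 0] by eventually_elim (simp add: True zero_mode)
  thus ?thesis by (rule tendsto_eventually)
next
  case False
  have "((\<lambda>t. coord (X t) n) \<longlongrightarrow> 0) at_top"
  proof (rule ccontr)
    assume "\<not> ((\<lambda>t. coord (X t) n) \<longlongrightarrow> 0) at_top"
    then obtain e where e: "e > 0" "\<not> (\<forall>\<^sub>F t in at_top. dist (coord (X t) n) 0 < e)"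
      unfolding tendsto_iff by blast
    have "\<exists>t\<ge>real j. e \<le> cmod (coord (X t) n)" for j :: nat
      using e(2) unfolding eventually_at_top_linorder by (auto simp: not_less)
    then obtain \<tau> where \<tau>: "\<And>j. real j \<le> \<tau> j" "\<And>j. e \<le> cmod (coord (X (\<tau> j)) n)" by metis
    have top: "filterlim \<tau> at_top sequentially"
      by (rule filterlim_at_top_mono[OF filterlim_real_sequentially]) (use \<tau>(1) in simp)
    obtain k Z where kZ: "strict_mono (k :: nat \<Rightarrow> nat)" "limit_trajectory a x0 X (\<tau> \<circ> k) Z"
      using limit_trajectory_exists[OF top] by blast
    interpret L: limit_trajectory a x0 X "\<tau> \<circ> k" Z by (rule kZ(2))
    have Yt: "Y ((\<tau> \<circ> k) j) 0 = X (\<tau> (k j))" for j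
      using \<tau>(1)[of "k j"] by (simp add: Y_def max_def)
    have "(\<lambda>j. cmod (coord (X (\<tau> (k j))) n)) \<longlonglongrightarrow> cmod (coord (Z 0) n)"
      using tendsto_norm[OF L.lim[of 0 n]] unfolding Yt .
    hence "e \<le> cmod (coord (Z 0) n)" by (rule Lim_bounded2) (use \<tau>(2) in auto)
    thus False using e(1) L.limit_is_constant[OF assms False] by simp
  qed
  thus ?thesis using False by simp
qed

end

lemma torus_open_band:
  assumes "torus_open \<omega>" "\<omega> \<noteq> {}"
  obtains \<alpha> \<beta> where "0 \<le> \<alpha>" "\<alpha> < \<beta>" "\<beta> \<le> 2 * pi" "{\<alpha>..\<beta>} \<subseteq> \<omega>"
proof -
  have op: "open \<omega>" and per: "periodic_2pi (\<lambda>x. x \<in> \<omega>)" using assms by (auto simp: torus_open_def)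
  obtain x where x: "x \<in> \<omega>" using assms(2) by blast
  define m where "m = \<lfloor>x / (2 * pi)\<rfloor>"
  define y where "y = x - 2 * pi * of_int m"
  have "of_int m \<le> x / (2 * pi)" "x / (2 * pi) < of_int m + 1" unfolding m_def by linarith+
  hence y2: "0 \<le> y" "y < 2 * pi" by (simp_all add: y_def field_simps)
  have y1: "y \<in> \<omega>" using periodic_2pi_shift[OF per, of x "- m"] x by (simp add: y_def)
  obtain e where e: "e > 0" "cball y e \<subseteq> \<omega>" using op y1 open_contains_cball by blast
  define b where "b = min (y + e) (2 * pi)"
  have "{y..b} \<subseteq> cball y e" by (auto simp: b_def dist_real_def)
  thus ?thesis using that[of y b] y2 e by (auto simp: b_def)
qed

text \<open>A bounded functional on \<open>H\<^sup>s\<close> does not distinguish functions with the same coordinates, so it is a functional on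
the sequences of real functions; averaging with \<open>flip\<close> extends it to all sequences.\<close>

lemma dual_as_functional:
  assumes s: "0 \<le> s" and \<psi>: "\<psi> \<in> sobolev_dual s"
  obtains f where "bounded_linear f" "\<And>g. g \<in> sobolev s \<Longrightarrow> \<psi> g = f (emb s g)"
proof -
  have add: "\<psi> (\<lambda>x. f x + g x) = \<psi> f + \<psi> g" if "f \<in> sobolev s" "g \<in> sobolev s" for f g
    using \<psi> that by (auto simp: sobolev_dual_def)
  have cm: "\<psi> (\<lambda>x. c * f x) = c * \<psi> f" if "f \<in> sobolev s" for c f
    using \<psi> that by (auto simp: sobolev_dual_def)
  obtain C where C: "\<And>f. f \<in> sobolev s \<Longrightarrow> \<bar>\<psi> f\<bar> \<le> C * sobolev_norm s f"
    using \<psi> unfolding sobolev_dual_def by blast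
  have cong: "\<psi> f = \<psi> g" if fg: "f \<in> sobolev s" "g \<in> sobolev s" "emb s f = emb s g" for f g
  proof -
    have mg: "(\<lambda>x. - 1 * g x) \<in> sobolev s" by (rule sobolev_cmult(1)[OF fg(2)])
    have "\<psi> (\<lambda>x. f x + - 1 * g x) = \<psi> f + - 1 * \<psi> g" using add[OF fg(1) mg] cm[OF fg(2), of "- 1"] by simp
    moreover have "\<bar>\<psi> (\<lambda>x. f x + - 1 * g x)\<bar> \<le> C * norm (emb s f + (- 1) *\<^sub>R emb s g)"
      using C[OF sobolev_add(1)[OF fg(1) mg]]
      unfolding norm_emb[OF sobolev_add(1)[OF fg(1) mg], symmetric] sobolev_add(2)[OF fg(1) mg] sobolev_cmult(2)[OF fg(2)] .
    ultimately show ?thesis using fg(3) by simp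
  qed
  define H where "H X = (1 / 2) *\<^sub>R (X + flip X)" for X
  have H: "bounded_linear H" unfolding H_def
    by (intro bounded_linear_scaleR_right[THEN bounded_linear_compose] bounded_linear_add bounded_linear_ident bounded_linear_flip)
  interpret H: bounded_linear H by (rule H)
  have Hh: "hermitian (H X)" for X by (rule hermitianI) (simp add: H_def add.commute)
  have Hid: "H X = X" if "hermitian X" for X
    using that by (simp add: H_def hermitian_def scaleR_2[symmetric])
  note r = realize[OF s Hh]
  define f where "f X = \<psi> (realize s (H X))" for X
  obtain C' where C': "\<And>X. norm (H X) \<le> norm X * C'" using H.bounded by blast
  have "bounded_linear f"
  proof (rule bounded_linear_intro)
    show "f (X + Y) = f X + f Y" for X Y
      unfolding f_def add[OF r(1) r(1), symmetric]
      by (rule cong[OF r(1) sobolev_add(1)[OF r(1) r(1)]]) (simp only: r(2) sobolev_add(2)[OF r(1) r(1)], rule H.add)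
    show "f (c *\<^sub>R X) = c *\<^sub>R f X" for c X
      unfolding f_def real_scaleR_def cm[OF r(1), symmetric]
      by (rule cong[OF r(1) sobolev_cmult(1)[OF r(1)]]) (simp only: r(2) sobolev_cmult(2)[OF r(1)], rule H.scaleR)
    show "norm (f X) \<le> norm X * (\<bar>C\<bar> * \<bar>C'\<bar>)" for X
    proof -
      have "norm (f X) \<le> C * norm (H X)"
        using C[OF r(1)[of X]] unfolding f_def norm_emb[OF r(1), symmetric] r(2) by simp
      also have "\<dots> \<le> \<bar>C\<bar> * (norm X * \<bar>C'\<bar>)"
        using C'[of X] mult_left_mono[OF abs_ge_self[of C'] norm_ge_zero[of X]] by (intro mult_mono) auto
      finally show ?thesis by (simp add: mult_ac)
    qed
  qed
  moreover have "\<psi> g = f (emb s g)" if g: "g \<in> sobolev s" for g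
    unfolding f_def by (rule cong[OF g r(1)]) (simp only: r(2), simp only: Hid[OF hermitian_emb[OF g]])
  ultimately show ?thesis using that by blast
qed

lemma weak_limit_of_coords:
  assumes s: "0 \<le> s" and u: "\<forall>\<^sub>F t in F. u t \<in> sobolev s" and f: "f \<in> sobolev s" and F: "F \<noteq> bot"
    and lim: "\<And>n. ((\<lambda>t. coord (emb s (u t)) n) \<longlongrightarrow> coord (emb s f) n) F"
    and B: "\<forall>\<^sub>F t in F. norm (emb s (u t)) \<le> B"
  shows "sobolev_weak_limit s u f F"
  unfolding sobolev_weak_limit_def
proof
  fix \<psi> assume "\<psi> \<in> sobolev_dual s"
  then obtain h where h: "bounded_linear h" "\<And>g. g \<in> sobolev s \<Longrightarrow> \<psi> g = h (emb s g)"
    using dual_as_functional[OF s] by blast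
  have "((\<lambda>t. h (emb s (u t))) \<longlongrightarrow> h (emb s f)) F" by (rule ell2_weak_functional[OF h(1) lim F B])
  thus "((\<lambda>t. \<psi> (u t)) \<longlongrightarrow> \<psi> f) F"
    unfolding h(2)[OF f] by (rule Lim_transform_eventually) (use u in eventually_elim, simp add: h(2))
qed

lemma strong_limit_of_coords:
  assumes rs: "r < s" and u: "\<forall>\<^sub>F t in F. u t \<in> sobolev s"
    and lim: "\<And>n. ((\<lambda>t. coord (emb s (u t)) n) \<longlongrightarrow> 0) F"
    and B: "\<forall>\<^sub>F t in F. norm (emb s (u t)) \<le> B"
  shows "((\<lambda>t. sobolev_norm r (u t)) \<longlongrightarrow> 0) F"
proof -
  have "((\<lambda>t. sqrt (\<Sum>\<^sub>\<infinity>n. (wt (- (s - r)) n)\<^sup>2 * (cmod (coord (emb s (u t)) n))\<^sup>2)) \<longlongrightarrow> sqrt 0) F"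
    by (intro tendsto_real_sqrt compact_embedding[OF lim B]) (use rs in simp)
  moreover have "\<forall>\<^sub>F t in F. sqrt (\<Sum>\<^sub>\<infinity>n. (wt (- (s - r)) n)\<^sup>2 * (cmod (coord (emb s (u t)) n))\<^sup>2) = sobolev_norm r (u t)"
    using u
  proof eventually_elim
    case (elim t)
    have e: "(wt (- (s - r)) n)\<^sup>2 * (cmod (coord (emb s (u t)) n))\<^sup>2 = sobolev_term r (u t) n" for n
    proof -
      have "wt (- (s - r)) n * wt s n = wt r n"
        by (simp add: wt_def powr_add[symmetric]  diff_divide_distrib)
      moreover have "0 \<le> wt s n" by (simp add: wt_def)
      moreover have "0 \<le> wt r n" by (simp add: wt_def)
      ultimately show ?thesis
        unfolding coord_emb[OF elim] sobolev_term_wt norm_mult norm_of_real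
        by (simp add: power_mult_distrib[symmetric] mult.assoc[symmetric])
    qed
    show ?case unfolding sobolev_norm_def e ..
  qed
  ultimately show ?thesis by (simp add: tendsto_cong)
qed

lemma fourier_coeff_0: "fourier_coeff f 0 = of_real (torus_mean f)"
  unfolding fourier_coeff_def distr_coeff_def regular_distr_def torus_mean_def
  by (simp add: set_lebesgue_integral_def scaleR_conv_of_real flip: of_real_mult) simp

lemma bbm_converges_to_mean:
  assumes \<omega>: "torus_open \<omega>" "\<omega> \<noteq> {}" and damping: "torus_smooth a" "\<And>x. 0 \<le> a x" "\<And>x. x \<in> \<omega> \<Longrightarrow> 0 < a x"
    and u: "bbm_solution a 1 {0..} u0 u"
  shows "sobolev_weak_limit 1 u (\<lambda>x. torus_mean u0) at_top"
    "s < 1 \<Longrightarrow> ((\<lambda>t. sobolev_norm s (\<lambda>x. u t x - torus_mean u0)) \<longlongrightarrow> 0) at_top"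
proof -
  have J: "{0..t} \<subseteq> {0..}" for t :: real by auto
  note ode = bbm_solution_ode[OF damping(1) _ u J, simplified]
  interpret damped_trajectory a "emb 1 u0" "\<lambda>t. emb 1 (u t)"
    by unfold_locales (use damping ode hermitian_emb in auto)
  obtain \<alpha> \<beta> where \<alpha>: "0 \<le> \<alpha>" "\<alpha> < \<beta>" "\<beta> \<le> 2 * pi" "{\<alpha>..\<beta>} \<subseteq> \<omega>"
    using torus_open_band[OF \<omega>] by blast
  let ?m = "torus_mean u0"
  have m: "coord (emb 1 u0) 0 = of_real ?m"
    by (simp add: coord_emb[OF ode(2)] wt_def fourier_coeff_0)
  have lim: "((\<lambda>t. coord (emb 1 (u t)) n) \<longlongrightarrow> coord (emb 1 (\<lambda>x. ?m)) n) at_top" for n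
    unfolding sobolev_const(2) m[symmetric] by (rule coord_tendsto[OF \<alpha>(1-3)]) (use damping(3) \<alpha>(4) in auto)
  have us: "\<forall>\<^sub>F t in at_top. u t \<in> sobolev 1"
    using eventually_ge_at_top[of 0] by eventually_elim (rule ode(3))
  have B: "\<forall>\<^sub>F t in at_top. norm (emb 1 (u t)) \<le> norm (emb 1 u0)"
    using eventually_ge_at_top[of 0] by eventually_elim (rule norm_le)
  show "sobolev_weak_limit 1 u (\<lambda>x. ?m) at_top"
    by (rule weak_limit_of_coords[OF _ us sobolev_const(1) trivial_limit_at_top_linorder lim B]) simp
  have d: "\<forall>\<^sub>F t in at_top. emb 1 (\<lambda>x. u t x - ?m) = emb 1 (u t) - emb 1 (\<lambda>x. ?m)"
    using us by eventually_elim (rule sobolev_diff(2)[OF _ sobolev_const(1)])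
  show "((\<lambda>t. sobolev_norm s (\<lambda>x. u t x - ?m)) \<longlongrightarrow> 0) at_top" if "s < 1"
  proof (rule strong_limit_of_coords[OF that])
    show "\<forall>\<^sub>F t in at_top. (\<lambda>x. u t x - ?m) \<in> sobolev 1"
      using us by eventually_elim (rule sobolev_diff(1)[OF _ sobolev_const(1)])
    show "((\<lambda>t. coord (emb 1 (\<lambda>x. u t x - ?m)) n) \<longlongrightarrow> 0) at_top" for n
    proof -
      have "((\<lambda>t. coord (emb 1 (u t)) n - coord (emb 1 (\<lambda>x. ?m)) n) \<longlongrightarrow> 0) at_top"
        using lim[of n] by (rule LIM_zero)
      thus ?thesis by (rule Lim_transform_eventually) (use d in eventually_elim, simp)
    qed
    show "\<forall>\<^sub>F t in at_top. norm (emb 1 (\<lambda>x. u t x - ?m)) \<le> norm (emb 1 u0) + norm (emb 1 (\<lambda>x. ?m))"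
      using d B
    proof eventually_elim
      case (elim t)
      show ?case unfolding elim(1) by (rule order_trans[OF norm_triangle_ineq4]) (use elim(2) in simp)
    qed
  qed
qed

theorem theorem3:
  fixes \<omega> :: "real set" and a :: "real \<Rightarrow> real"
  assumes "torus_open \<omega>" and "\<omega> \<noteq> {}"
    and "torus_smooth a" and "\<forall>x. a x \<ge> 0" and "\<forall>x\<in>\<omega>. a x > 0"
  shows "(\<forall>s\<ge>0. \<forall>R>0. \<exists>T>0. bbm_well_posed a s R T) \<and>
    (\<forall>T>0. (\<forall>R>0. bbm_well_posed a 1 R T) \<and>
       (\<forall>u0\<in>sobolev 1. \<forall>u. bbm_solution a 1 {0..T} u0 u \<longrightarrow>
          antimono_on {0..T} (\<lambda>t. sobolev_norm 1 (\<lambda>x. u t x - torus_mean u0)))) \<and>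
    (modified_UCP \<longrightarrow>
       (\<forall>u0\<in>sobolev 1. \<forall>u. bbm_solution a 1 {0..} u0 u \<longrightarrow>
          sobolev_weak_limit 1 u (\<lambda>x. torus_mean u0) at_top \<and>
          (\<forall>s<1. ((\<lambda>t. sobolev_norm s (\<lambda>x. u t x - torus_mean u0)) \<longlongrightarrow> 0) at_top)))"
proof (intro conjI allI ballI impI)
  note a = assms(3) assms(4)[rule_format]
  note lim = bbm_converges_to_mean[OF assms(1,2) a assms(5)[rule_format]]
  show "\<exists>T>0. bbm_well_posed a s R T" if "0 \<le> s" "0 < R" for s R
    by (rule bbm_locally_well_posed[OF a(1) that])
  show "bbm_well_posed a 1 R T" for R T
    by (rule bbm_globally_well_posed[OF a])
  show "antimono_on {0..T} (\<lambda>t. sobolev_norm 1 (\<lambda>x. u t x - torus_mean u0))"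
    if "bbm_solution a 1 {0..T} u0 u" for T u0 u
    by (rule bbm_energy_antimono[OF a that])
  show "sobolev_weak_limit 1 u (\<lambda>x. torus_mean u0) at_top" if "bbm_solution a 1 {0..} u0 u" for u0 u
    by (rule lim(1)[OF _ that])
  show "((\<lambda>t. sobolev_norm s (\<lambda>x. u t x - torus_mean u0)) \<longlongrightarrow> 0) at_top"
    if "bbm_solution a 1 {0..} u0 u" "s < 1" for u0 u s
    by (rule lim(2)[OF _ that])
qed

end
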